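(* Let $\mathcal A$ and $\mathcal B$ be finitely generated unital MF algebras. Then their unital full free product $\mathcal A*_{\mathbb C}\mathcal B$ is an MF algebra.
   Context: MF algebra: a unital C$^*$-algebra $\mathcal A$ is MF if there exist positive integers $n_k$ and a unital injective $*$-homomorphism from $\mathcal A$ into $\prod_k\mathcal M_{n_k}(\mathbb C)/\bigoplus_k\mathcal M_{n_k}(\mathbb C)$ (bounded sequences of matrices modulo sequences tending to $0$ in norm). Unital full free product $\mathcal A*_{\mathbb C}\mathcal B$: a unital C$^*$-algebra $\mathcal D$ with unital embeddings $\sigma_1:\mathcal A\to\mathcal D$, $\sigma_2:\mathcal B\to\mathcal D$ such that $\sigma_1(\mathcal A)\cup\sigma_2(\mathcal B)$ generates $\mathcal D$ and for any unital $*$-homomorphisms $\phi_1:\mathcal A\to\bar{\mathcal D}$, $\phi_2:\mathcal B\to\bar{\mathcal D}$ into a unital C$^*$-algebra there is a unital $*$-homomorphism $\psi:\mathcal D\to\bar{\mathcal D}$ with $\phi_i=\psi\circ\sigma_i$. *)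

theory Defs
  imports Complex_Main "HOL-Library.Extended_Real" "HOL-Library.Liminf_Limsup"
begin

record 'a cstar =
  cs_carrier :: "'a set"
  cs_zero :: 'a
  cs_one :: 'a
  cs_add :: "'a \<Rightarrow> 'a \<Rightarrow> 'a"
  cs_mult :: "'a \<Rightarrow> 'a \<Rightarrow> 'a"
  cs_smult :: "complex \<Rightarrow> 'a \<Rightarrow> 'a"
  cs_star :: "'a \<Rightarrow> 'a"
  cs_norm :: "'a \<Rightarrow> real"

definition cs_sub :: "'a cstar \<Rightarrow> 'a \<Rightarrow> 'a \<Rightarrow> 'a" where
  "cs_sub A x y = cs_add A x (cs_smult A (-1) y)"

definition unital_cstar_algebra :: "'a cstar \<Rightarrow> bool" where
  "unital_cstar_algebra A \<longleftrightarrow>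
    (let C = cs_carrier A; add = cs_add A; mult = cs_mult A; sm = cs_smult A;
         st = cs_star A; nm = cs_norm A; z = cs_zero A; u = cs_one A in
     \<comment> \<open>closure\<close>
     z \<in> C \<and> u \<in> C \<and>
     (\<forall>x\<in>C. \<forall>y\<in>C. add x y \<in> C \<and> mult x y \<in> C) \<and>
     (\<forall>c. \<forall>x\<in>C. sm c x \<in> C) \<and> (\<forall>x\<in>C. st x \<in> C) \<and>
     \<comment> \<open>complex vector space\<close>
     (\<forall>x\<in>C. \<forall>y\<in>C. \<forall>w\<in>C. add (add x y) w = add x (add y w)) \<and>
     (\<forall>x\<in>C. \<forall>y\<in>C. add x y = add y x) \<and>
     (\<forall>x\<in>C. add z x = x) \<and>
     (\<forall>x\<in>C. add x (sm (-1) x) = z) \<and>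
     (\<forall>x\<in>C. sm 1 x = x) \<and>
     (\<forall>a b. \<forall>x\<in>C. sm a (sm b x) = sm (a * b) x) \<and>
     (\<forall>a b. \<forall>x\<in>C. sm (a + b) x = add (sm a x) (sm b x)) \<and>
     (\<forall>a. \<forall>x\<in>C. \<forall>y\<in>C. sm a (add x y) = add (sm a x) (sm a y)) \<and>
     \<comment> \<open>associative unital algebra\<close>
     (\<forall>x\<in>C. \<forall>y\<in>C. \<forall>w\<in>C. mult (mult x y) w = mult x (mult y w)) \<and>
     (\<forall>x\<in>C. \<forall>y\<in>C. \<forall>w\<in>C. mult x (add y w) = add (mult x y) (mult x w)) \<and>
     (\<forall>x\<in>C. \<forall>y\<in>C. \<forall>w\<in>C. mult (add x y) w = add (mult x w) (mult y w)) \<and>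
     (\<forall>a. \<forall>x\<in>C. \<forall>y\<in>C. mult (sm a x) y = sm a (mult x y) \<and> mult x (sm a y) = sm a (mult x y)) \<and>
     (\<forall>x\<in>C. mult u x = x \<and> mult x u = x) \<and>
     \<comment> \<open>involution\<close>
     (\<forall>x\<in>C. st (st x) = x) \<and>
     (\<forall>x\<in>C. \<forall>y\<in>C. st (add x y) = add (st x) (st y)) \<and>
     (\<forall>a. \<forall>x\<in>C. st (sm a x) = sm (cnj a) (st x)) \<and>
     (\<forall>x\<in>C. \<forall>y\<in>C. st (mult x y) = mult (st y) (st x)) \<and>
     \<comment> \<open>norm, submultiplicativity, C*-identity\<close>
     (\<forall>x\<in>C. nm x \<ge> 0 \<and> (nm x = 0 \<longleftrightarrow> x = z)) \<and>
     (\<forall>x\<in>C. \<forall>y\<in>C. nm (add x y) \<le> nm x + nm y) \<and>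
     (\<forall>a. \<forall>x\<in>C. nm (sm a x) = cmod a * nm x) \<and>
     (\<forall>x\<in>C. \<forall>y\<in>C. nm (mult x y) \<le> nm x * nm y) \<and>
     (\<forall>x\<in>C. nm (mult (st x) x) = (nm x)\<^sup>2) \<and>
     \<comment> \<open>completeness\<close>
     (\<forall>f. range f \<subseteq> C \<longrightarrow>
        (\<forall>e>0. \<exists>N::nat. \<forall>m\<ge>N. \<forall>n\<ge>N. nm (cs_sub A (f m) (f n)) < e) \<longrightarrow>
        (\<exists>l\<in>C. \<forall>e>0. \<exists>N::nat. \<forall>n\<ge>N. nm (cs_sub A (f n) l) < e)))"

definition unital_star_hom :: "'a cstar \<Rightarrow> 'b cstar \<Rightarrow> ('a \<Rightarrow> 'b) \<Rightarrow> bool" where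
  "unital_star_hom A B h \<longleftrightarrow>
     (\<forall>x\<in>cs_carrier A. h x \<in> cs_carrier B) \<and>
     (\<forall>x\<in>cs_carrier A. \<forall>y\<in>cs_carrier A. h (cs_add A x y) = cs_add B (h x) (h y)) \<and>
     (\<forall>x\<in>cs_carrier A. \<forall>y\<in>cs_carrier A. h (cs_mult A x y) = cs_mult B (h x) (h y)) \<and>
     (\<forall>c. \<forall>x\<in>cs_carrier A. h (cs_smult A c x) = cs_smult B c (h x)) \<and>
     (\<forall>x\<in>cs_carrier A. h (cs_star A x) = cs_star B (h x)) \<and>
     h (cs_one A) = cs_one B"

definition cs_generates :: "'a cstar \<Rightarrow> 'a set \<Rightarrow> bool" where
  "cs_generates A S \<longleftrightarrow> S \<subseteq> cs_carrier A \<and>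
     (\<forall>T. T \<subseteq> cs_carrier A \<and> S \<subseteq> T \<and> cs_one A \<in> T \<and>
          (\<forall>x\<in>T. \<forall>y\<in>T. cs_add A x y \<in> T \<and> cs_mult A x y \<in> T) \<and>
          (\<forall>c. \<forall>x\<in>T. cs_smult A c x \<in> T) \<and> (\<forall>x\<in>T. cs_star A x \<in> T) \<and>
          (\<forall>f l. range f \<subseteq> T \<and> l \<in> cs_carrier A \<and>
                 (\<forall>e>0. \<exists>N::nat. \<forall>n\<ge>N. cs_norm A (cs_sub A (f n) l) < e) \<longrightarrow> l \<in> T)
        \<longrightarrow> cs_carrier A \<subseteq> T)"

definition finitely_generated :: "'a cstar \<Rightarrow> bool" where
  "finitely_generated A \<longleftrightarrow> (\<exists>S. finite S \<and> cs_generates A S)"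

text \<open>An \<open>m \<times> m\<close> complex matrix is represented by \<open>nat \<Rightarrow> nat \<Rightarrow> complex\<close> with entries
  outside \<open>{0..<m}\<^sup>2\<close> equal to zero; a sequence of matrices by \<open>nat \<Rightarrow> nat \<Rightarrow> nat \<Rightarrow> complex\<close>.\<close>

definition vecnorm :: "nat \<Rightarrow> (nat \<Rightarrow> complex) \<Rightarrow> real" where
  "vecnorm m v = sqrt (\<Sum>i<m. (cmod (v i))\<^sup>2)"

definition opnorm :: "nat \<Rightarrow> (nat \<Rightarrow> nat \<Rightarrow> complex) \<Rightarrow> real" where
  "opnorm m M = Sup ((\<lambda>v. vecnorm m (\<lambda>i. \<Sum>j<m. M i j * v j)) ` {v. vecnorm m v \<le> 1})"

definition prodM :: "(nat \<Rightarrow> nat) \<Rightarrow> (nat \<Rightarrow> nat \<Rightarrow> nat \<Rightarrow> complex) set" where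
  "prodM n = {x. (\<forall>k i j. (n k \<le> i \<or> n k \<le> j) \<longrightarrow> x k i j = 0) \<and>
                 (\<exists>C. \<forall>k. opnorm (n k) (x k) \<le> C)}"

definition mq_class :: "(nat \<Rightarrow> nat) \<Rightarrow> (nat \<Rightarrow> nat \<Rightarrow> nat \<Rightarrow> complex)
    \<Rightarrow> (nat \<Rightarrow> nat \<Rightarrow> nat \<Rightarrow> complex) set" where
  "mq_class n x = {y \<in> prodM n. (\<lambda>k. opnorm (n k) (\<lambda>i j. x k i j - y k i j)) \<longlonglongrightarrow> 0}"

definition mq_rep :: "(nat \<Rightarrow> nat \<Rightarrow> nat \<Rightarrow> complex) set \<Rightarrow> (nat \<Rightarrow> nat \<Rightarrow> nat \<Rightarrow> complex)" where
  "mq_rep X = (SOME x. x \<in> X)"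

definition MQ :: "(nat \<Rightarrow> nat) \<Rightarrow> (nat \<Rightarrow> nat \<Rightarrow> nat \<Rightarrow> complex) set cstar" where
  "MQ n = \<lparr>
     cs_carrier = mq_class n ` prodM n,
     cs_zero = mq_class n (\<lambda>k i j. 0),
     cs_one = mq_class n (\<lambda>k i j. if i = j \<and> i < n k then 1 else 0),
     cs_add = (\<lambda>X Y. mq_class n (\<lambda>k i j. mq_rep X k i j + mq_rep Y k i j)),
     cs_mult = (\<lambda>X Y. mq_class n (\<lambda>k i j. \<Sum>l<n k. mq_rep X k i l * mq_rep Y k l j)),
     cs_smult = (\<lambda>c X. mq_class n (\<lambda>k i j. c * mq_rep X k i j)),
     cs_star = (\<lambda>X. mq_class n (\<lambda>k i j. cnj (mq_rep X k j i))),
     cs_norm = (\<lambda>X. real_of_ereal (limsup (\<lambda>k. ereal (opnorm (n k) (mq_rep X k)))))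
   \<rparr>"

definition MF_algebra :: "'a cstar \<Rightarrow> bool" where
  "MF_algebra A \<longleftrightarrow> unital_cstar_algebra A \<and>
     (\<exists>n :: nat \<Rightarrow> nat. (\<forall>k. 0 < n k) \<and>
        (\<exists>\<phi>. unital_star_hom A (MQ n) \<phi> \<and> inj_on \<phi> (cs_carrier A)))"

definition unital_full_free_product ::
  "'a cstar \<Rightarrow> 'b cstar \<Rightarrow> 'd cstar \<Rightarrow> ('a \<Rightarrow> 'd) \<Rightarrow> ('b \<Rightarrow> 'd) \<Rightarrow> bool" where
  "unital_full_free_product A B D \<sigma>1 \<sigma>2 \<longleftrightarrow>
     unital_cstar_algebra D \<and>
     unital_star_hom A D \<sigma>1 \<and> inj_on \<sigma>1 (cs_carrier A) \<and>
     unital_star_hom B D \<sigma>2 \<and> inj_on \<sigma>2 (cs_carrier B) \<and>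
     cs_generates D (\<sigma>1 ` cs_carrier A \<union> \<sigma>2 ` cs_carrier B) \<and>
     (\<forall>(E :: 'd cstar) \<phi>1 \<phi>2. unital_cstar_algebra E \<and>
        unital_star_hom A E \<phi>1 \<and> unital_star_hom B E \<phi>2 \<longrightarrow>
        (\<exists>\<psi>. unital_star_hom D E \<psi> \<and>
             (\<forall>a\<in>cs_carrier A. \<phi>1 a = \<psi> (\<sigma>1 a)) \<and>
             (\<forall>b\<in>cs_carrier B. \<phi>2 b = \<psi> (\<sigma>2 b))))"

end

theory Submission
  imports Defs "HOL-Computational_Algebra.Polynomial" "HOL-Analysis.Analysis"
begin

text \<open>Choose a countable dense set \<open>d\<^sub>0, d\<^sub>1, \<dots>\<close> in \<open>\<D>\<close> and states \<open>F\<^sub>i\<close> of \<open>\<D>\<close> with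
  \<open>F\<^sub>i (d\<^sub>i\<^sup>\<star> d\<^sub>i) = \<parallel>d\<^sub>i\<parallel>\<^sup>2\<close>. For finitely many \<open>x\<^sub>1, \<dots>, x\<^sub>r\<close> in \<open>\<D>\<close> the functionals
  \<open>a \<mapsto> F (x\<^sub>j\<^sup>\<star> a x\<^sub>i)\<close> on \<open>\<A>\<close> form a completely positive family. Since the MF embedding of
  \<open>\<A>\<close> is isometric on matrices over \<open>\<A>\<close>, a separation argument approximates this family
  by vector functionals \<open>a \<mapsto> \<langle>\<Phi>(a) \<zeta>\<^sub>i, \<zeta>\<^sub>j\<rangle>\<close>, where \<open>\<Phi>\<close> is a direct sum of far entries of the
  embedding, and the same holds for \<open>\<B>\<close>. After an amplification both models have the same
  dimension, and as their vectors have almost the same Gram matrix, a unitary moves one family of vectors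
  close to the other. Letting the accuracy grow and treating every \<open>F\<^sub>i\<close> infinitely often
  yields homomorphisms of \<open>\<A>\<close> and \<open>\<B>\<close> into one quotient \<open>\<Prod> M\<^sub>p / \<Oplus> M\<^sub>p\<close>, hence a homomorphism \<open>\<psi>\<close>
  on \<open>\<D>\<close>. Asymptotically \<open>\<psi>(d\<^sub>i)\<close> maps the model of \<open>1\<close>, of norm \<open>1\<close>, to the model of \<open>d\<^sub>i\<close>, of norm
  \<open>\<parallel>d\<^sub>i\<parallel>\<close>, so \<open>\<psi>\<close> is isometric.\<close>

subsection \<open>\<open>C\<^sup>*\<close>-seminorms on polynomials\<close>

text \<open>Positivity is read off from norms instead of a spectrum: h is positive if it is
  self-adjoint and within distance t of t 1 for some t. Sums of positive elements are then
  immediate, and the hard point is positivity of x^* x; it is reached by norm estimates for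
  polynomials in single self-adjoint elements. Square roots, states and the isometry of injective
  homomorphisms follow from it. Of the GNS space of a state F only finitely many inner products
  F(y^* x) are ever used. A model therefore has to reproduce Gram numbers and the relations a x_i =
  x_j among finitely many elements of D. Such data are values of functionals on A and on B taken
  separately, which is what decouples the two factors. Complete positivity is tested on an r x r
  matrix over A, and its square root must again have entries in A; this is why roots are constructed
  inside closed subalgebras. The dimensions of the models are known only after the accuracy has been
  fixed, so the tolerance allowed between Gram matrices has to be independent of the
  dimension.\<close>

definition cpoly :: "complex poly \<Rightarrow> complex poly" where
  "cpoly p = map_poly cnj p"

lemma coeff_cpoly [simp]: "coeff (cpoly p) n = cnj (coeff p n)"
  by (simp add: cpoly_def coeff_map_poly)

lemma cpoly_simps [simp]:
  "cpoly 0 = 0" "cpoly 1 = 1" "cpoly (p + q) = cpoly p + cpoly q" "cpoly (- p) = - cpoly p"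
  "cpoly (p - q) = cpoly p - cpoly q" "cpoly (smult c p) = smult (cnj c) (cpoly p)"
  "cpoly (p * q) = cpoly p * cpoly q" "cpoly (cpoly p) = p"
  "cpoly (pCons c p) = pCons (cnj c) (cpoly p)"
  by (auto simp: poly_eq_iff coeff_mult coeff_pCons split: nat.split)

lemma cpoly_power [simp]: "cpoly (p ^ n) = cpoly p ^ n"
  by (induction n) simp_all

lemma complex_poly_ext: "(\<And>x. poly p x = poly q x) \<Longrightarrow> p = (q :: complex poly)"
  by (simp add: poly_eq_poly_eq_iff[symmetric] fun_eq_iff)

definition rc :: "real \<Rightarrow> complex poly" where
  "rc t = [:of_real t:]"

lemma poly_rc [simp]: "poly (rc t) x = of_real t"
  by (simp add: rc_def)

lemma cpoly_rc [simp]: "cpoly (rc t) = rc t"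
  by (simp add: rc_def)

text \<open>The iteration \<open>sqrt_iter\<close> at z = 1, where it increases to the fixed point 1
  of s = (1 + s^2)/2. The coefficients of that iteration are nonnegative, so this sequence dominates
  its norms and its increments whenever z has norm at most 1.\<close>

primrec sqrt_scal :: "nat \<Rightarrow> real" where
  "sqrt_scal 0 = 0"
| "sqrt_scal (Suc n) = (1 + (sqrt_scal n)\<^sup>2) / 2"

lemma sqrt_scal_bounds: "0 \<le> sqrt_scal n \<and> sqrt_scal n \<le> 1"
proof (induction n)
  case (Suc n)
  then have "(sqrt_scal n)\<^sup>2 \<le> 1" by (simp add: power_le_one)
  then show ?case by simp
qed simp

lemma sqrt_scal_mono: "sqrt_scal n \<le> sqrt_scal (Suc n)"
proof -
  have "0 \<le> (1 - sqrt_scal n)\<^sup>2" by simp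
  then show ?thesis by (simp add: power2_eq_square algebra_simps)
qed

lemma sqrt_scal_convergent: "Cauchy sqrt_scal"
proof -
  have "incseq sqrt_scal" using sqrt_scal_mono by (simp add: incseq_SucI)
  moreover have "Bseq sqrt_scal"
    using sqrt_scal_bounds by (intro BseqI'[of _ 1]) simp
  ultimately show ?thesis by (simp add: Bseq_mono_convergent convergent_Cauchy incseq_def)
qed

text \<open>The model is the norm of p(h) for a self-adjoint h in a C*-algebra; evaluation may have
  a kernel, so \<open>N\<close> is only a seminorm. On polynomials everything commutes and
  identities can be checked at complex numbers. For \<open>N 1\<close> an inequality is stated
  because 1 = 0 is possible in the algebra.\<close>

locale poly_norm =
  fixes N :: "complex poly \<Rightarrow> real"
  assumes N_triangle: "N (p + q) \<le> N p + N q"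
    and N_smult: "N (smult c p) = cmod c * N p"
    and N_mult: "N (p * q) \<le> N p * N q"
    and N_cstar: "N (cpoly p * p) = (N p)\<^sup>2"
    and N_one: "N 1 \<le> 1"
    and N_nonneg [simp]: "0 \<le> N p"
begin

lemma N_zero [simp]: "N 0 = 0"
  using N_smult[of 0 0] by simp

lemma N_minus [simp]: "N (- p) = N p"
  using N_smult[of "-1" p] by simp

lemma N_diff: "N (p - q) \<le> N p + N q"
  using N_triangle[of p "- q"] by simp

lemma N_diff_commute: "N (p - q) = N (q - p)"
  using N_minus[of "p - q"] by simp

lemma N_diff3: "N (p - r) \<le> N (p - q) + N (q - r)"
  using N_triangle[of "p - q" "q - r"] by simp

lemma N_rc_mult [simp]: "N (rc t * p) = \<bar>t\<bar> * N p"
  using N_smult[of "of_real t" p] by (simp add: rc_def)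

lemma N_rc: "N (rc t) \<le> \<bar>t\<bar>"
  using N_rc_mult[of t 1] N_one mult_left_le[of "N 1" "\<bar>t\<bar>"] by simp

lemma rc_zero [simp]: "rc 0 = 0" and rc_one [simp]: "rc 1 = 1"
  by (simp_all add: rc_def one_pCons)

lemma N_cpoly [simp]: "N (cpoly p) = N p"
proof -
  have *: "N p \<le> N (cpoly p)" for p
  proof (cases "N p = 0")
    case False
    have "N p * N p \<le> N (cpoly p) * N p"
      using N_cstar[of p] N_mult[of "cpoly p" p] by (simp add: power2_eq_square)
    then show ?thesis using False N_nonneg[of p]
      by (simp add: mult_le_cancel_right)
  qed simp
  show ?thesis using *[of p] *[of "cpoly p"] by simp
qed

lemma N_sq: "cpoly p = p \<Longrightarrow> N (p\<^sup>2) = (N p)\<^sup>2"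
  using N_cstar[of p] by (simp add: power2_eq_square)

lemma N_power_le: "n > 0 \<or> N 1 = 1 \<Longrightarrow> N (p ^ n) \<le> N p ^ n"
proof (induction n)
  case (Suc n)
  show ?case
  proof (cases "n = 0")
    case False
    then have "N (p ^ n) \<le> N p ^ n" using Suc by simp
    then have "N p * N (p ^ n) \<le> N p * N p ^ n" by (intro mult_left_mono) simp_all
    then show ?thesis using N_mult[of p "p ^ n"] by simp
  qed simp
qed simp

lemma N_power_two: "cpoly p = p \<Longrightarrow> N (p ^ (2 ^ n)) = N p ^ (2 ^ n)"
proof (induction n)
  case (Suc n)
  have "N (p ^ (2 ^ Suc n)) = N ((p ^ (2 ^ n))\<^sup>2)"
    by (simp add: power_mult[symmetric] mult.commute)
  also have "\<dots> = N p ^ (2 ^ Suc n)"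
    using Suc by (subst N_sq) (simp_all add: power_mult[symmetric] mult.commute)
  finally show ?case .
qed simp

text \<open>The C*-identity yields equality for exponents that are powers of two. Splitting p^(2^n)
  into p^n and p^(2^n - n) carries it over to all n > 0, as submultiplicativity bounds the second
  factor.\<close>

lemma N_power: "cpoly p = p \<Longrightarrow> 0 < n \<Longrightarrow> N (p ^ n) = N p ^ n"
proof (rule antisym)
  assume p: "cpoly p = p" and n: "0 < n"
  show "N (p ^ n) \<le> N p ^ n" using N_power_le n by blast
  show "N p ^ n \<le> N (p ^ n)"
  proof (cases "N p = 0")
    case False
    then have Np: "N p > 0" using N_nonneg[of p] by linarith
    have less: "n < 2 ^ n" by simp
    have "N p ^ n * N p ^ (2 ^ n - n) = N (p ^ n * p ^ (2 ^ n - n))"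
      using N_power_two[OF p, of n] less by (simp add: power_add[symmetric])
    also have "\<dots> \<le> N (p ^ n) * N (p ^ (2 ^ n - n))" by (rule N_mult)
    also have "\<dots> \<le> N (p ^ n) * N p ^ (2 ^ n - n)"
      using less by (intro mult_left_mono N_power_le) simp_all
    finally show ?thesis using Np by (simp add: mult_le_cancel_right)
  qed (use n in \<open>simp add: power_0_left\<close>)
qed

text \<open>A fixed point w of w = (z + w^2)/2 satisfies (1 - w)^2 = 1 - z, so 1 - w is a square
  root of 1 - z.\<close>

primrec sqrt_iter :: "complex poly \<Rightarrow> nat \<Rightarrow> complex poly" where
  "sqrt_iter z 0 = 0"
| "sqrt_iter z (Suc n) = smult (1/2) (z + (sqrt_iter z n)\<^sup>2)"

lemma cpoly_sqrt_iter: "cpoly z = z \<Longrightarrow> cpoly (sqrt_iter z n) = sqrt_iter z n"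
  by (induction n) simp_all

lemma N_sqrt_iter:
  assumes "N z \<le> 1"
  shows "N (sqrt_iter z n) \<le> sqrt_scal n"
proof (induction n)
  case (Suc n)
  have "N ((sqrt_iter z n)\<^sup>2) \<le> (N (sqrt_iter z n))\<^sup>2"
    unfolding power2_eq_square by (rule N_mult)
  also have "\<dots> \<le> (sqrt_scal n)\<^sup>2" using Suc by (simp add: power_mono)
  finally have "N (z + (sqrt_iter z n)\<^sup>2) \<le> 1 + (sqrt_scal n)\<^sup>2"
    using N_triangle[of z "(sqrt_iter z n)\<^sup>2"] assms by linarith
  then show ?case by (simp add: N_smult)
qed simp

text \<open>The difference of consecutive squares factors as (b - a)(b + a). Majorising both factors
  by the scalar iteration reproduces exactly the scalar increment.\<close>

lemma N_sqrt_iter_step: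
  assumes "N z \<le> 1"
  shows "N (sqrt_iter z (Suc n) - sqrt_iter z n) \<le> sqrt_scal (Suc n) - sqrt_scal n"
proof (induction n)
  case 0
  then show ?case using assms by (simp add: N_smult)
next
  case (Suc n)
  let ?a = "sqrt_iter z n" and ?b = "sqrt_iter z (Suc n)"
  let ?s = "sqrt_scal n" and ?t = "sqrt_scal (Suc n)"
  have "sqrt_iter z (Suc (Suc n)) - ?b = smult (1/2) (?b\<^sup>2 - ?a\<^sup>2)"
    by (simp add: smult_diff_right[symmetric] smult_add_right)
  also have "?b\<^sup>2 - ?a\<^sup>2 = (?b - ?a) * (?b + ?a)"
    by (simp only: power2_eq_square algebra_simps)
  finally have "N (sqrt_iter z (Suc (Suc n)) - ?b) = 1/2 * N ((?b - ?a) * (?b + ?a))"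
    by (simp add: N_smult)
  also have "N ((?b - ?a) * (?b + ?a)) \<le> N (?b - ?a) * N (?b + ?a)" by (rule N_mult)
  also have "\<dots> \<le> (?t - ?s) * (?t + ?s)"
    using Suc N_sqrt_iter[OF assms, of n] N_sqrt_iter[OF assms, of "Suc n"]
      N_triangle[of ?b ?a] sqrt_scal_mono[of n]
    by (intro mult_mono) (linarith | simp)+
  finally show ?case by (simp add: power2_eq_square field_simps)
qed

lemma N_sqrt_iter_diff:
  assumes "N z \<le> 1" and "n \<le> m"
  shows "N (sqrt_iter z m - sqrt_iter z n) \<le> sqrt_scal m - sqrt_scal n"
  using assms(2)
proof (induction m rule: dec_induct)
  case (step m)
  show ?case using N_diff3[of "sqrt_iter z (Suc m)" "sqrt_iter z n" "sqrt_iter z m"]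
      N_sqrt_iter_step[OF assms(1), of m] step by linarith
qed simp

text \<open>The residue W_n^2 - (1 - z) is twice an increment of the iteration, so convergence of
  the scalar majorant drives it to 0. The bound on 1 - W_n is recorded because it certifies that a
  limit of W_n is positive.\<close>

lemma ex_sqrt_seq:
  assumes "cpoly z = z" and "N z \<le> 1"
  obtains W where "\<And>n. cpoly (W n) = W n" "\<And>n. N (1 - W n) \<le> 1"
    "\<And>e. e > 0 \<Longrightarrow> \<exists>M. \<forall>m\<ge>M. \<forall>n\<ge>M. N (W m - W n) < e"
    "(\<lambda>n. N ((W n)\<^sup>2 - (1 - z))) \<longlonglongrightarrow> 0"
proof
  let ?W = "\<lambda>n. 1 - sqrt_iter z n"
  show "cpoly (?W n) = ?W n" for n using assms by (simp add: cpoly_sqrt_iter)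
  show "N (1 - ?W n) \<le> 1" for n
    using N_sqrt_iter[OF assms(2), of n] sqrt_scal_bounds[of n] by simp
  have dist: "N (?W m - ?W n) \<le> \<bar>sqrt_scal m - sqrt_scal n\<bar>" for m n
  proof -
    have eq: "?W m - ?W n = sqrt_iter z n - sqrt_iter z m" by simp
    show ?thesis
    proof (cases "n \<le> m")
      case True
      then show ?thesis unfolding eq
        using N_sqrt_iter_diff[OF assms(2) True] N_diff_commute[of "sqrt_iter z m" "sqrt_iter z n"]
        by linarith
    next
      case False
      then show ?thesis unfolding eq
        using N_sqrt_iter_diff[OF assms(2), of m n] by linarith
    qed
  qed
  show "\<exists>M. \<forall>m\<ge>M. \<forall>n\<ge>M. N (?W m - ?W n) < e" if e: "e > 0" for e
  proof -
    obtain M where M: "\<forall>m\<ge>M. \<forall>n\<ge>M. \<bar>sqrt_scal m - sqrt_scal n\<bar> < e"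
      using sqrt_scal_convergent e unfolding Cauchy_def dist_real_def by blast
    show ?thesis
    proof (intro exI[of _ M] allI impI)
      fix m n assume "M \<le> m" "M \<le> n"
      then show "N (?W m - ?W n) < e" using dist[of m n] M le_less_trans by blast
    qed
  qed
  have eq: "(?W n)\<^sup>2 - (1 - z) = smult 2 (sqrt_iter z (Suc n) - sqrt_iter z n)" for n
    by (rule complex_poly_ext) (simp add: power2_eq_square algebra_simps)
  have bd: "N ((?W n)\<^sup>2 - (1 - z)) \<le> 2 * (sqrt_scal (Suc n) - sqrt_scal n)" for n
    unfolding eq N_smult using N_sqrt_iter_step[OF assms(2), of n]
    by (simp del: sqrt_iter.simps sqrt_scal.simps)
  obtain L where "sqrt_scal \<longlonglongrightarrow> L"
    using Cauchy_convergent[OF sqrt_scal_convergent] unfolding convergent_def by blast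
  then have "(\<lambda>n. 2 * (sqrt_scal (Suc n) - sqrt_scal n)) \<longlonglongrightarrow> 2 * (L - L)"
    by (intro tendsto_intros LIMSEQ_Suc)
  then have lim: "(\<lambda>n. 2 * (sqrt_scal (Suc n) - sqrt_scal n)) \<longlonglongrightarrow> 0" by simp
  show "(\<lambda>n. N ((?W n)\<^sup>2 - (1 - z))) \<longlonglongrightarrow> 0"
    by (rule Lim_null_comparison[OF _ lim]) (simp only: real_norm_def abs_of_nonneg[OF N_nonneg] bd eventually_True)
qed

lemma ex_sqrt_approx:
  assumes "cpoly z = z" and "N z \<le> 1" and "e > 0"
  shows "\<exists>w. cpoly w = w \<and> N (w\<^sup>2 - (1 - z)) < e"
proof (rule ex_sqrt_seq[OF assms(1,2)])
  fix W assume W: "\<And>n. cpoly (W n) = W n" and lim: "(\<lambda>n. N ((W n)\<^sup>2 - (1 - z))) \<longlonglongrightarrow> 0"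
  have "eventually (\<lambda>n. N ((W n)\<^sup>2 - (1 - z)) < e) sequentially"
    using lim assms(3) by (rule order_tendstoD(2))
  then obtain n where "N ((W n)\<^sup>2 - (1 - z)) < e" by (auto simp: eventually_sequentially)
  then show ?thesis using W by blast
qed

text \<open>In spectral terms the values of p lie in [0, 2t]: this is where the disc of radius t
  around t meets the real axis.\<close>

definition pos :: "complex poly \<Rightarrow> bool" where
  "pos p \<longleftrightarrow> cpoly p = p \<and> (\<exists>t. N (rc t - p) \<le> t)"

lemma posI: "cpoly p = p \<Longrightarrow> N (rc t - p) \<le> t \<Longrightarrow> pos p"
  unfolding pos_def by blast

lemma pos_cpoly: "pos p \<Longrightarrow> cpoly p = p"
  unfolding pos_def by blast

text \<open>If \<open>w'\<^sup>2 = 1 - w\<^sup>2\<close> then \<open>u = w + \<i> w'\<close> is unitary and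
  \<open>2 w\<^sup>2 - 1\<close> is the real part of \<open>u\<^sup>2\<close>.\<close>
lemma N_one_minus_sq:
  assumes w: "cpoly w = w" and "N w \<le> 1"
  shows "N (1 - 2 * w\<^sup>2) \<le> 1"
proof (rule field_le_epsilon)
  fix e :: real assume e: "e > 0"
  have "N (w\<^sup>2) \<le> 1" using N_sq[OF w] assms(2) by (simp add: power_le_one)
  moreover have "cpoly (w\<^sup>2) = w\<^sup>2" by (simp add: w)
  ultimately obtain v where v: "cpoly v = v" and n: "N (v\<^sup>2 - (1 - w\<^sup>2)) < e / 2"
    using ex_sqrt_approx[of "w\<^sup>2" "e / 2"] e by auto
  define u where "u = w + smult \<i> v"
  have uu: "cpoly u * u = w\<^sup>2 + v\<^sup>2"
    unfolding u_def
    by (rule complex_poly_ext) (simp add: v w power2_eq_square algebra_simps)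
  have eq: "w\<^sup>2 + v\<^sup>2 = 1 + (v\<^sup>2 - (1 - w\<^sup>2))"
    by (rule complex_poly_ext) simp
  have "N (w\<^sup>2 + v\<^sup>2) \<le> 1 + e / 2"
    unfolding eq using N_triangle[of 1 "v\<^sup>2 - (1 - w\<^sup>2)"] N_one n by linarith
  then have u2: "(N u)\<^sup>2 \<le> 1 + e / 2" using N_cstar[of u] uu by simp
  have eq': "v\<^sup>2 - w\<^sup>2 = - smult (1/2) (u\<^sup>2 + (cpoly u)\<^sup>2)"
    unfolding u_def
    by (rule complex_poly_ext) (simp add: v w power2_eq_square algebra_simps)
  have "N (v\<^sup>2 - w\<^sup>2) = 1/2 * N (u\<^sup>2 + (cpoly u)\<^sup>2)"
    unfolding eq' N_minus N_smult by simp
  also have "\<dots> \<le> 1/2 * (N u * N u + N (cpoly u) * N (cpoly u))"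
    using N_triangle[of "u\<^sup>2" "(cpoly u)\<^sup>2"] N_mult[of u u] N_mult[of "cpoly u" "cpoly u"]
    by (simp add: power2_eq_square)
  also have "\<dots> = (N u)\<^sup>2" by (simp add: power2_eq_square)
  finally have vw: "N (v\<^sup>2 - w\<^sup>2) \<le> 1 + e / 2" using u2 by linarith
  have eq: "1 - 2 * w\<^sup>2 = (v\<^sup>2 - w\<^sup>2) - (v\<^sup>2 - (1 - w\<^sup>2))"
    by (rule complex_poly_ext) simp
  show "N (1 - 2 * w\<^sup>2) \<le> 1 + e"
    unfolding eq
    using N_diff[of "v\<^sup>2 - w\<^sup>2" "v\<^sup>2 - (1 - w\<^sup>2)"] n vw by linarith
qed

text \<open>The factor r = 1 / sqrt s moves w into the unit ball, where
  \<open>N_one_minus_sq\<close> applies; s/2 is the midpoint of the interval [0, s] of possible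
  values of w^2.\<close>

lemma N_sq_bound:
  assumes w: "cpoly w = w" and s: "(N w)\<^sup>2 \<le> s"
  shows "N (rc (s / 2) - w\<^sup>2) \<le> s / 2"
proof (cases "s = 0")
  case True
  then have "N (w\<^sup>2) = 0" using N_sq[OF w] s by simp
  then show ?thesis using True by simp
next
  case False
  then have s0: "s > 0" using order_trans[OF zero_le_power2 s] by simp
  define r where "r = 1 / sqrt s"
  have r0: "r > 0" using s0 by (simp add: r_def)
  have "r * r = 1 / (sqrt s * sqrt s)" by (simp add: r_def)
  then have r: "r * r * s = 1" using s0 by simp
  have "r * r * (N w)\<^sup>2 \<le> r * r * s" using s by (intro mult_left_mono) simp_all
  then have "(r * N w)\<^sup>2 \<le> 1\<^sup>2" using r by (simp add: power2_eq_square algebra_simps)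
  then have "r * N w \<le> 1" by (rule power2_le_imp_le) simp
  then have "N (rc r * w) \<le> 1" using r0 by simp
  then have 1: "N (1 - 2 * (rc r * w)\<^sup>2) \<le> 1"
    using w by (intro N_one_minus_sq) simp_all
  have "complex_of_real (r * r * s) = 1" using r by simp
  then have rs: "of_real r * (of_real r * (of_real s * x)) = (x::complex)" for x
    by (simp add: mult.assoc[symmetric])
  have "rc (s / 2) - w\<^sup>2 = rc (s / 2) * (1 - 2 * (rc r * w)\<^sup>2)"
    by (rule complex_poly_ext) (simp add: power2_eq_square algebra_simps rs)
  then show ?thesis using 1 s0 by (simp add: N_smult)
qed

lemma pos_sq: "cpoly w = w \<Longrightarrow> pos (w\<^sup>2)"
  using N_sq_bound[of w "(N w)\<^sup>2"] by (intro posI[of _ "(N w)\<^sup>2 / 2"]) auto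

text \<open>With z = (t - p)/t, of norm at most 1, one has p = t (1 - z), and the iteration supplies
  approximate roots of 1 - z.\<close>

lemma pos_sqrt_approx:
  assumes "pos p" and "e > 0"
  shows "\<exists>w. cpoly w = w \<and> N (w\<^sup>2 - p) < e"
proof -
  from assms(1) obtain t where p: "cpoly p = p" and t: "N (rc t - p) \<le> t"
    unfolding pos_def by blast
  show ?thesis
  proof (cases "t = 0")
    case True
    then have "N p \<le> 0" using t by simp
    then show ?thesis using assms(2) by (intro exI[of _ 0]) simp
  next
    case False
    then have t0: "t > 0" using t N_nonneg[of "rc t - p"] by linarith
    define z where "z = rc (1 / t) * (rc t - p)"
    have "N z \<le> 1" using t t0 unfolding z_def N_rc_mult by (simp add: field_simps)
    moreover have "cpoly z = z" by (simp add: z_def p)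
    ultimately obtain w where w: "cpoly w = w" and n: "N (w\<^sup>2 - (1 - z)) < e / t"
      using ex_sqrt_approx[of z "e / t"] assms(2) t0 by auto
    define r where "r = sqrt t"
    have r: "of_real r * (of_real r * x) = of_real t * (x::complex)" for x
      using t0 by (simp add: r_def mult.assoc[symmetric] of_real_mult[symmetric])
    have eq: "(rc r * w)\<^sup>2 - p = rc t * (w\<^sup>2 - (1 - z))"
      using t0 by (intro complex_poly_ext)
        (simp add: power2_eq_square algebra_simps r z_def)
    have "N ((rc r * w)\<^sup>2 - p) < e" unfolding eq N_rc_mult using n t0 by (simp add: field_simps)
    then show ?thesis using w by (intro exI[of _ "rc r * w"]) simp
  qed
qed

text \<open>The radius in \<open>pos\<close> is merely known to exist. Comparison with the square of
  an approximate root shows that every radius from half the norm upwards works, which provides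
  common radii for sums and limits.\<close>

lemma pos_upper:
  assumes "pos p" and "N p / 2 \<le> t"
  shows "N (rc t - p) \<le> t"
proof (rule field_le_epsilon)
  fix e :: real assume "e > 0"
  then obtain w where w: "cpoly w = w" "N (w\<^sup>2 - p) < e / 2"
    using pos_sqrt_approx[OF assms(1), of "e / 2"] by auto
  have Nw: "(N w)\<^sup>2 \<le> 2 * t + e / 2"
    using N_triangle[of "w\<^sup>2 - p" p] w N_sq[OF w(1)] assms(2) by simp
  define x where "x = rc ((2 * t + e/2) / 2) - w\<^sup>2"
  have x: "N x \<le> t + e / 4"
    using N_sq_bound[OF w(1) Nw] unfolding x_def by (simp add: add_divide_distrib)
  have c: "N (rc (e / 4)) \<le> e / 4" using N_rc[of "e / 4"] \<open>e > 0\<close> by simp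
  have eq: "rc t - p = x + (w\<^sup>2 - p) - rc (e / 4)"
    unfolding x_def by (rule complex_poly_ext) (simp add: field_simps)
  show "N (rc t - p) \<le> t + e"
    unfolding eq
    using w(2) x c N_triangle[of x "w\<^sup>2 - p"] N_diff[of "x + (w\<^sup>2 - p)" "rc (e / 4)"]
    by linarith
qed

text \<open>The radius N p + 1 serves all approximants at distance less than 1 from p at the same
  time, so the defining inequality passes to the limit.\<close>

lemma pos_limit:
  assumes p: "cpoly p = p" and lim: "\<And>e. e > 0 \<Longrightarrow> \<exists>q. pos q \<and> N (p - q) < e"
  shows "pos p"
proof (rule posI[OF p, of "N p + 1"], rule field_le_epsilon)
  fix e :: real assume e: "e > 0"
  then obtain q where q: "pos q" "N (p - q) < min e 1" using lim[of "min e 1"] by auto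
  have "N q \<le> N p + 1" using N_diff3[of q 0 p] q(2) by (simp add: N_diff_commute)
  then have "N (rc (N p + 1) - q) \<le> N p + 1"
    using q(1) N_nonneg[of p] N_nonneg[of q] by (intro pos_upper) linarith+
  then show "N (rc (N p + 1) - p) \<le> N p + 1 + e"
    using N_diff3[of "rc (N p + 1)" p q] q(2) by (simp add: N_diff_commute)
qed

lemma pos_add:
  assumes "pos p" "pos q"
  shows "pos (p + q)"
proof (rule posI[of _ "N p + N q"])
  have eq: "rc (N p + N q) - (p + q) = (rc (N p) - p) + (rc (N q) - q)"
    by (rule complex_poly_ext) simp
  show "N (rc (N p + N q) - (p + q)) \<le> N p + N q" unfolding eq
    using pos_upper[OF assms(1), of "N p"] pos_upper[OF assms(2), of "N q"]
      N_triangle[of "rc (N p) - p" "rc (N q) - q"] by simp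
qed (simp add: assms pos_cpoly)

text \<open>Polynomials commute, so the product of two squares is the square of a product;
  approximate roots and closedness do the rest.\<close>

lemma pos_mult:
  assumes "pos p" "pos q"
  shows "pos (p * q)"
proof (rule pos_limit)
  show "cpoly (p * q) = p * q" using assms by (simp add: pos_cpoly)
  fix e :: real assume e: "e > 0"
  define K where "K = 2 * (N p + N q + 2)"
  have K: "K > 0" unfolding K_def by (intro mult_pos_pos add_nonneg_pos add_nonneg_nonneg) simp_all
  define d where "d = min 1 (e / K)"
  have d: "d > 0" "d \<le> 1" "d * K \<le> e"
    using e K by (auto simp: d_def min_def field_simps)
  obtain v where v: "cpoly v = v" "N (v\<^sup>2 - p) < d" using pos_sqrt_approx[OF assms(1) d(1)] by auto
  obtain w where w: "cpoly w = w" "N (w\<^sup>2 - q) < d" using pos_sqrt_approx[OF assms(2) d(1)] by auto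
  have Nw: "N (w\<^sup>2) \<le> N q + 1" using w d N_triangle[of "w\<^sup>2 - q" q] by simp
  have "p * q - (v * w)\<^sup>2 = - ((v\<^sup>2 - p) * w\<^sup>2 + p * (w\<^sup>2 - q))"
    by (simp add: power2_eq_square algebra_simps)
  then have "N (p * q - (v * w)\<^sup>2) = N ((v\<^sup>2 - p) * w\<^sup>2 + p * (w\<^sup>2 - q))" by (simp only: N_minus)
  also have "\<dots> \<le> N (v\<^sup>2 - p) * N (w\<^sup>2) + N p * N (w\<^sup>2 - q)"
    using N_triangle[of "(v\<^sup>2 - p) * w\<^sup>2" "p * (w\<^sup>2 - q)"] N_mult[of "v\<^sup>2 - p" "w\<^sup>2"]
      N_mult[of p "w\<^sup>2 - q"] by linarith
  also have "\<dots> \<le> d * (N q + 1) + N p * d"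
    using v w Nw d by (intro add_mono mult_mono) auto
  also have "\<dots> < e" using d e mult_nonneg_nonneg[of d "N p"] mult_nonneg_nonneg[of d "N q"]
    by (simp add: algebra_simps K_def)
  finally show "\<exists>q'. pos q' \<and> N (p * q - q') < e"
    using v w by (intro exI[of _ "(v * w)\<^sup>2"]) (simp add: pos_sq)
qed

lemma pos_rc [simp]: "0 \<le> t \<Longrightarrow> pos (rc t)"
  by (rule posI[of _ t]) simp_all

lemma pos_zero [simp]: "pos 0" and pos_one [simp]: "pos 1"
  using pos_rc[of 0] pos_rc[of 1] by simp_all

lemma pos_rc_mult: "0 \<le> t \<Longrightarrow> pos p \<Longrightarrow> pos (rc t * p)"
  using pos_mult[of "rc t" p] by simp

lemma pos_power: "pos p \<Longrightarrow> pos (p ^ n)"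
  by (induction n) (simp_all add: pos_mult)

lemma pos_upper_bound: "cpoly p = p \<Longrightarrow> N p \<le> t \<Longrightarrow> pos (rc t - p)"
  by (rule posI[of _ t]) simp_all

text \<open>With \<open>c + k = v\<^sup>2\<close> and \<open>c - k = w\<^sup>2\<close>, the element \<open>u = k + \<i> v w\<close> satisfies
  \<open>u\<^sup>\<star> u = c\<^sup>2\<close>, and \<open>k\<close> is its real part.\<close>
lemma pos_bound:
  assumes k: "cpoly k = k" and m: "pos (rc c - k)" and p: "pos (rc c + k)" and c: "0 \<le> c"
  shows "N k \<le> c"
proof -
  have "(N k)\<^sup>2 \<le> c\<^sup>2"
  proof (rule field_le_epsilon)
    fix e :: real assume e: "e > 0"
    obtain w where w: "cpoly w = w" "N (w\<^sup>2 - (rc c - k)) < 1"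
      using pos_sqrt_approx[OF m, of 1] by auto
    define q where "q = (rc c + k) * (rc c - k)"
    have "pos q" unfolding q_def by (intro pos_mult m p)
    then obtain v where v: "cpoly v = v" "N (v\<^sup>2 - q) < e" using pos_sqrt_approx e by blast
    define u where "u = k + smult \<i> v"
    have "cpoly u * u = rc (c\<^sup>2) + (v\<^sup>2 - q)"
      unfolding u_def q_def
      by (rule complex_poly_ext) (simp add: v k power2_eq_square algebra_simps)
    then have "(N u)\<^sup>2 \<le> c\<^sup>2 + e"
      using N_cstar[of u] N_triangle[of "rc (c\<^sup>2)" "v\<^sup>2 - q"] N_rc[of "c\<^sup>2"] v by simp
    moreover have "k = smult (1/2) (u + cpoly u)"
      unfolding u_def by (rule complex_poly_ext) (simp add: v k)
    then have "N k = 1/2 * N (u + cpoly u)" by (metis N_smult norm_divide norm_numeral norm_one)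
    then have "N k \<le> N u" using N_triangle[of u "cpoly u"] by simp
    then have "(N k)\<^sup>2 \<le> (N u)\<^sup>2" by (simp add: power_mono)
    ultimately show "(N k)\<^sup>2 \<le> c\<^sup>2 + e" by linarith
  qed
  then show ?thesis using c by (simp add: power2_le_iff_abs_le)
qed

text \<open>The identity in the induction step shows that the expression is the sum of (j + 1) s^j
  (1 - s)^2 over j < m.\<close>

lemma pos_power_gap:
  assumes s: "pos s"
  shows "pos (1 - of_nat (Suc m) * s ^ m + of_nat m * s ^ Suc m)"
proof (induction m)
  case (Suc m)
  have eq: "1 - of_nat (Suc (Suc m)) * s ^ Suc m + of_nat (Suc m) * s ^ Suc (Suc m)
      = (1 - of_nat (Suc m) * s ^ m + of_nat m * s ^ Suc m)
        + rc (real (Suc m)) * (s ^ m * (1 - s)\<^sup>2)"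
    by (rule complex_poly_ext) (simp add: power2_eq_square algebra_simps)
  have "pos (s ^ m * (1 - s)\<^sup>2)"
    using s by (intro pos_mult pos_power pos_sq) (simp_all add: pos_cpoly)
  then show ?case unfolding eq by (intro pos_add[OF Suc.IH] pos_rc_mult) simp_all
qed simp

text \<open>On \<open>s \<ge> 0\<close> one has \<open>s\<^sup>m - s\<^sup>m\<^sup>+\<^sup>1 \<le> 1/(m+1)\<close>, by AM-GM.\<close>
lemma pos_power_diff_upper:
  assumes s: "pos s"
  shows "pos (rc (1 / Suc m) - (s ^ m - s ^ Suc m))"
proof -
  have "rc (1 / Suc m) - (s ^ m - s ^ Suc m)
     = rc (1 / Suc m) * ((1 - of_nat (Suc m) * s ^ m + of_nat m * s ^ Suc m) + s ^ Suc m)"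
    by (rule complex_poly_ext) (simp add: field_simps del: of_nat_Suc, simp add: algebra_simps)
  then show ?thesis using s by (simp only:) (intro pos_add pos_rc_mult pos_power_gap pos_power; simp)
qed

text \<open>The hypothesis bounds s^(m+1) by s^m + t, hence by the number N(s^m) + t. Norms of
  powers are powers of norms, which turns this into an inequality for N s.\<close>

lemma pos_power_diff_lower:
  assumes s: "pos s" and h: "pos (rc t + (s ^ m - s ^ Suc m))" and t: "0 \<le> t" and m: "0 < m"
  shows "N s ^ m * (N s - 1) \<le> t"
proof -
  have cs: "cpoly s = s" using s by (rule pos_cpoly)
  let ?c = "N (s ^ m) + t"
  have "rc ?c - s ^ Suc m = (rc (N (s ^ m)) - s ^ m) + (rc t + (s ^ m - s ^ Suc m))"
    by (rule complex_poly_ext) simp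
  moreover have "pos (rc (N (s ^ m)) - s ^ m)" using cs by (intro pos_upper_bound) simp_all
  ultimately have "pos (rc ?c - s ^ Suc m)" using h by (simp only: pos_add)
  moreover have "pos (rc ?c + s ^ Suc m)" using t s by (intro pos_add pos_power pos_rc) simp_all
  ultimately have "N (s ^ Suc m) \<le> ?c" using t cs by (intro pos_bound) simp_all
  then show ?thesis using N_power[OF cs m] N_power[OF cs, of "Suc m"]
    by (simp add: algebra_simps)
qed

end

section \<open>Algebra and norm in a unital C*-algebra\<close>

notation cs_zero ("\<zero>\<index>")
  and cs_one ("\<one>\<index>")
  and cs_add (infixl "\<oplus>\<index>" 65)
  and cs_sub (infixl "\<ominus>\<index>" 65)
  and cs_mult (infixl "\<otimes>\<index>" 70)
  and cs_smult (infixr "\<odot>\<index>" 75)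
  and cs_star ("\<star>\<index> _" [81] 80)
  and cs_norm ("\<parallel>_\<parallel>\<index>")

locale cstar_algebra =
  fixes A :: "'a cstar" (structure)
  assumes cstar: "unital_cstar_algebra A"
begin

abbreviation C :: "'a set" where
  "C \<equiv> cs_carrier A"

lemmas ax = cstar[unfolded unital_cstar_algebra_def Let_def]

lemma laws:
  "\<forall>x\<in>C. \<forall>y\<in>C. \<forall>w\<in>C. x \<oplus> y \<oplus> w = x \<oplus> (y \<oplus> w)"
  "\<forall>x\<in>C. \<forall>y\<in>C. x \<oplus> y = y \<oplus> x"
  "\<forall>x\<in>C. \<zero> \<oplus> x = x"
  "\<forall>x\<in>C. x \<oplus> - 1 \<odot> x = \<zero>"
  "\<forall>x\<in>C. 1 \<odot> x = x"
  "\<forall>a b. \<forall>x\<in>C. a \<odot> b \<odot> x = (a * b) \<odot> x"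
  "\<forall>a b. \<forall>x\<in>C. (a + b) \<odot> x = a \<odot> x \<oplus> b \<odot> x"
  "\<forall>a. \<forall>x\<in>C. \<forall>y\<in>C. a \<odot> (x \<oplus> y) = a \<odot> x \<oplus> a \<odot> y"
  "\<forall>x\<in>C. \<forall>y\<in>C. \<forall>w\<in>C. x \<otimes> y \<otimes> w = x \<otimes> (y \<otimes> w)"
  "\<forall>x\<in>C. \<forall>y\<in>C. \<forall>w\<in>C. x \<otimes> (y \<oplus> w) = x \<otimes> y \<oplus> x \<otimes> w"
  "\<forall>x\<in>C. \<forall>y\<in>C. \<forall>w\<in>C. (x \<oplus> y) \<otimes> w = x \<otimes> w \<oplus> y \<otimes> w"
  "\<forall>a. \<forall>x\<in>C. \<forall>y\<in>C. (a \<odot> x) \<otimes> y = a \<odot> (x \<otimes> y) \<and> x \<otimes> (a \<odot> y) = a \<odot> (x \<otimes> y)"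
  "\<forall>x\<in>C. \<one> \<otimes> x = x \<and> x \<otimes> \<one> = x"
  "\<forall>x\<in>C. \<star> (\<star> x) = x"
  "\<forall>x\<in>C. \<forall>y\<in>C. \<star> (x \<oplus> y) = \<star> x \<oplus> \<star> y"
  "\<forall>a. \<forall>x\<in>C. \<star> (a \<odot> x) = cnj a \<odot> \<star> x"
  "\<forall>x\<in>C. \<forall>y\<in>C. \<star> (x \<otimes> y) = \<star> y \<otimes> \<star> x"
  "\<forall>x\<in>C. 0 \<le> \<parallel>x\<parallel> \<and> (\<parallel>x\<parallel> = 0) = (x = \<zero>)"
  "\<forall>x\<in>C. \<forall>y\<in>C. \<parallel>x \<oplus> y\<parallel> \<le> \<parallel>x\<parallel> + \<parallel>y\<parallel>"
  "\<forall>a. \<forall>x\<in>C. \<parallel>a \<odot> x\<parallel> = cmod a * \<parallel>x\<parallel>"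
  "\<forall>x\<in>C. \<forall>y\<in>C. \<parallel>x \<otimes> y\<parallel> \<le> \<parallel>x\<parallel> * \<parallel>y\<parallel>"
  "\<forall>x\<in>C. \<parallel>\<star> x \<otimes> x\<parallel> = \<parallel>x\<parallel>\<^sup>2"
  by (insert ax, (elim conjE, assumption)+)

lemma closed [simp, intro]:
  "\<zero> \<in> C" "\<one> \<in> C" "x \<in> C \<Longrightarrow> y \<in> C \<Longrightarrow> x \<oplus> y \<in> C" "x \<in> C \<Longrightarrow> y \<in> C \<Longrightarrow> x \<otimes> y \<in> C"
  "x \<in> C \<Longrightarrow> c \<odot> x \<in> C" "x \<in> C \<Longrightarrow> \<star> x \<in> C"
  by (insert ax, (elim conjE, blast)+)

lemma sub_closed [simp, intro]: "x \<in> C \<Longrightarrow> y \<in> C \<Longrightarrow> x \<ominus> y \<in> C"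
  by (simp add: cs_sub_def)

lemma add_assoc: "x \<in> C \<Longrightarrow> y \<in> C \<Longrightarrow> z \<in> C \<Longrightarrow> (x \<oplus> y) \<oplus> z = x \<oplus> (y \<oplus> z)"
  using laws(1) by blast

lemma add_commute: "x \<in> C \<Longrightarrow> y \<in> C \<Longrightarrow> x \<oplus> y = y \<oplus> x"
  using laws(2) by blast

lemma add_left_commute: "x \<in> C \<Longrightarrow> y \<in> C \<Longrightarrow> z \<in> C \<Longrightarrow> x \<oplus> (y \<oplus> z) = y \<oplus> (x \<oplus> z)"
  by (metis add_assoc add_commute)

lemmas add_ac = add_assoc add_commute add_left_commute

lemma add_zero [simp]: "x \<in> C \<Longrightarrow> \<zero> \<oplus> x = x" "x \<in> C \<Longrightarrow> x \<oplus> \<zero> = x"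
proof -
  show "\<zero> \<oplus> x = x" if "x \<in> C" using laws(3) that by blast
  then show "x \<oplus> \<zero> = x" if "x \<in> C" using that add_commute[of x \<zero>] by simp
qed

lemma sub_self [simp]: "x \<in> C \<Longrightarrow> x \<ominus> x = \<zero>"
  unfolding cs_sub_def using laws(4) by blast

lemma one_sm [simp]: "x \<in> C \<Longrightarrow> 1 \<odot> x = x"
  using laws(5) by blast

lemma sm_sm [simp]: "x \<in> C \<Longrightarrow> a \<odot> b \<odot> x = (a * b) \<odot> x"
  using laws(6) by blast

lemma sm_add_left: "x \<in> C \<Longrightarrow> (a + b) \<odot> x = a \<odot> x \<oplus> b \<odot> x"
  using laws(7) by blast

lemma sm_add_right: "x \<in> C \<Longrightarrow> y \<in> C \<Longrightarrow> a \<odot> (x \<oplus> y) = a \<odot> x \<oplus> a \<odot> y"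
  using laws(8) by blast

lemma mult_assoc: "x \<in> C \<Longrightarrow> y \<in> C \<Longrightarrow> z \<in> C \<Longrightarrow> (x \<otimes> y) \<otimes> z = x \<otimes> (y \<otimes> z)"
  using laws(9) by blast

lemma distl: "x \<in> C \<Longrightarrow> y \<in> C \<Longrightarrow> z \<in> C \<Longrightarrow> x \<otimes> (y \<oplus> z) = x \<otimes> y \<oplus> x \<otimes> z"
  using laws(10) by blast

lemma distr: "x \<in> C \<Longrightarrow> y \<in> C \<Longrightarrow> z \<in> C \<Longrightarrow> (x \<oplus> y) \<otimes> z = x \<otimes> z \<oplus> y \<otimes> z"
  using laws(11) by blast

lemma mult_sm [simp]:
  "x \<in> C \<Longrightarrow> y \<in> C \<Longrightarrow> (a \<odot> x) \<otimes> y = a \<odot> (x \<otimes> y)"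
  "x \<in> C \<Longrightarrow> y \<in> C \<Longrightarrow> x \<otimes> (a \<odot> y) = a \<odot> (x \<otimes> y)"
  using laws(12) by blast+

lemma mult_one [simp]: "x \<in> C \<Longrightarrow> \<one> \<otimes> x = x" "x \<in> C \<Longrightarrow> x \<otimes> \<one> = x"
  using laws(13) by blast+

lemma star_star [simp]: "x \<in> C \<Longrightarrow> \<star> (\<star> x) = x"
  using laws(14) by blast

lemma star_add [simp]: "x \<in> C \<Longrightarrow> y \<in> C \<Longrightarrow> \<star> (x \<oplus> y) = \<star> x \<oplus> \<star> y"
  using laws(15) by blast

lemma star_sm [simp]: "x \<in> C \<Longrightarrow> \<star> (a \<odot> x) = cnj a \<odot> \<star> x"
  using laws(16) by blast

lemma star_mult [simp]: "x \<in> C \<Longrightarrow> y \<in> C \<Longrightarrow> \<star> (x \<otimes> y) = \<star> y \<otimes> \<star> x"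
  using laws(17) by blast

lemma nm_nonneg [simp]: "x \<in> C \<Longrightarrow> 0 \<le> \<parallel>x\<parallel>"
  using laws(18) by blast

lemma nm_eq_zero: "x \<in> C \<Longrightarrow> \<parallel>x\<parallel> = 0 \<longleftrightarrow> x = \<zero>"
  using laws(18) by blast

lemma nm_add: "x \<in> C \<Longrightarrow> y \<in> C \<Longrightarrow> \<parallel>x \<oplus> y\<parallel> \<le> \<parallel>x\<parallel> + \<parallel>y\<parallel>"
  using laws(19) by blast

lemma nm_sm [simp]: "x \<in> C \<Longrightarrow> \<parallel>a \<odot> x\<parallel> = cmod a * \<parallel>x\<parallel>"
  using laws(20) by blast

lemma nm_mult: "x \<in> C \<Longrightarrow> y \<in> C \<Longrightarrow> \<parallel>x \<otimes> y\<parallel> \<le> \<parallel>x\<parallel> * \<parallel>y\<parallel>"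
  using laws(21) by blast

lemma nm_cstar: "x \<in> C \<Longrightarrow> \<parallel>\<star> x \<otimes> x\<parallel> = \<parallel>x\<parallel>\<^sup>2"
  using laws(22) by blast

lemma complete:
  assumes "\<And>n. f n \<in> C" and "\<And>e. e > 0 \<Longrightarrow> \<exists>M::nat. \<forall>m\<ge>M. \<forall>n\<ge>M. \<parallel>f m \<ominus> f n\<parallel> < e"
  shows "\<exists>l\<in>C. (\<lambda>n. \<parallel>f n \<ominus> l\<parallel>) \<longlonglongrightarrow> 0"
proof -
  have "\<forall>f. range f \<subseteq> C \<longrightarrow> (\<forall>e>0. \<exists>N::nat. \<forall>m\<ge>N. \<forall>n\<ge>N. \<parallel>f m \<ominus> f n\<parallel> < e) \<longrightarrow>
      (\<exists>l\<in>C. \<forall>e>0. \<exists>N::nat. \<forall>n\<ge>N. \<parallel>f n \<ominus> l\<parallel> < e)"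
    using ax by (elim conjE) assumption
  then obtain l where l: "l \<in> C" "\<And>e. e > 0 \<Longrightarrow> \<exists>N::nat. \<forall>n\<ge>N. \<parallel>f n \<ominus> l\<parallel> < e"
    using assms by (metis image_subsetI)
  have "(\<lambda>n. \<parallel>f n \<ominus> l\<parallel>) \<longlonglongrightarrow> 0"
    using l assms(1) by (simp add: LIMSEQ_iff)
  then show ?thesis using l(1) by blast
qed

lemma zero_sm [simp]: "x \<in> C \<Longrightarrow> 0 \<odot> x = \<zero>"
  by (metis closed(5) mult_zero_left nm_eq_zero nm_sm norm_zero)

lemma sm_zero [simp]: "a \<odot> \<zero> = \<zero>"
  using sm_sm[of \<zero> a 0] by simp

lemma mult_zero [simp]: "x \<in> C \<Longrightarrow> \<zero> \<otimes> x = \<zero>" "x \<in> C \<Longrightarrow> x \<otimes> \<zero> = \<zero>"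
  using mult_sm(1)[of \<zero> x 0] mult_sm(2)[of x \<zero> 0] by simp_all

lemma star_zero [simp]: "\<star> \<zero> = \<zero>"
  using star_sm[of \<zero> 0] by simp

lemma star_one [simp]: "\<star> \<one> = \<one>"
  using star_mult[of \<one> "\<star> \<one>"] by simp

lemma nm_zero [simp]: "\<parallel>\<zero>\<parallel> = 0"
  by (simp add: nm_eq_zero)

text \<open>The C*-identity at 1 leaves the values 0 and 1, the former being that of the zero
  algebra.\<close>

lemma nm_one_le: "\<parallel>\<one>\<parallel> \<le> 1"
proof -
  have "\<parallel>\<one>\<parallel> * (\<parallel>\<one>\<parallel> - 1) = 0" using nm_cstar[of \<one>] by (simp add: power2_eq_square algebra_simps)
  then show ?thesis by auto
qed

lemma nm_star [simp]: "x \<in> C \<Longrightarrow> \<parallel>\<star> x\<parallel> = \<parallel>x\<parallel>"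
proof -
  have *: "\<parallel>x\<parallel> \<le> \<parallel>\<star> x\<parallel>" if x: "x \<in> C" for x
  proof (cases "\<parallel>x\<parallel> = 0")
    case False
    have "\<parallel>x\<parallel> * \<parallel>x\<parallel> \<le> \<parallel>\<star> x\<parallel> * \<parallel>x\<parallel>"
      using nm_cstar[OF x] nm_mult[of "\<star> x" x] x by (simp add: power2_eq_square)
    then show ?thesis using False x nm_nonneg[OF x] by (simp add: mult_le_cancel_right)
  qed (use x in simp)
  show ?thesis if "x \<in> C" using *[of x] *[of "\<star> x"] that by simp
qed

lemma sm_sub: "x \<in> C \<Longrightarrow> y \<in> C \<Longrightarrow> a \<odot> (x \<ominus> y) = a \<odot> x \<ominus> a \<odot> y"
  by (simp add: cs_sub_def sm_add_right)

lemma sm_diff_left: "x \<in> C \<Longrightarrow> (a - b) \<odot> x = a \<odot> x \<ominus> b \<odot> x"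
  using sm_add_left[of x a "- b"] by (simp add: cs_sub_def)

lemma star_sub [simp]: "x \<in> C \<Longrightarrow> y \<in> C \<Longrightarrow> \<star> (x \<ominus> y) = \<star> x \<ominus> \<star> y"
  by (simp add: cs_sub_def)

lemma dist_subl: "x \<in> C \<Longrightarrow> y \<in> C \<Longrightarrow> z \<in> C \<Longrightarrow> x \<otimes> (y \<ominus> z) = x \<otimes> y \<ominus> x \<otimes> z"
  by (simp add: cs_sub_def distl)

lemma dist_subr: "x \<in> C \<Longrightarrow> y \<in> C \<Longrightarrow> z \<in> C \<Longrightarrow> (x \<ominus> y) \<otimes> z = x \<otimes> z \<ominus> y \<otimes> z"
  by (simp add: cs_sub_def distr)

lemma add_sub_assoc: "x \<in> C \<Longrightarrow> y \<in> C \<Longrightarrow> z \<in> C \<Longrightarrow> (x \<oplus> y) \<ominus> z = x \<oplus> (y \<ominus> z)"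
  by (simp add: cs_sub_def add_assoc)

lemma add_sub_cancel [simp]:
  "x \<in> C \<Longrightarrow> y \<in> C \<Longrightarrow> x \<oplus> y \<ominus> y = x" "x \<in> C \<Longrightarrow> y \<in> C \<Longrightarrow> y \<oplus> x \<ominus> y = x"
  "x \<in> C \<Longrightarrow> y \<in> C \<Longrightarrow> x \<ominus> y \<oplus> y = x" "x \<in> C \<Longrightarrow> y \<in> C \<Longrightarrow> y \<oplus> (x \<ominus> y) = x"
proof -
  assume x: "x \<in> C" and y: "y \<in> C"
  show 1: "x \<oplus> y \<ominus> y = x" using x y by (simp add: add_sub_assoc)
  then show "y \<oplus> x \<ominus> y = x" using x y by (simp add: add_commute)
  have "x \<ominus> y \<oplus> y = x \<oplus> (y \<ominus> y)" using x y unfolding cs_sub_def by (simp add: add_ac)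
  then show 2: "x \<ominus> y \<oplus> y = x" using x y by simp
  then show "y \<oplus> (x \<ominus> y) = x" using x y by (simp add: add_commute)
qed

lemma sub_eq_zero: "x \<in> C \<Longrightarrow> y \<in> C \<Longrightarrow> x \<ominus> y = \<zero> \<longleftrightarrow> x = y"
  by (metis add_sub_cancel(3) add_zero(1) sub_self)

lemma minus_sub: "x \<in> C \<Longrightarrow> y \<in> C \<Longrightarrow> (-1) \<odot> (x \<ominus> y) = y \<ominus> x"
  by (simp add: cs_sub_def sm_add_right add_commute)

lemma nm_sub_commute: "x \<in> C \<Longrightarrow> y \<in> C \<Longrightarrow> \<parallel>x \<ominus> y\<parallel> = \<parallel>y \<ominus> x\<parallel>"
  using nm_sm[of "x \<ominus> y" "-1"] by (simp add: minus_sub)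

lemma sub_add_sub: "x \<in> C \<Longrightarrow> y \<in> C \<Longrightarrow> z \<in> C \<Longrightarrow> (x \<ominus> y) \<oplus> (y \<ominus> z) = x \<ominus> z"
  by (metis add_sub_assoc add_sub_cancel(3) sub_closed)

lemma nm_sub_triangle: "x \<in> C \<Longrightarrow> y \<in> C \<Longrightarrow> z \<in> C \<Longrightarrow> \<parallel>x \<ominus> z\<parallel> \<le> \<parallel>x \<ominus> y\<parallel> + \<parallel>y \<ominus> z\<parallel>"
  using nm_add[of "x \<ominus> y" "y \<ominus> z"] by (simp add: sub_add_sub)

lemma add_sub_add:
  "x \<in> C \<Longrightarrow> y \<in> C \<Longrightarrow> z \<in> C \<Longrightarrow> w \<in> C \<Longrightarrow> (x \<oplus> y) \<ominus> (z \<oplus> w) = (x \<ominus> z) \<oplus> (y \<ominus> w)"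
  by (simp add: cs_sub_def sm_add_right add_ac)

lemma nm_diff_le: "x \<in> C \<Longrightarrow> y \<in> C \<Longrightarrow> \<bar>\<parallel>x\<parallel> - \<parallel>y\<parallel>\<bar> \<le> \<parallel>x \<ominus> y\<parallel>"
  using nm_add[of "x \<ominus> y" y] nm_add[of "y \<ominus> x" x] nm_sub_commute[of x y] by simp

lemma limit_unique:
  assumes "\<And>n. f n \<in> C" "x \<in> C" "y \<in> C"
    and "(\<lambda>n. \<parallel>f n \<ominus> x\<parallel>) \<longlonglongrightarrow> 0" "(\<lambda>n. \<parallel>f n \<ominus> y\<parallel>) \<longlonglongrightarrow> 0"
  shows "x = y"
proof -
  have "(\<lambda>n. \<parallel>f n \<ominus> x\<parallel> + \<parallel>f n \<ominus> y\<parallel>) \<longlonglongrightarrow> 0 + 0"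
    using assms by (intro tendsto_add)
  moreover have "\<parallel>x \<ominus> y\<parallel> \<le> \<parallel>f n \<ominus> x\<parallel> + \<parallel>f n \<ominus> y\<parallel>" for n
    using nm_sub_triangle[of x "f n" y] assms by (simp add: nm_sub_commute[of x])
  ultimately have "\<parallel>x \<ominus> y\<parallel> \<le> 0 + 0" by (intro LIMSEQ_le_const) auto
  then have "\<parallel>x \<ominus> y\<parallel> = 0" using assms by (intro antisym) simp_all
  then show ?thesis using assms nm_eq_zero[of "x \<ominus> y"] sub_eq_zero by simp
qed

subsection \<open>Polynomials in a self-adjoint element\<close>

definition peval :: "'a \<Rightarrow> complex poly \<Rightarrow> 'a" where
  "peval h p = fold_coeffs (\<lambda>a b. a \<odot> \<one> \<oplus> h \<otimes> b) p \<zero>"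

context
  fixes h assumes h: "h \<in> C"
begin

lemma peval_0 [simp]: "peval h 0 = \<zero>"
  by (simp add: peval_def)

lemma peval_pCons [simp]: "peval h (pCons a p) = a \<odot> \<one> \<oplus> h \<otimes> peval h p"
  using h by (cases "p = 0 \<and> a = 0") (auto simp: peval_def fold_coeffs_pCons_not_0_0_eq)

lemma peval_closed [simp, intro]: "peval h p \<in> C"
  using h by (induction p) simp_all

lemma peval_add: "peval h (p + q) = peval h p \<oplus> peval h q"
proof (induction p arbitrary: q)
  case (pCons a p)
  show ?case
    using h by (cases q) (simp add: pCons.IH sm_add_left distl add_ac)
qed simp

lemma peval_smult: "peval h (smult c p) = c \<odot> peval h p"
  using h by (induction p) (simp_all add: sm_add_right)

lemma peval_minus: "peval h (- p) = (-1) \<odot> peval h p"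
  using peval_smult[of "-1" p] by simp

lemma peval_diff: "peval h (p - q) = peval h p \<ominus> peval h q"
  using peval_add[of p "- q"] by (simp add: peval_minus cs_sub_def)

lemma peval_one [simp]: "peval h 1 = \<one>"
  using h by (simp add: one_pCons)

lemma peval_rc: "peval h (rc t) = of_real t \<odot> \<one>"
  using h by (simp add: rc_def)

lemma peval_X: "peval h [:0, 1:] = h"
  using h by simp

lemma peval_mult: "peval h (p * q) = peval h p \<otimes> peval h q"
  using h by (induction p) (simp_all add: peval_add peval_smult distr mult_assoc)

lemma peval_commute: "peval h p \<otimes> peval h q = peval h q \<otimes> peval h p"
  by (metis mult.commute peval_mult)

lemma peval_power: "peval h (p ^ 2) = peval h p \<otimes> peval h p"
  by (simp add: power2_eq_square peval_mult)

lemma peval_star: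
  assumes hs: "\<star> h = h"
  shows "\<star> (peval h p) = peval h (cpoly p)"
proof (induction p)
  case (pCons a p)
  have "h \<otimes> peval h q = peval h q \<otimes> h" for q
    using peval_commute[of "[:0,1:]" q] unfolding peval_X .
  then show ?case using h hs by (simp add: pCons.IH)
qed simp

text \<open>Evaluation at a self-adjoint h turns \<open>cpoly\<close> into the involution, so all
  results on seminorms apply to the elements p(h).\<close>

lemma poly_norm_peval: "\<star> h = h \<Longrightarrow> poly_norm (\<lambda>p. \<parallel>peval h p\<parallel>)"
  by unfold_locales (simp_all add: peval_add peval_smult peval_mult nm_add nm_mult nm_one_le
      nm_cstar peval_star[symmetric])

end

text \<open>Square roots are limits of polynomials in the element; this keeps them inside a
  prescribed closed subalgebra.\<close>

lemma peval_in_subalgebra: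
  assumes "h \<in> T" "\<one> \<in> T" "T \<subseteq> C"
    and "\<And>x y. x \<in> T \<Longrightarrow> y \<in> T \<Longrightarrow> x \<oplus> y \<in> T" "\<And>x y. x \<in> T \<Longrightarrow> y \<in> T \<Longrightarrow> x \<otimes> y \<in> T"
    and "\<And>c x. x \<in> T \<Longrightarrow> c \<odot> x \<in> T"
  shows "peval h p \<in> T"
proof (induction p)
  case 0
  have "h \<in> C" using assms by blast
  moreover have "0 \<odot> \<one> \<in> T" using assms by blast
  ultimately show ?case by simp
next
  case (pCons a p)
  have "h \<in> C" using assms by blast
  then show ?case using assms pCons by simp
qed

subsection \<open>Positive elements\<close>

text \<open>The metric notion of \<open>pos\<close>, now without commutativity. If squares x^* x
  were taken as the definition, positivity of sums would become the difficult statement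
  instead.\<close>

definition cpos :: "'a \<Rightarrow> bool" where
  "cpos h \<longleftrightarrow> h \<in> C \<and> \<star> h = h \<and> (\<exists>t::real. \<parallel>of_real t \<odot> \<one> \<ominus> h\<parallel> \<le> t)"

lemma cposD: "cpos h \<Longrightarrow> h \<in> C" "cpos h \<Longrightarrow> \<star> h = h"
  unfolding cpos_def by blast+

lemma cposI: "h \<in> C \<Longrightarrow> \<star> h = h \<Longrightarrow> \<parallel>of_real t \<odot> \<one> \<ominus> h\<parallel> \<le> t \<Longrightarrow> cpos h"
  unfolding cpos_def by blast

lemma cpos_peval:
  assumes h: "h \<in> C" "\<star> h = h" and p: "cpoly p = p"
  shows "cpos (peval h p) \<longleftrightarrow> poly_norm.pos (\<lambda>p. \<parallel>peval h p\<parallel>) p"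
proof -
  interpret poly_norm "\<lambda>p. \<parallel>peval h p\<parallel>" using h by (rule poly_norm_peval)
  show ?thesis unfolding cpos_def pos_def
    using h p by (simp add: peval_star peval_diff peval_rc)
qed

lemma cpos_pos:
  assumes "h \<in> C" "\<star> h = h"
  shows "cpos h \<longleftrightarrow> poly_norm.pos (\<lambda>p. \<parallel>peval h p\<parallel>) [:0, 1:]"
  using cpos_peval[of h "[:0, 1:]"] assms by simp

lemma cpos_upper:
  assumes "cpos h" and "\<parallel>h\<parallel> / 2 \<le> t"
  shows "\<parallel>of_real t \<odot> \<one> \<ominus> h\<parallel> \<le> t"
proof -
  have h: "h \<in> C" "\<star> h = h" using assms(1) by (simp_all add: cposD)
  interpret poly_norm "\<lambda>p. \<parallel>peval h p\<parallel>" using h by (rule poly_norm_peval)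
  have "pos [:0, 1:]" using assms(1) cpos_pos h by blast
  then have "\<parallel>peval h (rc t - [:0, 1:])\<parallel> \<le> t" using assms(2) h by (intro pos_upper) simp_all
  then show ?thesis using h by (simp add: peval_diff peval_rc)
qed

text \<open>Radii add up by the triangle inequality, so commutation of h and k does not enter;
  \<open>cpos_upper\<close> provides the norms as radii.\<close>

lemma cpos_add:
  assumes "cpos h" "cpos k"
  shows "cpos (h \<oplus> k)"
proof (rule cposI)
  have hk: "h \<in> C" "k \<in> C" using assms by (simp_all add: cposD)
  then have "of_real (\<parallel>h\<parallel> + \<parallel>k\<parallel>) \<odot> \<one> \<ominus> (h \<oplus> k)
      = (of_real \<parallel>h\<parallel> \<odot> \<one> \<ominus> h) \<oplus> (of_real \<parallel>k\<parallel> \<odot> \<one> \<ominus> k)"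
    by (simp add: sm_add_left add_sub_add)
  also have "\<parallel>\<dots>\<parallel> \<le> \<parallel>of_real \<parallel>h\<parallel> \<odot> \<one> \<ominus> h\<parallel> + \<parallel>of_real \<parallel>k\<parallel> \<odot> \<one> \<ominus> k\<parallel>"
    using hk by (intro nm_add) simp_all
  also have "\<dots> \<le> \<parallel>h\<parallel> + \<parallel>k\<parallel>" using assms hk by (intro add_mono cpos_upper) simp_all
  finally show "\<parallel>of_real (\<parallel>h\<parallel> + \<parallel>k\<parallel>) \<odot> \<one> \<ominus> (h \<oplus> k)\<parallel> \<le> \<parallel>h\<parallel> + \<parallel>k\<parallel>" .
qed (use assms in \<open>simp_all add: cposD\<close>)

lemma cpos_sm:
  assumes "cpos h" and t: "0 \<le> t"
  shows "cpos (of_real t \<odot> h)"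
proof (rule cposI)
  have h: "h \<in> C" using assms by (simp add: cposD)
  have "of_real (t * \<parallel>h\<parallel>) \<odot> \<one> \<ominus> of_real t \<odot> h = of_real t \<odot> (of_real \<parallel>h\<parallel> \<odot> \<one> \<ominus> h)"
    using h by (simp add: sm_sub)
  also have "\<parallel>\<dots>\<parallel> = t * \<parallel>of_real \<parallel>h\<parallel> \<odot> \<one> \<ominus> h\<parallel>" using h t by simp
  also have "\<dots> \<le> t * \<parallel>h\<parallel>" using assms h by (intro mult_left_mono cpos_upper) simp_all
  finally show "\<parallel>of_real (t * \<parallel>h\<parallel>) \<odot> \<one> \<ominus> of_real t \<odot> h\<parallel> \<le> t * \<parallel>h\<parallel>" .
qed (use assms in \<open>simp_all add: cposD\<close>)

lemma cpos_bound:
  assumes "k \<in> C" "\<star> k = k" "cpos (of_real c \<odot> \<one> \<ominus> k)" "cpos (of_real c \<odot> \<one> \<oplus> k)" "0 \<le> c"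
  shows "\<parallel>k\<parallel> \<le> c"
proof -
  interpret poly_norm "\<lambda>p. \<parallel>peval k p\<parallel>" using assms by (intro poly_norm_peval)
  have *: "peval k (rc c - [:0, 1:]) = of_real c \<odot> \<one> \<ominus> k" "peval k (rc c + [:0, 1:]) = of_real c \<odot> \<one> \<oplus> k"
    using assms(1) by (simp_all add: peval_diff peval_add peval_rc)
  have "\<parallel>peval k [:0, 1:]\<parallel> \<le> c"
    using assms * by (intro pos_bound) (simp_all add: cpos_peval[symmetric])
  then show ?thesis using assms by simp
qed

lemma cpos_sq: "w \<in> C \<Longrightarrow> \<star> w = w \<Longrightarrow> cpos (w \<otimes> w)"
proof -
  assume w: "w \<in> C" "\<star> w = w"
  interpret poly_norm "\<lambda>p. \<parallel>peval w p\<parallel>" using w by (rule poly_norm_peval)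
  have "pos ([:0, 1:]\<^sup>2)" by (rule pos_sq) simp
  then show ?thesis using cpos_peval[of w "[:0, 1:]\<^sup>2"] w by (simp add: peval_power)
qed

lemma cpos_one_minus: "h \<in> C \<Longrightarrow> \<star> h = h \<Longrightarrow> \<parallel>h\<parallel> \<le> t \<Longrightarrow> cpos (of_real t \<odot> \<one> \<ominus> h)"
proof -
  assume h: "h \<in> C" "\<star> h = h" "\<parallel>h\<parallel> \<le> t"
  have "of_real t \<odot> \<one> \<ominus> (of_real t \<odot> \<one> \<ominus> h) = h"
    using h by (metis add_sub_cancel(2,3) closed(2,5) sub_closed)
  then show ?thesis using h by (intro cposI[of _ t]) simp_all
qed

lemma cpos_one_plus: "h \<in> C \<Longrightarrow> \<star> h = h \<Longrightarrow> \<parallel>h\<parallel> \<le> t \<Longrightarrow> cpos (of_real t \<odot> \<one> \<oplus> h)"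
  using cpos_one_minus[of "(-1) \<odot> h" t] by (simp add: cs_sub_def)

end

section \<open>Positivity of x^* x\<close>

lemma growth_le_one:
  fixes q K :: real
  assumes "\<And>m::nat. 0 < m \<Longrightarrow> q ^ m \<le> 1 + K * m"
  shows "q \<le> 1"
proof (rule ccontr)
  assume "\<not> q \<le> 1"
  define d where "d = q - 1"
  have d: "d > 0" using \<open>\<not> q \<le> 1\<close> by (simp add: d_def)
  \<comment> \<open>Bernoulli at exponent k, squared, makes q^(2k) grow quadratically in k; against
    the linear bound at exponent 2k this keeps k d^2 bounded.\<close>
  have bound: "real k * d\<^sup>2 \<le> 2 * K" if "0 < k" for k :: nat
  proof -
    have "1 + real k * d \<le> q ^ k"
      using Bernoulli_inequality[of d k] d by (simp add: d_def)
    then have "(1 + real k * d)\<^sup>2 \<le> (q ^ k)\<^sup>2" using d by (intro power_mono) simp_all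
    also have "(q ^ k)\<^sup>2 = q ^ (2 * k)" by (simp add: power_mult[symmetric] mult.commute)
    also have "\<dots> \<le> 1 + K * real (2 * k)" using assms[of "2 * k"] that by simp
    finally have "real k * (real k * d\<^sup>2) \<le> real k * (2 * K - 2 * d)"
      by (simp add: power2_eq_square algebra_simps)
    then have "real k * d\<^sup>2 \<le> 2 * K - 2 * d" using that by simp
    then show ?thesis using d by simp
  qed
  obtain k :: nat where "2 * K / d\<^sup>2 < real k" using reals_Archimedean2 by blast
  then have "2 * K < real (Suc k) * d\<^sup>2" using d by (simp add: field_simps) (smt (verit) zero_less_power)
  then show False using bound[of "Suc k"] by simp
qed

context cstar_algebra
begin

lemma cpos_zero [simp]: "cpos \<zero>"
  by (rule cposI[of _ 0]) (simp_all)

lemma cpos_const [simp]: "0 \<le> t \<Longrightarrow> cpos (of_real t \<odot> \<one>)"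
  by (rule cposI[of _ t]) simp_all

text \<open>The recursion for the middle factor: one more multiplication by b + y y^* preserves the
  shape c + y S y^*, with c replaced by b c and S by c + (b + y^* y) S.\<close>

lemma mult_add_sandwich:
  assumes "y \<in> C" "S \<in> C"
  shows "(b \<odot> \<one> \<oplus> y \<otimes> \<star> y) \<otimes> (c \<odot> \<one> \<oplus> y \<otimes> (S \<otimes> \<star> y)) =
    (b * c) \<odot> \<one> \<oplus> y \<otimes> ((c \<odot> \<one> \<oplus> (b \<odot> \<one> \<oplus> \<star> y \<otimes> y) \<otimes> S) \<otimes> \<star> y)"
  using assms by (simp add: distl distr mult_assoc sm_add_right add_ac mult.commute)

text \<open>The elements \<open>y\<^sup>\<star> y\<close> and \<open>y y\<^sup>\<star>\<close> have the same spectrum up to \<open>0\<close>; this is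
  seen on powers, as \<open>(b + y y\<^sup>\<star>)\<^sup>m = b\<^sup>m + y S y\<^sup>\<star>\<close> with \<open>S\<close> growing like \<open>m c\<^sup>m\<close>
  when \<open>\<parallel>b + y\<^sup>\<star> y\<parallel> \<le> c\<close>.\<close>
lemma cpos_flip:
  assumes y: "y \<in> C" and pos: "cpos (of_real t \<odot> \<one> \<ominus> \<star> y \<otimes> y)" and t: "0 \<le> t"
  shows "cpos (of_real t \<odot> \<one> \<ominus> y \<otimes> \<star> y)"
proof -
  \<comment> \<open>The second entry makes c an admissible radius in \<open>cpos_upper\<close>, the
    first one ensures c > 0 and b >= 0. Reflection at c turns t - a into b + a, a form suited to
    powers.\<close>
  define c where "c = max (t + 1) (\<parallel>of_real t \<odot> \<one> \<ominus> \<star> y \<otimes> y\<parallel> / 2)"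
  define b where "b = c - t"
  have c: "c > 0" "0 \<le> b" "b \<le> c" using t by (auto simp: c_def b_def)
  have shift: "of_real c \<odot> \<one> \<ominus> (of_real t \<odot> \<one> \<ominus> a) = of_real b \<odot> \<one> \<oplus> a" if "a \<in> C" for a
  proof -
    have "of_real c \<odot> \<one> \<ominus> (of_real t \<odot> \<one> \<ominus> a) = (of_real c \<odot> \<one> \<ominus> of_real t \<odot> \<one>) \<oplus> a"
      using that by (simp add: cs_sub_def sm_add_right add_ac)
    then show ?thesis by (simp add: b_def sm_diff_left)
  qed
  have "\<parallel>of_real c \<odot> \<one> \<ominus> (of_real t \<odot> \<one> \<ominus> \<star> y \<otimes> y)\<parallel> \<le> c"
    using pos by (rule cpos_upper) (simp add: c_def)
  then have ub: "\<parallel>of_real b \<odot> \<one> \<oplus> \<star> y \<otimes> y\<parallel> \<le> c" using y by (simp add: shift)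
  define Z where "Z = of_real b \<odot> \<one> \<oplus> y \<otimes> \<star> y"
  have Z: "Z \<in> C" "\<star> Z = Z" using y by (simp_all add: Z_def)
  interpret poly_norm "\<lambda>p. \<parallel>peval Z p\<parallel>" using Z by (rule poly_norm_peval)
  have pow: "\<exists>S\<in>C. peval Z ([:0, 1:] ^ m) = of_real (b ^ m) \<odot> \<one> \<oplus> y \<otimes> (S \<otimes> \<star> y)
      \<and> \<parallel>S\<parallel> * c \<le> real m * c ^ m" for m
  proof (induction m)
    case 0
    then show ?case using y Z by (intro bexI[of _ \<zero>]) simp_all
  next
    case (Suc m)
    then obtain S where S: "S \<in> C" "peval Z ([:0, 1:] ^ m) = of_real (b ^ m) \<odot> \<one> \<oplus> y \<otimes> (S \<otimes> \<star> y)"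
      "\<parallel>S\<parallel> * c \<le> real m * c ^ m" by blast
    define S' where "S' = of_real (b ^ m) \<odot> \<one> \<oplus> (of_real b \<odot> \<one> \<oplus> \<star> y \<otimes> y) \<otimes> S"
    have "peval Z ([:0, 1:] ^ Suc m) = peval Z [:0, 1:] \<otimes> peval Z ([:0, 1:] ^ m)"
      unfolding power_Suc using Z by (intro peval_mult)
    also have "\<dots> = Z \<otimes> (of_real (b ^ m) \<odot> \<one> \<oplus> y \<otimes> (S \<otimes> \<star> y))"
      using Z S by simp
    also have "\<dots> = of_real (b * b ^ m) \<odot> \<one> \<oplus> y \<otimes> (S' \<otimes> \<star> y)"
      unfolding Z_def S'_def using mult_add_sandwich[OF y S(1), of "of_real b" "of_real (b ^ m)"] by simp
    finally have eq: "peval Z ([:0, 1:] ^ Suc m) = of_real (b ^ Suc m) \<odot> \<one> \<oplus> y \<otimes> (S' \<otimes> \<star> y)" by simp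
    have "\<parallel>S'\<parallel> \<le> \<parallel>of_real (b ^ m) \<odot> \<one>\<parallel> + \<parallel>(of_real b \<odot> \<one> \<oplus> \<star> y \<otimes> y) \<otimes> S\<parallel>"
      unfolding S'_def using y S by (intro nm_add) simp_all
    also have "\<parallel>of_real (b ^ m) \<odot> \<one>\<parallel> = b ^ m * \<parallel>\<one>\<parallel>" using c by (simp add: norm_power)
    also have "\<dots> \<le> c ^ m * 1" using c nm_one_le by (intro mult_mono power_mono) simp_all
    also have "\<parallel>(of_real b \<odot> \<one> \<oplus> \<star> y \<otimes> y) \<otimes> S\<parallel> \<le> \<parallel>of_real b \<odot> \<one> \<oplus> \<star> y \<otimes> y\<parallel> * \<parallel>S\<parallel>"
      using y S by (intro nm_mult) simp_all
    also have "\<dots> \<le> c * \<parallel>S\<parallel>" using ub S by (intro mult_right_mono) simp_all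
    finally have "\<parallel>S'\<parallel> \<le> c ^ m + c * \<parallel>S\<parallel>" by simp
    then have "\<parallel>S'\<parallel> * c \<le> (c ^ m + c * \<parallel>S\<parallel>) * c" using c by (intro mult_right_mono) simp_all
    also have "\<dots> = c ^ Suc m + c * (\<parallel>S\<parallel> * c)" by (simp add: algebra_simps)
    also have "\<dots> \<le> c ^ Suc m + c * (real m * c ^ m)" using S c by (intro add_left_mono mult_left_mono) simp_all
    also have "\<dots> = real (Suc m) * c ^ Suc m" by (simp add: algebra_simps)
    finally have "\<parallel>S'\<parallel> * c \<le> real (Suc m) * c ^ Suc m" .
    moreover have "S' \<in> C" using y S by (simp add: S'_def)
    ultimately show ?case using eq by blast
  qed
  define K where "K = \<parallel>y\<parallel>\<^sup>2 / c"
  have "(\<parallel>Z\<parallel> / c) ^ m \<le> 1 + K * real m" if m: "0 < m" for m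
  proof -
    obtain S where S: "S \<in> C" "peval Z ([:0, 1:] ^ m) = of_real (b ^ m) \<odot> \<one> \<oplus> y \<otimes> (S \<otimes> \<star> y)"
      "\<parallel>S\<parallel> * c \<le> real m * c ^ m" using pow by blast
    have "\<parallel>Z\<parallel> ^ m = \<parallel>peval Z ([:0, 1:] ^ m)\<parallel>"
      using N_power[of "[:0, 1:]" m] m Z by simp
    also have "\<dots> \<le> \<parallel>of_real (b ^ m) \<odot> \<one>\<parallel> + \<parallel>y \<otimes> (S \<otimes> \<star> y)\<parallel>"
      unfolding S(2) using y S by (intro nm_add) simp_all
    also have "\<parallel>of_real (b ^ m) \<odot> \<one>\<parallel> = b ^ m * \<parallel>\<one>\<parallel>" using c by (simp add: norm_power)
    also have "\<dots> \<le> c ^ m * 1" using c nm_one_le by (intro mult_mono power_mono) simp_all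
    also have "\<parallel>y \<otimes> (S \<otimes> \<star> y)\<parallel> \<le> \<parallel>y\<parallel> * (\<parallel>S\<parallel> * \<parallel>\<star> y\<parallel>)"
      using y S nm_mult[of y "S \<otimes> \<star> y"] nm_mult[of S "\<star> y"]
        mult_left_mono[of "\<parallel>S \<otimes> \<star> y\<parallel>" "\<parallel>S\<parallel> * \<parallel>\<star> y\<parallel>" "\<parallel>y\<parallel>"] by simp
    also have "\<dots> = K * (\<parallel>S\<parallel> * c)" using c y by (simp add: K_def power2_eq_square)
    also have "\<dots> \<le> K * (real m * c ^ m)" using c S by (intro mult_left_mono) (simp_all add: K_def)
    finally have "\<parallel>Z\<parallel> ^ m \<le> c ^ m * (1 + K * real m)" by (simp add: algebra_simps)
    then show ?thesis using c by (simp add: power_divide divide_le_eq mult.commute)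
  qed
  then have "\<parallel>Z\<parallel> / c \<le> 1" by (rule growth_le_one)
  then have "\<parallel>Z\<parallel> \<le> c" using c by simp
  then have "\<parallel>of_real c \<odot> \<one> \<ominus> (of_real t \<odot> \<one> \<ominus> y \<otimes> \<star> y)\<parallel> \<le> c"
    using y by (simp add: shift Z_def)
  then show ?thesis using y by (intro cposI[of _ c]) simp_all
qed

text \<open>Twice this sum is R^2 + J^2 for the self-adjoint elements R = y + y^* and J = i y - i
  y^*, which are real multiples of the real and imaginary parts of y.\<close>

lemma cpos_sum_flip:
  assumes y: "y \<in> C"
  shows "cpos (\<star> y \<otimes> y \<oplus> y \<otimes> \<star> y)"
proof -
  define P where "P = y \<otimes> y \<oplus> \<star> y \<otimes> \<star> y"
  define Q where "Q = \<star> y \<otimes> y \<oplus> y \<otimes> \<star> y"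
  have PQ: "P \<in> C" "Q \<in> C" using y by (simp_all add: P_def Q_def)
  define R where "R = y \<oplus> \<star> y"
  define J where "J = \<i> \<odot> (y \<ominus> \<star> y)"
  have "R \<otimes> R = P \<oplus> Q"
    unfolding R_def P_def Q_def using y by (simp add: distl distr add_ac)
  moreover have "J \<otimes> J = Q \<ominus> P"
    unfolding J_def P_def Q_def using y by (simp add: cs_sub_def distl distr sm_add_right add_ac)
  ultimately have "R \<otimes> R \<oplus> J \<otimes> J = P \<oplus> (Q \<ominus> P) \<oplus> Q"
    using PQ by (simp add: add_ac del: add_sub_cancel)
  also have "\<dots> = of_real 2 \<odot> Q" using PQ sm_add_left[of Q 1 1] by simp
  finally have "Q = of_real (1/2) \<odot> (R \<otimes> R \<oplus> J \<otimes> J)" using PQ by simp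
  moreover have "cpos (R \<otimes> R)" using y unfolding R_def by (intro cpos_sq) (simp_all add: add_commute)
  moreover have "\<star> J = J" unfolding J_def using y
    by (simp add: cs_sub_def sm_add_right add_commute)
  then have "cpos (J \<otimes> J)" using y by (intro cpos_sq) (simp_all add: J_def)
  ultimately have "cpos Q" by (metis cpos_add cpos_sm zero_le_divide_1_iff zero_le_numeral)
  then show ?thesis by (simp add: Q_def)
qed

text \<open>With \<open>h = x\<^sup>\<star> x\<close>, \<open>s = 1 - h\<close> and \<open>y = x s\<^sup>n\<close>, the positive part of
  \<open>y\<^sup>\<star> y = h s\<^sup>2\<^sup>n\<close> is small. So is that of \<open>y y\<^sup>\<star>\<close>, and as \<open>y\<^sup>\<star> y + y y\<^sup>\<star> \<ge> 0\<close>,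
  \<open>h s\<^sup>2\<^sup>n\<close> has a small negative part too; this bounds the spectrum of \<open>s\<close> by \<open>1\<close>.\<close>
lemma cpos_star_mult_aux:
  assumes x: "x \<in> C" and x1: "\<parallel>x\<parallel> \<le> 1"
  shows "cpos (\<star> x \<otimes> x)"
proof -
  define h where "h = \<star> x \<otimes> x"
  have h: "h \<in> C" "\<star> h = h" using x by (simp_all add: h_def)
  interpret poly_norm "\<lambda>p. \<parallel>peval h p\<parallel>" using h by (rule poly_norm_peval)
  define s :: "complex poly" where "s = 1 - [:0, 1:]"
  have cs: "cpoly s = s" by (simp add: s_def)
  have h1: "\<parallel>h\<parallel> \<le> 1" using nm_cstar[OF x] x1 x by (simp add: h_def power_le_one)
  have ps: "pos s"
    using h h1 by (intro posI[of _ 1] cs) (simp add: s_def)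
  have bound: "\<parallel>peval h s\<parallel> ^ (2 * n) * (\<parallel>peval h s\<parallel> - 1) \<le> 1 / Suc (2 * n)" if n: "0 < n" for n
  proof -
    define \<tau> where "\<tau> = 1 / real (Suc (2 * n))"
    have \<tau>: "0 \<le> \<tau>" by (simp add: \<tau>_def)
    define k where "k = s ^ (2 * n) - s ^ Suc (2 * n)"
    \<comment> \<open>Even exponents are used so that the power splits symmetrically: y^* y = s^n h
      s^n, which is s^(2n) - s^(2n+1) because h = 1 - s.\<close>
    define y where "y = x \<otimes> peval h (s ^ n)"
    have y: "y \<in> C" using x h by (simp add: y_def peval_closed)
    have "\<star> y \<otimes> y = peval h (s ^ n) \<otimes> (h \<otimes> peval h (s ^ n))"
      using x h cs by (simp add: y_def peval_star mult_assoc h_def[symmetric] peval_closed)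
        (simp add: h_def mult_assoc peval_closed[OF h(1)])
    also have "\<dots> = peval h (s ^ n) \<otimes> (peval h [:0, 1:] \<otimes> peval h (s ^ n))" using h by simp
    also have "\<dots> = peval h (s ^ n * ([:0, 1:] * s ^ n))" using h by (simp only: peval_mult)
    also have "s ^ n * ([:0, 1:] * s ^ n) = k"
      unfolding k_def by (rule complex_poly_ext) (simp add: s_def power_mult power2_eq_square algebra_simps
          power_mult_distrib[symmetric])
    finally have yy: "\<star> y \<otimes> y = peval h k" .
    have ck: "cpoly k = k" using cs by (simp add: k_def)
    have "pos (rc \<tau> - k)" unfolding \<tau>_def k_def by (rule pos_power_diff_upper[OF ps])
    then have "cpos (peval h (rc \<tau> - k))" using h ck by (simp add: cpos_peval)
    then have "cpos (of_real \<tau> \<odot> \<one> \<ominus> \<star> y \<otimes> y)" using h by (simp add: peval_diff peval_rc yy)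
    then have "cpos (of_real \<tau> \<odot> \<one> \<ominus> y \<otimes> \<star> y)" using y \<tau> by (intro cpos_flip)
    then have "cpos ((\<star> y \<otimes> y \<oplus> y \<otimes> \<star> y) \<oplus> (of_real \<tau> \<odot> \<one> \<ominus> y \<otimes> \<star> y))"
      using y by (intro cpos_add cpos_sum_flip)
    also have "(\<star> y \<otimes> y \<oplus> y \<otimes> \<star> y) \<oplus> (of_real \<tau> \<odot> \<one> \<ominus> y \<otimes> \<star> y) = of_real \<tau> \<odot> \<one> \<oplus> \<star> y \<otimes> y"
      using y by (simp add: add_assoc) (simp add: add_commute)
    finally have "cpos (peval h (rc \<tau> + k))" using h by (simp add: peval_add peval_rc yy)
    then have "pos (rc \<tau> + k)" using h ck by (simp add: cpos_peval)
    then show ?thesis unfolding k_def \<tau>_def[symmetric] using \<tau> n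
      by (intro pos_power_diff_lower[OF ps]) simp_all
  qed
  have "\<parallel>peval h s\<parallel> \<le> 1"
  proof (rule ccontr)
    assume a: "\<not> \<parallel>peval h s\<parallel> \<le> 1"
    define a where "a = \<parallel>peval h s\<parallel>"
    have a1: "a > 1" using \<open>\<not> \<parallel>peval h s\<parallel> \<le> 1\<close> by (simp add: a_def)
    obtain n where n: "1 / (a - 1) < real n" using reals_Archimedean2 by blast
    have "0 < n" using n a1 by (smt (verit) divide_pos_pos of_nat_0_less_iff)
    \<comment> \<open>If a > 1, the left side of \<open>bound\<close> stays above a - 1 while the
      right side tends to 0.\<close>
    have "a - 1 \<le> a ^ (2 * n) * (a - 1)"
      using a1 mult_right_mono[of 1 "a ^ (2 * n)" "a - 1"] by simp
    also have "\<dots> \<le> 1 / real (Suc (2 * n))" using bound[OF \<open>0 < n\<close>] by (simp only: a_def)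
    also have "\<dots> \<le> 1 / n" using \<open>0 < n\<close> by (simp add: frac_le)
    finally show False using n a1 \<open>0 < n\<close> by (simp add: field_simps)
  qed
  then have "\<parallel>of_real 1 \<odot> \<one> \<ominus> h\<parallel> \<le> 1" using h by (simp add: s_def peval_diff)
  then show ?thesis using h cposI unfolding h_def by blast
qed

text \<open>Scaling reduces this to norm at most 1. Together with \<open>ex_sqrt'\<close> it
  identifies metric positivity with being of the form x^* x, an algebraic property that
  homomorphisms preserve before any norm estimate for them is known.\<close>

theorem cpos_star_mult:
  assumes x: "x \<in> C"
  shows "cpos (\<star> x \<otimes> x)"
proof (cases "\<parallel>x\<parallel> = 0")
  case True
  then have "x = \<zero>" using x by (simp add: nm_eq_zero)
  then show ?thesis by simp
next
  case False
  define r where "r = 1 / \<parallel>x\<parallel>"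
  have r: "r * r * \<parallel>x\<parallel>\<^sup>2 = 1" "0 \<le> r" using False x by (simp_all add: r_def power2_eq_square)
  have "cpos (\<star> (of_real r \<odot> x) \<otimes> (of_real r \<odot> x))"
    using x False r by (intro cpos_star_mult_aux) (simp_all add: r_def norm_divide)
  then have "cpos (of_real (\<parallel>x\<parallel>\<^sup>2) \<odot> (\<star> (of_real r \<odot> x) \<otimes> (of_real r \<odot> x)))"
    by (intro cpos_sm) simp_all
  also have "of_real (\<parallel>x\<parallel>\<^sup>2) \<odot> (\<star> (of_real r \<odot> x) \<otimes> (of_real r \<odot> x))
      = of_real (r * r * \<parallel>x\<parallel>\<^sup>2) \<odot> (\<star> x \<otimes> x)"
    using x by (simp add: mult_ac)
  finally show ?thesis using r x by simp
qed

section \<open>Norm limits, square roots and their uniqueness\<close>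

definition clim :: "(nat \<Rightarrow> 'a) \<Rightarrow> 'a \<Rightarrow> bool" where
  "clim f l \<longleftrightarrow> (\<lambda>n. \<parallel>f n \<ominus> l\<parallel>) \<longlonglongrightarrow> 0"

lemma clim_unique:
  "clim f x \<Longrightarrow> clim f y \<Longrightarrow> (\<And>n. f n \<in> C) \<Longrightarrow> x \<in> C \<Longrightarrow> y \<in> C \<Longrightarrow> x = y"
  unfolding clim_def by (rule limit_unique)

lemma clim_le:
  assumes "\<And>n. \<parallel>f n \<ominus> l\<parallel> \<le> g n" "g \<longlonglongrightarrow> 0" "\<And>n. f n \<in> C" "l \<in> C"
  shows "clim f l"
  unfolding clim_def
  by (rule Lim_null_comparison[OF _ assms(2)]) (use assms in simp)

lemma clim_norm: "clim f l \<Longrightarrow> (\<And>n. f n \<in> C) \<Longrightarrow> l \<in> C \<Longrightarrow> (\<lambda>n. \<parallel>f n\<parallel>) \<longlonglongrightarrow> \<parallel>l\<parallel>"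
  unfolding clim_def
  by (rule LIM_zero_cancel, erule Lim_null_comparison[rotated]) (simp add: nm_diff_le)

lemma clim_add:
  assumes "clim f x" "clim g y" "\<And>n. f n \<in> C" "\<And>n. g n \<in> C" "x \<in> C" "y \<in> C"
  shows "clim (\<lambda>n. f n \<oplus> g n) (x \<oplus> y)"
proof (rule clim_le)
  show "(\<lambda>n. \<parallel>f n \<ominus> x\<parallel> + \<parallel>g n \<ominus> y\<parallel>) \<longlonglongrightarrow> 0"
    using tendsto_add[OF assms(1,2)[unfolded clim_def]] by simp
qed (use assms in \<open>simp_all add: add_sub_add nm_add\<close>)

lemma clim_sm:
  assumes "clim f x" "\<And>n. f n \<in> C" "x \<in> C"
  shows "clim (\<lambda>n. c \<odot> f n) (c \<odot> x)"
proof (rule clim_le)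
  show "(\<lambda>n. cmod c * \<parallel>f n \<ominus> x\<parallel>) \<longlonglongrightarrow> 0"
    using tendsto_mult_right_zero[OF assms(1)[unfolded clim_def]] .
qed (use assms in \<open>simp_all add: sm_sub[symmetric]\<close>)

lemma clim_star:
  assumes "clim f x" "\<And>n. f n \<in> C" "x \<in> C"
  shows "clim (\<lambda>n. \<star> (f n)) (\<star> x)"
  using assms(1) unfolding clim_def
  by (simp add: assms star_sub[symmetric] del: star_sub)

lemma clim_mult:
  assumes "clim f x" "clim g y" "\<And>n. f n \<in> C" "\<And>n. g n \<in> C" "x \<in> C" "y \<in> C"
  shows "clim (\<lambda>n. f n \<otimes> g n) (x \<otimes> y)"
proof (rule clim_le)
  have "(\<lambda>n. \<parallel>f n \<ominus> x\<parallel> * \<parallel>g n\<parallel> + \<parallel>x\<parallel> * \<parallel>g n \<ominus> y\<parallel>) \<longlonglongrightarrow> 0 * \<parallel>y\<parallel> + \<parallel>x\<parallel> * 0"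
    using assms clim_norm[OF assms(2,4,6)] unfolding clim_def by (intro tendsto_intros)
  then show "(\<lambda>n. \<parallel>f n \<ominus> x\<parallel> * \<parallel>g n\<parallel> + \<parallel>x\<parallel> * \<parallel>g n \<ominus> y\<parallel>) \<longlonglongrightarrow> 0" by simp
  fix n
  have "f n \<otimes> g n \<ominus> x \<otimes> y = (f n \<ominus> x) \<otimes> g n \<oplus> x \<otimes> (g n \<ominus> y)"
    using assms by (simp add: dist_subl dist_subr sub_add_sub)
  then show "\<parallel>f n \<otimes> g n \<ominus> x \<otimes> y\<parallel> \<le> \<parallel>f n \<ominus> x\<parallel> * \<parallel>g n\<parallel> + \<parallel>x\<parallel> * \<parallel>g n \<ominus> y\<parallel>"
    using assms nm_add[of "(f n \<ominus> x) \<otimes> g n" "x \<otimes> (g n \<ominus> y)"] nm_mult[of "f n \<ominus> x" "g n"]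
      nm_mult[of x "g n \<ominus> y"] by simp
qed (use assms in simp_all)

lemma clim_const [simp]: "x \<in> C \<Longrightarrow> clim (\<lambda>n. x) x"
  by (simp add: clim_def)

text \<open>The root is a norm limit of polynomials in h and so stays in every closed unital
  subalgebra T that contains h. Later T is the commutant of an element, or the set of block matrices
  with entries from an embedded algebra.\<close>

lemma ex_sqrt:
  assumes h: "cpos h" and T: "h \<in> T" "\<one> \<in> T" "T \<subseteq> C"
    and "\<And>x y. x \<in> T \<Longrightarrow> y \<in> T \<Longrightarrow> x \<oplus> y \<in> T" "\<And>x y. x \<in> T \<Longrightarrow> y \<in> T \<Longrightarrow> x \<otimes> y \<in> T"
    and Tsm: "\<And>c x. x \<in> T \<Longrightarrow> c \<odot> x \<in> T"
    and Tlim: "\<And>f l. (\<And>n. f n \<in> T) \<Longrightarrow> l \<in> C \<Longrightarrow> clim f l \<Longrightarrow> l \<in> T"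
  shows "\<exists>w. w \<in> T \<and> cpos w \<and> w \<otimes> w = h"
proof (cases "\<parallel>h\<parallel> = 0")
  case True
  then have "h = \<zero>" using h by (simp add: nm_eq_zero cposD)
  then show ?thesis using T by (intro exI[of _ \<zero>]) simp
next
  case False
  have hC: "h \<in> C" "\<star> h = h" using h by (simp_all add: cposD)
  define t where "t = \<parallel>h\<parallel>"
  have t: "t > 0" using False hC nm_nonneg[of h] unfolding t_def by linarith
  interpret poly_norm "\<lambda>p. \<parallel>peval h p\<parallel>" using hC by (rule poly_norm_peval)
  \<comment> \<open>Normalised such that 1 - z = h / t; the root of 1 - z is multiplied by sqrt t at
    the end.\<close>
  define z where "z = rc (1 / t) * (rc t - [:0, 1:])"
  have "\<parallel>peval h (rc t - [:0, 1:])\<parallel> \<le> t"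
    using cpos_upper[OF h, of t] t hC by (simp add: peval_diff peval_rc t_def)
  then have z: "\<parallel>peval h z\<parallel> \<le> 1" "cpoly z = z" using t unfolding z_def N_rc_mult by (simp_all add: field_simps)
  show ?thesis
  proof (rule ex_sqrt_seq[OF z(2,1)])
    fix W assume W: "\<And>n. cpoly (W n) = W n" "\<And>n. \<parallel>peval h (1 - W n)\<parallel> \<le> 1"
      and Cau: "\<And>e. e > 0 \<Longrightarrow> \<exists>M. \<forall>m\<ge>M. \<forall>n\<ge>M. \<parallel>peval h (W m - W n)\<parallel> < e"
      and lim: "(\<lambda>n. \<parallel>peval h ((W n)\<^sup>2 - (1 - z))\<parallel>) \<longlonglongrightarrow> 0"
    have "\<exists>l\<in>C. (\<lambda>n. \<parallel>peval h (W n) \<ominus> l\<parallel>) \<longlonglongrightarrow> 0"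
      using Cau hC by (intro complete) (simp_all add: peval_closed peval_diff)
    then obtain l where l: "l \<in> C" "clim (\<lambda>n. peval h (W n)) l" by (auto simp: clim_def)
    have WC: "peval h (W n) \<in> C" for n using hC by (simp add: peval_closed)
    have "peval h p \<in> T" for p by (rule peval_in_subalgebra) fact+
    then have lT: "l \<in> T" using l by (rule Tlim)
    have "clim (\<lambda>n. \<star> (peval h (W n))) (\<star> l)" using l WC by (intro clim_star)
    then have ls: "\<star> l = l" using l WC W(1) hC
      by (intro clim_unique[of "\<lambda>n. peval h (W n)"]) (simp_all add: peval_star)
    have "clim (\<lambda>n. peval h (W n) \<otimes> peval h (W n)) (l \<otimes> l)" using l WC by (intro clim_mult)
    moreover have "clim (\<lambda>n. peval h (W n) \<otimes> peval h (W n)) (peval h (1 - z))"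
      using lim hC unfolding clim_def by (simp only: peval_diff[of h "_\<^sup>2"] peval_power)
    ultimately have "l \<otimes> l = peval h (1 - z)" using WC l hC
      by (intro clim_unique[of "\<lambda>n. peval h (W n) \<otimes> peval h (W n)"]) (simp_all add: peval_closed)
    also have "1 - z = rc (1 / t) * [:0, 1:]"
      using t by (intro complex_poly_ext) (simp add: z_def field_simps)
    also have "peval h \<dots> = of_real (1 / t) \<odot> h"
      using hC by (simp only: peval_mult peval_rc peval_X) simp
    finally have ll: "l \<otimes> l = of_real (1 / t) \<odot> h" .
    \<comment> \<open>The bound by 1 on the norm of 1 - W_n survives in the limit, and it says that
      l is positive with radius 1.\<close>
    have "clim (\<lambda>n. \<one> \<oplus> (-1) \<odot> peval h (W n)) (\<one> \<oplus> (-1) \<odot> l)"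
      using l WC by (intro clim_add clim_sm) simp_all
    then have "(\<lambda>n. \<parallel>\<one> \<oplus> (-1) \<odot> peval h (W n)\<parallel>) \<longlonglongrightarrow> \<parallel>\<one> \<oplus> (-1) \<odot> l\<parallel>"
      using l WC by (intro clim_norm) simp_all
    moreover have "\<parallel>\<one> \<oplus> (-1) \<odot> peval h (W n)\<parallel> \<le> 1" for n
      using W(2)[of n] hC by (simp add: peval_diff cs_sub_def)
    ultimately have "\<parallel>\<one> \<oplus> (-1) \<odot> l\<parallel> \<le> 1" by (intro LIMSEQ_le_const2) auto
    then have lpos: "cpos l" using l ls by (intro cposI[of _ 1]) (simp_all add: cs_sub_def)
    define r where "r = sqrt t"
    have r: "complex_of_real r * complex_of_real r = of_real t"
      using t by (simp add: r_def of_real_mult[symmetric] del: of_real_mult)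
    have "(of_real r \<odot> l) \<otimes> (of_real r \<odot> l) = of_real t \<odot> (l \<otimes> l)" using l by (simp add: r)
    also have "\<dots> = h" unfolding ll using t hC by simp
    finally have "(of_real r \<odot> l) \<otimes> (of_real r \<odot> l) = h" .
    moreover have "cpos (of_real r \<odot> l)" using lpos t by (intro cpos_sm) (simp_all add: r_def)
    ultimately show ?thesis using Tsm[OF lT] by blast
  qed
qed

lemma ex_sqrt': "cpos h \<Longrightarrow> \<exists>w. cpos w \<and> w \<otimes> w = h"
  using ex_sqrt[of h C] by (auto simp: cposD)

lemma cpos_conj:
  assumes "cpos h" "y \<in> C"
  shows "cpos (\<star> y \<otimes> (h \<otimes> y))"
proof -
  obtain w where w: "cpos w" "w \<otimes> w = h" using ex_sqrt' assms by blast
  have "\<star> (w \<otimes> y) \<otimes> (w \<otimes> y) = \<star> y \<otimes> ((w \<otimes> w) \<otimes> y)"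
    using w(1) assms(2) by (simp add: cposD mult_assoc)
  moreover have "cpos (\<star> (w \<otimes> y) \<otimes> (w \<otimes> y))" using assms w by (intro cpos_star_mult) (simp add: cposD)
  ultimately show ?thesis using w by simp
qed

lemma cpos_antisym: "cpos h \<Longrightarrow> cpos ((-1) \<odot> h) \<Longrightarrow> h = \<zero>"
proof -
  assume h: "cpos h" "cpos ((-1) \<odot> h)"
  then have "\<parallel>h\<parallel> \<le> 0" by (intro cpos_bound) (simp_all add: cposD cs_sub_def)
  then have "\<parallel>h\<parallel> = 0" using h by (intro antisym) (simp_all add: cposD)
  then show "h = \<zero>" using h by (simp add: nm_eq_zero cposD)
qed

text \<open>For G = R - Z commutation gives (R + Z) G = 0. The positive elements G R G and G Z G
  then have sum 0, so both vanish. Their difference is G^3, and G^4 = 0 forces G = 0 by the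
  C*-identity.\<close>

lemma cpos_sqrt_unique:
  assumes R: "cpos R" and Z: "cpos Z" and com: "R \<otimes> Z = Z \<otimes> R" and sq: "R \<otimes> R = Z \<otimes> Z"
  shows "R = Z"
proof -
  have C: "R \<in> C" "Z \<in> C" "\<star> R = R" "\<star> Z = Z" using R Z by (simp_all add: cposD)
  define G where "G = R \<ominus> Z"
  have G: "G \<in> C" "\<star> G = G" using C by (simp_all add: G_def)
  have "(R \<oplus> Z) \<otimes> G = (R \<otimes> R \<oplus> Z \<otimes> R) \<ominus> (R \<otimes> Z \<oplus> Z \<otimes> Z)"
    unfolding G_def using C by (simp add: distr dist_subl add_sub_add)
  also have "\<dots> = \<zero>" using C by (simp add: com sq add_commute)
  finally have "(R \<oplus> Z) \<otimes> G = \<zero>" .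
  then have "G \<otimes> ((R \<oplus> Z) \<otimes> G) = \<zero>" using G by simp
  then have s: "G \<otimes> (R \<otimes> G) \<oplus> G \<otimes> (Z \<otimes> G) = \<zero>" using C G by (simp add: distr distl)
  have pR: "cpos (G \<otimes> (R \<otimes> G))" and pZ: "cpos (G \<otimes> (Z \<otimes> G))"
    using cpos_conj[OF R G(1)] cpos_conj[OF Z G(1)] G by simp_all
  have neg: "b = (-1) \<odot> a" if "a \<oplus> b = \<zero>" "a \<in> C" "b \<in> C" for a b
    using that by (metis add_sub_cancel(2) add_zero(1) closed(5) cs_sub_def)
  have "G \<otimes> (Z \<otimes> G) = (-1) \<odot> (G \<otimes> (R \<otimes> G))" using neg[OF s] C G by simp
  then have R0: "G \<otimes> (R \<otimes> G) = \<zero>" using cpos_antisym[OF pR] pZ by simp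
  then have Z0: "G \<otimes> (Z \<otimes> G) = \<zero>" using s C G by simp
  have "G \<otimes> (G \<otimes> G) = G \<otimes> (R \<otimes> G) \<ominus> G \<otimes> (Z \<otimes> G)"
    using C G by (subst (2) G_def) (simp add: dist_subl dist_subr)
  then have "G \<otimes> (G \<otimes> G) = \<zero>" using R0 Z0 by simp
  then have "G \<otimes> (G \<otimes> (G \<otimes> G)) = \<zero>" using G by simp
  then have "\<star> (G \<otimes> G) \<otimes> (G \<otimes> G) = \<zero>" using G by (simp add: mult_assoc)
  then have "\<parallel>G \<otimes> G\<parallel> = 0" using nm_cstar[of "G \<otimes> G"] G by simp
  then have "\<parallel>G\<parallel> = 0" using nm_cstar[of G] G by simp
  then show ?thesis using G C by (simp add: nm_eq_zero G_def sub_eq_zero)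
qed

end

subsection \<open>Homomorphisms\<close>

locale cstar_hom = A: cstar_algebra A + B: cstar_algebra B
  for A :: "'a cstar" and B :: "'b cstar" +
  fixes \<phi> :: "'a \<Rightarrow> 'b"
  assumes hom: "unital_star_hom A B \<phi>"
begin

lemma hom_closed [simp]: "x \<in> A.C \<Longrightarrow> \<phi> x \<in> B.C"
  and hom_add [simp]: "x \<in> A.C \<Longrightarrow> y \<in> A.C \<Longrightarrow> \<phi> (x \<oplus>\<^bsub>A\<^esub> y) = \<phi> x \<oplus>\<^bsub>B\<^esub> \<phi> y"
  and hom_mult [simp]: "x \<in> A.C \<Longrightarrow> y \<in> A.C \<Longrightarrow> \<phi> (x \<otimes>\<^bsub>A\<^esub> y) = \<phi> x \<otimes>\<^bsub>B\<^esub> \<phi> y"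
  and hom_sm [simp]: "x \<in> A.C \<Longrightarrow> \<phi> (c \<odot>\<^bsub>A\<^esub> x) = c \<odot>\<^bsub>B\<^esub> \<phi> x"
  and hom_star [simp]: "x \<in> A.C \<Longrightarrow> \<phi> (\<star>\<^bsub>A\<^esub> x) = \<star>\<^bsub>B\<^esub> (\<phi> x)"
  and hom_one [simp]: "\<phi> \<one>\<^bsub>A\<^esub> = \<one>\<^bsub>B\<^esub>"
  using hom unfolding unital_star_hom_def by blast+

lemma hom_zero [simp]: "\<phi> \<zero>\<^bsub>A\<^esub> = \<zero>\<^bsub>B\<^esub>"
  using hom_sm[of "\<zero>\<^bsub>A\<^esub>" 0] by simp

lemma hom_sub [simp]: "x \<in> A.C \<Longrightarrow> y \<in> A.C \<Longrightarrow> \<phi> (x \<ominus>\<^bsub>A\<^esub> y) = \<phi> x \<ominus>\<^bsub>B\<^esub> \<phi> y"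
  by (simp add: cs_sub_def)

lemma hom_cpos: "A.cpos h \<Longrightarrow> B.cpos (\<phi> h)"
proof -
  assume "A.cpos h"
  then obtain w where w: "A.cpos w" "w \<otimes>\<^bsub>A\<^esub> w = h" using A.ex_sqrt' by blast
  then have "\<phi> h = \<star>\<^bsub>B\<^esub> (\<phi> w) \<otimes>\<^bsub>B\<^esub> \<phi> w"
    using A.cposD[OF w(1)] by (metis hom_mult hom_star)
  then show ?thesis using A.cposD[OF w(1)] by (simp add: B.cpos_star_mult)
qed

text \<open>In A the element x^* x is at most the square of the norm of x. Homomorphisms preserve
  this order bound, and for the positive image it is a norm bound.\<close>

lemma contractive:
  assumes x: "x \<in> A.C"
  shows "\<parallel>\<phi> x\<parallel>\<^bsub>B\<^esub> \<le> \<parallel>x\<parallel>\<^bsub>A\<^esub>"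
proof -
  let ?h = "\<star>\<^bsub>A\<^esub> x \<otimes>\<^bsub>A\<^esub> x"
  let ?t = "(\<parallel>x\<parallel>\<^bsub>A\<^esub>)\<^sup>2"
  have "A.cpos (of_real ?t \<odot>\<^bsub>A\<^esub> \<one>\<^bsub>A\<^esub> \<ominus>\<^bsub>A\<^esub> ?h)"
    using x A.nm_cstar[OF x] by (intro A.cpos_one_minus) simp_all
  from hom_cpos[OF this] have "B.cpos (of_real ?t \<odot>\<^bsub>B\<^esub> \<one>\<^bsub>B\<^esub> \<ominus>\<^bsub>B\<^esub> \<phi> ?h)" using x by simp
  moreover have "B.cpos (of_real ?t \<odot>\<^bsub>B\<^esub> \<one>\<^bsub>B\<^esub> \<oplus>\<^bsub>B\<^esub> \<phi> ?h)"
    using x by (intro B.cpos_add B.cpos_const hom_cpos A.cpos_star_mult) simp_all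
  ultimately have "\<parallel>\<phi> ?h\<parallel>\<^bsub>B\<^esub> \<le> ?t" using x by (intro B.cpos_bound) simp_all
  then have "(\<parallel>\<phi> x\<parallel>\<^bsub>B\<^esub>)\<^sup>2 \<le> ?t" using x by (simp add: B.nm_cstar)
  then show ?thesis by (rule power2_le_imp_le) (use x in simp)
qed

text \<open>With q the square of the norm of \<phi> x, the claim is that z = q - x^* x is positive.
  Let r be the positive root of z^2. The images of r and z are both positive and have the same
  square, hence agree, and injectivity gives z = r.\<close>

lemma isometric:
  assumes inj: "inj_on \<phi> A.C" and x: "x \<in> A.C"
  shows "\<parallel>\<phi> x\<parallel>\<^bsub>B\<^esub> = \<parallel>x\<parallel>\<^bsub>A\<^esub>"
proof (rule antisym[OF contractive[OF x]])
  define k where "k = \<star>\<^bsub>A\<^esub> x \<otimes>\<^bsub>A\<^esub> x"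
  define q where "q = (\<parallel>\<phi> x\<parallel>\<^bsub>B\<^esub>)\<^sup>2"
  define z where "z = of_real q \<odot>\<^bsub>A\<^esub> \<one>\<^bsub>A\<^esub> \<ominus>\<^bsub>A\<^esub> k"
  have k: "k \<in> A.C" "\<star>\<^bsub>A\<^esub> k = k" and z: "z \<in> A.C" "\<star>\<^bsub>A\<^esub> z = z"
    using x by (simp_all add: k_def z_def)
  have "\<phi> z = of_real q \<odot>\<^bsub>B\<^esub> \<one>\<^bsub>B\<^esub> \<ominus>\<^bsub>B\<^esub> \<phi> k" using k by (simp add: z_def)
  moreover have "\<parallel>\<phi> k\<parallel>\<^bsub>B\<^esub> = q" "\<star>\<^bsub>B\<^esub> (\<phi> k) = \<phi> k" using x by (simp_all add: k_def q_def B.nm_cstar)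
  ultimately have pz: "B.cpos (\<phi> z)" using k by (simp add: B.cpos_one_minus)
  \<comment> \<open>The commutant of z: a root found there commutes with z, as uniqueness of
    positive roots demands.\<close>
  let ?T = "{y \<in> A.C. y \<otimes>\<^bsub>A\<^esub> z = z \<otimes>\<^bsub>A\<^esub> y}"
  have "\<exists>r. r \<in> ?T \<and> A.cpos r \<and> r \<otimes>\<^bsub>A\<^esub> r = z \<otimes>\<^bsub>A\<^esub> z"
  proof (rule A.ex_sqrt)
    show "A.cpos (z \<otimes>\<^bsub>A\<^esub> z)" using z by (rule A.cpos_sq)
    show "f \<otimes>\<^bsub>A\<^esub> g \<in> ?T" if "f \<in> ?T" "g \<in> ?T" for f g
    proof -
      have "f \<otimes>\<^bsub>A\<^esub> g \<otimes>\<^bsub>A\<^esub> z = f \<otimes>\<^bsub>A\<^esub> (z \<otimes>\<^bsub>A\<^esub> g)" using that z by (simp add: A.mult_assoc)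
      also have "\<dots> = z \<otimes>\<^bsub>A\<^esub> (f \<otimes>\<^bsub>A\<^esub> g)" using that z by (simp add: A.mult_assoc[symmetric])
      finally show ?thesis using that by simp
    qed
    show "l \<in> ?T" if f: "\<And>n. f n \<in> ?T" and l: "l \<in> A.C" "A.clim f l" for f l
    proof -
      have "A.clim (\<lambda>n. f n \<otimes>\<^bsub>A\<^esub> z) (l \<otimes>\<^bsub>A\<^esub> z)" "A.clim (\<lambda>n. z \<otimes>\<^bsub>A\<^esub> f n) (z \<otimes>\<^bsub>A\<^esub> l)"
        using f l z by (blast intro: A.clim_mult[OF l(2) A.clim_const] A.clim_mult[OF A.clim_const l(2)])+
      moreover have "(\<lambda>n. f n \<otimes>\<^bsub>A\<^esub> z) = (\<lambda>n. z \<otimes>\<^bsub>A\<^esub> f n)" using f by auto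
      ultimately have "l \<otimes>\<^bsub>A\<^esub> z = z \<otimes>\<^bsub>A\<^esub> l" using f l z
        by (intro A.clim_unique[of "\<lambda>n. z \<otimes>\<^bsub>A\<^esub> f n"]) auto
      then show ?thesis using l by simp
    qed
  qed (use z in \<open>auto simp: A.distl A.distr A.mult_assoc\<close>)
  then obtain r where r: "r \<in> A.C" "r \<otimes>\<^bsub>A\<^esub> z = z \<otimes>\<^bsub>A\<^esub> r" "A.cpos r" "r \<otimes>\<^bsub>A\<^esub> r = z \<otimes>\<^bsub>A\<^esub> z" by blast
  have "\<phi> r = \<phi> z"
  proof (rule B.cpos_sqrt_unique[OF hom_cpos[OF r(3)] pz])
    show "\<phi> r \<otimes>\<^bsub>B\<^esub> \<phi> z = \<phi> z \<otimes>\<^bsub>B\<^esub> \<phi> r" using r z hom_mult by metis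
    show "\<phi> r \<otimes>\<^bsub>B\<^esub> \<phi> r = \<phi> z \<otimes>\<^bsub>B\<^esub> \<phi> z" using r z hom_mult by metis
  qed
  then have "r = z" using inj r z by (auto dest: inj_onD)
  then have "A.cpos z" using r by simp
  moreover have "A.cpos (of_real q \<odot>\<^bsub>A\<^esub> \<one>\<^bsub>A\<^esub> \<oplus>\<^bsub>A\<^esub> k)"
    using x unfolding k_def by (intro A.cpos_add A.cpos_const A.cpos_star_mult) (simp add: q_def)
  ultimately have "\<parallel>k\<parallel>\<^bsub>A\<^esub> \<le> q" using k unfolding z_def by (intro A.cpos_bound) (simp_all add: q_def)
  then have "(\<parallel>x\<parallel>\<^bsub>A\<^esub>)\<^sup>2 \<le> (\<parallel>\<phi> x\<parallel>\<^bsub>B\<^esub>)\<^sup>2" using x by (simp add: k_def q_def A.nm_cstar)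
  then show "\<parallel>x\<parallel>\<^bsub>A\<^esub> \<le> \<parallel>\<phi> x\<parallel>\<^bsub>B\<^esub>" by (rule power2_le_imp_le) (use x in simp)
qed

end

context cstar_algebra
begin

subsection \<open>States\<close>

definition Sa :: "'a set" where
  "Sa = {h \<in> C. \<star> h = h}"

lemma SaI: "x \<in> C \<Longrightarrow> \<star> x = x \<Longrightarrow> x \<in> Sa"
  by (simp add: Sa_def)

lemma Sa_closed [simp]:
  "x \<in> Sa \<Longrightarrow> x \<in> C" "x \<in> Sa \<Longrightarrow> \<star> x = x" "x \<in> Sa \<Longrightarrow> y \<in> Sa \<Longrightarrow> x \<oplus> y \<in> Sa"
  "x \<in> Sa \<Longrightarrow> of_real t \<odot> x \<in> Sa" "x \<in> Sa \<Longrightarrow> (-1) \<odot> x \<in> Sa" "\<zero> \<in> Sa" "\<one> \<in> Sa"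
  by (auto simp: Sa_def)

text \<open>Hahn-Banach is carried out on the real vector space \<open>Sa\<close>, by showing that
  minimal sublinear functionals are linear. For scaling one inequality suffices as an axiom, since
  scaling back gives the other.\<close>

definition sublin :: "('a \<Rightarrow> real) \<Rightarrow> bool" where
  "sublin q \<longleftrightarrow> (\<forall>x\<in>Sa. \<forall>y\<in>Sa. q (x \<oplus> y) \<le> q x + q y) \<and>
     (\<forall>x\<in>Sa. \<forall>t>0. q (of_real t \<odot> x) \<le> t * q x) \<and> q \<zero> = 0"

lemma sublinD:
  "sublin q \<Longrightarrow> x \<in> Sa \<Longrightarrow> y \<in> Sa \<Longrightarrow> q (x \<oplus> y) \<le> q x + q y"
  "sublin q \<Longrightarrow> x \<in> Sa \<Longrightarrow> t > 0 \<Longrightarrow> q (of_real t \<odot> x) \<le> t * q x"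
  "sublin q \<Longrightarrow> q \<zero> = 0"
  unfolding sublin_def by blast+

lemma sublin_scale:
  assumes q: "sublin q" and x: "x \<in> Sa" and t: "0 \<le> t"
  shows "q (of_real t \<odot> x) = t * q x"
proof (cases "t = 0")
  case False
  then have t: "t > 0" using t by simp
  have "q (of_real (1 / t) \<odot> of_real t \<odot> x) \<le> 1 / t * q (of_real t \<odot> x)"
    using t x by (intro sublinD(2)[OF q]) simp_all
  also have "of_real (1 / t) \<odot> of_real t \<odot> x = x" using t x by simp
  finally have "t * q x \<le> q (of_real t \<odot> x)" using t by (simp add: field_simps)
  then show ?thesis using sublinD(2)[OF q x t] by simp
qed (use x sublinD(3)[OF q] in simp)

lemma sublin_neg:
  assumes q: "sublin q" and x: "x \<in> Sa"
  shows "- q ((-1) \<odot> x) \<le> q x"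
  using sublinD(1)[OF q x, of "(-1) \<odot> x"] sublinD(3)[OF q] x sub_self[of x]
  by (simp add: cs_sub_def)

text \<open>The witness is q'(y), the infimum of q(y + t x) - t q(x) over t >= 0. It lies below q
  and at -x it has dropped to -q(x) or less. Hence a sublinear functional that cannot be lowered is
  odd, and so linear.\<close>

lemma sublin_push:
  assumes q: "sublin q" and x: "x \<in> Sa"
  shows "\<exists>q'. sublin q' \<and> (\<forall>y\<in>Sa. q' y \<le> q y) \<and> q' ((-1) \<odot> x) \<le> - q x"
proof -
  define V where "V y = (\<lambda>t. q (y \<oplus> of_real t \<odot> x) - t * q x) ` {0..}" for y
  define q' where "q' y = Inf (V y)" for y
  have lower: "- q ((-1) \<odot> y) \<le> v" if v: "v \<in> V y" and y: "y \<in> Sa" for v y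
  proof -
    obtain t where t: "0 \<le> t" "v = q (y \<oplus> of_real t \<odot> x) - t * q x" using v by (auto simp: V_def)
    have "of_real t \<odot> x = (y \<oplus> of_real t \<odot> x) \<oplus> (-1) \<odot> y"
      using x y add_sub_cancel(2)[of "of_real t \<odot> x" y] unfolding cs_sub_def by simp
    then have "t * q x \<le> q (y \<oplus> of_real t \<odot> x) + q ((-1) \<odot> y)"
      using sublinD(1)[OF q, of "y \<oplus> of_real t \<odot> x" "(-1) \<odot> y"] sublin_scale[OF q x t(1)] x y by simp
    then show ?thesis using t by simp
  qed
  have bdd: "bdd_below (V y)" if "y \<in> Sa" for y
    by (rule bdd_belowI[of _ "- q ((-1) \<odot> y)"]) (rule lower[OF _ that])
  have ne: "V y \<noteq> {}" for y by (auto simp: V_def)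
  have le: "q' y \<le> q (y \<oplus> of_real t \<odot> x) - t * q x" if "y \<in> Sa" "0 \<le> t" for y t
    unfolding q'_def using bdd[OF that(1)] that(2) by (intro cInf_lower) (auto simp: V_def)
  have le_q: "q' y \<le> q y" if "y \<in> Sa" for y using le[OF that, of 0] that x by simp
  have approx: "\<exists>t\<ge>0. q (y \<oplus> of_real t \<odot> x) - t * q x < q' y + e" if "e > 0" for y e
  proof -
    have "\<exists>v\<in>V y. v < q' y + e" unfolding q'_def using ne that by (intro cInf_lessD) auto
    then show ?thesis by (auto simp: V_def)
  qed
  have "sublin q'"
    unfolding sublin_def
  proof (intro conjI ballI allI impI)
    fix y z assume yz: "y \<in> Sa" "z \<in> Sa"
    show "q' (y \<oplus> z) \<le> q' y + q' z"
    proof (rule field_le_epsilon)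
      fix e :: real assume e: "e > 0"
      obtain t where t: "t \<ge> 0" "q (y \<oplus> of_real t \<odot> x) - t * q x < q' y + e / 2"
        using approx[of "e / 2"] e by auto
      obtain s where s: "s \<ge> 0" "q (z \<oplus> of_real s \<odot> x) - s * q x < q' z + e / 2"
        using approx[of "e / 2"] e by auto
      have "(y \<oplus> z) \<oplus> of_real (t + s) \<odot> x = (y \<oplus> of_real t \<odot> x) \<oplus> (z \<oplus> of_real s \<odot> x)"
        using x yz by (simp add: sm_add_left add_ac)
      then have "q ((y \<oplus> z) \<oplus> of_real (t + s) \<odot> x) \<le> q (y \<oplus> of_real t \<odot> x) + q (z \<oplus> of_real s \<odot> x)"
        using sublinD(1)[OF q] x yz by simp
      then show "q' (y \<oplus> z) \<le> q' y + q' z + e"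
        using le[of "y \<oplus> z" "t + s"] yz t s by (simp add: algebra_simps)
    qed
  next
    fix y and r :: real assume y: "y \<in> Sa" and r: "r > 0"
    have "q' (of_real r \<odot> y) / r \<le> q' y"
    proof (rule field_le_epsilon)
      fix e :: real assume e: "e > 0"
      obtain t where t: "t \<ge> 0" "q (y \<oplus> of_real t \<odot> x) - t * q x < q' y + e"
        using approx[of e] e by auto
      have "q' (of_real r \<odot> y) \<le> q (of_real r \<odot> y \<oplus> of_real (r * t) \<odot> x) - (r * t) * q x"
        using y r t by (intro le) simp_all
      also have "of_real r \<odot> y \<oplus> of_real (r * t) \<odot> x = of_real r \<odot> (y \<oplus> of_real t \<odot> x)"
        using x y by (simp add: sm_add_right)
      also have "q \<dots> \<le> r * q (y \<oplus> of_real t \<odot> x)" using x y r by (intro sublinD(2)[OF q]) simp_all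
      finally have "q' (of_real r \<odot> y) \<le> r * (q (y \<oplus> of_real t \<odot> x) - t * q x)" by (simp add: algebra_simps)
      also have "\<dots> \<le> r * (q' y + e)" using t r by (intro mult_left_mono) simp_all
      finally show "q' (of_real r \<odot> y) / r \<le> q' y + e" using r by (simp add: divide_le_eq mult.commute)
    qed
    then show "q' (of_real r \<odot> y) \<le> r * q' y" using r by (simp add: divide_le_eq mult.commute)
  next
    have "0 \<le> q' \<zero>" unfolding q'_def using ne lower[of _ \<zero>] sublinD(3)[OF q]
      by (intro cInf_greatest) auto
    then show "q' \<zero> = 0" using le_q[of \<zero>] sublinD(3)[OF q] by simp
  qed
  moreover have "(-1) \<odot> x \<oplus> of_real 1 \<odot> x = \<zero>"
    using x sub_self[of x] by (simp add: cs_sub_def add_commute)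
  then have "q' ((-1) \<odot> x) \<le> - q x" using le[of "(-1) \<odot> x" 1] x sublinD(3)[OF q] by simp
  ultimately show ?thesis using le_q by blast
qed

text \<open>Members of the chain are bounded below by -p(-x), so the infimum is finite. Two nearly
  optimal members, for x and for y, can be replaced by the smaller of them, which gives
  subadditivity.\<close>

lemma sublin_chain_inf:
  assumes p: "sublin p" and K: "K \<noteq> {}"
    and sub: "\<And>q. q \<in> K \<Longrightarrow> sublin q" and le: "\<And>q x. q \<in> K \<Longrightarrow> x \<in> Sa \<Longrightarrow> q x \<le> p x"
    and chain: "\<And>q r. q \<in> K \<Longrightarrow> r \<in> K \<Longrightarrow> (\<forall>x. q x \<le> r x) \<or> (\<forall>x. r x \<le> q x)"
  shows "sublin (\<lambda>x. Inf ((\<lambda>q. q x) ` K))" and "x \<in> Sa \<Longrightarrow> q \<in> K \<Longrightarrow> Inf ((\<lambda>q. q x) ` K) \<le> q x"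
proof -
  define u where "u x = Inf ((\<lambda>q. q x) ` K)" for x
  have pl: "- p ((-1) \<odot> x) \<le> q x" if "q \<in> K" "x \<in> Sa" for q x
    using sublin_neg[OF sub[OF that(1)] that(2)] le[OF that(1), of "(-1) \<odot> x"] that(2) by simp
  have "bdd_below ((\<lambda>q. q x) ` K)" if "x \<in> Sa" for x
    by (rule bdd_belowI[of _ "- p ((-1) \<odot> x)"]) (use pl that in auto)
  then have lower: "u x \<le> q x" if "q \<in> K" "x \<in> Sa" for q x
    unfolding u_def using that by (intro cInf_lower) auto
  then show "x \<in> Sa \<Longrightarrow> q \<in> K \<Longrightarrow> Inf ((\<lambda>q. q x) ` K) \<le> q x" by (simp add: u_def)
  have approx: "\<exists>q\<in>K. q x < u x + e" if "e > 0" for x e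
  proof -
    have "\<exists>v\<in>(\<lambda>q. q x) ` K. v < u x + e" unfolding u_def using K that by (intro cInf_lessD) auto
    then show ?thesis by auto
  qed
  have "sublin u"
    unfolding sublin_def
  proof (intro conjI ballI allI impI)
    fix x y assume xy: "x \<in> Sa" "y \<in> Sa"
    show "u (x \<oplus> y) \<le> u x + u y"
    proof (rule field_le_epsilon)
      fix e :: real assume e: "e > 0"
      obtain q where q: "q \<in> K" "q x < u x + e / 2" using approx[of "e / 2"] e by auto
      obtain r where r: "r \<in> K" "r y < u y + e / 2" using approx[of "e / 2"] e by auto
      obtain s where s: "s \<in> K" "\<And>z. s z \<le> q z" "\<And>z. s z \<le> r z" using chain[OF q(1) r(1)] q(1) r(1) by blast
      have "u (x \<oplus> y) \<le> s (x \<oplus> y)" using s xy by (intro lower) simp_all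
      also have "\<dots> \<le> s x + s y" using xy by (intro sublinD(1) sub s)
      finally show "u (x \<oplus> y) \<le> u x + u y + e" using s(2)[of x] s(3)[of y] q r by simp
    qed
  next
    fix x and t :: real assume x: "x \<in> Sa" and t: "t > 0"
    have "u (of_real t \<odot> x) / t \<le> u x"
    proof (rule field_le_epsilon)
      fix e :: real assume e: "e > 0"
      obtain q where q: "q \<in> K" "q x < u x + e" using approx e by blast
      have "u (of_real t \<odot> x) \<le> q (of_real t \<odot> x)" using q x by (intro lower) simp_all
      also have "\<dots> \<le> t * q x" using sublinD(2)[OF sub[OF q(1)] x t] .
      also have "\<dots> \<le> t * (u x + e)" using q t by (intro mult_left_mono) simp_all
      finally show "u (of_real t \<odot> x) / t \<le> u x + e" using t by (simp add: divide_le_eq mult.commute)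
    qed
    then show "u (of_real t \<odot> x) \<le> t * u x" using t by (simp add: divide_le_eq mult.commute)
  next
    have "(\<lambda>q. q \<zero>) ` K = (\<lambda>q. 0) ` K" using sublinD(3)[OF sub] by (intro image_cong) simp_all
    then show "u \<zero> = 0" using K by (simp add: u_def)
  qed
  then show "sublin (\<lambda>x. Inf ((\<lambda>q. q x) ` K))" by (simp add: u_def[abs_def])
qed

lemma ex_minimal_sublin:
  assumes p: "sublin p"
  shows "\<exists>m. sublin m \<and> (\<forall>x\<in>Sa. m x \<le> p x) \<and>
     (\<forall>q. sublin q \<longrightarrow> (\<forall>x\<in>Sa. q x \<le> m x) \<longrightarrow> (\<forall>x\<in>Sa. q x = m x))"
proof -
  \<comment> \<open>Fixing the values outside \<open>Sa\<close> allows the pointwise order on the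
    whole type, which is antisymmetric, to express comparison on \<open>Sa\<close>.\<close>
  define cut :: "('a \<Rightarrow> real) \<Rightarrow> 'a \<Rightarrow> real" where "cut q = (\<lambda>x. if x \<in> Sa then q x else 0)" for q
  have cut: "sublin (cut q)" if "sublin q" for q
    using that unfolding sublin_def cut_def by simp
  define S where "S = {q. sublin q \<and> (\<forall>x\<in>Sa. q x \<le> p x) \<and> (\<forall>x. x \<notin> Sa \<longrightarrow> q x = 0)}"
  \<comment> \<open>The order is reversed: what Zorn's lemma delivers as maximal is a minimal
    functional.\<close>
  define P :: "('a \<Rightarrow> real) \<Rightarrow> ('a \<Rightarrow> real) \<Rightarrow> bool" where "P a b \<longleftrightarrow> (\<forall>x. b x \<le> a x)" for a b
  have "\<exists>m\<in>S. \<forall>a\<in>S. P m a \<longrightarrow> a = m"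
  proof (rule predicate_Zorn)
    show "partial_order_on S (relation_of P S)"
      by (rule partial_order_on_relation_ofI) (auto simp: P_def intro!: ext antisym intro: order_trans)
  next
    fix K assume K: "K \<in> Chains (relation_of P S)"
    then have KS: "q \<in> S" if "q \<in> K" for q using that by (auto simp: Chains_def relation_of_def)
    show "\<exists>u\<in>S. \<forall>a\<in>K. P a u"
    proof (cases "K = {}")
      case True
      have "cut p \<in> S" unfolding S_def using cut[OF p] by (auto simp: cut_def)
      then show ?thesis using True by auto
    next
      case False
      let ?u = "cut (\<lambda>x. Inf ((\<lambda>q. q x) ` K))"
      have sub: "\<And>q. q \<in> K \<Longrightarrow> sublin q" and le: "\<And>q x. q \<in> K \<Longrightarrow> x \<in> Sa \<Longrightarrow> q x \<le> p x"
        using KS by (auto simp: S_def)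
      have ch: "(\<forall>x. q x \<le> r x) \<or> (\<forall>x. r x \<le> q x)" if "q \<in> K" "r \<in> K" for q r
        using K that by (auto simp: Chains_def relation_of_def P_def)
      have 1: "sublin ?u"
        by (intro cut sublin_chain_inf(1)[where p = p, OF p False]) (fact sub le ch)+
      have inf: "Inf ((\<lambda>q. q x) ` K) \<le> q x" if "x \<in> Sa" "q \<in> K" for x q
        by (rule sublin_chain_inf(2)[where p = p, OF p False _ _ _ that]) (fact sub le ch)+
      have 2: "?u x \<le> q x" if "q \<in> K" for q x
        using inf[of x q] that KS[OF that] by (auto simp: cut_def S_def)
      then have "\<forall>x\<in>Sa. ?u x \<le> p x" using False le order_trans by blast
      then have "?u \<in> S" using 1 by (simp add: S_def cut_def)
      then show ?thesis using 2 by (auto simp: P_def)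
    qed
  qed
  then obtain m where m: "m \<in> S" "\<And>a. a \<in> S \<Longrightarrow> P m a \<Longrightarrow> a = m" by blast
  have "q x = m x" if q: "sublin q" "\<forall>x\<in>Sa. q x \<le> m x" and x: "x \<in> Sa" for q x
  proof -
    have "cut q \<in> S" using m(1) q cut[OF q(1)] unfolding S_def by (auto simp: cut_def intro: order_trans)
    moreover have "P m (cut q)" using q m(1) by (auto simp: P_def cut_def S_def)
    ultimately have "cut q = m" by (rule m(2))
    then show ?thesis using x by (auto simp: cut_def)
  qed
  then show ?thesis using m(1) by (auto simp: S_def)
qed

text \<open>One push in the direction h forces every functional below the result to take a value of
  at most -p(h) at -h. A minimal functional there is odd by a further push, hence linear, and its
  value at h is at least p(h).\<close>

lemma ex_linear_below:
  assumes p: "sublin p" and h: "h \<in> Sa"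
  shows "\<exists>f. (\<forall>x\<in>Sa. \<forall>y\<in>Sa. f (x \<oplus> y) = f x + f y) \<and> (\<forall>t. \<forall>x\<in>Sa. f (of_real t \<odot> x) = t * f x) \<and>
     (\<forall>x\<in>Sa. f x \<le> p x) \<and> p h \<le> f h"
proof -
  obtain p' where p': "sublin p'" "\<And>y. y \<in> Sa \<Longrightarrow> p' y \<le> p y" "p' ((-1) \<odot> h) \<le> - p h"
    using sublin_push[OF p h] by blast
  obtain f where f: "sublin f" "\<And>x. x \<in> Sa \<Longrightarrow> f x \<le> p' x"
    and min: "\<And>q x. sublin q \<Longrightarrow> (\<And>x. x \<in> Sa \<Longrightarrow> q x \<le> f x) \<Longrightarrow> x \<in> Sa \<Longrightarrow> q x = f x"
    using ex_minimal_sublin[OF p'(1)] by metis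
  have neg: "f ((-1) \<odot> x) = - f x" if x: "x \<in> Sa" for x
  proof -
    obtain q where q: "sublin q" "\<And>y. y \<in> Sa \<Longrightarrow> q y \<le> f y" "q ((-1) \<odot> x) \<le> - f x"
      using sublin_push[OF f(1) x] by blast
    then have "f ((-1) \<odot> x) \<le> - f x" using min[OF q(1,2), of "(-1) \<odot> x"] x by simp
    then show ?thesis using sublin_neg[OF f(1) x] by simp
  qed
  have add: "f (x \<oplus> y) = f x + f y" if xy: "x \<in> Sa" "y \<in> Sa" for x y
  proof -
    have "x = (x \<oplus> y) \<oplus> (-1) \<odot> y" using xy add_sub_cancel(1)[of x y] unfolding cs_sub_def by simp
    then have "f x \<le> f (x \<oplus> y) + f ((-1) \<odot> y)"
      using sublinD(1)[OF f(1), of "x \<oplus> y" "(-1) \<odot> y"] xy by simp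
    then show ?thesis using neg[OF xy(2)] sublinD(1)[OF f(1) xy] by simp
  qed
  have scale: "f (of_real t \<odot> x) = t * f x" if x: "x \<in> Sa" for t x
  proof (cases "0 \<le> t")
    case False
    have "f (of_real t \<odot> x) = f ((-1) \<odot> of_real (- t) \<odot> x)" using x by simp
    also have "\<dots> = - f (of_real (- t) \<odot> x)" using x by (intro neg Sa_closed)
    also have "f (of_real (- t) \<odot> x) = - t * f x" using x False by (intro sublin_scale[OF f(1)]) simp_all
    finally show ?thesis by simp
  qed (use sublin_scale[OF f(1) x] in simp)
  have "p h \<le> f h" using p'(3) f(2)[of "(-1) \<odot> h"] neg[OF h] h by simp
  moreover have "f x \<le> p x" if "x \<in> Sa" for x using f(2)[OF that] p'(2)[OF that] by simp
  ultimately show ?thesis using add scale by blast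
qed

text \<open>The largest spectral value of h, expressed through the order.\<close>

definition lam :: "'a \<Rightarrow> real" where
  "lam h = Inf {t. cpos (of_real t \<odot> \<one> \<ominus> h)}"

definition is_state :: "('a \<Rightarrow> complex) \<Rightarrow> bool" where
  "is_state F \<longleftrightarrow> (\<forall>x\<in>C. \<forall>y\<in>C. F (x \<oplus> y) = F x + F y) \<and> (\<forall>c. \<forall>x\<in>C. F (c \<odot> x) = c * F x) \<and>
     (\<forall>x\<in>C. F (\<star> x) = cnj (F x)) \<and> (\<forall>x\<in>C. 0 \<le> Re (F (\<star> x \<otimes> x))) \<and> F \<one> = 1"

context
  assumes nontriv: "\<one> \<noteq> \<zero>"
begin

lemma nm_one: "\<parallel>\<one>\<parallel> = 1"
proof -
  have "\<parallel>\<one>\<parallel> * (\<parallel>\<one>\<parallel> - 1) = 0" using nm_cstar[of \<one>] by (simp add: power2_eq_square algebra_simps)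
  then show ?thesis using nontriv nm_eq_zero[of \<one>] by auto
qed

lemma cpos_constD: "cpos (of_real t \<odot> \<one>) \<Longrightarrow> 0 \<le> t"
proof -
  assume "cpos (of_real t \<odot> \<one>)"
  then obtain s where "\<parallel>of_real s \<odot> \<one> \<ominus> of_real t \<odot> \<one>\<parallel> \<le> s" unfolding cpos_def by blast
  also have "of_real s \<odot> \<one> \<ominus> of_real t \<odot> \<one> = of_real (s - t) \<odot> \<one>" by (simp add: sm_diff_left)
  finally have "\<bar>s - t\<bar> \<le> s" using nm_one by (simp del: of_real_diff)
  then show "0 \<le> t" by simp
qed

lemma lam_set:
  assumes h: "h \<in> Sa"
  shows "cpos (of_real \<parallel>h\<parallel> \<odot> \<one> \<ominus> h)" "cpos (of_real t \<odot> \<one> \<ominus> h) \<Longrightarrow> - \<parallel>h\<parallel> \<le> t"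
    "bdd_below {t. cpos (of_real t \<odot> \<one> \<ominus> h)}"
proof -
  show "cpos (of_real \<parallel>h\<parallel> \<odot> \<one> \<ominus> h)" using h by (intro cpos_one_minus) simp_all
  have *: "- \<parallel>h\<parallel> \<le> t" if "cpos (of_real t \<odot> \<one> \<ominus> h)" for t
  proof -
    have "cpos ((of_real t \<odot> \<one> \<ominus> h) \<oplus> (of_real \<parallel>h\<parallel> \<odot> \<one> \<oplus> h))"
      using h that by (intro cpos_add cpos_one_plus) simp_all
    also have "(of_real t \<odot> \<one> \<ominus> h) \<oplus> (of_real \<parallel>h\<parallel> \<odot> \<one> \<oplus> h) = of_real (t + \<parallel>h\<parallel>) \<odot> \<one>"
    proof -
      have "(of_real t \<odot> \<one> \<ominus> h) \<oplus> (of_real \<parallel>h\<parallel> \<odot> \<one> \<oplus> h) = (of_real t \<odot> \<one> \<ominus> h) \<oplus> h \<oplus> of_real \<parallel>h\<parallel> \<odot> \<one>"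
        using h by (simp add: add_ac del: add_sub_cancel)
      then show ?thesis using h by (simp add: sm_add_left)
    qed
    finally show ?thesis using cpos_constD by fastforce
  qed
  then show "cpos (of_real t \<odot> \<one> \<ominus> h) \<Longrightarrow> - \<parallel>h\<parallel> \<le> t" .
  show "bdd_below {t. cpos (of_real t \<odot> \<one> \<ominus> h)}" by (rule bdd_belowI[of _ "- \<parallel>h\<parallel>"]) (use * in simp)
qed

lemma lam_le: "h \<in> Sa \<Longrightarrow> cpos (of_real t \<odot> \<one> \<ominus> h) \<Longrightarrow> lam h \<le> t"
  unfolding lam_def by (intro cInf_lower lam_set(3)) simp_all

lemma lam_approx: "h \<in> Sa \<Longrightarrow> e > 0 \<Longrightarrow> \<exists>t. cpos (of_real t \<odot> \<one> \<ominus> h) \<and> t < lam h + e"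
proof -
  assume h: "h \<in> Sa" and e: "e > 0"
  then have "\<exists>t\<in>{t. cpos (of_real t \<odot> \<one> \<ominus> h)}. t < lam h + e"
    unfolding lam_def using lam_set(1)[OF h] by (intro cInf_lessD) auto
  then show ?thesis by auto
qed

lemma sublin_lam: "sublin lam"
  unfolding sublin_def
proof (intro conjI ballI allI impI)
  fix x y assume xy: "x \<in> Sa" "y \<in> Sa"
  show "lam (x \<oplus> y) \<le> lam x + lam y"
  proof (rule field_le_epsilon)
    fix e :: real assume "e > 0"
    then obtain s t where s: "cpos (of_real s \<odot> \<one> \<ominus> x)" "s < lam x + e / 2"
      and t: "cpos (of_real t \<odot> \<one> \<ominus> y)" "t < lam y + e / 2"
      using lam_approx[OF xy(1), of "e / 2"] lam_approx[OF xy(2), of "e / 2"] by auto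
    have "cpos ((of_real s \<odot> \<one> \<ominus> x) \<oplus> (of_real t \<odot> \<one> \<ominus> y))" using s t by (intro cpos_add)
    also have "(of_real s \<odot> \<one> \<ominus> x) \<oplus> (of_real t \<odot> \<one> \<ominus> y) = of_real (s + t) \<odot> \<one> \<ominus> (x \<oplus> y)"
      using xy by (simp add: sm_add_left add_sub_add)
    finally show "lam (x \<oplus> y) \<le> lam x + lam y + e"
      using lam_le[of "x \<oplus> y" "s + t"] xy s t by simp
  qed
next
  fix x and r :: real assume x: "x \<in> Sa" and r: "r > 0"
  have "lam (of_real r \<odot> x) / r \<le> lam x"
  proof (rule field_le_epsilon)
    fix e :: real assume "e > 0"
    then obtain t where t: "cpos (of_real t \<odot> \<one> \<ominus> x)" "t < lam x + e" using lam_approx x by blast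
    have "cpos (of_real r \<odot> (of_real t \<odot> \<one> \<ominus> x))" using t r by (intro cpos_sm) simp_all
    also have "of_real r \<odot> (of_real t \<odot> \<one> \<ominus> x) = of_real (r * t) \<odot> \<one> \<ominus> of_real r \<odot> x"
      using x by (simp add: sm_sub)
    finally have "lam (of_real r \<odot> x) \<le> r * t" using x by (intro lam_le) simp_all
    also have "\<dots> \<le> r * (lam x + e)" using t r by (intro mult_left_mono) simp_all
    finally show "lam (of_real r \<odot> x) / r \<le> lam x + e" using r by (simp add: divide_le_eq mult.commute)
  qed
  then show "lam (of_real r \<odot> x) \<le> r * lam x" using r by (simp add: divide_le_eq mult.commute)
next
  have z: "of_real t \<odot> \<one> \<ominus> \<zero> = of_real t \<odot> \<one>" for t by (simp add: cs_sub_def)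
  have "{t. cpos (of_real t \<odot> \<one> \<ominus> \<zero>)} = {0..}" unfolding z using cpos_constD by auto
  then show "lam \<zero> = 0" by (simp add: lam_def)
qed

text \<open>A linear f on self-adjoint elements with f <= \<open>lam\<close> is already a real
  state: \<open>lam\<close> is at most 0 at -x for positive x, and its values at 1 and -1 pin down
  f(1) = 1. Choosing f maximal at d^* d gives the norm condition, and f(re x) + i f(im x) extends it
  to all elements.\<close>

theorem ex_state:
  assumes d: "d \<in> C"
  shows "\<exists>F. is_state F \<and> \<parallel>d\<parallel>\<^sup>2 \<le> Re (F (\<star> d \<otimes> d))"
proof -
  let ?h = "\<star> d \<otimes> d"
  have h: "?h \<in> Sa" using d by (intro SaI) simp_all
  obtain f where f': "\<forall>x\<in>Sa. \<forall>y\<in>Sa. f (x \<oplus> y) = f x + f y"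
    "\<forall>t. \<forall>x\<in>Sa. f (of_real t \<odot> x) = t * f x" "\<forall>x\<in>Sa. f x \<le> lam x" "lam ?h \<le> f ?h"
    using ex_linear_below[OF sublin_lam h] by (elim exE conjE)
  then have f: "\<And>x y. x \<in> Sa \<Longrightarrow> y \<in> Sa \<Longrightarrow> f (x \<oplus> y) = f x + f y"
    "\<And>t x. x \<in> Sa \<Longrightarrow> f (of_real t \<odot> x) = t * f x" "\<And>x. x \<in> Sa \<Longrightarrow> f x \<le> lam x" "lam ?h \<le> f ?h"
    by (simp_all only:)
  have pos: "0 \<le> f x" if "cpos x" for x
  proof -
    have x: "x \<in> Sa" using that by (intro SaI cposD)
    have "lam ((-1) \<odot> x) \<le> 0" using x that by (intro lam_le) (simp_all add: cs_sub_def)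
    then show ?thesis using f(3)[of "(-1) \<odot> x"] f(2)[of x "-1"] x by simp
  qed
  have one: "f \<one> = 1"
  proof (rule antisym)
    have "lam \<one> \<le> 1" by (intro lam_le) simp_all
    then show "f \<one> \<le> 1" using f(3)[of \<one>] by simp
    have "of_real (-1) \<odot> \<one> \<ominus> (-1) \<odot> \<one> = \<zero>" by simp
    then have "lam ((-1) \<odot> \<one>) \<le> -1" by (intro lam_le) simp_all
    then show "1 \<le> f \<one>" using f(3)[of "(-1) \<odot> \<one>"] f(2)[of \<one> "-1"] by simp
  qed
  define re im where "re x = (1/2) \<odot> (x \<oplus> \<star> x)" and "im x = (- \<i> / 2) \<odot> (x \<ominus> \<star> x)" for x
  have re: "re x \<in> Sa" and im: "im x \<in> Sa" if "x \<in> C" for x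
    using that by (auto intro!: SaI simp: re_def im_def add_commute cs_sub_def sm_add_right)
  define F where "F x = Complex (f (re x)) (f (im x))" for x
  have re_Sa: "re x = x" and im_Sa: "im x = \<zero>" if "x \<in> Sa" for x
    using that sm_add_left[of x "1/2" "1/2"] by (simp_all add: re_def im_def sm_add_right)
  have f0: "f \<zero> = 0" using f(2)[of \<zero> 0] by simp
  have F_Sa: "F x = of_real (f x)" if "x \<in> Sa" for x
    using that re_Sa im_Sa f0 by (simp add: F_def complex_eq_iff)
  have F_add: "F (x \<oplus> y) = F x + F y" if xy: "x \<in> C" "y \<in> C" for x y
  proof -
    have "re (x \<oplus> y) = re x \<oplus> re y" "im (x \<oplus> y) = im x \<oplus> im y"
      using xy by (simp_all add: re_def im_def sm_add_right add_ac cs_sub_def)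
    then show ?thesis using f(1) re im xy by (simp add: F_def complex_eq_iff)
  qed
  have F_real: "F (of_real t \<odot> x) = of_real t * F x" if x: "x \<in> C" for t x
  proof -
    have "re (of_real t \<odot> x) = of_real t \<odot> re x" "im (of_real t \<odot> x) = of_real t \<odot> im x"
      using x by (simp_all add: re_def im_def sm_add_right cs_sub_def mult.commute)
    then show ?thesis using f(2) re im x by (simp add: F_def complex_eq_iff)
  qed
  have F_i: "F (\<i> \<odot> x) = \<i> * F x" if x: "x \<in> C" for x
  proof -
    have "re (\<i> \<odot> x) = of_real (-1) \<odot> im x" "im (\<i> \<odot> x) = re x"
      using x by (simp_all add: re_def im_def sm_add_right cs_sub_def)
    then show ?thesis using f(2)[of "im x" "-1"] re im x by (simp add: F_def complex_eq_iff)
  qed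
  have F_sm: "F (c \<odot> x) = c * F x" if x: "x \<in> C" for c x
  proof -
    have "c \<odot> x = of_real (Re c) \<odot> x \<oplus> of_real (Im c) \<odot> \<i> \<odot> x"
      using x sm_add_left[of x "of_real (Re c)" "of_real (Im c) * \<i>"] complex_eq[of c]
      by (simp add: mult.commute)
    then have "F (c \<odot> x) = F (of_real (Re c) \<odot> x) + F (of_real (Im c) \<odot> \<i> \<odot> x)"
      using x F_add by (simp del: sm_sm)
    also have "\<dots> = of_real (Re c) * F x + of_real (Im c) * (\<i> * F x)"
      using x F_real[of x] F_real[of "\<i> \<odot> x"] F_i by (simp del: sm_sm)
    also have "\<dots> = (of_real (Re c) + \<i> * of_real (Im c)) * F x" by (simp add: algebra_simps)
    finally show ?thesis by (simp flip: complex_eq)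
  qed
  have F_star: "F (\<star> x) = cnj (F x)" if x: "x \<in> C" for x
  proof -
    have "re (\<star> x) = re x" "im (\<star> x) = of_real (-1) \<odot> im x"
      using x by (simp_all add: re_def im_def sm_add_right cs_sub_def add_commute)
    then show ?thesis using f(2)[of "im x" "-1"] im x by (simp add: F_def complex_eq_iff)
  qed
  have F_pos: "0 \<le> Re (F (\<star> x \<otimes> x))" if x: "x \<in> C" for x
  proof -
    have "\<star> x \<otimes> x \<in> Sa" using x by (intro SaI) simp_all
    then show ?thesis using F_Sa pos[OF cpos_star_mult[OF x]] by simp
  qed
  have st: "is_state F"
    unfolding is_state_def using F_add F_sm F_star F_pos one F_Sa[of \<one>] by simp
  have "\<parallel>d\<parallel>\<^sup>2 \<le> lam ?h"
    unfolding lam_def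
  proof (rule cInf_greatest)
    show "{t. cpos (of_real t \<odot> \<one> \<ominus> ?h)} \<noteq> {}" using lam_set(1)[OF h] by blast
    fix t assume "t \<in> {t. cpos (of_real t \<odot> \<one> \<ominus> ?h)}"
    then have t: "cpos (of_real t \<odot> \<one> \<ominus> ?h)" by simp
    \<comment> \<open>Every t above d^* d is nonnegative and bounds the norm of d^* d, so the
      infimum \<open>lam\<close> of these t is at least that norm.\<close>
    have "cpos ((of_real t \<odot> \<one> \<ominus> ?h) \<oplus> ?h)" using t d by (intro cpos_add cpos_star_mult)
    then have "0 \<le> t" using d by (intro cpos_constD) simp
    then have "\<parallel>?h\<parallel> \<le> t" using t d by (intro cpos_bound cpos_add cpos_const cpos_star_mult) simp_all
    then show "\<parallel>d\<parallel>\<^sup>2 \<le> t" using d by (simp add: nm_cstar)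
  qed
  then have "\<parallel>d\<parallel>\<^sup>2 \<le> Re (F ?h)" using f(4) F_Sa[OF h] by simp
  then show ?thesis using st by blast
qed

end

end

subsection \<open>Matrices\<close>

text \<open>Vectors are functions on all natural numbers of which only the entries below m count;
  identities of vectors are therefore shown for indices below m and used through
  \<open>vecnorm_cong\<close> and \<open>cip_cong\<close>.\<close>

definition mv :: "nat \<Rightarrow> (nat \<Rightarrow> nat \<Rightarrow> complex) \<Rightarrow> (nat \<Rightarrow> complex) \<Rightarrow> nat \<Rightarrow> complex" where
  "mv m M v = (\<lambda>i. \<Sum>j<m. M i j * v j)"

definition mm :: "nat \<Rightarrow> (nat \<Rightarrow> nat \<Rightarrow> complex) \<Rightarrow> (nat \<Rightarrow> nat \<Rightarrow> complex) \<Rightarrow> nat \<Rightarrow> nat \<Rightarrow> complex" where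
  "mm m M N = (\<lambda>i j. \<Sum>l<m. M i l * N l j)"

definition adj :: "(nat \<Rightarrow> nat \<Rightarrow> complex) \<Rightarrow> nat \<Rightarrow> nat \<Rightarrow> complex" where
  "adj M = (\<lambda>i j. cnj (M j i))"

definition mid :: "nat \<Rightarrow> nat \<Rightarrow> nat \<Rightarrow> complex" where
  "mid m = (\<lambda>i j. if i = j \<and> i < m then 1 else 0)"

definition cip :: "nat \<Rightarrow> (nat \<Rightarrow> complex) \<Rightarrow> (nat \<Rightarrow> complex) \<Rightarrow> complex" where
  "cip m v w = (\<Sum>i<m. v i * cnj (w i))"

lemma vecnorm_L2: "vecnorm m v = L2_set (\<lambda>i. cmod (v i)) {..<m}"
  by (simp add: vecnorm_def L2_set_def)

lemma vecnorm_nonneg [simp]: "0 \<le> vecnorm m v"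
  by (simp add: vecnorm_L2)

lemma vecnorm_triangle: "vecnorm m (\<lambda>i. v i + w i) \<le> vecnorm m v + vecnorm m w"
proof -
  have "vecnorm m (\<lambda>i. v i + w i) \<le> L2_set (\<lambda>i. cmod (v i) + cmod (w i)) {..<m}"
    unfolding vecnorm_L2 by (intro L2_set_mono norm_triangle_ineq) simp
  then show ?thesis
    using L2_set_triangle_ineq[of "\<lambda>i. cmod (v i)" "\<lambda>i. cmod (w i)" "{..<m}"]
    by (simp only: vecnorm_L2)
qed

lemma vecnorm_scale [simp]: "vecnorm m (\<lambda>i. c * v i) = cmod c * vecnorm m v"
  unfolding vecnorm_L2 by (simp add: norm_mult L2_set_right_distrib)

lemma vecnorm_cong: "(\<And>i. i < m \<Longrightarrow> v i = w i) \<Longrightarrow> vecnorm m v = vecnorm m w"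
  by (simp add: vecnorm_def)

lemma vecnorm_zero [simp]: "vecnorm m (\<lambda>i. 0) = 0"
  by (simp add: vecnorm_def)

lemma vecnorm_diff: "vecnorm m (\<lambda>i. v i - w i) \<le> vecnorm m v + vecnorm m w"
  using vecnorm_triangle[of m v "\<lambda>i. (-1) * w i"] by (simp only: vecnorm_scale) simp

lemma vecnorm_diff_commute: "vecnorm m (\<lambda>i. v i - w i) = vecnorm m (\<lambda>i. w i - v i)"
  by (simp add: vecnorm_def norm_minus_commute)

lemma vecnorm_diff3: "vecnorm m (\<lambda>i. u i - w i) \<le> vecnorm m (\<lambda>i. u i - v i) + vecnorm m (\<lambda>i. v i - w i)"
  using vecnorm_triangle[of m "\<lambda>i. u i - v i" "\<lambda>i. v i - w i"] by simp

lemma vecnorm_sq: "(vecnorm m v)\<^sup>2 = (\<Sum>i<m. (cmod (v i))\<^sup>2)"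
  by (simp add: vecnorm_def sum_nonneg)

lemma cip_self: "cip m v v = of_real ((vecnorm m v)\<^sup>2)"
  unfolding cip_def vecnorm_sq by (simp add: complex_norm_square[symmetric] del: of_real_power)

lemma cip_cauchy: "cmod (cip m v w) \<le> vecnorm m v * vecnorm m w"
proof -
  have "cmod (cip m v w) \<le> (\<Sum>i<m. \<bar>cmod (v i)\<bar> * \<bar>cmod (w i)\<bar>)"
    unfolding cip_def by (rule order_trans[OF norm_sum]) (simp add: norm_mult)
  also have "\<dots> \<le> vecnorm m v * vecnorm m w" unfolding vecnorm_L2 by (rule L2_set_mult_ineq)
  finally show ?thesis .
qed

lemma cip_commute: "cip m w v = cnj (cip m v w)"
  by (simp add: cip_def mult.commute)

lemma cip_add_left: "cip m (\<lambda>i. u i + v i) w = cip m u w + cip m v w"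
  and cip_add_right: "cip m w (\<lambda>i. u i + v i) = cip m w u + cip m w v"
  and cip_diff_left: "cip m (\<lambda>i. u i - v i) w = cip m u w - cip m v w"
  and cip_diff_right: "cip m w (\<lambda>i. u i - v i) = cip m w u - cip m w v"
  and cip_scale_left: "cip m (\<lambda>i. c * v i) w = c * cip m v w"
  and cip_scale_right: "cip m w (\<lambda>i. c * v i) = cnj c * cip m w v"
  by (simp_all add: cip_def algebra_simps sum.distrib sum_subtractf sum_distrib_left)

lemma cip_cong: "(\<And>i. i < m \<Longrightarrow> v i = v' i) \<Longrightarrow> (\<And>i. i < m \<Longrightarrow> w i = w' i) \<Longrightarrow> cip m v w = cip m v' w'"
  by (simp add: cip_def)

lemma cip_adj: "cip m (mv m M v) w = cip m v (mv m (adj M) w)"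
proof -
  have "cip m (mv m M v) w = (\<Sum>i<m. \<Sum>j<m. M i j * v j * cnj (w i))"
    by (simp add: cip_def mv_def sum_distrib_right)
  also have "\<dots> = (\<Sum>j<m. \<Sum>i<m. M i j * v j * cnj (w i))" by (rule sum.swap)
  also have "\<dots> = cip m v (mv m (adj M) w)"
    by (simp add: cip_def mv_def adj_def sum_distrib_left mult_ac)
  finally show ?thesis .
qed

lemma adj_adj [simp]: "adj (adj M) = M"
  by (simp add: adj_def)

lemma mv_mm: "mv m (mm m M N) v = mv m M (mv m N v)"
proof (rule ext)
  fix i
  have "mv m (mm m M N) v i = (\<Sum>j<m. \<Sum>l<m. M i l * N l j * v j)"
    by (simp add: mv_def mm_def sum_distrib_right)
  also have "\<dots> = (\<Sum>l<m. \<Sum>j<m. M i l * N l j * v j)" by (rule sum.swap)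
  also have "\<dots> = mv m M (mv m N v) i" by (simp add: mv_def sum_distrib_left mult.assoc)
  finally show "mv m (mm m M N) v i = mv m M (mv m N v) i" .
qed

lemma mm_assoc: "mm m (mm m L M) N = mm m L (mm m M N)"
proof (intro ext)
  fix i j
  have "mm m (mm m L M) N i j = (\<Sum>l<m. \<Sum>k<m. L i k * M k l * N l j)"
    by (simp add: mm_def sum_distrib_right)
  also have "\<dots> = (\<Sum>k<m. \<Sum>l<m. L i k * M k l * N l j)" by (rule sum.swap)
  also have "\<dots> = mm m L (mm m M N) i j" by (simp add: mm_def sum_distrib_left mult.assoc)
  finally show "mm m (mm m L M) N i j = mm m L (mm m M N) i j" .
qed

lemma adj_mm: "adj (mm m M N) = mm m (adj N) (adj M)"
  by (intro ext) (simp add: adj_def mm_def mult.commute)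

lemma mv_diff: "mv m M (\<lambda>i. v i - w i) = (\<lambda>i. mv m M v i - mv m M w i)"
  and mv_scale: "mv m M (\<lambda>i. c * v i) = (\<lambda>i. c * mv m M v i)"
  and mv_add_left: "mv m (\<lambda>i j. M i j + N i j) v = (\<lambda>i. mv m M v i + mv m N v i)"
  and mv_diff_left: "mv m (\<lambda>i j. M i j - N i j) v = (\<lambda>i. mv m M v i - mv m N v i)"
  and mv_scale_left: "mv m (\<lambda>i j. c * M i j) v = (\<lambda>i. c * mv m M v i)"
  by (simp_all add: mv_def fun_eq_iff algebra_simps sum.distrib sum_subtractf sum_distrib_left)

lemma mv_mid: "i < m \<Longrightarrow> mv m (mid m) v i = v i"
proof -
  assume i: "i < m"
  have "mv m (mid m) v i = (\<Sum>j<m. if j = i then v i else 0)"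
    unfolding mv_def mid_def using i by (intro sum.cong) auto
  then show ?thesis using i by simp
qed

lemma opnorm_alt: "opnorm m M = Sup ((\<lambda>v. vecnorm m (mv m M v)) ` {v. vecnorm m v \<le> 1})"
  by (simp add: opnorm_def mv_def)

lemma vecnorm_comp_le: "i < m \<Longrightarrow> cmod (v i) \<le> vecnorm m v"
  unfolding vecnorm_L2 by (rule member_le_L2_set) auto

lemma vecnorm_mv_crude: "vecnorm m (mv m M v) \<le> (\<Sum>i<m. \<Sum>j<m. cmod (M i j)) * vecnorm m v"
proof -
  have "vecnorm m (mv m M v) \<le> (\<Sum>i<m. cmod (mv m M v i))"
    unfolding vecnorm_L2 by (rule L2_set_le_sum) simp
  also have "\<dots> \<le> (\<Sum>i<m. \<Sum>j<m. cmod (M i j) * vecnorm m v)"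
  proof (rule sum_mono)
    fix i
    show "cmod (mv m M v i) \<le> (\<Sum>j<m. cmod (M i j) * vecnorm m v)"
      unfolding mv_def by (rule order_trans[OF norm_sum])
        (auto simp: norm_mult intro!: sum_mono mult_left_mono vecnorm_comp_le)
  qed
  finally show ?thesis by (simp add: sum_distrib_right)
qed

lemma opnorm_bdd: "bdd_above ((\<lambda>v. vecnorm m (mv m M v)) ` {v. vecnorm m v \<le> 1})"
proof (rule bdd_aboveI2)
  fix v assume "v \<in> {v. vecnorm m v \<le> 1}"
  then have "vecnorm m v \<le> 1" by simp
  then have "(\<Sum>i<m. \<Sum>j<m. cmod (M i j)) * vecnorm m v \<le> (\<Sum>i<m. \<Sum>j<m. cmod (M i j)) * 1"
    by (intro mult_left_mono sum_nonneg) simp_all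
  then show "vecnorm m (mv m M v) \<le> (\<Sum>i<m. \<Sum>j<m. cmod (M i j))"
    using vecnorm_mv_crude[of m M v] by linarith
qed

lemma opnorm_nonneg [simp]: "0 \<le> opnorm m M"
proof -
  have "vecnorm m (mv m M (\<lambda>i. 0)) \<le> opnorm m M"
    unfolding opnorm_alt by (intro cSup_upper opnorm_bdd) simp
  then show ?thesis using vecnorm_nonneg order_trans by blast
qed

lemma opnorm_bound: "vecnorm m (mv m M v) \<le> opnorm m M * vecnorm m v"
proof (cases "vecnorm m v = 0")
  case True
  then show ?thesis using vecnorm_mv_crude[of m M v] by simp
next
  case False
  then have pos: "vecnorm m v > 0" using vecnorm_nonneg[of m v] by linarith
  define c where "c = complex_of_real (1 / vecnorm m v)"
  have c: "cmod c = 1 / vecnorm m v" using pos by (simp add: c_def norm_divide)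
  have "vecnorm m (mv m M (\<lambda>i. c * v i)) \<le> opnorm m M"
    unfolding opnorm_alt using pos c by (intro cSup_upper opnorm_bdd) (auto intro!: imageI)
  then have "1 / vecnorm m v * vecnorm m (mv m M v) \<le> opnorm m M"
    by (simp add: mv_scale c)
  then show ?thesis using pos by (simp add: field_simps)
qed

lemma opnorm_le:
  assumes "0 \<le> c" and "\<And>v. vecnorm m (mv m M v) \<le> c * vecnorm m v"
  shows "opnorm m M \<le> c"
  unfolding opnorm_alt
proof (rule cSup_least)
  have "vecnorm m (\<lambda>i. 0) \<le> 1" by simp
  then show "(\<lambda>v. vecnorm m (mv m M v)) ` {v. vecnorm m v \<le> 1} \<noteq> {}" by blast
  fix x assume "x \<in> (\<lambda>v. vecnorm m (mv m M v)) ` {v. vecnorm m v \<le> 1}"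
  then obtain v where v: "vecnorm m v \<le> 1" "x = vecnorm m (mv m M v)" by blast
  have "x \<le> c * vecnorm m v" using v assms by simp
  also have "\<dots> \<le> c" using v assms(1) by (simp add: mult_left_le)
  finally show "x \<le> c" .
qed

lemma opnorm_triangle: "opnorm m (\<lambda>i j. M i j + N i j) \<le> opnorm m M + opnorm m N"
proof (rule opnorm_le)
  fix v
  show "vecnorm m (mv m (\<lambda>i j. M i j + N i j) v) \<le> (opnorm m M + opnorm m N) * vecnorm m v"
    using vecnorm_triangle[of m "mv m M v" "mv m N v"] opnorm_bound[of m M v] opnorm_bound[of m N v]
    by (simp add: mv_add_left distrib_right)
qed simp

lemma opnorm_scale_le: "opnorm m (\<lambda>i j. c * M i j) \<le> cmod c * opnorm m M"
proof (rule opnorm_le)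
  fix v
  show "vecnorm m (mv m (\<lambda>i j. c * M i j) v) \<le> cmod c * opnorm m M * vecnorm m v"
    using mult_left_mono[OF opnorm_bound[of m M v], of "cmod c"] by (simp add: mv_scale_left mult.assoc)
qed simp

lemma opnorm_zero [simp]: "opnorm m (\<lambda>i j. 0) = 0"
  using opnorm_scale_le[of m 0 "\<lambda>i j. 0"] opnorm_nonneg[of m "\<lambda>i j. 0"] by simp

lemma opnorm_scale: "opnorm m (\<lambda>i j. c * M i j) = cmod c * opnorm m M"
proof (cases "c = 0")
  case False
  have "opnorm m (\<lambda>i j. inverse c * (c * M i j)) \<le> cmod (inverse c) * opnorm m (\<lambda>i j. c * M i j)"
    by (rule opnorm_scale_le)
  also have "(\<lambda>i j. inverse c * (c * M i j)) = M" using False by (simp add: mult.assoc[symmetric])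
  finally have "cmod c * opnorm m M \<le> opnorm m (\<lambda>i j. c * M i j)"
    using False by (simp add: norm_inverse norm_divide field_simps)
  then show ?thesis using opnorm_scale_le[of m c M] by simp
qed simp

lemma opnorm_diff_commute: "opnorm m (\<lambda>i j. M i j - N i j) = opnorm m (\<lambda>i j. N i j - M i j)"
  using opnorm_scale[of m "-1" "\<lambda>i j. M i j - N i j"] by simp

lemma opnorm_diff3:
  "opnorm m (\<lambda>i j. L i j - N i j) \<le> opnorm m (\<lambda>i j. L i j - M i j) + opnorm m (\<lambda>i j. M i j - N i j)"
  using opnorm_triangle[of m "\<lambda>i j. L i j - M i j" "\<lambda>i j. M i j - N i j"] by simp

lemma opnorm_mm: "opnorm m (mm m M N) \<le> opnorm m M * opnorm m N"
proof (rule opnorm_le)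
  fix v
  have "vecnorm m (mv m M (mv m N v)) \<le> opnorm m M * (opnorm m N * vecnorm m v)"
    using opnorm_bound[of m M "mv m N v"] mult_left_mono[OF opnorm_bound[of m N v], of "opnorm m M"]
    by simp
  then show "vecnorm m (mv m (mm m M N) v) \<le> opnorm m M * opnorm m N * vecnorm m v"
    by (simp add: mv_mm mult.assoc)
qed simp

lemma opnorm_mid: "opnorm m (mid m) \<le> 1"
proof (rule opnorm_le)
  fix v
  have "vecnorm m (mv m (mid m) v) = vecnorm m v" by (intro vecnorm_cong mv_mid)
  then show "vecnorm m (mv m (mid m) v) \<le> 1 * vecnorm m v" by simp
qed simp

lemma opnorm_adj_le: "opnorm m (adj M) \<le> opnorm m M"
proof (rule opnorm_le)
  fix w
  let ?u = "mv m (adj M) w"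
  have "(vecnorm m ?u)\<^sup>2 = cmod (cip m ?u ?u)" by (simp add: cip_self norm_power)
  also have "cip m ?u ?u = cip m w (mv m M ?u)" using cip_adj[of m "adj M" w ?u] by simp
  also have "cmod \<dots> \<le> vecnorm m w * vecnorm m (mv m M ?u)" by (rule cip_cauchy)
  also have "\<dots> \<le> vecnorm m w * (opnorm m M * vecnorm m ?u)"
    by (intro mult_left_mono opnorm_bound) simp
  finally have *: "vecnorm m ?u * vecnorm m ?u \<le> (opnorm m M * vecnorm m w) * vecnorm m ?u"
    by (simp add: power2_eq_square algebra_simps)
  show "vecnorm m ?u \<le> opnorm m M * vecnorm m w"
  proof (cases "vecnorm m ?u = 0")
    case False
    then have "vecnorm m ?u > 0" using vecnorm_nonneg[of m ?u] by linarith
    then show ?thesis using * by (simp only: mult_le_cancel_right_pos)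
  qed simp
qed simp

lemma opnorm_adj [simp]: "opnorm m (adj M) = opnorm m M"
  using opnorm_adj_le[of m M] opnorm_adj_le[of m "adj M"] by simp

lemma opnorm_cstar: "opnorm m (mm m (adj M) M) = (opnorm m M)\<^sup>2"
proof (rule antisym)
  show "opnorm m (mm m (adj M) M) \<le> (opnorm m M)\<^sup>2"
    using opnorm_mm[of m "adj M" M] by (simp add: power2_eq_square)
  have "opnorm m M \<le> sqrt (opnorm m (mm m (adj M) M))"
  proof (rule opnorm_le)
    fix v
    have "(vecnorm m (mv m M v))\<^sup>2 = cmod (cip m (mv m M v) (mv m M v))" by (simp add: cip_self norm_power)
    also have "cip m (mv m M v) (mv m M v) = cip m v (mv m (mm m (adj M) M) v)"
      by (simp add: cip_adj mv_mm)
    also have "cmod \<dots> \<le> vecnorm m v * vecnorm m (mv m (mm m (adj M) M) v)" by (rule cip_cauchy)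
    also have "\<dots> \<le> vecnorm m v * (opnorm m (mm m (adj M) M) * vecnorm m v)"
      by (intro mult_left_mono opnorm_bound) simp
    also have "\<dots> = (sqrt (opnorm m (mm m (adj M) M)) * vecnorm m v)\<^sup>2"
      by (simp add: power_mult_distrib) (simp add: power2_eq_square)
    finally show "vecnorm m (mv m M v) \<le> sqrt (opnorm m (mm m (adj M) M)) * vecnorm m v"
      by (rule power2_le_imp_le) simp
  qed simp
  then have "(opnorm m M)\<^sup>2 \<le> (sqrt (opnorm m (mm m (adj M) M)))\<^sup>2" by (intro power_mono) simp_all
  then show "(opnorm m M)\<^sup>2 \<le> opnorm m (mm m (adj M) M)" by simp
qed

lemma opnorm_entry:
  assumes "i < m" "j < m"
  shows "cmod (M i j) \<le> opnorm m M"
proof -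
  let ?e = "\<lambda>l. if l = j then 1 else 0 :: complex"
  have "mv m M ?e i = (\<Sum>l<m. if l = j then M i j else 0)"
    unfolding mv_def by (intro sum.cong) simp_all
  then have "M i j = mv m M ?e i" using assms by simp
  also have "cmod \<dots> \<le> vecnorm m (mv m M ?e)" using assms(1) by (rule vecnorm_comp_le)
  also have "\<dots> \<le> opnorm m M * vecnorm m ?e" by (rule opnorm_bound)
  also have "vecnorm m ?e = 1"
  proof -
    have "(\<Sum>i<m. (cmod (?e i))\<^sup>2) = (\<Sum>i<m. if i = j then 1 else 0)" by (intro sum.cong) simp_all
    then show ?thesis using assms(2) by (simp add: vecnorm_def)
  qed
  finally show ?thesis by simp
qed

subsection \<open>The quotient of bounded sequences by null sequences\<close>

definition lsup :: "(nat \<Rightarrow> real) \<Rightarrow> real" where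
  "lsup a = real_of_ereal (limsup (\<lambda>k. ereal (a k)))"

text \<open>Boundedness makes the limsup finite, so its conversion to a real number loses nothing.
  The estimates for the quotient norm work with this description by eventual bounds.\<close>

lemma lsup_le_iff:
  assumes a: "\<And>k. 0 \<le> a k" "\<And>k. a k \<le> B"
  shows "lsup a \<le> c \<longleftrightarrow> (\<forall>e>0. \<forall>\<^sub>F k in sequentially. a k < c + e)"
proof -
  let ?L = "limsup (\<lambda>k. ereal (a k))"
  have "?L \<le> ereal B" using a by (intro Limsup_bounded) (simp add: eventually_sequentially)
  moreover have "0 \<le> ?L"
  proof -
    have "0 = limsup (\<lambda>k::nat. (0::ereal))" by (simp add: Limsup_const)
    also have "\<dots> \<le> ?L" using a by (intro Limsup_mono always_eventually) simp
    finally show ?thesis .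
  qed
  ultimately have L: "?L = ereal (lsup a)" unfolding lsup_def by (cases ?L) auto
  have "lsup a \<le> c \<longleftrightarrow> ?L \<le> ereal c" by (simp add: L)
  also have "\<dots> \<longleftrightarrow> (\<forall>y>ereal c. \<forall>\<^sub>F k in sequentially. ereal (a k) < y)" by (rule Limsup_le_iff)
  also have "\<dots> \<longleftrightarrow> (\<forall>e>0. \<forall>\<^sub>F k in sequentially. a k < c + e)"
  proof (intro iffI allI impI)
    fix e :: real assume *: "\<forall>y>ereal c. \<forall>\<^sub>F k in sequentially. ereal (a k) < y" and "e > 0"
    then have "ereal c < ereal (c + e)" by simp
    with * have "\<forall>\<^sub>F k in sequentially. ereal (a k) < ereal (c + e)" by blast
    then show "\<forall>\<^sub>F k in sequentially. a k < c + e" by simp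
  next
    fix y assume *: "\<forall>e>0. \<forall>\<^sub>F k in sequentially. a k < c + e" and y: "y > ereal c"
    show "\<forall>\<^sub>F k in sequentially. ereal (a k) < y"
    proof (cases y)
      case (real r)
      then show ?thesis using * y by (auto dest: spec[of _ "r - c"])
    qed (use y in auto)
  qed
  finally show ?thesis .
qed

lemma lsup_nonneg:
  assumes a: "\<And>k. 0 \<le> a k" "\<And>k. a k \<le> B"
  shows "0 \<le> lsup a"
proof (rule ccontr)
  assume "\<not> 0 \<le> lsup a"
  then have "\<forall>\<^sub>F k in sequentially. a k < lsup a + (- lsup a)"
    using lsup_le_iff[where a = a and c = "lsup a", OF a] by (auto dest: spec[of _ "- lsup a"])
  then have "\<forall>\<^sub>F k in sequentially. False" using a(1) by (auto elim!: eventually_mono simp: not_less[symmetric])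
  then show False by simp
qed

lemma lsup_eq_0_iff:
  assumes a: "\<And>k. 0 \<le> a k" "\<And>k. a k \<le> B"
  shows "lsup a = 0 \<longleftrightarrow> a \<longlonglongrightarrow> 0"
proof -
  have "lsup a = 0 \<longleftrightarrow> lsup a \<le> 0" using lsup_nonneg[where a = a, OF a] by auto
  also have "\<dots> \<longleftrightarrow> a \<longlonglongrightarrow> 0"
    unfolding lsup_le_iff[where a = a, OF a] tendsto_iff using a(1) by simp
  finally show ?thesis .
qed

type_synonym matseq = "nat \<Rightarrow> nat \<Rightarrow> nat \<Rightarrow> complex"

definition sadd :: "matseq \<Rightarrow> matseq \<Rightarrow> matseq" where
  "sadd x y = (\<lambda>k i j. x k i j + y k i j)"

definition ssub :: "matseq \<Rightarrow> matseq \<Rightarrow> matseq" where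
  "ssub x y = (\<lambda>k i j. x k i j - y k i j)"

definition ssm :: "complex \<Rightarrow> matseq \<Rightarrow> matseq" where
  "ssm c x = (\<lambda>k i j. c * x k i j)"

definition smul :: "(nat \<Rightarrow> nat) \<Rightarrow> matseq \<Rightarrow> matseq \<Rightarrow> matseq" where
  "smul n x y = (\<lambda>k. mm (n k) (x k) (y k))"

definition sstar :: "matseq \<Rightarrow> matseq" where
  "sstar x = (\<lambda>k. adj (x k))"

definition sone :: "(nat \<Rightarrow> nat) \<Rightarrow> matseq" where
  "sone n = (\<lambda>k. mid (n k))"

definition sn :: "(nat \<Rightarrow> nat) \<Rightarrow> matseq \<Rightarrow> real" where
  "sn n x = lsup (\<lambda>k. opnorm (n k) (x k))"

definition sim :: "(nat \<Rightarrow> nat) \<Rightarrow> matseq \<Rightarrow> matseq \<Rightarrow> bool" where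
  "sim n x y \<longleftrightarrow> (\<lambda>k. opnorm (n k) (ssub x y k)) \<longlonglongrightarrow> 0"

lemma prodM_bound: "x \<in> prodM n \<Longrightarrow> \<exists>B. \<forall>k. opnorm (n k) (x k) \<le> B"
  by (simp add: prodM_def)

lemma prodM_outside: "x \<in> prodM n \<Longrightarrow> n k \<le> i \<or> n k \<le> j \<Longrightarrow> x k i j = 0"
  unfolding prodM_def by blast

lemma prodMI:
  "(\<And>k i j. n k \<le> i \<or> n k \<le> j \<Longrightarrow> x k i j = 0) \<Longrightarrow> (\<And>k. opnorm (n k) (x k) \<le> B) \<Longrightarrow> x \<in> prodM n"
  unfolding prodM_def by blast

lemma prodM_sadd [simp, intro]:
  assumes "x \<in> prodM n" "y \<in> prodM n"
  shows "sadd x y \<in> prodM n"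
proof -
  obtain B B' where B: "\<And>k. opnorm (n k) (x k) \<le> B" "\<And>k. opnorm (n k) (y k) \<le> B'"
    using assms prodM_bound by metis
  show ?thesis
  proof (rule prodMI)
    show "opnorm (n k) (sadd x y k) \<le> B + B'" for k
      using opnorm_triangle[of "n k" "x k" "y k"] B[of k] unfolding sadd_def by linarith
  qed (use assms in \<open>auto simp: sadd_def prodM_outside\<close>)
qed

lemma prodM_ssm [simp, intro]:
  assumes "x \<in> prodM n"
  shows "ssm c x \<in> prodM n"
proof -
  obtain B where B: "\<And>k. opnorm (n k) (x k) \<le> B" using assms prodM_bound by metis
  show ?thesis
  proof (rule prodMI)
    show "opnorm (n k) (ssm c x k) \<le> cmod c * B" for k
      unfolding ssm_def opnorm_scale using B by (intro mult_left_mono) simp_all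
  qed (use assms in \<open>auto simp: ssm_def prodM_outside\<close>)
qed

lemma ssub_alt: "ssub x y = sadd x (ssm (-1) y)"
  by (simp add: ssub_def sadd_def ssm_def)

lemma prodM_ssub [simp, intro]: "x \<in> prodM n \<Longrightarrow> y \<in> prodM n \<Longrightarrow> ssub x y \<in> prodM n"
  by (simp add: ssub_alt)

lemma prodM_smul [simp, intro]:
  assumes "x \<in> prodM n" "y \<in> prodM n"
  shows "smul n x y \<in> prodM n"
proof -
  obtain B B' where B: "\<And>k. opnorm (n k) (x k) \<le> B" "\<And>k. opnorm (n k) (y k) \<le> B'"
    using assms prodM_bound by metis
  show ?thesis
  proof (rule prodMI)
    show "opnorm (n k) (smul n x y k) \<le> B * B'" for k
    proof -
      have "opnorm (n k) (smul n x y k) \<le> opnorm (n k) (x k) * opnorm (n k) (y k)"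
        unfolding smul_def by (rule opnorm_mm)
      also have "\<dots> \<le> B * B'" using B opnorm_nonneg order_trans by (intro mult_mono) blast+
      finally show ?thesis .
    qed
  qed (use assms in \<open>auto simp: smul_def mm_def prodM_outside\<close>)
qed

lemma prodM_sstar [simp, intro]:
  assumes "x \<in> prodM n"
  shows "sstar x \<in> prodM n"
proof -
  obtain B where B: "\<And>k. opnorm (n k) (x k) \<le> B" using assms prodM_bound by metis
  show ?thesis
  proof (rule prodMI)
    show "opnorm (n k) (sstar x k) \<le> B" for k unfolding sstar_def using B by simp
  qed (use assms in \<open>auto simp: sstar_def adj_def prodM_outside\<close>)
qed

lemma prodM_sone [simp, intro]: "sone n \<in> prodM n"
  by (rule prodMI[of _ _ 1]) (auto simp: sone_def opnorm_mid, auto simp: mid_def)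

lemma prodM_zero [simp, intro]: "(\<lambda>k i j. 0) \<in> prodM n"
  by (rule prodMI[of _ _ 0]) auto

lemma sim_refl [simp]: "sim n x x"
  by (simp add: sim_def ssub_def)

lemma sim_sym: "sim n x y \<Longrightarrow> sim n y x"
  unfolding sim_def ssub_def by (subst opnorm_diff_commute)

lemma sim_from_bound:
  assumes "g \<longlonglongrightarrow> 0" and "\<And>k. opnorm (n k) (ssub x y k) \<le> g k"
  shows "sim n x y"
  unfolding sim_def
  by (rule Lim_null_comparison[OF _ assms(1)]) (use assms(2) in simp)

lemma sim_trans:
  assumes "sim n x y" "sim n y z"
  shows "sim n x z"
proof (rule sim_from_bound)
  show "(\<lambda>k. opnorm (n k) (ssub x y k) + opnorm (n k) (ssub y z k)) \<longlonglongrightarrow> 0"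
    using tendsto_add[OF assms[unfolded sim_def]] by simp
  show "opnorm (n k) (ssub x z k) \<le> opnorm (n k) (ssub x y k) + opnorm (n k) (ssub y z k)" for k
    unfolding ssub_def by (rule opnorm_diff3)
qed

lemma mq_class_alt: "mq_class n x = {y \<in> prodM n. sim n x y}"
  by (simp add: mq_class_def sim_def ssub_def)

lemma mq_class_eq_iff:
  assumes "x \<in> prodM n" "y \<in> prodM n"
  shows "mq_class n x = mq_class n y \<longleftrightarrow> sim n x y"
proof
  assume "mq_class n x = mq_class n y"
  then have "y \<in> mq_class n x" using assms by (simp add: mq_class_alt)
  then show "sim n x y" by (simp add: mq_class_alt)
next
  assume "sim n x y"
  then show "mq_class n x = mq_class n y"
    unfolding mq_class_alt using sim_trans sim_sym by blast
qed

text \<open>The operations of \<open>MQ\<close> pick representatives by choice. Every pick is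
  equivalent to x, so the operations can be computed on arbitrary representatives.\<close>

lemma mq_rep:
  assumes "x \<in> prodM n"
  shows "mq_rep (mq_class n x) \<in> prodM n" "sim n x (mq_rep (mq_class n x))"
proof -
  have "x \<in> mq_class n x" using assms by (simp add: mq_class_alt)
  then have "mq_rep (mq_class n x) \<in> mq_class n x" unfolding mq_rep_def
    by (rule someI[where P = "\<lambda>y. y \<in> mq_class n x"])
  then show "mq_rep (mq_class n x) \<in> prodM n" "sim n x (mq_rep (mq_class n x))"
    by (simp_all add: mq_class_alt)
qed

lemma sim_sadd:
  assumes "sim n x x'" "sim n y y'"
  shows "sim n (sadd x y) (sadd x' y')"
proof (rule sim_from_bound)
  show "(\<lambda>k. opnorm (n k) (ssub x x' k) + opnorm (n k) (ssub y y' k)) \<longlonglongrightarrow> 0"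
    using tendsto_add[OF assms[unfolded sim_def]] by simp
  show "opnorm (n k) (ssub (sadd x y) (sadd x' y') k) \<le> opnorm (n k) (ssub x x' k) + opnorm (n k) (ssub y y' k)" for k
    using opnorm_triangle[of "n k" "ssub x x' k" "ssub y y' k"]
    by (simp add: ssub_def sadd_def algebra_simps)
qed

lemma sim_ssm:
  assumes "sim n x x'"
  shows "sim n (ssm c x) (ssm c x')"
proof (rule sim_from_bound)
  show "(\<lambda>k. cmod c * opnorm (n k) (ssub x x' k)) \<longlonglongrightarrow> 0"
    using tendsto_mult_right_zero[OF assms[unfolded sim_def]] .
  show "opnorm (n k) (ssub (ssm c x) (ssm c x') k) \<le> cmod c * opnorm (n k) (ssub x x' k)" for k
    using opnorm_scale[of "n k" c "ssub x x' k"] by (simp add: ssub_def ssm_def algebra_simps)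
qed

lemma sim_sstar:
  assumes "sim n x x'"
  shows "sim n (sstar x) (sstar x')"
proof (rule sim_from_bound[OF assms[unfolded sim_def]])
  have "ssub (sstar x) (sstar x') k = adj (ssub x x' k)" for k
    by (simp add: ssub_def sstar_def adj_def)
  then show "opnorm (n k) (ssub (sstar x) (sstar x') k) \<le> opnorm (n k) (ssub x x' k)" for k by simp
qed

text \<open>The bounds are asked of x' and y because the difference is written as (x - x') y + x' (y
  - y').\<close>

lemma sim_smul:
  assumes "sim n x x'" "sim n y y'" "x' \<in> prodM n" "y \<in> prodM n"
  shows "sim n (smul n x y) (smul n x' y')"
proof -
  obtain B B' where B: "\<And>k. opnorm (n k) (x' k) \<le> B" "\<And>k. opnorm (n k) (y k) \<le> B'"
    using assms prodM_bound by metis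
  show ?thesis
  proof (rule sim_from_bound)
    show "(\<lambda>k. opnorm (n k) (ssub x x' k) * B' + B * opnorm (n k) (ssub y y' k)) \<longlonglongrightarrow> 0"
      using tendsto_add[OF tendsto_mult_left_zero[OF assms(1)[unfolded sim_def], of B']
          tendsto_mult_right_zero[OF assms(2)[unfolded sim_def], of B]] by simp
    fix k
    have "ssub (smul n x y) (smul n x' y') k =
        (\<lambda>i j. mm (n k) (ssub x x' k) (y k) i j + mm (n k) (x' k) (ssub y y' k) i j)"
      by (intro ext) (simp add: ssub_def smul_def mm_def sum.distrib[symmetric] sum_subtractf[symmetric] algebra_simps)
    then have "opnorm (n k) (ssub (smul n x y) (smul n x' y') k) \<le>
        opnorm (n k) (mm (n k) (ssub x x' k) (y k)) + opnorm (n k) (mm (n k) (x' k) (ssub y y' k))"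
      using opnorm_triangle by simp
    also have "\<dots> \<le> opnorm (n k) (ssub x x' k) * opnorm (n k) (y k) + opnorm (n k) (x' k) * opnorm (n k) (ssub y y' k)"
      by (intro add_mono opnorm_mm)
    also have "\<dots> \<le> opnorm (n k) (ssub x x' k) * B' + B * opnorm (n k) (ssub y y' k)"
      using B by (intro add_mono mult_left_mono mult_right_mono) simp_all
    finally show "opnorm (n k) (ssub (smul n x y) (smul n x' y') k) \<le>
      opnorm (n k) (ssub x x' k) * B' + B * opnorm (n k) (ssub y y' k)" .
  qed
qed

lemma MQ_carrier: "cs_carrier (MQ n) = mq_class n ` prodM n"
  by (simp add: MQ_def)

lemma MQ_zero: "cs_zero (MQ n) = mq_class n (\<lambda>k i j. 0)"
  by (simp add: MQ_def)

lemma MQ_one: "cs_one (MQ n) = mq_class n (sone n)"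
  by (simp add: MQ_def sone_def mid_def)

lemma MQ_add:
  assumes "x \<in> prodM n" "y \<in> prodM n"
  shows "cs_add (MQ n) (mq_class n x) (mq_class n y) = mq_class n (sadd x y)"
proof -
  have "cs_add (MQ n) (mq_class n x) (mq_class n y) = mq_class n (sadd (mq_rep (mq_class n x)) (mq_rep (mq_class n y)))"
    by (simp add: MQ_def sadd_def)
  also have "\<dots> = mq_class n (sadd x y)"
    by (rule mq_class_eq_iff[THEN iffD2, OF _ _ sim_sym])
      (intro prodM_sadd sim_sadd mq_rep assms)+
  finally show ?thesis .
qed

lemma MQ_mult:
  assumes "x \<in> prodM n" "y \<in> prodM n"
  shows "cs_mult (MQ n) (mq_class n x) (mq_class n y) = mq_class n (smul n x y)"
proof -
  have "cs_mult (MQ n) (mq_class n x) (mq_class n y) = mq_class n (smul n (mq_rep (mq_class n x)) (mq_rep (mq_class n y)))"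
    by (simp add: MQ_def smul_def mm_def)
  also have "\<dots> = mq_class n (smul n x y)"
    by (rule mq_class_eq_iff[THEN iffD2, OF _ _ sim_sym])
      (intro prodM_smul sim_smul mq_rep assms)+
  finally show ?thesis .
qed

lemma MQ_sm:
  assumes "x \<in> prodM n"
  shows "cs_smult (MQ n) c (mq_class n x) = mq_class n (ssm c x)"
proof -
  have "cs_smult (MQ n) c (mq_class n x) = mq_class n (ssm c (mq_rep (mq_class n x)))"
    by (simp add: MQ_def ssm_def)
  also have "\<dots> = mq_class n (ssm c x)"
    by (rule mq_class_eq_iff[THEN iffD2, OF _ _ sim_sym])
      (intro prodM_ssm sim_ssm mq_rep assms)+
  finally show ?thesis .
qed

lemma MQ_star:
  assumes "x \<in> prodM n"
  shows "cs_star (MQ n) (mq_class n x) = mq_class n (sstar x)"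
proof -
  have "cs_star (MQ n) (mq_class n x) = mq_class n (sstar (mq_rep (mq_class n x)))"
    by (simp add: MQ_def sstar_def adj_def)
  also have "\<dots> = mq_class n (sstar x)"
    by (rule mq_class_eq_iff[THEN iffD2, OF _ _ sim_sym])
      (intro prodM_sstar sim_sstar mq_rep assms)+
  finally show ?thesis .
qed

lemma sn_le:
  assumes "x \<in> prodM n"
  shows "sn n x \<le> c \<longleftrightarrow> (\<forall>e>0. \<forall>\<^sub>F k in sequentially. opnorm (n k) (x k) < c + e)"
proof -
  obtain B where "\<And>k. opnorm (n k) (x k) \<le> B" using assms prodM_bound by metis
  then show ?thesis unfolding sn_def by (intro lsup_le_iff[of "\<lambda>k. opnorm (n k) (x k)"]) simp_all
qed

lemma sn_eventually:
  assumes "x \<in> prodM n" "e > 0"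
  shows "\<forall>\<^sub>F k in sequentially. opnorm (n k) (x k) < sn n x + e"
  using sn_le[OF assms(1), of "sn n x"] assms(2) by simp

lemma sn_nonneg [simp]:
  assumes "x \<in> prodM n"
  shows "0 \<le> sn n x"
proof -
  obtain B where "\<And>k. opnorm (n k) (x k) \<le> B" using assms prodM_bound by metis
  then show ?thesis unfolding sn_def by (intro lsup_nonneg[of "\<lambda>k. opnorm (n k) (x k)"]) simp_all
qed

lemma sn_eq_0:
  assumes "x \<in> prodM n"
  shows "sn n x = 0 \<longleftrightarrow> (\<lambda>k. opnorm (n k) (x k)) \<longlonglongrightarrow> 0"
proof -
  obtain B where "\<And>k. opnorm (n k) (x k) \<le> B" using assms prodM_bound by metis
  then show ?thesis unfolding sn_def by (intro lsup_eq_0_iff[of "\<lambda>k. opnorm (n k) (x k)"]) simp_all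
qed

lemma sn_triangle:
  assumes "x \<in> prodM n" "y \<in> prodM n"
  shows "sn n (sadd x y) \<le> sn n x + sn n y"
  unfolding sn_le[OF prodM_sadd[OF assms]]
proof (intro allI impI)
  fix e :: real assume "e > 0"
  then show "\<forall>\<^sub>F k in sequentially. opnorm (n k) (sadd x y k) < sn n x + sn n y + e"
    using eventually_conj[OF sn_eventually[OF assms(1), of "e/2"] sn_eventually[OF assms(2), of "e/2"]]
  proof (simp, elim eventually_mono)
    fix k assume "opnorm (n k) (x k) < sn n x + e / 2 \<and> opnorm (n k) (y k) < sn n y + e / 2"
    then show "opnorm (n k) (sadd x y k) < sn n x + sn n y + e"
      using opnorm_triangle[of "n k" "x k" "y k"] unfolding sadd_def by linarith
  qed
qed

lemma sn_cong:
  assumes "x \<in> prodM n" "y \<in> prodM n" "sim n x y"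
  shows "sn n x = sn n y"
proof -
  have *: "sn n x \<le> sn n y" if "x \<in> prodM n" "y \<in> prodM n" "sim n x y" for x y
  proof -
    have "sn n (ssub x y) = 0" using that by (subst sn_eq_0) (simp_all add: sim_def)
    moreover have "x = sadd (ssub x y) y" by (simp add: sadd_def ssub_def)
    ultimately show ?thesis using sn_triangle[of "ssub x y" n y] that by simp
  qed
  show ?thesis using *[OF assms] *[OF assms(2,1) sim_sym[OF assms(3)]] by simp
qed

lemma MQ_norm:
  assumes "x \<in> prodM n"
  shows "cs_norm (MQ n) (mq_class n x) = sn n x"
proof -
  have "cs_norm (MQ n) (mq_class n x) = sn n (mq_rep (mq_class n x))"
    by (simp add: MQ_def sn_def lsup_def)
  then show ?thesis using sn_cong mq_rep assms by metis
qed

lemma MQ_sub: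
  assumes "x \<in> prodM n" "y \<in> prodM n"
  shows "cs_sub (MQ n) (mq_class n x) (mq_class n y) = mq_class n (ssub x y)"
  unfolding cs_sub_def using assms by (simp add: MQ_sm MQ_add ssub_alt)

lemma sn_scale:
  assumes "x \<in> prodM n"
  shows "sn n (ssm c x) = cmod c * sn n x"
proof -
  have le: "sn n (ssm c x) \<le> cmod c * sn n x" if x: "x \<in> prodM n" for c x
    unfolding sn_le[OF prodM_ssm[OF x]]
  proof (intro allI impI)
    fix e :: real assume e: "e > 0"
    have "\<forall>\<^sub>F k in sequentially. opnorm (n k) (x k) < sn n x + e / (cmod c + 1)"
      using x e by (intro sn_eventually) (simp_all add: add_nonneg_pos)
    then show "\<forall>\<^sub>F k in sequentially. opnorm (n k) (ssm c x k) < cmod c * sn n x + e"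
    proof eventually_elim
      case (elim k)
      have "cmod c * opnorm (n k) (x k) \<le> cmod c * (sn n x + e / (cmod c + 1))"
        using elim by (intro mult_left_mono) simp_all
      also have "\<dots> = cmod c * sn n x + e * (cmod c / (cmod c + 1))" by (simp add: algebra_simps)
      also have "\<dots> < cmod c * sn n x + e * 1"
        using e by (intro add_strict_left_mono mult_strict_left_mono)
          (simp_all add: divide_less_eq add_nonneg_pos)
      finally show ?case by (simp add: ssm_def opnorm_scale)
    qed
  qed
  show ?thesis
  proof (cases "c = 0")
    case True
    then have "cmod c * sn n x = 0" by simp
    then show ?thesis using le[OF assms, of c] sn_nonneg[OF prodM_ssm[OF assms, of c]] by linarith
  next
    case False
    then have "ssm (inverse c) (ssm c x) = x" by (simp add: ssm_def mult.assoc[symmetric])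
    then have "sn n x \<le> cmod (inverse c) * sn n (ssm c x)"
      using le[OF prodM_ssm[OF assms], of "inverse c" c] by (simp only:)
    then have "cmod c * sn n x \<le> sn n (ssm c x)" using False by (simp add: norm_inverse norm_divide field_simps)
    then show ?thesis using le[OF assms, of c] by simp
  qed
qed

lemma sn_mult:
  assumes "x \<in> prodM n" "y \<in> prodM n"
  shows "sn n (smul n x y) \<le> sn n x * sn n y"
  unfolding sn_le[OF prodM_smul[OF assms]]
proof (intro allI impI)
  fix e :: real assume e: "e > 0"
  define S where "S = sn n x + sn n y + 1"
  have S: "S > 0" using assms sn_nonneg unfolding S_def by (intro add_nonneg_pos add_nonneg_nonneg) simp_all
  define d where "d = min 1 (e / (2 * S))"
  have d: "d > 0" "d \<le> 1" "d * S < e"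
  proof -
    show "d > 0" "d \<le> 1" using e S by (simp_all add: d_def)
    have "d * S \<le> e / (2 * S) * S" using S by (intro mult_right_mono) (simp_all add: d_def)
    also have "\<dots> = e / 2" using S by simp
    finally show "d * S < e" using e by simp
  qed
  have "d * d \<le> d * 1" using d by (intro mult_left_mono) simp_all
  then have fin: "(sn n x + d) * (sn n y + d) < sn n x * sn n y + e"
    using d(3) by (simp add: S_def algebra_simps)
  have "\<forall>\<^sub>F k in sequentially. opnorm (n k) (x k) < sn n x + d \<and> opnorm (n k) (y k) < sn n y + d"
    using sn_eventually assms d by (intro eventually_conj) blast+
  then show "\<forall>\<^sub>F k in sequentially. opnorm (n k) (smul n x y k) < sn n x * sn n y + e"
  proof eventually_elim
    case (elim k)
    have "opnorm (n k) (smul n x y k) \<le> opnorm (n k) (x k) * opnorm (n k) (y k)"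
      unfolding smul_def by (rule opnorm_mm)
    also have "\<dots> \<le> (sn n x + d) * (sn n y + d)"
      using elim assms d by (intro mult_mono) (simp_all add: add_nonneg_nonneg)
    finally show ?case using fin by simp
  qed
qed

lemma sn_star [simp]: "sn n (sstar x) = sn n x"
  by (simp add: sn_def sstar_def)

lemma sn_cstar:
  assumes x: "x \<in> prodM n"
  shows "sn n (smul n (sstar x) x) = (sn n x)\<^sup>2"
proof (rule antisym)
  show "sn n (smul n (sstar x) x) \<le> (sn n x)\<^sup>2"
    using sn_mult[of "sstar x" n x] x by (simp add: power2_eq_square)
  let ?M = "sn n (smul n (sstar x) x)"
  have M0: "0 \<le> ?M" using x by simp
  have "sn n x \<le> sqrt ?M"
    unfolding sn_le[OF x]
  proof (intro allI impI)
    fix e :: real assume e: "e > 0"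
    have "\<forall>\<^sub>F k in sequentially. opnorm (n k) (smul n (sstar x) x k) < ?M + e\<^sup>2"
      using x e by (intro sn_eventually) simp_all
    then show "\<forall>\<^sub>F k in sequentially. opnorm (n k) (x k) < sqrt ?M + e"
    proof eventually_elim
      case (elim k)
      have "(opnorm (n k) (x k))\<^sup>2 < ?M + e\<^sup>2"
        using elim by (simp add: smul_def sstar_def opnorm_cstar)
      also have "\<dots> \<le> (sqrt ?M + e)\<^sup>2" using M0 e by (simp add: power2_sum)
      finally show ?case by (rule power2_less_imp_less) (use M0 e in simp)
    qed
  qed
  then have "(sn n x)\<^sup>2 \<le> (sqrt ?M)\<^sup>2" using x by (intro power_mono) simp_all
  then show "(sn n x)\<^sup>2 \<le> ?M" using M0 by simp
qed

lemma smul_sone: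
  assumes "x \<in> prodM n"
  shows "smul n (sone n) x = x" "smul n x (sone n) = x"
proof -
  show "smul n (sone n) x = x"
  proof (intro ext)
    fix k i j
    have "(\<Sum>l<n k. mid (n k) i l * x k l j) = (\<Sum>l<n k. if l = i then x k i j else 0)"
      unfolding mid_def by (intro sum.cong) auto
    then show "smul n (sone n) x k i j = x k i j"
      using prodM_outside[OF assms, of k i j] by (simp add: smul_def sone_def mm_def)
  qed
  show "smul n x (sone n) = x"
  proof (intro ext)
    fix k i j
    have "(\<Sum>l<n k. x k i l * mid (n k) l j) = (\<Sum>l<n k. if l = j then x k i j else 0)"
      unfolding mid_def by (intro sum.cong) auto
    then show "smul n x (sone n) k i j = x k i j"
      using prodM_outside[OF assms, of k i j] by (simp add: smul_def sone_def mm_def)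
  qed
qed

lemma matseq_laws:
  "sadd (sadd x y) z = sadd x (sadd y z)" "sadd x y = sadd y x" "sadd (\<lambda>k i j. 0) x = x"
  "sadd x (ssm (-1) x) = (\<lambda>k i j. 0)" "ssm 1 x = x" "ssm a (ssm b x) = ssm (a * b) x"
  "ssm (a + b) x = sadd (ssm a x) (ssm b x)" "ssm a (sadd x y) = sadd (ssm a x) (ssm a y)"
  "smul n (smul n x y) z = smul n x (smul n y z)"
  "smul n x (sadd y z) = sadd (smul n x y) (smul n x z)"
  "smul n (sadd x y) z = sadd (smul n x z) (smul n y z)"
  "smul n (ssm a x) y = ssm a (smul n x y)" "smul n x (ssm a y) = ssm a (smul n x y)"
  "sstar (sstar x) = x" "sstar (sadd x y) = sadd (sstar x) (sstar y)"
  "sstar (ssm a x) = ssm (cnj a) (sstar x)" "sstar (smul n x y) = smul n (sstar y) (sstar x)"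
  by (simp_all add: sadd_def ssm_def smul_def sstar_def fun_eq_iff mm_assoc adj_mm)
    (simp_all add: adj_def mm_def algebra_simps sum.distrib sum_distrib_left)

lemma MQ_norm_sub_le:
  assumes "x \<in> prodM n" "y \<in> prodM n"
  shows "cs_norm (MQ n) (cs_sub (MQ n) (mq_class n x) (mq_class n y)) = sn n (ssub x y)"
  using assms by (simp add: MQ_sub MQ_norm)

lemma sn_triangle3:
  assumes "x \<in> prodM n" "y \<in> prodM n" "z \<in> prodM n"
  shows "sn n (ssub x z) \<le> sn n (ssub x y) + sn n (ssub y z)"
proof -
  have "ssub x z = sadd (ssub x y) (ssub y z)" by (simp add: ssub_def sadd_def)
  then show ?thesis using sn_triangle[of "ssub x y" n "ssub y z"] assms by simp
qed

text \<open>The limit is a diagonal sequence.\<close>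
lemma matseq_diagonal:
  assumes g: "\<And>t. g t \<in> prodM n" and step: "\<And>t. sn n (ssub (g (Suc t)) (g t)) < (1/2) ^ t"
  shows "\<exists>y\<in>prodM n. \<forall>t. sn n (ssub y (g t)) \<le> 2 * (1/2) ^ t"
proof -
  have "\<exists>K. \<forall>k\<ge>K. opnorm (n k) (ssub (g (Suc t)) (g t) k) < (1/2) ^ t" for t
  proof -
    let ?x = "ssub (g (Suc t)) (g t)"
    have "\<forall>\<^sub>F k in sequentially. opnorm (n k) (?x k) < sn n ?x + ((1/2) ^ t - sn n ?x)"
      using g step by (intro sn_eventually) simp_all
    then show ?thesis by (simp add: eventually_sequentially)
  qed
  then obtain K where K: "\<And>t k. K t \<le> k \<Longrightarrow> opnorm (n k) (ssub (g (Suc t)) (g t) k) < (1/2) ^ t"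
    by metis
  define K' where "K' t = t + (\<Sum>i\<le>t. K i)" for t
  have K'_ge: "K i \<le> K' t" if "i \<le> t" for i t
    unfolding K'_def using that by (intro trans_le_add2 member_le_sum) simp_all
  define T where "T k = {t. t = 0 \<or> K' t \<le> k}" for k
  have T_fin: "finite (T k)" for k
    by (rule finite_subset[of _ "{..k}"]) (auto simp: T_def K'_def)
  define \<tau> where "\<tau> k = Max (T k)" for k
  have \<tau>_in: "\<tau> k \<in> T k" for k unfolding \<tau>_def using T_fin by (intro Max_in) (auto simp: T_def)
  have \<tau>_ge: "t \<le> \<tau> k" if "K' t \<le> k" for t k
    unfolding \<tau>_def using T_fin that by (intro Max_ge) (auto simp: T_def)
  have small: "opnorm (n k) (ssub (g (Suc i)) (g i) k) < (1/2) ^ i" if "i < \<tau> k" for i k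
  proof -
    have "K' (\<tau> k) \<le> k" using \<tau>_in[of k] that by (auto simp: T_def)
    then show ?thesis using K'_ge[of i "\<tau> k"] that by (intro K) simp
  qed
  define y where "y k = g (\<tau> k) k" for k
  have telescope: "opnorm (n k) (ssub (g t) (g s) k) \<le> 2 * (1/2) ^ s - 2 * (1/2) ^ t"
    if "s \<le> t" "t \<le> \<tau> k" for s t k
    using that
  proof (induction t rule: dec_induct)
    case base
    then show ?case by (simp add: ssub_def)
  next
    case (step t)
    have "opnorm (n k) (ssub (g (Suc t)) (g s) k)
        \<le> opnorm (n k) (ssub (g (Suc t)) (g t) k) + opnorm (n k) (ssub (g t) (g s) k)"
      unfolding ssub_def by (rule opnorm_diff3)
    also have "\<dots> \<le> (1/2) ^ t + (2 * (1/2) ^ s - 2 * (1/2) ^ t)"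
      using step small[of t k] by (intro add_mono) simp_all
    finally show ?case by simp
  qed
  have close: "opnorm (n k) (ssub y (g s) k) \<le> 2 * (1/2) ^ s" if "s \<le> \<tau> k" for s k
  proof -
    have "ssub y (g s) k = ssub (g (\<tau> k)) (g s) k" by (simp add: ssub_def y_def)
    then have "opnorm (n k) (ssub y (g s) k) \<le> 2 * (1/2) ^ s - 2 * (1/2) ^ \<tau> k"
      using telescope[OF that order_refl] by simp
    then show ?thesis by (smt (verit) zero_le_power half_gt_zero)
  qed
  have y: "y \<in> prodM n"
  proof -
    obtain B where B: "\<And>k. opnorm (n k) (g 0 k) \<le> B" using prodM_bound[OF g] by metis
    show ?thesis
    proof (rule prodMI)
      show "opnorm (n k) (y k) \<le> 2 + B" for k
        using opnorm_triangle[of "n k" "ssub y (g 0) k" "g 0 k"] close[of 0 k] B[of k]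
        by (simp add: ssub_def)
    qed (simp add: y_def prodM_outside[OF g])
  qed
  have "sn n (ssub y (g t)) \<le> 2 * (1/2) ^ t" for t
    unfolding sn_le[OF prodM_ssub[OF y g]]
  proof (intro allI impI)
    fix e :: real assume e: "e > 0"
    show "\<forall>\<^sub>F k in sequentially. opnorm (n k) (ssub y (g t) k) < 2 * (1/2) ^ t + e"
      unfolding eventually_sequentially
    proof (intro exI[of _ "K' t"] allI impI)
      fix k assume "K' t \<le> k"
      then show "opnorm (n k) (ssub y (g t) k) < 2 * (1/2) ^ t + e" using close[OF \<tau>_ge, of t k] e by simp
    qed
  qed
  then show ?thesis using y by blast
qed

text \<open>Sampling the Cauchy sequence at indices beyond its thresholds gives increments below
  2^(-t), hence a diagonal limit, and the whole sequence converges to it.\<close>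

lemma MQ_complete:
  assumes f: "range f \<subseteq> cs_carrier (MQ n)"
    and Cau: "\<forall>e>0. \<exists>N::nat. \<forall>m\<ge>N. \<forall>k\<ge>N. cs_norm (MQ n) (cs_sub (MQ n) (f m) (f k)) < e"
  shows "\<exists>l\<in>cs_carrier (MQ n). \<forall>e>0. \<exists>N::nat. \<forall>m\<ge>N. cs_norm (MQ n) (cs_sub (MQ n) (f m) l) < e"
proof -
  have "\<forall>m. \<exists>x. x \<in> prodM n \<and> f m = mq_class n x" using f unfolding MQ_carrier by blast
  then obtain r where r: "\<And>m. r m \<in> prodM n" "\<And>m. f m = mq_class n (r m)" by metis
  have Cau': "\<exists>N. \<forall>m\<ge>N. \<forall>k\<ge>N. sn n (ssub (r m) (r k)) < (1/2) ^ t" for t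
    using Cau r by (auto simp: MQ_norm_sub_le dest: spec[of _ "(1/2) ^ t"])
  then obtain M where M: "\<And>t m k. M t \<le> m \<Longrightarrow> M t \<le> k \<Longrightarrow> sn n (ssub (r m) (r k)) < (1/2) ^ t"
    by metis
  define s where "s t = (\<Sum>i\<le>t. M i)" for t
  have s: "M t \<le> s t" "M t \<le> s (Suc t)" for t
    unfolding s_def by (rule member_le_sum; simp)+
  obtain y where y: "y \<in> prodM n" "\<And>t. sn n (ssub y (r (s t))) \<le> 2 * (1/2) ^ t"
    using matseq_diagonal[of "\<lambda>t. r (s t)" n] r(1) M s by blast
  have "\<exists>N. \<forall>m\<ge>N. cs_norm (MQ n) (cs_sub (MQ n) (f m) (mq_class n y)) < e" if e: "e > 0" for e
  proof -
    obtain t where t: "(1/2) ^ t < e / 3" using real_arch_pow_inv[of "e / 3" "1/2"] e by auto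
    show ?thesis
    proof (intro exI[of _ "M t"] allI impI)
      fix m assume m: "M t \<le> m"
      have "ssub (r (s t)) y = ssm (-1) (ssub y (r (s t)))" by (simp add: ssub_def ssm_def)
      then have "sn n (ssub (r (s t)) y) = sn n (ssub y (r (s t)))" using y r by (simp add: sn_scale)
      then have "sn n (ssub (r m) y) < (1/2) ^ t + 2 * (1/2) ^ t"
        using sn_triangle3[of "r m" n "r (s t)" y] M[OF m s(1)] y(1) y(2)[of t] r(1)[of m] r(1)[of "s t"] by linarith
      then show "cs_norm (MQ n) (cs_sub (MQ n) (f m) (mq_class n y)) < e"
        using t y r by (simp add: MQ_norm_sub_le)
    qed
  qed
  then show ?thesis using y by (auto simp: MQ_carrier)
qed

theorem MQ_cstar: "unital_cstar_algebra (MQ n)"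
proof -
  have zero: "sn n x = 0 \<longleftrightarrow> mq_class n x = mq_class n (\<lambda>k i j. 0)" if "x \<in> prodM n" for x
    using that by (simp add: mq_class_eq_iff sn_eq_0 sim_def ssub_def)
  note ops = MQ_zero MQ_one MQ_add MQ_mult MQ_sm MQ_star MQ_norm
  show ?thesis
    unfolding unital_cstar_algebra_def Let_def
  proof (intro conjI)
    show "\<forall>f. range f \<subseteq> cs_carrier (MQ n) \<longrightarrow>
        (\<forall>e>0. \<exists>N::nat. \<forall>m\<ge>N. \<forall>k\<ge>N. cs_norm (MQ n) (cs_sub (MQ n) (f m) (f k)) < e) \<longrightarrow>
        (\<exists>l\<in>cs_carrier (MQ n). \<forall>e>0. \<exists>N::nat. \<forall>m\<ge>N. cs_norm (MQ n) (cs_sub (MQ n) (f m) l) < e)"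
      using MQ_complete by blast
  qed (unfold MQ_carrier ball_simps, simp_all add: ops matseq_laws(1,3-) smul_sone zero sn_triangle
      sn_scale sn_mult sn_cstar, simp add: matseq_laws(2))
qed

subsection \<open>Finite-dimensional representations of tails\<close>

definition zero_outside :: "nat \<Rightarrow> (nat \<Rightarrow> nat \<Rightarrow> complex) \<Rightarrow> bool" where
  "zero_outside m M \<longleftrightarrow> (\<forall>i j. m \<le> i \<or> m \<le> j \<longrightarrow> M i j = 0)"

lemma mm_mid: "zero_outside m M \<Longrightarrow> mm m (mid m) M = M" "zero_outside m M \<Longrightarrow> mm m M (mid m) = M"
proof -
  assume M: "zero_outside m M"
  show "mm m (mid m) M = M"
  proof (intro ext)
    fix i j
    have "(\<Sum>l<m. mid m i l * M l j) = (\<Sum>l<m. if l = i then M i j else 0)"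
      unfolding mid_def by (intro sum.cong) auto
    then show "mm m (mid m) M i j = M i j" using M by (simp add: mm_def zero_outside_def)
  qed
  show "mm m M (mid m) = M"
  proof (intro ext)
    fix i j
    have "(\<Sum>l<m. M i l * mid m l j) = (\<Sum>l<m. if l = j then M i j else 0)"
      unfolding mid_def by (intro sum.cong) auto
    then show "mm m M (mid m) i j = M i j" using M by (simp add: mm_def zero_outside_def)
  qed
qed

lemma zero_outside_mid [simp]: "zero_outside m (mid m)"
  by (simp add: zero_outside_def mid_def)

lemma zero_outside_mm: "zero_outside m M \<Longrightarrow> zero_outside m N \<Longrightarrow> zero_outside m (mm m M N)"
  by (simp add: zero_outside_def mm_def)

lemma zero_outside_adj: "zero_outside m M \<Longrightarrow> zero_outside m (adj M)"
  by (auto simp: zero_outside_def adj_def)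

text \<open>A unital \<open>*\<close>-representation of the algebra of sequences that only depends, with norm bounds,
  on the entries of index at least \<open>K\<close>.\<close>
definition tail_hom :: "(nat \<Rightarrow> nat) \<Rightarrow> nat \<Rightarrow> nat \<Rightarrow> (matseq \<Rightarrow> nat \<Rightarrow> nat \<Rightarrow> complex) \<Rightarrow> bool" where
  "tail_hom n K M \<Phi> \<longleftrightarrow>
     (\<forall>x y. \<Phi> (sadd x y) = (\<lambda>i j. \<Phi> x i j + \<Phi> y i j)) \<and>
     (\<forall>c x. \<Phi> (ssm c x) = (\<lambda>i j. c * \<Phi> x i j)) \<and>
     (\<forall>x y. \<Phi> (smul n x y) = mm M (\<Phi> x) (\<Phi> y)) \<and>
     (\<forall>x. \<Phi> (sstar x) = adj (\<Phi> x)) \<and>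
     \<Phi> (sone n) = mid M \<and>
     (\<forall>x. zero_outside M (\<Phi> x)) \<and>
     (\<forall>x c. (\<forall>k\<ge>K. opnorm (n k) (x k) \<le> c) \<longrightarrow> opnorm M (\<Phi> x) \<le> c)"

lemma tail_homD:
  assumes "tail_hom n K M \<Phi>"
  shows "\<Phi> (sadd x y) = (\<lambda>i j. \<Phi> x i j + \<Phi> y i j)" "\<Phi> (ssm c x) = (\<lambda>i j. c * \<Phi> x i j)"
    "\<Phi> (smul n x y) = mm M (\<Phi> x) (\<Phi> y)" "\<Phi> (sstar x) = adj (\<Phi> x)" "\<Phi> (sone n) = mid M"
    "zero_outside M (\<Phi> x)" "(\<And>k. K \<le> k \<Longrightarrow> opnorm (n k) (x k) \<le> B) \<Longrightarrow> opnorm M (\<Phi> x) \<le> B"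
  using assms unfolding tail_hom_def by blast+

lemma tail_hom_ssub: "tail_hom n K M \<Phi> \<Longrightarrow> \<Phi> (ssub x y) = (\<lambda>i j. \<Phi> x i j - \<Phi> y i j)"
proof -
  assume "tail_hom n K M \<Phi>"
  note D = tail_homD[OF this]
  show "\<Phi> (ssub x y) = (\<lambda>i j. \<Phi> x i j - \<Phi> y i j)" unfolding ssub_alt D by simp
qed

lemma tail_hom_mono: "tail_hom n K M \<Phi> \<Longrightarrow> K' \<le> K \<Longrightarrow> tail_hom n K' M \<Phi>"
  unfolding tail_hom_def using order_trans by blast

text \<open>The direct sum of the matrix algebras numbered by \<open>ks\<close>, repetitions
  allowed. \<open>b\<close> sends a coordinate of the sum to the pair of block number and position
  in the block; its inverse is \<open>B\<close>.\<close>

locale blocks =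
  fixes n :: "nat \<Rightarrow> nat" and ks :: "nat list" and M :: nat and b :: "nat \<Rightarrow> nat \<times> nat"
  assumes bij: "bij_betw b {..<M} (SIGMA l:{..<length ks}. {..<n (ks ! l)})"
begin

abbreviation dm :: "nat \<Rightarrow> nat" where
  "dm l \<equiv> n (ks ! l)"

definition B :: "nat \<Rightarrow> nat \<Rightarrow> nat" where
  "B l \<alpha> = inv_into {..<M} b (l, \<alpha>)"

definition \<Phi> :: "matseq \<Rightarrow> nat \<Rightarrow> nat \<Rightarrow> complex" where
  "\<Phi> x i j = (if i < M \<and> j < M \<and> fst (b i) = fst (b j)
     then x (ks ! fst (b i)) (snd (b i)) (snd (b j)) else 0)"

definition embed :: "(nat \<Rightarrow> nat \<Rightarrow> complex) \<Rightarrow> nat \<Rightarrow> complex" where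
  "embed \<eta> i = \<eta> (fst (b i)) (snd (b i))"

lemma b_B: "l < length ks \<Longrightarrow> \<alpha> < dm l \<Longrightarrow> b (B l \<alpha>) = (l, \<alpha>)"
  and B_less: "l < length ks \<Longrightarrow> \<alpha> < dm l \<Longrightarrow> B l \<alpha> < M"
proof -
  assume "l < length ks" "\<alpha> < dm l"
  then have "(l, \<alpha>) \<in> b ` {..<M}" using bij by (auto simp: bij_betw_def)
  from f_inv_into_f[OF this] inv_into_into[OF this]
  show "b (B l \<alpha>) = (l, \<alpha>)" "B l \<alpha> < M" by (simp_all add: B_def)
qed

lemma b_range: "i < M \<Longrightarrow> fst (b i) < length ks \<and> snd (b i) < dm (fst (b i))"
proof -
  assume "i < M"
  then have "b i \<in> (SIGMA l:{..<length ks}. {..<dm l})" using bij unfolding bij_betw_def by blast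
  then show ?thesis by (auto simp: mem_Sigma_iff)
qed

lemma B_b: "i < M \<Longrightarrow> B (fst (b i)) (snd (b i)) = i"
  using bij by (simp add: B_def bij_betw_def)

lemma sum_blocks: "(\<Sum>i<M. g i) = (\<Sum>l<length ks. \<Sum>\<alpha><dm l. g (B l \<alpha>))"
proof -
  have "(\<Sum>i<M. g i) = (\<Sum>i<M. (\<lambda>(l, \<alpha>). g (B l \<alpha>)) (b i))"
    by (intro sum.cong) (simp_all add: B_b case_prod_beta)
  also have "\<dots> = (\<Sum>(l, \<alpha>)\<in>(SIGMA l:{..<length ks}. {..<dm l}). g (B l \<alpha>))"
    by (rule sum.reindex_bij_betw[OF bij])
  also have "\<dots> = (\<Sum>l<length ks. \<Sum>\<alpha><dm l. g (B l \<alpha>))" by (simp add: sum.Sigma)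
  finally show ?thesis .
qed

lemma \<Phi>_blocks:
  assumes i: "i < M" and h: "\<And>j. j < M \<Longrightarrow> fst (b j) \<noteq> fst (b i) \<Longrightarrow> h j = 0"
  shows "(\<Sum>j<M. h j) = (\<Sum>\<alpha><dm (fst (b i)). h (B (fst (b i)) \<alpha>))"
proof -
  let ?p = "fst (b i)"
  have "(\<Sum>\<alpha><dm l. h (B l \<alpha>)) = (if l = ?p then \<Sum>\<alpha><dm ?p. h (B ?p \<alpha>) else 0)"
    if l: "l < length ks" for l
    using h[OF B_less] b_B l by auto
  then have "(\<Sum>j<M. h j) = (\<Sum>l<length ks. if l = ?p then \<Sum>\<alpha><dm ?p. h (B ?p \<alpha>) else 0)"
    unfolding sum_blocks by (intro sum.cong) auto
  then show ?thesis using b_range[OF i] by simp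
qed

lemma mv_\<Phi>:
  assumes i: "i < M"
  shows "mv M (\<Phi> x) v i = mv (dm (fst (b i))) (x (ks ! fst (b i))) (\<lambda>\<beta>. v (B (fst (b i)) \<beta>)) (snd (b i))"
proof -
  have "mv M (\<Phi> x) v i = (\<Sum>\<alpha><dm (fst (b i)). \<Phi> x i (B (fst (b i)) \<alpha>) * v (B (fst (b i)) \<alpha>))"
    unfolding mv_def using i by (rule \<Phi>_blocks) (simp add: \<Phi>_def)
  also have "\<dots> = mv (dm (fst (b i))) (x (ks ! fst (b i))) (\<lambda>\<beta>. v (B (fst (b i)) \<beta>)) (snd (b i))"
    unfolding mv_def using i b_range[OF i] by (intro sum.cong) (simp_all add: \<Phi>_def b_B B_less)
  finally show ?thesis .
qed

lemma vecnorm_blocks: "(vecnorm M v)\<^sup>2 = (\<Sum>l<length ks. (vecnorm (dm l) (\<lambda>\<alpha>. v (B l \<alpha>)))\<^sup>2)"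
  unfolding vecnorm_sq by (rule sum_blocks)

lemma cip_blocks: "cip M v w = (\<Sum>l<length ks. cip (dm l) (\<lambda>\<alpha>. v (B l \<alpha>)) (\<lambda>\<alpha>. w (B l \<alpha>)))"
  unfolding cip_def by (rule sum_blocks)

lemma mv_\<Phi>_B:
  "l < length ks \<Longrightarrow> \<alpha> < dm l \<Longrightarrow> mv M (\<Phi> x) v (B l \<alpha>) = mv (dm l) (x (ks ! l)) (\<lambda>\<beta>. v (B l \<beta>)) \<alpha>"
  by (simp add: mv_\<Phi> B_less b_B)

text \<open>The forms of a direct sum add up over its blocks. This is what makes the set of
  attainable Gram data closed under addition.\<close>

lemma cip_embed:
  "cip M (mv M (\<Phi> x) (embed \<eta>)) (embed \<eta>')
     = (\<Sum>l<length ks. cip (dm l) (mv (dm l) (x (ks ! l)) (\<eta> l)) (\<eta>' l))"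
  unfolding cip_blocks
proof (intro sum.cong refl cip_cong)
  fix l \<alpha> assume l: "l \<in> {..<length ks}" and \<alpha>: "\<alpha> < dm l"
  then show "embed \<eta>' (B l \<alpha>) = \<eta>' l \<alpha>" by (simp add: embed_def b_B)
  have "mv M (\<Phi> x) (embed \<eta>) (B l \<alpha>) = mv (dm l) (x (ks ! l)) (\<lambda>\<beta>. embed \<eta> (B l \<beta>)) \<alpha>"
    using l \<alpha> by (intro mv_\<Phi>_B) simp_all
  also have "\<dots> = mv (dm l) (x (ks ! l)) (\<eta> l) \<alpha>"
    unfolding mv_def using l by (intro sum.cong) (simp_all add: embed_def b_B)
  finally show "mv M (\<Phi> x) (embed \<eta>) (B l \<alpha>) = mv (dm l) (x (ks ! l)) (\<eta> l) \<alpha>" .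
qed

lemma tail_hom_\<Phi>:
  assumes K: "\<And>k. k \<in> set ks \<Longrightarrow> K \<le> k"
  shows "tail_hom n K M \<Phi>"
  unfolding tail_hom_def
proof (intro conjI allI impI)
  fix x y
  show "\<Phi> (sadd x y) = (\<lambda>i j. \<Phi> x i j + \<Phi> y i j)" by (intro ext) (simp add: \<Phi>_def sadd_def)
  show "\<Phi> (sstar x) = adj (\<Phi> x)" by (intro ext) (auto simp: \<Phi>_def sstar_def adj_def)
  show "zero_outside M (\<Phi> x)" by (auto simp: zero_outside_def \<Phi>_def)
  show "\<Phi> (smul n x y) = mm M (\<Phi> x) (\<Phi> y)"
  proof (intro ext)
    fix i j
    show "\<Phi> (smul n x y) i j = mm M (\<Phi> x) (\<Phi> y) i j"
    proof (cases "i < M \<and> j < M")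
      case True
      then have i: "i < M" and j: "j < M" by auto
      have "mm M (\<Phi> x) (\<Phi> y) i j =
          (\<Sum>\<alpha><dm (fst (b i)). \<Phi> x i (B (fst (b i)) \<alpha>) * \<Phi> y (B (fst (b i)) \<alpha>) j)"
        unfolding mm_def using i by (rule \<Phi>_blocks) (simp add: \<Phi>_def)
      also have "\<dots> = (\<Sum>\<alpha><dm (fst (b i)). if fst (b i) = fst (b j) then
          x (ks ! fst (b i)) (snd (b i)) \<alpha> * y (ks ! fst (b i)) \<alpha> (snd (b j)) else 0)"
        using i j b_range[OF i] by (intro sum.cong refl) (auto simp: \<Phi>_def b_B B_less)
      also have "\<dots> = \<Phi> (smul n x y) i j" using i j by (simp add: \<Phi>_def smul_def mm_def)
      finally show ?thesis by simp
    qed (auto simp: \<Phi>_def mm_def)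
  qed
next
  fix c x
  show "\<Phi> (ssm c x) = (\<lambda>i j. c * \<Phi> x i j)" by (intro ext) (simp add: \<Phi>_def ssm_def)
next
  show "\<Phi> (sone n) = mid M"
  proof (intro ext)
    fix i j
    have "i < M \<Longrightarrow> j < M \<Longrightarrow> b i = b j \<longleftrightarrow> i = j"
      using bij by (auto simp: bij_betw_def inj_on_def)
    then show "\<Phi> (sone n) i j = mid M i j"
      using b_range[of i] by (auto simp: \<Phi>_def sone_def mid_def prod_eq_iff)
  qed
next
  fix x c assume c: "\<forall>k\<ge>K. opnorm (n k) (x k) \<le> c"
  then have c0: "0 \<le> c" using opnorm_nonneg[of "n K" "x K"] by (meson order_refl order_trans)
  show "opnorm M (\<Phi> x) \<le> c"
  proof (rule opnorm_le[OF c0])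
    fix v
    have "(vecnorm M (mv M (\<Phi> x) v))\<^sup>2 =
        (\<Sum>l<length ks. (vecnorm (dm l) (mv (dm l) (x (ks ! l)) (\<lambda>\<beta>. v (B l \<beta>))))\<^sup>2)"
      unfolding vecnorm_blocks
      by (intro sum.cong refl arg_cong[of _ _ "\<lambda>z. z\<^sup>2"] vecnorm_cong) (simp add: mv_\<Phi>_B)
    also have "\<dots> \<le> (\<Sum>l<length ks. (c * vecnorm (dm l) (\<lambda>\<beta>. v (B l \<beta>)))\<^sup>2)"
    proof (intro sum_mono power_mono)
      fix l assume l: "l \<in> {..<length ks}"
      have "vecnorm (dm l) (mv (dm l) (x (ks ! l)) (\<lambda>\<beta>. v (B l \<beta>)))
          \<le> opnorm (dm l) (x (ks ! l)) * vecnorm (dm l) (\<lambda>\<beta>. v (B l \<beta>))" by (rule opnorm_bound)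
      also have "\<dots> \<le> c * vecnorm (dm l) (\<lambda>\<beta>. v (B l \<beta>))"
        using c K l by (intro mult_right_mono) simp_all
      finally show "vecnorm (dm l) (mv (dm l) (x (ks ! l)) (\<lambda>\<beta>. v (B l \<beta>))) \<le> c * vecnorm (dm l) (\<lambda>\<beta>. v (B l \<beta>))" .
    qed simp
    also have "\<dots> = (c * vecnorm M v)\<^sup>2"
      by (simp add: power_mult_distrib vecnorm_blocks[of v] sum_distrib_left)
    finally show "vecnorm M (mv M (\<Phi> x) v) \<le> c * vecnorm M v"
      by (rule power2_le_imp_le) (use c0 in simp)
  qed
qed

end

text \<open>Hides the numbering of coordinates; what remains are the dimension, the tail property
  and the forms at embedded families of block vectors.\<close>

lemma ex_block_model:
  assumes "\<And>k. k \<in> set ks \<Longrightarrow> K \<le> k"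
  shows "\<exists>\<Phi> em. tail_hom n K (\<Sum>k\<leftarrow>ks. n k) \<Phi> \<and>
    (\<forall>x \<eta> \<eta>'. cip (\<Sum>k\<leftarrow>ks. n k) (mv (\<Sum>k\<leftarrow>ks. n k) (\<Phi> x) (em \<eta>)) (em \<eta>')
     = (\<Sum>l<length ks. cip (n (ks ! l)) (mv (n (ks ! l)) (x (ks ! l)) (\<eta> l)) (\<eta>' l)))"
proof -
  let ?I = "SIGMA l:{..<length ks}. {..<n (ks ! l)}"
  have "card ?I = (\<Sum>l<length ks. n (ks ! l))" by simp
  also have "\<dots> = (\<Sum>k\<leftarrow>ks. n k)" by (simp add: sum_list_sum_nth atLeast0LessThan)
  finally have "card ?I = (\<Sum>k\<leftarrow>ks. n k)" .
  then obtain b where "bij_betw b {..<\<Sum>k\<leftarrow>ks. n k} ?I"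
    using ex_bij_betw_nat_finite[of ?I] by (auto simp: atLeast0LessThan)
  then interpret blocks n ks "\<Sum>k\<leftarrow>ks. n k" b by unfold_locales
  show ?thesis using tail_hom_\<Phi>[OF assms] cip_embed by blast
qed

section \<open>Unitary matrices, conjugation, and maps between quotients\<close>

definition unitary :: "nat \<Rightarrow> (nat \<Rightarrow> nat \<Rightarrow> complex) \<Rightarrow> bool" where
  "unitary m U \<longleftrightarrow> zero_outside m U \<and> mm m (adj U) U = mid m \<and> mm m U (adj U) = mid m"

lemma unitary_opnorm: "unitary m U \<Longrightarrow> opnorm m U \<le> 1"
proof -
  assume "unitary m U"
  then have "(opnorm m U)\<^sup>2 \<le> 1\<^sup>2" using opnorm_cstar[of m U] opnorm_mid[of m] by (simp add: unitary_def)
  then show ?thesis by (rule power2_le_imp_le) simp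
qed

lemma unitary_adj: "unitary m U \<Longrightarrow> unitary m (adj U)"
  by (simp add: unitary_def zero_outside_adj)

lemma unitary_mid: "unitary m (mid m)"
proof -
  have "adj (mid m) = mid m" by (intro ext) (auto simp: adj_def mid_def)
  then show ?thesis by (simp add: unitary_def mm_mid)
qed

lemma unitary_mm:
  assumes "unitary m U" "unitary m V"
  shows "unitary m (mm m U V)"
proof -
  have "mm m (mm m (adj V) (adj U)) (mm m U V) = mm m (adj V) (mm m (mm m (adj U) U) V)"
    by (simp add: mm_assoc)
  moreover have "mm m (mm m U V) (mm m (adj V) (adj U)) = mm m U (mm m (mm m V (adj V)) (adj U))"
    by (simp add: mm_assoc)
  ultimately show ?thesis
    using assms by (simp add: unitary_def zero_outside_mm adj_mm mm_mid zero_outside_adj)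
qed

lemma cip_unitary:
  assumes "unitary m U"
  shows "cip m (mv m U v) (mv m U w) = cip m v w"
proof -
  have "cip m (mv m U v) (mv m U w) = cip m v (mv m (mm m (adj U) U) w)" by (simp add: cip_adj mv_mm)
  also have "\<dots> = cip m v w" using assms by (intro cip_cong) (simp_all add: unitary_def mv_mid)
  finally show ?thesis .
qed

lemma vecnorm_eq_cip: "(vecnorm m v)\<^sup>2 = Re (cip m v v)"
  by (simp add: cip_self)

lemma vecnorm_unitary:
  assumes "unitary m U"
  shows "vecnorm m (mv m U v) = vecnorm m v"
proof -
  have "(vecnorm m (mv m U v))\<^sup>2 = (vecnorm m v)\<^sup>2" using assms by (simp only: vecnorm_eq_cip cip_unitary)
  then show ?thesis by (simp add: power2_eq_iff_nonneg)
qed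

lemma tail_hom_conj:
  assumes \<Phi>: "tail_hom n K M \<Phi>" and U: "unitary M U"
  shows "tail_hom n K M (\<lambda>x. mm M (adj U) (mm M (\<Phi> x) U))"
  unfolding tail_hom_def
proof (intro conjI allI impI)
  note \<Phi>D = tail_homD[OF \<Phi>]
  fix x y
  show "mm M (adj U) (mm M (\<Phi> (sadd x y)) U) =
      (\<lambda>i j. mm M (adj U) (mm M (\<Phi> x) U) i j + mm M (adj U) (mm M (\<Phi> y) U) i j)"
    unfolding \<Phi>D by (intro ext) (simp add: mm_def algebra_simps sum.distrib)
  have "mm M (mm M (adj U) (mm M (\<Phi> x) U)) (mm M (adj U) (mm M (\<Phi> y) U))
      = mm M (adj U) (mm M (\<Phi> x) (mm M (mm M U (adj U)) (mm M (\<Phi> y) U)))"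
    by (simp add: mm_assoc)
  also have "\<dots> = mm M (adj U) (mm M (\<Phi> x) (mm M (\<Phi> y) U))"
    using U \<Phi>D(6) by (simp add: unitary_def mm_mid zero_outside_mm)
  finally show "mm M (adj U) (mm M (\<Phi> (smul n x y)) U) =
      mm M (mm M (adj U) (mm M (\<Phi> x) U)) (mm M (adj U) (mm M (\<Phi> y) U))"
    by (simp add: \<Phi>D mm_assoc)
  show "mm M (adj U) (mm M (\<Phi> (sstar x)) U) = adj (mm M (adj U) (mm M (\<Phi> x) U))"
    by (simp add: \<Phi>D adj_mm mm_assoc)
  show "zero_outside M (mm M (adj U) (mm M (\<Phi> x) U))"
    using U \<Phi>D(6) by (simp add: unitary_def zero_outside_mm zero_outside_adj)
next
  fix c x
  show "mm M (adj U) (mm M (\<Phi> (ssm c x)) U) = (\<lambda>i j. c * mm M (adj U) (mm M (\<Phi> x) U) i j)"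
    unfolding tail_homD(2)[OF \<Phi>] by (intro ext) (simp add: mm_def sum_distrib_left mult_ac)
next
  show "mm M (adj U) (mm M (\<Phi> (sone n)) U) = mid M"
    using U tail_homD(5)[OF \<Phi>] by (simp add: mm_mid unitary_def)
next
  fix x c assume c: "\<forall>k\<ge>K. opnorm (n k) (x k) \<le> c"
  then have "opnorm M (\<Phi> x) \<le> c" using tail_homD(7)[OF \<Phi>] by blast
  moreover have "opnorm M (mm M (adj U) (mm M (\<Phi> x) U)) \<le> 1 * (opnorm M (\<Phi> x) * 1)"
  proof -
    have "opnorm M (mm M (adj U) (mm M (\<Phi> x) U)) \<le> opnorm M (adj U) * opnorm M (mm M (\<Phi> x) U)"
      by (rule opnorm_mm)
    also have "\<dots> \<le> 1 * opnorm M (mm M (\<Phi> x) U)"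
      using unitary_opnorm[OF U] by (intro mult_right_mono) simp_all
    also have "\<dots> \<le> 1 * (opnorm M (\<Phi> x) * opnorm M U)" using opnorm_mm by simp
    also have "\<dots> \<le> 1 * (opnorm M (\<Phi> x) * 1)"
      using unitary_opnorm[OF U] by (intro mult_left_mono) simp_all
    finally show ?thesis .
  qed
  ultimately show "opnorm M (mm M (adj U) (mm M (\<Phi> x) U)) \<le> c" by simp
qed

text \<open>\<open>\<Phi> N\<close> is controlled by the entries of index at least N, where x - y is
  small. Null sequences thus go to null sequences, and the family of representations descends to the
  quotients.\<close>

lemma tail_hom_sim:
  assumes \<Phi>: "\<And>N. tail_hom n N (p N) (\<Phi> N)" and xy: "sim n x y"
  shows "sim p (\<lambda>N. \<Phi> N x) (\<lambda>N. \<Phi> N y)"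
  unfolding sim_def LIMSEQ_iff
proof (intro allI impI)
  fix e :: real assume e: "e > 0"
  then obtain K where K: "\<And>k. K \<le> k \<Longrightarrow> opnorm (n k) (ssub x y k) < e / 2"
    using xy unfolding sim_def LIMSEQ_iff by (metis diff_zero half_gt_zero opnorm_nonneg abs_of_nonneg real_norm_def)
  have "opnorm (p N) (ssub (\<lambda>N. \<Phi> N x) (\<lambda>N. \<Phi> N y) N) < e" if N: "K \<le> N" for N
  proof -
    have "ssub (\<lambda>N. \<Phi> N x) (\<lambda>N. \<Phi> N y) N = \<Phi> N (ssub x y)"
      using tail_hom_ssub[OF \<Phi>] by (simp add: ssub_def)
    moreover have "opnorm (p N) (\<Phi> N (ssub x y)) \<le> e / 2"
      using K N by (intro tail_homD(7)[OF \<Phi>]) (meson less_imp_le order_trans)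
    ultimately show ?thesis using e by simp
  qed
  then show "\<exists>K. \<forall>N\<ge>K. norm (opnorm (p N) (ssub (\<lambda>N. \<Phi> N x) (\<lambda>N. \<Phi> N y) N) - 0) < e"
    by (intro exI[of _ K]) simp
qed

lemma tail_hom_prodM:
  assumes \<Phi>: "\<And>N. tail_hom n N (p N) (\<Phi> N)" and x: "x \<in> prodM n"
  shows "(\<lambda>N. \<Phi> N x) \<in> prodM p"
proof -
  obtain B where B: "\<And>k. opnorm (n k) (x k) \<le> B" using prodM_bound[OF x] by metis
  show ?thesis
    using tail_homD(6)[OF \<Phi>] B by (intro prodMI[of _ _ B] tail_homD(7)[OF \<Phi>]) (auto simp: zero_outside_def)
qed

definition tail_map :: "(nat \<Rightarrow> nat) \<Rightarrow> (nat \<Rightarrow> matseq \<Rightarrow> nat \<Rightarrow> nat \<Rightarrow> complex) \<Rightarrow> matseq set \<Rightarrow> matseq set" where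
  "tail_map p \<Phi> X = mq_class p (\<lambda>N. \<Phi> N (mq_rep X))"

lemma tail_map_class:
  assumes \<Phi>: "\<And>N. tail_hom n N (p N) (\<Phi> N)" and x: "x \<in> prodM n"
  shows "tail_map p \<Phi> (mq_class n x) = mq_class p (\<lambda>N. \<Phi> N x)"
  unfolding tail_map_def
  by (rule mq_class_eq_iff[THEN iffD2, OF _ _ sim_sym])
    (intro tail_hom_prodM[OF \<Phi>] tail_hom_sim[OF \<Phi>] mq_rep x)+

lemma tail_map_hom:
  assumes \<Phi>: "\<And>N. tail_hom n N (p N) (\<Phi> N)"
  shows "unital_star_hom (MQ n) (MQ p) (tail_map p \<Phi>)"
proof -
  note cl = tail_map_class[OF \<Phi>]
  note pr = tail_hom_prodM[OF \<Phi>]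
  have raw: "(\<lambda>N. \<Phi> N (sadd x y)) = sadd (\<lambda>N. \<Phi> N x) (\<lambda>N. \<Phi> N y)"
    "(\<lambda>N. \<Phi> N (smul n x y)) = smul p (\<lambda>N. \<Phi> N x) (\<lambda>N. \<Phi> N y)"
    "(\<lambda>N. \<Phi> N (ssm c x)) = ssm c (\<lambda>N. \<Phi> N x)"
    "(\<lambda>N. \<Phi> N (sstar x)) = sstar (\<lambda>N. \<Phi> N x)"
    "(\<lambda>N. \<Phi> N (sone n)) = sone p" for x y c
    by (unfold tail_homD(1-5)[OF \<Phi>], simp_all add: sadd_def smul_def ssm_def sstar_def sone_def)
  show ?thesis
    unfolding unital_star_hom_def MQ_carrier ball_simps
    by (simp add: cl pr raw MQ_add MQ_mult MQ_sm MQ_star MQ_one)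
qed

lemma unital_star_hom_comp:
  "unital_star_hom A B f \<Longrightarrow> unital_star_hom B D g \<Longrightarrow> unital_star_hom A D (g \<circ> f)"
  unfolding unital_star_hom_def by simp

subsection \<open>Vectors with almost equal Gram matrices\<close>

text \<open>The matrix 1 - \<gamma> d d^*, a Householder reflection with a complex factor; the phase
  of \<gamma> accounts for inner products that are not real.\<close>

definition reflection :: "nat \<Rightarrow> complex \<Rightarrow> (nat \<Rightarrow> complex) \<Rightarrow> nat \<Rightarrow> nat \<Rightarrow> complex" where
  "reflection m \<gamma> d = (\<lambda>i j. if i < m \<and> j < m then mid m i j - \<gamma> * d i * cnj (d j) else 0)"

lemma mv_reflection: "i < m \<Longrightarrow> mv m (reflection m \<gamma> d) v i = v i - \<gamma> * cip m v d * d i"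
proof -
  assume i: "i < m"
  have "mv m (reflection m \<gamma> d) v i = (\<Sum>j<m. mid m i j * v j - \<gamma> * d i * (v j * cnj (d j)))"
    unfolding mv_def reflection_def using i by (intro sum.cong) (simp_all add: algebra_simps)
  also have "\<dots> = mv m (mid m) v i - \<gamma> * d i * cip m v d"
    by (simp add: sum_subtractf mv_def cip_def sum_distrib_left)
  finally show ?thesis using i by (simp add: mv_mid mult_ac)
qed

text \<open>Two such matrices with factors \<alpha> and \<beta> are inverse to each other if
  \<alpha> + \<beta> equals \<alpha> \<beta> times the squared norm of d; for conjugate factors this
  is the hypothesis.\<close>

lemma unitary_reflection:
  assumes \<gamma>: "2 * Re \<gamma> = (cmod \<gamma>)\<^sup>2 * (vecnorm m d)\<^sup>2"
  shows "unitary m (reflection m \<gamma> d)"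
proof -
  have adj: "adj (reflection m \<gamma> d) = reflection m (cnj \<gamma>) d" for \<gamma>
    by (intro ext) (auto simp: adj_def reflection_def mid_def)
  have zo: "zero_outside m (reflection m \<gamma> d)" for \<gamma>
    by (simp add: zero_outside_def reflection_def)
  have prod: "mm m (reflection m \<alpha> d) (reflection m \<beta> d) = mid m"
    if "\<alpha> + \<beta> = \<alpha> * \<beta> * of_real ((vecnorm m d)\<^sup>2)" for \<alpha> \<beta>
  proof (intro ext)
    fix i j
    show "mm m (reflection m \<alpha> d) (reflection m \<beta> d) i j = mid m i j"
    proof (cases "i < m \<and> j < m")
      case True
      let ?c = "\<lambda>l. reflection m \<beta> d l j"
      have cip: "cip m ?c d = cnj (d j) - \<beta> * cnj (d j) * of_real ((vecnorm m d)\<^sup>2)"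
      proof -
        have "cip m ?c d = (\<Sum>l<m. (if l = j then cnj (d j) else 0) - \<beta> * cnj (d j) * (d l * cnj (d l)))"
          unfolding cip_def reflection_def mid_def using True by (intro sum.cong) (auto simp: algebra_simps)
        also have "\<dots> = cnj (d j) - \<beta> * cnj (d j) * cip m d d"
          using True by (simp add: sum_subtractf sum_distrib_left[symmetric] cip_def)
        finally show ?thesis by (simp add: cip_self)
      qed
      have "mm m (reflection m \<alpha> d) (reflection m \<beta> d) i j = mv m (reflection m \<alpha> d) ?c i"
        by (simp add: mm_def mv_def)
      also have "\<dots> = ?c i - \<alpha> * cip m ?c d * d i" using True by (intro mv_reflection) simp
      also have "\<dots> = mid m i j - d i * cnj (d j) * ((\<alpha> + \<beta>) - \<alpha> * \<beta> * of_real ((vecnorm m d)\<^sup>2))"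
        unfolding cip using True by (simp add: reflection_def algebra_simps)
      also have "\<dots> = mid m i j" using that by simp
      finally show ?thesis .
    qed (auto simp: mm_def reflection_def mid_def)
  qed
  have "\<gamma> + cnj \<gamma> = of_real (2 * Re \<gamma>)" by (simp add: complex_add_cnj)
  also have "\<dots> = \<gamma> * cnj \<gamma> * of_real ((vecnorm m d)\<^sup>2)"
    unfolding \<gamma> by (simp add: complex_mult_cnj cmod_def)
  finally have *: "\<gamma> + cnj \<gamma> = \<gamma> * cnj \<gamma> * of_real ((vecnorm m d)\<^sup>2)" .
  then have "cnj \<gamma> + \<gamma> = cnj \<gamma> * \<gamma> * of_real ((vecnorm m d)\<^sup>2)" by (simp add: algebra_simps)
  then show ?thesis unfolding unitary_def adj using prod * zo by blast
qed

text \<open>Induction on the number of vectors: the new vector is moved into place by a reflection which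
  almost fixes the previous ones, since these are almost orthogonal to the direction of the
  reflection.\<close>
lemma approx_congruence_step:
  fixes u w :: "nat \<Rightarrow> complex"
  assumes e: "0 < e" and d: "0 < \<delta>" "\<delta> \<le> e\<^sup>2 / 16"
    and norms: "\<bar>(vecnorm m u)\<^sup>2 - (vecnorm m w)\<^sup>2\<bar> \<le> \<delta>"
    and ortho: "\<And>i. i < r \<Longrightarrow> cmod (cip m (\<eta> i) (\<lambda>l. u l - w l)) \<le> e\<^sup>2 / 8"
  shows "\<exists>R. unitary m R \<and> vecnorm m (\<lambda>l. mv m R u l - w l) < e \<and>
     (\<forall>i<r. vecnorm m (\<lambda>l. mv m R (\<eta> i) l - \<eta> i l) \<le> e / 2)"
proof -
  define dd where "dd l = u l - w l" for l
  define D where "D = vecnorm m dd"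
  show ?thesis
  \<comment> \<open>If u is already near w, the identity serves. Otherwise D is bounded below and
    may be divided by.\<close>
  proof (cases "D < e / 2")
    case True
    have "vecnorm m (\<lambda>l. mv m (mid m) u l - w l) = D"
      unfolding D_def dd_def by (intro vecnorm_cong) (simp add: mv_mid)
    moreover have "vecnorm m (\<lambda>l. mv m (mid m) (\<eta> i) l - \<eta> i l) = vecnorm m (\<lambda>l. 0)" for i
      by (intro vecnorm_cong) (simp add: mv_mid)
    ultimately show ?thesis using True e by (intro exI[of _ "mid m"]) (simp add: unitary_mid)
  next
    case False
    then have D: "D > 0" "e / 2 \<le> D" using e by auto
    \<comment> \<open>The reflection would send u exactly to w for \<gamma> = 1 / <u, u - w>. As u
      and w have nearly equal norms, the real part of <u, u - w> is close to D^2/2; replacing it by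
      this value makes the reflection unitary.\<close>
    define z where "z = Complex (D\<^sup>2 / 2) (Im (cip m u dd))"
    define \<gamma> where "\<gamma> = 1 / z"
    have z: "D\<^sup>2 / 2 \<le> cmod z" using abs_Re_le_cmod[of z] by (simp add: z_def)
    have z0: "z \<noteq> 0" using D by (auto simp: z_def complex_eq_iff)
    have \<gamma>_le: "cmod \<gamma> \<le> 2 / D\<^sup>2"
    proof -
      have "cmod \<gamma> = 1 / cmod z" by (simp add: \<gamma>_def norm_divide)
      also have "\<dots> \<le> 1 / (D\<^sup>2 / 2)" using z z0 D by (intro divide_left_mono) simp_all
      finally show ?thesis by simp
    qed
    have "Re \<gamma> = (D\<^sup>2 / 2) / (cmod z)\<^sup>2" by (simp add: \<gamma>_def Re_divide z_def cmod_power2)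
    then have "2 * Re \<gamma> = (cmod \<gamma>)\<^sup>2 * (vecnorm m dd)\<^sup>2"
      by (simp add: \<gamma>_def norm_divide D_def power_divide)
    then have U: "unitary m (reflection m \<gamma> dd)" by (rule unitary_reflection)
    have cud: "cip m u dd = of_real ((vecnorm m u)\<^sup>2) - cip m u w"
      unfolding dd_def[abs_def] by (simp add: cip_diff_right cip_self)
    have "D\<^sup>2 = Re (cip m dd dd)" by (simp add: D_def vecnorm_eq_cip)
    also have "\<dots> = (vecnorm m u)\<^sup>2 - 2 * Re (cip m u w) + (vecnorm m w)\<^sup>2"
      unfolding dd_def[abs_def] using cip_commute[of m w u]
      by (simp add: cip_diff_right cip_diff_left vecnorm_eq_cip)
    finally have "z - cip m u dd = of_real (((vecnorm m w)\<^sup>2 - (vecnorm m u)\<^sup>2) / 2)"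
      using cud by (simp add: z_def complex_eq_iff field_simps)
    then have "cmod (z - cip m u dd) = \<bar>((vecnorm m w)\<^sup>2 - (vecnorm m u)\<^sup>2) / 2\<bar>"
      by (simp only: norm_of_real)
    then have zc: "cmod (z - cip m u dd) \<le> \<delta> / 2" using norms by simp
    have "vecnorm m (\<lambda>l. mv m (reflection m \<gamma> dd) u l - w l) = vecnorm m (\<lambda>l. (\<gamma> * (z - cip m u dd)) * dd l)"
      using z0 by (intro vecnorm_cong) (simp add: mv_reflection \<gamma>_def dd_def field_simps)
    also have "\<dots> = cmod \<gamma> * cmod (z - cip m u dd) * D" by (simp add: norm_mult D_def)
    also have "\<dots> \<le> 2 / D\<^sup>2 * (\<delta> / 2) * D" using \<gamma>_le zc D d by (intro mult_mono) simp_all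
    also have "\<dots> = \<delta> / D" using D by (simp add: power2_eq_square)
    also have "\<dots> \<le> \<delta> / (e / 2)" using D d e by (intro divide_left_mono) simp_all
    also have "\<dots> \<le> (e\<^sup>2 / 16) / (e / 2)" using d e by (intro divide_right_mono) simp_all
    also have "\<dots> < e" using e by (simp add: power2_eq_square)
    finally have 1: "vecnorm m (\<lambda>l. mv m (reflection m \<gamma> dd) u l - w l) < e" .
    have 2: "vecnorm m (\<lambda>l. mv m (reflection m \<gamma> dd) (\<eta> i) l - \<eta> i l) \<le> e / 2" if i: "i < r" for i
    proof -
      have "vecnorm m (\<lambda>l. mv m (reflection m \<gamma> dd) (\<eta> i) l - \<eta> i l)
          = vecnorm m (\<lambda>l. (- \<gamma> * cip m (\<eta> i) dd) * dd l)"
        by (intro vecnorm_cong) (simp add: mv_reflection)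
      also have "\<dots> = cmod \<gamma> * cmod (cip m (\<eta> i) dd) * D" by (simp only: vecnorm_scale) (simp add: norm_mult D_def)
      also have "\<dots> \<le> 2 / D\<^sup>2 * (e\<^sup>2 / 8) * D"
        using \<gamma>_le ortho[OF i] D by (intro mult_mono) (simp_all add: dd_def[abs_def])
      also have "\<dots> = e\<^sup>2 / 4 / D" using D by (simp add: power2_eq_square)
      also have "\<dots> \<le> e\<^sup>2 / 4 / (e / 2)" using D e by (intro divide_left_mono) simp_all
      also have "\<dots> = e / 2" using e by (simp add: power2_eq_square)
      finally show ?thesis .
    qed
    show ?thesis using U 1 2 by blast
  qed
qed

text \<open>The tolerance \<delta> is chosen before the dimension m and depends on r, C and e only.
  This order matters, since models get their dimension after the accuracy is fixed.\<close>

lemma approx_congruence: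
  fixes C e :: real and r :: nat
  assumes C: "0 \<le> C"
  shows "0 < e \<Longrightarrow> \<exists>\<delta>>0. \<forall>m \<xi> \<eta>. (\<forall>i<r. vecnorm m (\<xi> i) \<le> C \<and> vecnorm m (\<eta> i) \<le> C) \<longrightarrow>
     (\<forall>i<r. \<forall>j<r. cmod (cip m (\<xi> i) (\<xi> j) - cip m (\<eta> i) (\<eta> j)) < \<delta>) \<longrightarrow>
     (\<exists>U. unitary m U \<and> (\<forall>i<r. vecnorm m (\<lambda>l. mv m U (\<xi> i) l - \<eta> i l) < e))"
proof (induction r arbitrary: e)
  case 0
  then show ?case using unitary_mid by (intro exI[of _ 1]) auto
next
  case (Suc r)
  \<comment> \<open>e/4 leaves room for the e/2 by which the reflection may move earlier vectors.
    The other bound gives e' C <= e^2/16, which together with \<delta> <= e^2/16 meets the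
    near-orthogonality e^2/8 required by the reflection step; C + 1 keeps the denominator
    positive.\<close>
  define e' where "e' = min (e / 4) (e\<^sup>2 / (16 * (C + 1)))"
  have C1: "16 * (C + 1) > 0" using C by simp
  have e': "e' > 0" "e' \<le> e / 4" "e' * C \<le> e\<^sup>2 / 16"
  proof -
    show "e' > 0" unfolding e'_def using Suc.prems C1 by simp
    show "e' \<le> e / 4" unfolding e'_def by (rule min.cobounded1)
    have "e' * C \<le> e\<^sup>2 / (16 * (C + 1)) * C" using C by (intro mult_right_mono) (simp_all add: e'_def)
    also have "\<dots> \<le> e\<^sup>2 / (16 * (C + 1)) * (C + 1)" using C by (intro mult_left_mono) simp_all
    also have "\<dots> = e\<^sup>2 / 16"
    proof -
      have "e\<^sup>2 / (16 * c) * c = e\<^sup>2 / 16" if "c > 0" for c :: real using that by simp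
      from this[of "C + 1"] show ?thesis using C by linarith
    qed
    finally show "e' * C \<le> e\<^sup>2 / 16" .
  qed
  obtain \<delta>' where \<delta>': "\<delta>' > 0" "\<And>m \<xi> \<eta>. (\<forall>i<r. vecnorm m (\<xi> i) \<le> C \<and> vecnorm m (\<eta> i) \<le> C) \<Longrightarrow>
     (\<forall>i<r. \<forall>j<r. cmod (cip m (\<xi> i) (\<xi> j) - cip m (\<eta> i) (\<eta> j)) < \<delta>') \<Longrightarrow>
     (\<exists>U. unitary m U \<and> (\<forall>i<r. vecnorm m (\<lambda>l. mv m U (\<xi> i) l - \<eta> i l) < e'))"
    using Suc.IH[OF e'(1)] by blast
  define \<delta> where "\<delta> = min \<delta>' (e\<^sup>2 / 16)"
  have \<delta>: "\<delta> > 0" "\<delta> \<le> \<delta>'" "\<delta> \<le> e\<^sup>2 / 16" using \<delta>'(1) Suc.prems by (simp_all add: \<delta>_def)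
  have "\<exists>U. unitary m U \<and> (\<forall>i<Suc r. vecnorm m (\<lambda>l. mv m U (\<xi> i) l - \<eta> i l) < e)"
    if b: "\<forall>i<Suc r. vecnorm m (\<xi> i) \<le> C \<and> vecnorm m (\<eta> i) \<le> C"
      and g: "\<forall>i<Suc r. \<forall>j<Suc r. cmod (cip m (\<xi> i) (\<xi> j) - cip m (\<eta> i) (\<eta> j)) < \<delta>" for m \<xi> \<eta>
  proof -
    have "\<forall>i<r. \<forall>j<r. cmod (cip m (\<xi> i) (\<xi> j) - cip m (\<eta> i) (\<eta> j)) < \<delta>'"
      using g \<delta>(2) by (meson less_SucI order_less_le_trans)
    then obtain V where V: "unitary m V" "\<And>i. i < r \<Longrightarrow> vecnorm m (\<lambda>l. mv m V (\<xi> i) l - \<eta> i l) < e'"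
      using \<delta>'(2)[of m \<xi> \<eta>] b by auto
    define u where "u = mv m V (\<xi> r)"
    have u: "vecnorm m u \<le> C" using b V by (simp add: u_def vecnorm_unitary)
    have "cip m u u = cip m (\<xi> r) (\<xi> r)" using V by (simp add: u_def cip_unitary)
    then have "cmod (of_real ((vecnorm m u)\<^sup>2) - of_real ((vecnorm m (\<eta> r))\<^sup>2)) < \<delta>"
      using g by (simp add: cip_self[symmetric] del: of_real_power)
    then have norms: "\<bar>(vecnorm m u)\<^sup>2 - (vecnorm m (\<eta> r))\<^sup>2\<bar> \<le> \<delta>"
      by (simp only: of_real_diff[symmetric] norm_of_real)
    \<comment> \<open>V preserves inner products and moves \<open>\<xi> i\<close> close to
      \<open>\<eta> i\<close>, so the Gram hypothesis says that \<open>\<eta> i\<close> pairs almost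
      equally with u and with the target \<open>\<eta> r\<close>.\<close>
    have ortho: "cmod (cip m (\<eta> i) (\<lambda>l. u l - \<eta> r l)) \<le> e\<^sup>2 / 8" if i: "i < r" for i
    proof -
      have "cip m (\<eta> i) (\<lambda>l. u l - \<eta> r l) =
        (cip m (\<xi> i) (\<xi> r) - cip m (\<eta> i) (\<eta> r)) - cip m (\<lambda>l. mv m V (\<xi> i) l - \<eta> i l) u"
        using cip_unitary[OF V(1), of "\<xi> i" "\<xi> r"] by (simp add: cip_diff_right cip_diff_left u_def)
      then have "cmod (cip m (\<eta> i) (\<lambda>l. u l - \<eta> r l)) \<le>
          cmod (cip m (\<xi> i) (\<xi> r) - cip m (\<eta> i) (\<eta> r)) + cmod (cip m (\<lambda>l. mv m V (\<xi> i) l - \<eta> i l) u)"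
        by (simp only: norm_triangle_ineq4)
      also have "\<dots> \<le> \<delta> + e' * C"
      proof (intro add_mono)
        show "cmod (cip m (\<xi> i) (\<xi> r) - cip m (\<eta> i) (\<eta> r)) \<le> \<delta>" using g i by (simp add: less_imp_le)
        have "cmod (cip m (\<lambda>l. mv m V (\<xi> i) l - \<eta> i l) u) \<le> vecnorm m (\<lambda>l. mv m V (\<xi> i) l - \<eta> i l) * vecnorm m u"
          by (rule cip_cauchy)
        also have "\<dots> \<le> e' * C" using V(2)[OF i] u e' by (intro mult_mono) simp_all
        finally show "cmod (cip m (\<lambda>l. mv m V (\<xi> i) l - \<eta> i l) u) \<le> e' * C" .
      qed
      also have "\<dots> \<le> e\<^sup>2 / 8" using \<delta> e' by simp
      finally show ?thesis .
    qed
    obtain R where R: "unitary m R" "vecnorm m (\<lambda>l. mv m R u l - \<eta> r l) < e"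
      "\<And>i. i < r \<Longrightarrow> vecnorm m (\<lambda>l. mv m R (\<eta> i) l - \<eta> i l) \<le> e / 2"
      using approx_congruence_step[where \<eta> = \<eta> and r = r, OF Suc.prems \<delta>(1,3) norms ortho] by blast
    have "vecnorm m (\<lambda>l. mv m (mm m R V) (\<xi> i) l - \<eta> i l) < e" if i: "i < Suc r" for i
    proof (cases "i = r")
      case True
      then show ?thesis using R(2) by (simp add: mv_mm u_def)
    next
      case False
      then have i: "i < r" using i by simp
      have "vecnorm m (\<lambda>l. mv m R (mv m V (\<xi> i)) l - \<eta> i l) \<le>
          vecnorm m (\<lambda>l. mv m R (mv m V (\<xi> i)) l - mv m R (\<eta> i) l) + vecnorm m (\<lambda>l. mv m R (\<eta> i) l - \<eta> i l)"
        by (rule vecnorm_diff3)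
      also have "vecnorm m (\<lambda>l. mv m R (mv m V (\<xi> i)) l - mv m R (\<eta> i) l)
          = vecnorm m (mv m R (\<lambda>l. mv m V (\<xi> i) l - \<eta> i l))"
        by (simp add: mv_diff)
      also have "\<dots> < e'" using V(2)[OF i] R(1) by (simp add: vecnorm_unitary)
      finally show ?thesis using R(3)[OF i] e'(2) Suc.prems by (simp add: mv_mm)
    qed
    then show ?thesis using unitary_mm[OF R(1) V(1)] by blast
  qed
  then show ?case using \<delta>(1) by blast
qed

subsection \<open>Positivity of block matrices\<close>

lemma MQ_algebra: "cstar_algebra (MQ n)"
  by (rule cstar_algebra.intro, rule MQ_cstar)

lemma class_rep:
  assumes "X \<in> cs_carrier (MQ n)"
  shows "mq_rep X \<in> prodM n" "mq_class n (mq_rep X) = X"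
proof -
  obtain x where x: "x \<in> prodM n" "X = mq_class n x" using assms by (auto simp: MQ_carrier)
  then show "mq_rep X \<in> prodM n" using mq_rep by simp
  then show "mq_class n (mq_rep X) = X"
    using x mq_rep[OF x(1)] by (simp add: mq_class_eq_iff sim_sym)
qed

text \<open>This is Y^2 <= B Y for 0 <= Y <= B. It follows from nonnegativity of the form at the
  test vector v - Y v / B.\<close>

lemma posdef_bound:
  assumes herm: "adj Y = Y" and pos: "\<And>v. 0 \<le> Re (cip m (mv m Y v) v)" and B: "opnorm m Y \<le> B" "0 < B"
  shows "(vecnorm m (mv m Y v))\<^sup>2 \<le> B * Re (cip m (mv m Y v) v)"
proof -
  let ?w = "mv m Y v"
  define s where "s = 1 / B"
  have s: "s > 0" "s * B = 1" using B by (simp_all add: s_def)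
  define z where "z l = v l - of_real s * ?w l" for l
  have vw: "cip m (mv m Y ?w) v = cip m ?w ?w" using cip_adj[of m Y ?w v] herm by simp
  have "cip m (mv m Y z) z = cip m ?w v - of_real s * cip m (mv m Y ?w) v
      - of_real s * cip m ?w ?w + of_real (s * s) * cip m (mv m Y ?w) ?w"
    unfolding z_def[abs_def] mv_diff mv_scale cip_diff_left cip_diff_right cip_scale_left cip_scale_right
    by (simp add: algebra_simps)
  then have "Re (cip m (mv m Y z) z) = Re (cip m ?w v) - 2 * s * (vecnorm m ?w)\<^sup>2 + s * s * Re (cip m (mv m Y ?w) ?w)"
    unfolding vw by (simp add: cip_self)
  moreover have "Re (cip m (mv m Y ?w) ?w) \<le> B * (vecnorm m ?w)\<^sup>2"
  proof -
    have "Re (cip m (mv m Y ?w) ?w) \<le> vecnorm m (mv m Y ?w) * vecnorm m ?w"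
      using complex_Re_le_cmod cip_cauchy order_trans by blast
    also have "\<dots> \<le> opnorm m Y * vecnorm m ?w * vecnorm m ?w" by (intro mult_right_mono opnorm_bound) simp
    also have "\<dots> \<le> B * vecnorm m ?w * vecnorm m ?w" using B by (intro mult_right_mono) simp_all
    finally show ?thesis by (simp add: power2_eq_square mult.assoc)
  qed
  then have "s * s * Re (cip m (mv m Y ?w) ?w) \<le> s * s * (B * (vecnorm m ?w)\<^sup>2)"
    using s by (intro mult_left_mono) simp_all
  moreover have "s * s * (B * (vecnorm m ?w)\<^sup>2) = s * (vecnorm m ?w)\<^sup>2"
    using s(2) by (simp add: mult.assoc[symmetric] mult.commute)
  ultimately have "s * (vecnorm m ?w)\<^sup>2 \<le> Re (cip m ?w v)" using pos[of z] by linarith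
  then have "B * (s * (vecnorm m ?w)\<^sup>2) \<le> B * Re (cip m ?w v)" using B by (intro mult_left_mono) simp_all
  then show ?thesis using s(2) by (simp add: mult.assoc[symmetric] mult.commute)
qed

text \<open>A positive semidefinite matrix Y of norm at most B satisfies |B - Y| <= B, which is the
  metric form of positivity. The entries of index below K do not affect the limsup.\<close>

lemma MQ_cpos_of_posdef:
  assumes Y: "Y \<in> prodM n" and herm: "sstar Y = Y"
    and pos: "\<And>k v. K \<le> k \<Longrightarrow> 0 \<le> Re (cip (n k) (mv (n k) (Y k) v) v)"
  shows "cstar_algebra.cpos (MQ n) (mq_class n Y)"
proof -
  interpret Q: cstar_algebra "MQ n" by (rule MQ_algebra)
  obtain B0 where B0: "\<And>k. opnorm (n k) (Y k) \<le> B0" using prodM_bound[OF Y] by metis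
  define B where "B = max B0 1"
  have B: "0 < B" "\<And>k. opnorm (n k) (Y k) \<le> B" using B0 by (auto simp: B_def intro: le_max_iff_disj[THEN iffD2])
  have hk: "adj (Y k) = Y k" for k using herm by (metis sstar_def)
  have le: "opnorm (n k) (ssub (ssm (of_real B) (sone n)) Y k) \<le> B" if k: "K \<le> k" for k
  proof (rule opnorm_le)
    fix v
    let ?m = "n k" and ?w = "mv (n k) (Y k) v"
    have "vecnorm ?m (mv ?m (ssub (ssm (of_real B) (sone n)) Y k) v) = vecnorm ?m (\<lambda>i. of_real B * v i - ?w i)"
    proof (rule vecnorm_cong)
      fix i assume i: "i < ?m"
      have "mv ?m (ssub (ssm (of_real B) (sone n)) Y k) v i = of_real B * mv ?m (mid ?m) v i - ?w i"
        by (simp add: mv_def ssub_def ssm_def sone_def algebra_simps sum_subtractf sum_distrib_left)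
      then show "mv ?m (ssub (ssm (of_real B) (sone n)) Y k) v i = of_real B * v i - ?w i"
        using i by (simp add: mv_mid)
    qed
    \<comment> \<open>In the expansion of |B v - w|^2 the term |w|^2, at most B <w, v> by
      \<open>posdef_bound\<close>, is outweighed by the mixed term 2 B <w, v>.\<close>
    also have "\<dots> \<le> B * vecnorm ?m v"
    proof (rule power2_le_imp_le)
      have "cip ?m (\<lambda>i. of_real B * v i - ?w i) (\<lambda>i. of_real B * v i - ?w i)
        = of_real (B * B) * cip ?m v v - of_real B * cip ?m v ?w - of_real B * cip ?m ?w v + cip ?m ?w ?w"
        unfolding cip_diff_left cip_diff_right cip_scale_left cip_scale_right by (simp add: algebra_simps)
      then have "(vecnorm ?m (\<lambda>i. of_real B * v i - ?w i))\<^sup>2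
        = B * B * (vecnorm ?m v)\<^sup>2 - 2 * B * Re (cip ?m ?w v) + (vecnorm ?m ?w)\<^sup>2"
        unfolding vecnorm_eq_cip using cip_commute[of ?m v ?w] by simp
      moreover have "(vecnorm ?m ?w)\<^sup>2 \<le> B * Re (cip ?m ?w v)"
        using hk pos[OF k] B by (intro posdef_bound) simp_all
      moreover have "0 \<le> B * Re (cip ?m ?w v)" using B pos[OF k] by (intro mult_nonneg_nonneg) simp_all
      ultimately show "(vecnorm ?m (\<lambda>i. of_real B * v i - ?w i))\<^sup>2 \<le> (B * vecnorm ?m v)\<^sup>2"
        by (simp add: power2_eq_square algebra_simps)
    qed (use B in simp)
    finally show "vecnorm ?m (mv ?m (ssub (ssm (of_real B) (sone n)) Y k) v) \<le> B * vecnorm ?m v" .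
  qed (use B in simp)
  have "sn n (ssub (ssm (of_real B) (sone n)) Y) \<le> B"
    unfolding sn_le[OF prodM_ssub[OF prodM_ssm[OF prodM_sone] Y]]
  proof (intro allI impI)
    fix e :: real assume "e > 0"
    then show "\<forall>\<^sub>F k in sequentially. opnorm (n k) (ssub (ssm (of_real B) (sone n)) Y k) < B + e"
      unfolding eventually_sequentially using le by (intro exI[of _ K]) fastforce
  qed
  then show ?thesis
    using Y herm by (intro Q.cposI[of _ B]) (simp_all add: MQ_carrier MQ_star MQ_one MQ_sm MQ_norm_sub_le)
qed

lemma sum_lessThan_add: "(\<Sum>t<a + m. g t) = (\<Sum>t<a. g t) + (\<Sum>\<beta><m::nat. g (a + \<beta>) :: 'b::comm_monoid_add)"
  by (induction m) (simp_all add: add.assoc)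

lemma sum_split: "(\<Sum>t<r * m. g t) = (\<Sum>j<r. \<Sum>\<beta><m::nat. g (j * m + \<beta>) :: 'b::comm_monoid_add)"
proof (induction r)
  case (Suc r)
  have "Suc r * m = r * m + m" by simp
  then show ?case by (simp only: sum_lessThan_add Suc.IH sum.lessThan_Suc)
qed simp

lemma block_index_less: "j < r \<Longrightarrow> \<beta> < m \<Longrightarrow> j * m + \<beta> < r * (m::nat)"
proof -
  assume "j < r" "\<beta> < m"
  then have "j * m + \<beta> < Suc j * m" by simp
  also have "\<dots> \<le> r * m" using \<open>j < r\<close> by (intro mult_le_mono1) simp
  finally show ?thesis .
qed

text \<open>The r x r matrices over the quotient are realised as the quotient for the dimensions r
  n_k, and this extracts one entry. Zeros outside n_k keep the result in
  \<open>prodM n\<close>.\<close>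

definition blk :: "(nat \<Rightarrow> nat) \<Rightarrow> nat \<Rightarrow> nat \<Rightarrow> matseq \<Rightarrow> matseq" where
  "blk n i j Z = (\<lambda>k \<alpha> \<beta>. if \<alpha> < n k \<and> \<beta> < n k then Z k (i * n k + \<alpha>) (j * n k + \<beta>) else 0)"

lemma vecnorm_block_le:
  assumes "i < r"
  shows "vecnorm m (\<lambda>\<alpha>. v (i * m + \<alpha>)) \<le> vecnorm (r * m) v"
proof (rule power2_le_imp_le)
  have "(\<Sum>\<alpha><m. (cmod (v (i * m + \<alpha>)))\<^sup>2) \<le> (\<Sum>j<r. \<Sum>\<alpha><m. (cmod (v (j * m + \<alpha>)))\<^sup>2)"
    using assms by (intro member_le_sum[of i]) (auto intro: sum_nonneg)
  then show "(vecnorm m (\<lambda>\<alpha>. v (i * m + \<alpha>)))\<^sup>2 \<le> (vecnorm (r * m) v)\<^sup>2"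
    by (simp add: vecnorm_sq sum_split)
qed simp

text \<open>The vector v is placed in block j of a long vector V of the same norm; its image under
  the block is then block i of Z V.\<close>

lemma opnorm_blk:
  assumes i: "i < r" and j: "j < r"
  shows "opnorm (n k) (blk n i j Z k) \<le> opnorm (r * n k) (Z k)"
proof (rule opnorm_le)
  fix v :: "nat \<Rightarrow> complex"
  let ?m = "n k"
  define V where "V t = (if j * ?m \<le> t \<and> t < j * ?m + ?m then v (t - j * ?m) else 0)" for t
  have Vb: "V (l * ?m + \<beta>) = (if l = j then v \<beta> else 0)" if "\<beta> < ?m" for l \<beta>
  proof -
    have "l = j" if "j * ?m \<le> l * ?m + \<beta>" "l * ?m + \<beta> < j * ?m + ?m"
    proof -
      have "(l * ?m + \<beta>) div ?m = j" using that by (intro div_nat_eqI) (simp_all add: mult.commute)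
      then show ?thesis using \<open>\<beta> < ?m\<close> by simp
    qed
    then show ?thesis using that by (auto simp: V_def)
  qed
  have "(vecnorm (r * ?m) V)\<^sup>2 = (\<Sum>l<r. if l = j then (vecnorm ?m v)\<^sup>2 else 0)"
    unfolding vecnorm_sq sum_split by (intro sum.cong refl) (simp add: Vb)
  then have nV: "vecnorm (r * ?m) V = vecnorm ?m v" using j by (simp add: power2_eq_iff_nonneg)
  have "vecnorm ?m (mv ?m (blk n i j Z k) v) = vecnorm ?m (\<lambda>\<alpha>. mv (r * ?m) (Z k) V (i * ?m + \<alpha>))"
  proof (rule vecnorm_cong)
    fix \<alpha> assume \<alpha>: "\<alpha> < ?m"
    have "mv (r * ?m) (Z k) V (i * ?m + \<alpha>)
        = (\<Sum>l<r. if l = j then \<Sum>\<beta><?m. Z k (i * ?m + \<alpha>) (j * ?m + \<beta>) * v \<beta> else 0)"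
      unfolding mv_def sum_split by (intro sum.cong refl) (simp add: Vb)
    then show "mv ?m (blk n i j Z k) v \<alpha> = mv (r * ?m) (Z k) V (i * ?m + \<alpha>)"
      using j \<alpha> by (simp add: mv_def blk_def)
  qed
  also have "\<dots> \<le> vecnorm (r * ?m) (mv (r * ?m) (Z k) V)" using i by (rule vecnorm_block_le)
  also have "\<dots> \<le> opnorm (r * ?m) (Z k) * vecnorm ?m v" using opnorm_bound[of "r * ?m" "Z k" V] nV by simp
  finally show "vecnorm ?m (mv ?m (blk n i j Z k) v) \<le> opnorm (r * ?m) (Z k) * vecnorm ?m v" .
qed simp

lemma prodM_blk:
  assumes "i < r" "j < r" and Z: "Z \<in> prodM (\<lambda>k. r * n k)"
  shows "blk n i j Z \<in> prodM n"
proof -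
  obtain B where B: "\<And>k. opnorm (r * n k) (Z k) \<le> B" using prodM_bound[OF Z] by metis
  show ?thesis
  proof (rule prodMI)
    show "opnorm (n k) (blk n i j Z k) \<le> B" for k using opnorm_blk[OF assms(1,2), of n k Z] B[of k] by linarith
  qed (auto simp: blk_def)
qed

lemma blk_ssub: "blk n i j (ssub Z W) = ssub (blk n i j Z) (blk n i j W)"
  by (intro ext) (simp add: blk_def ssub_def)

lemma blk_sadd: "blk n i j (sadd Z W) = sadd (blk n i j Z) (blk n i j W)"
  by (intro ext) (simp add: blk_def sadd_def)

lemma blk_ssm: "blk n i j (ssm c Z) = ssm c (blk n i j Z)"
  by (intro ext) (simp add: blk_def ssm_def)

lemma blk_sstar: "blk n i j (sstar Z) = sstar (blk n j i Z)"
  by (intro ext) (auto simp: blk_def sstar_def adj_def)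

lemma blk_sone:
  assumes "i < r" "j < r"
  shows "blk n i j (sone (\<lambda>k. r * n k)) = (if i = j then sone n else (\<lambda>k \<alpha> \<beta>. 0))"
proof (intro ext)
  fix k \<alpha> \<beta>
  have "i = j \<and> \<alpha> = \<beta>" if "i * n k + \<alpha> = j * n k + \<beta>" "\<alpha> < n k" "\<beta> < n k"
  proof -
    have "(i * n k + \<alpha>) div n k = (j * n k + \<beta>) div n k" using that(1) by simp
    then have "i = j" using that(2,3) by simp
    then show ?thesis using that(1) by simp
  qed
  then show "blk n i j (sone (\<lambda>k. r * n k)) k \<alpha> \<beta> = (if i = j then sone n else (\<lambda>k \<alpha> \<beta>. 0)) k \<alpha> \<beta>"
    using block_index_less[OF assms(1), of \<alpha> "n k"] by (auto simp: blk_def sone_def mid_def)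
qed

primrec ssum :: "(nat \<Rightarrow> matseq) \<Rightarrow> nat \<Rightarrow> matseq" where
  "ssum g 0 = (\<lambda>k \<alpha> \<beta>. 0)"
| "ssum g (Suc m) = sadd (ssum g m) (g m)"

lemma ssum_apply: "ssum g m k \<alpha> \<beta> = (\<Sum>l<m. g l k \<alpha> \<beta>)"
  by (induction m) (simp_all add: sadd_def)

lemma prodM_ssum: "(\<And>l. l < m \<Longrightarrow> g l \<in> prodM n) \<Longrightarrow> ssum g m \<in> prodM n"
  by (induction m) simp_all

lemma blk_smul:
  "blk n i j (smul (\<lambda>k. r * n k) Z W) = ssum (\<lambda>l. smul n (blk n i l Z) (blk n l j W)) r"
proof (intro ext)
  fix k \<alpha> \<beta>
  show "blk n i j (smul (\<lambda>k. r * n k) Z W) k \<alpha> \<beta> = ssum (\<lambda>l. smul n (blk n i l Z) (blk n l j W)) r k \<alpha> \<beta>"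
    by (auto simp: ssum_apply blk_def smul_def mm_def sum_split)
qed

lemma sim_blk:
  assumes "i < r" "j < r" "sim (\<lambda>k. r * n k) Z W"
  shows "sim n (blk n i j Z) (blk n i j W)"
proof (rule sim_from_bound)
  show "opnorm (n k) (ssub (blk n i j Z) (blk n i j W) k) \<le> opnorm (r * n k) (ssub Z W k)" for k
    unfolding blk_ssub[symmetric] by (rule opnorm_blk[OF assms(1,2)])
qed (use assms(3) in \<open>simp add: sim_def\<close>)

lemma sn_blk:
  assumes "i < r" "j < r" and Z: "Z \<in> prodM (\<lambda>k. r * n k)"
  shows "sn n (blk n i j Z) \<le> sn (\<lambda>k. r * n k) Z"
  unfolding sn_le[OF prodM_blk[OF assms]]
proof (intro allI impI)
  fix e :: real assume "e > 0"
  from sn_eventually[OF Z this]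
  show "\<forall>\<^sub>F k in sequentially. opnorm (n k) (blk n i j Z k) < sn (\<lambda>k. r * n k) Z + e"
    by eventually_elim (rule le_less_trans[OF opnorm_blk[OF assms(1,2)]])
qed

context cstar_algebra
begin

primrec csum :: "(nat \<Rightarrow> 'a) \<Rightarrow> nat \<Rightarrow> 'a" where
  "csum g 0 = \<zero>"
| "csum g (Suc m) = csum g m \<oplus> g m"

lemma csum_closed [simp]: "(\<And>l. l < m \<Longrightarrow> g l \<in> C) \<Longrightarrow> csum g m \<in> C"
  by (induction m) simp_all

lemma csum_mult:
  "(\<And>l. l < m \<Longrightarrow> g l \<in> C) \<Longrightarrow> y \<in> C \<Longrightarrow> csum g m \<otimes> y = csum (\<lambda>l. g l \<otimes> y) m"
  "(\<And>l. l < m \<Longrightarrow> g l \<in> C) \<Longrightarrow> y \<in> C \<Longrightarrow> y \<otimes> csum g m = csum (\<lambda>l. y \<otimes> g l) m"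
  by (induction m) (simp_all add: distl distr)

lemma csum_star: "(\<And>l. l < m \<Longrightarrow> g l \<in> C) \<Longrightarrow> \<star> (csum g m) = csum (\<lambda>l. \<star> (g l)) m"
  by (induction m) simp_all

lemma csum_cong: "(\<And>l. l < m \<Longrightarrow> g l = h l) \<Longrightarrow> csum g m = csum h m"
  by (induction m) simp_all

lemma stateD:
  assumes "is_state F"
  shows "x \<in> C \<Longrightarrow> y \<in> C \<Longrightarrow> F (x \<oplus> y) = F x + F y" "x \<in> C \<Longrightarrow> F (c \<odot> x) = c * F x"
    "x \<in> C \<Longrightarrow> F (\<star> x) = cnj (F x)" "x \<in> C \<Longrightarrow> 0 \<le> Re (F (\<star> x \<otimes> x))" "F \<one> = 1"
  using assms unfolding is_state_def by blast+

lemma state_csum: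
  assumes F: "is_state F"
  shows "(\<And>l. l < m \<Longrightarrow> g l \<in> C) \<Longrightarrow> F (csum g m) = (\<Sum>l<m. F (g l))"
proof (induction m)
  case 0
  show ?case using stateD(2)[OF F, of \<zero> 0] by simp
qed (simp add: stateD(1)[OF F])

end

lemma (in cstar_hom) hom_csum: "(\<And>l. l < m \<Longrightarrow> g l \<in> A.C) \<Longrightarrow> \<phi> (A.csum g m) = B.csum (\<lambda>l. \<phi> (g l)) m"
  by (induction m) simp_all

lemma MQ_csum:
  "(\<And>l. l < m \<Longrightarrow> g l \<in> prodM n) \<Longrightarrow> cstar_algebra.csum (MQ n) (\<lambda>l. mq_class n (g l)) m = mq_class n (ssum g m)"
proof (induction m)
  case 0
  interpret Q: cstar_algebra "MQ n" by (rule MQ_algebra)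
  show ?case by (simp add: MQ_zero)
next
  case (Suc m)
  interpret Q: cstar_algebra "MQ n" by (rule MQ_algebra)
  show ?case using Suc by (simp add: MQ_add prodM_ssum)
qed

locale mf_embedding = cstar_hom A "MQ n" \<phi> for A :: "'a cstar" and n :: "nat \<Rightarrow> nat" and \<phi> +
  assumes inj: "inj_on \<phi> A.C" and npos: "\<And>k. 0 < n k"
begin

definition lift :: "'a \<Rightarrow> matseq" where
  "lift a = mq_rep (\<phi> a)"

lemma lift: "a \<in> A.C \<Longrightarrow> lift a \<in> prodM n" "a \<in> A.C \<Longrightarrow> mq_class n (lift a) = \<phi> a"
  unfolding lift_def using class_rep hom_closed by blast+

text \<open>The subalgebra \<open>M\<^sub>r(A)\<close> of the quotient for the dimensions \<open>r n\<^sub>k\<close>.\<close>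
definition MrA :: "nat \<Rightarrow> matseq set set" where
  "MrA r = {X \<in> cs_carrier (MQ (\<lambda>k. r * n k)). \<forall>i<r. \<forall>j<r. mq_class n (blk n i j (mq_rep X)) \<in> \<phi> ` A.C}"

lemma blk_class:
  assumes "i < r" "j < r" "Z \<in> prodM (\<lambda>k. r * n k)"
  shows "mq_class n (blk n i j (mq_rep (mq_class (\<lambda>k. r * n k) Z))) = mq_class n (blk n i j Z)"
  using assms mq_rep[OF assms(3)]
  by (subst mq_class_eq_iff) (auto intro!: prodM_blk sim_blk sim_sym[OF mq_rep(2)])

lemma class_in_MrA:
  assumes "Z \<in> prodM (\<lambda>k. r * n k)"
  shows "mq_class (\<lambda>k. r * n k) Z \<in> MrA r \<longleftrightarrow> (\<forall>i<r. \<forall>j<r. mq_class n (blk n i j Z) \<in> \<phi> ` A.C)"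
  unfolding MrA_def using assms blk_class[OF _ _ assms] by (simp add: MQ_carrier)

lemma MrA_cases:
  assumes "X \<in> MrA r"
  obtains Z where "Z \<in> prodM (\<lambda>k. r * n k)" "X = mq_class (\<lambda>k. r * n k) Z"
    "\<And>i j. i < r \<Longrightarrow> j < r \<Longrightarrow> mq_class n (blk n i j Z) \<in> \<phi> ` A.C"
  using assms class_rep[of X "\<lambda>k. r * n k"] that[of "mq_rep X"] unfolding MrA_def by simp

lemma image_add: "X \<in> \<phi> ` A.C \<Longrightarrow> Y \<in> \<phi> ` A.C \<Longrightarrow> X \<oplus>\<^bsub>MQ n\<^esub> Y \<in> \<phi> ` A.C"
  and image_mult: "X \<in> \<phi> ` A.C \<Longrightarrow> Y \<in> \<phi> ` A.C \<Longrightarrow> X \<otimes>\<^bsub>MQ n\<^esub> Y \<in> \<phi> ` A.C"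
  and image_sm: "X \<in> \<phi> ` A.C \<Longrightarrow> c \<odot>\<^bsub>MQ n\<^esub> X \<in> \<phi> ` A.C"
  by (auto simp flip: hom_add hom_mult hom_sm)

lemma class_image:
  assumes "x \<in> prodM n" "mq_class n x \<in> \<phi> ` A.C"
  shows "mq_class n (ssm c x) \<in> \<phi> ` A.C"
    and "y \<in> prodM n \<Longrightarrow> mq_class n y \<in> \<phi> ` A.C \<Longrightarrow> mq_class n (sadd x y) \<in> \<phi> ` A.C"
    and "y \<in> prodM n \<Longrightarrow> mq_class n y \<in> \<phi> ` A.C \<Longrightarrow> mq_class n (smul n x y) \<in> \<phi> ` A.C"
  using image_sm[OF assms(2), of c] image_add[OF assms(2), of "mq_class n y"]
    image_mult[OF assms(2), of "mq_class n y"] assms(1)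
  by (simp_all add: MQ_sm MQ_add MQ_mult)

text \<open>The embedding is isometric, so a convergent sequence in its range comes from a Cauchy
  sequence in the complete algebra A.\<close>

lemma image_closed:
  assumes X: "\<And>t. X t \<in> \<phi> ` A.C" and L: "L \<in> B.C" "B.clim X L"
  shows "L \<in> \<phi> ` A.C"
proof -
  have "\<forall>t. \<exists>a. a \<in> A.C \<and> X t = \<phi> a" using X by blast
  then obtain a where a: "\<And>t. a t \<in> A.C" "\<And>t. X t = \<phi> (a t)" by metis
  have XC: "X t \<in> B.C" for t using a by simp
  have dist: "\<parallel>a s \<ominus>\<^bsub>A\<^esub> a t\<parallel>\<^bsub>A\<^esub> \<le> \<parallel>X s \<ominus>\<^bsub>MQ n\<^esub> L\<parallel>\<^bsub>MQ n\<^esub> + \<parallel>X t \<ominus>\<^bsub>MQ n\<^esub> L\<parallel>\<^bsub>MQ n\<^esub>" for s t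
  proof -
    have "\<parallel>a s \<ominus>\<^bsub>A\<^esub> a t\<parallel>\<^bsub>A\<^esub> = \<parallel>X s \<ominus>\<^bsub>MQ n\<^esub> X t\<parallel>\<^bsub>MQ n\<^esub>"
      using isometric[OF inj, of "a s \<ominus>\<^bsub>A\<^esub> a t"] a by simp
    then show ?thesis using B.nm_sub_triangle[of "X s" L "X t"] B.nm_sub_commute[of L "X t"] XC L by simp
  qed
  have "\<exists>l\<in>A.C. (\<lambda>t. \<parallel>a t \<ominus>\<^bsub>A\<^esub> l\<parallel>\<^bsub>A\<^esub>) \<longlonglongrightarrow> 0"
  proof (rule A.complete[OF a(1)])
    fix e :: real assume "e > 0"
    then have "\<forall>\<^sub>F t in sequentially. \<parallel>X t \<ominus>\<^bsub>MQ n\<^esub> L\<parallel>\<^bsub>MQ n\<^esub> < e / 2"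
      using L(2) unfolding B.clim_def by (intro order_tendstoD(2)[of _ 0]) simp_all
    then obtain M where M: "\<And>t. M \<le> t \<Longrightarrow> \<parallel>X t \<ominus>\<^bsub>MQ n\<^esub> L\<parallel>\<^bsub>MQ n\<^esub> < e / 2"
      by (auto simp: eventually_sequentially)
    show "\<exists>M. \<forall>s\<ge>M. \<forall>t\<ge>M. \<parallel>a s \<ominus>\<^bsub>A\<^esub> a t\<parallel>\<^bsub>A\<^esub> < e"
    proof (intro exI[of _ M] allI impI)
      fix s t assume "M \<le> s" "M \<le> t"
      then show "\<parallel>a s \<ominus>\<^bsub>A\<^esub> a t\<parallel>\<^bsub>A\<^esub> < e" using dist[of s t] M[of s] M[of t] by linarith
    qed
  qed
  then obtain l where l: "l \<in> A.C" "(\<lambda>t. \<parallel>a t \<ominus>\<^bsub>A\<^esub> l\<parallel>\<^bsub>A\<^esub>) \<longlonglongrightarrow> 0" by blast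
  have "B.clim X (\<phi> l)"
  proof (rule B.clim_le[OF _ l(2)])
    show "\<parallel>X t \<ominus>\<^bsub>MQ n\<^esub> \<phi> l\<parallel>\<^bsub>MQ n\<^esub> \<le> \<parallel>a t \<ominus>\<^bsub>A\<^esub> l\<parallel>\<^bsub>A\<^esub>" for t
      using contractive[of "a t \<ominus>\<^bsub>A\<^esub> l"] a l by simp
  qed (use XC l in simp_all)
  then have "L = \<phi> l" using L XC l by (intro B.clim_unique[of X]) simp_all
  then show ?thesis using l by blast
qed

lemma zero_in_image: "mq_class n (\<lambda>k \<alpha> \<beta>. 0) \<in> \<phi> ` A.C" and one_in_image: "mq_class n (sone n) \<in> \<phi> ` A.C"
  using imageI[of "\<zero>\<^bsub>A\<^esub>" A.C \<phi>] imageI[of "\<one>\<^bsub>A\<^esub>" A.C \<phi>] by (simp_all add: MQ_zero MQ_one)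

text \<open>Sums, products and limits are seen blockwise, and the range of \<phi> is closed; so
  \<open>MrA r\<close> is a closed unital subalgebra. A positive matrix over A then has its root
  among the matrices over A, where complete positivity can be applied.\<close>

lemma MrA_sqrt:
  assumes h: "cstar_algebra.cpos (MQ (\<lambda>k. r * n k)) h" and hM: "h \<in> MrA r"
  shows "\<exists>w\<in>MrA r. cstar_algebra.cpos (MQ (\<lambda>k. r * n k)) w \<and> w \<otimes>\<^bsub>MQ (\<lambda>k. r * n k)\<^esub> w = h"
proof -
  let ?N = "\<lambda>k. r * n k"
  interpret R: cstar_algebra "MQ ?N" by (rule MQ_algebra)
  have "\<exists>w. w \<in> MrA r \<and> R.cpos w \<and> w \<otimes>\<^bsub>MQ ?N\<^esub> w = h"
  proof (rule R.ex_sqrt[OF h hM])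
    show "\<one>\<^bsub>MQ ?N\<^esub> \<in> MrA r"
      using zero_in_image one_in_image by (simp add: MQ_one class_in_MrA blk_sone)
    show "MrA r \<subseteq> R.C" by (auto simp: MrA_def)
    show "X \<oplus>\<^bsub>MQ ?N\<^esub> Y \<in> MrA r" if XY: "X \<in> MrA r" "Y \<in> MrA r" for X Y
      by (rule MrA_cases[OF XY(1)], rule MrA_cases[OF XY(2)])
        (simp add: MQ_add class_in_MrA blk_sadd prodM_blk class_image)
    show "c \<odot>\<^bsub>MQ ?N\<^esub> X \<in> MrA r" if X: "X \<in> MrA r" for c X
      by (rule MrA_cases[OF X])
        (simp add: MQ_sm class_in_MrA blk_ssm prodM_blk class_image)
    show "X \<otimes>\<^bsub>MQ ?N\<^esub> Y \<in> MrA r" if XY: "X \<in> MrA r" "Y \<in> MrA r" for X Y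
    proof (rule MrA_cases[OF XY(1)], rule MrA_cases[OF XY(2)])
      fix Z W
      assume Z: "Z \<in> prodM ?N" "X = mq_class ?N Z" "\<And>i j. i < r \<Longrightarrow> j < r \<Longrightarrow> mq_class n (blk n i j Z) \<in> \<phi> ` A.C"
        and W: "W \<in> prodM ?N" "Y = mq_class ?N W" "\<And>i j. i < r \<Longrightarrow> j < r \<Longrightarrow> mq_class n (blk n i j W) \<in> \<phi> ` A.C"
      have "mq_class n (ssum (\<lambda>l. smul n (blk n i l Z) (blk n l j W)) m) \<in> \<phi> ` A.C"
        if "i < r" "j < r" "m \<le> r" for i j m
        using that(3)
      proof (induction m)
        case 0
        then show ?case using zero_in_image by simp
      next
        case (Suc m)
        then have "mq_class n (smul n (blk n i m Z) (blk n m j W)) \<in> \<phi> ` A.C"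
          using Z W that by (intro class_image(3) prodM_blk) simp_all
        moreover have "ssum (\<lambda>l. smul n (blk n i l Z) (blk n l j W)) m \<in> prodM n"
          using Suc Z W that by (intro prodM_ssum prodM_smul prodM_blk) simp_all
        moreover have "smul n (blk n i m Z) (blk n m j W) \<in> prodM n"
          using Suc Z W that by (intro prodM_smul prodM_blk) simp_all
        ultimately show ?case using Suc by (simp add: class_image(2))
      qed
      then show "X \<otimes>\<^bsub>MQ ?N\<^esub> Y \<in> MrA r" using Z W by (simp add: MQ_mult class_in_MrA blk_smul)
    qed
    show "L \<in> MrA r" if X: "\<And>t. X t \<in> MrA r" and L: "L \<in> R.C" "R.clim X L" for X L
    proof -
      have XC: "X t \<in> R.C" for t using X by (simp add: MrA_def)
      have "mq_class n (blk n i j (mq_rep L)) \<in> \<phi> ` A.C" if ij: "i < r" "j < r" for i j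
      proof (rule image_closed)
        show "mq_class n (blk n i j (mq_rep (X t))) \<in> \<phi> ` A.C" for t using X ij by (simp add: MrA_def)
        show "mq_class n (blk n i j (mq_rep L)) \<in> B.C"
          using class_rep[OF L(1)] ij by (simp add: MQ_carrier prodM_blk)
        show "B.clim (\<lambda>t. mq_class n (blk n i j (mq_rep (X t)))) (mq_class n (blk n i j (mq_rep L)))"
        proof (rule B.clim_le[OF _ L(2)[unfolded R.clim_def]])
          fix t
          have pr: "mq_rep (X t) \<in> prodM ?N" "mq_rep L \<in> prodM ?N" using class_rep L XC by blast+
          then have "\<parallel>X t \<ominus>\<^bsub>MQ ?N\<^esub> L\<parallel>\<^bsub>MQ ?N\<^esub> = sn ?N (ssub (mq_rep (X t)) (mq_rep L))"
            using MQ_norm_sub_le[OF pr] class_rep(2)[OF XC] class_rep(2)[OF L(1)] by simp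
          then show "\<parallel>mq_class n (blk n i j (mq_rep (X t))) \<ominus>\<^bsub>MQ n\<^esub> mq_class n (blk n i j (mq_rep L))\<parallel>\<^bsub>MQ n\<^esub>
              \<le> \<parallel>X t \<ominus>\<^bsub>MQ ?N\<^esub> L\<parallel>\<^bsub>MQ ?N\<^esub>"
            using sn_blk[OF ij, of "ssub (mq_rep (X t)) (mq_rep L)" n] pr ij
            by (simp add: MQ_norm_sub_le prodM_blk blk_ssub)
        qed (use class_rep[OF L(1)] class_rep[OF XC] ij in \<open>simp_all add: MQ_carrier prodM_blk\<close>)
      qed
      then show ?thesis using L by (simp add: MrA_def)
    qed
  qed
  then show ?thesis by blast
qed

end

lemma vecnorm_sum: "vecnorm m (\<lambda>i. \<Sum>q<r. f q i) \<le> (\<Sum>q<(r::nat). vecnorm m (f q))"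
proof (induction r)
  case (Suc r)
  have "vecnorm m (\<lambda>i. (\<Sum>q<r. f q i) + f r i) \<le> vecnorm m (\<lambda>i. \<Sum>q<r. f q i) + vecnorm m (f r)"
    by (rule vecnorm_triangle)
  then show ?case using Suc by simp
qed simp

lemma vecnorm_blocks_le: "vecnorm (r * m) u \<le> (\<Sum>p<r. vecnorm m (\<lambda>\<alpha>. u (p * m + \<alpha>)))"
proof -
  have "(vecnorm (r * m) u)\<^sup>2 = (\<Sum>p<r. (vecnorm m (\<lambda>\<alpha>. u (p * m + \<alpha>)))\<^sup>2)"
    by (simp add: vecnorm_sq sum_split)
  then have "vecnorm (r * m) u = L2_set (\<lambda>p. vecnorm m (\<lambda>\<alpha>. u (p * m + \<alpha>))) {..<r}"
    unfolding L2_set_def by (metis real_sqrt_unique vecnorm_nonneg)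
  then show ?thesis by (simp add: L2_set_le_sum)
qed

context cstar_algebra
begin

text \<open>Families of functionals that define a completely positive map on \<open>r \<times> r\<close> matrices, like
  \<open>G i j a = F (x\<^sub>j\<^sup>\<star> a x\<^sub>i)\<close>.\<close>
definition cp_family :: "nat \<Rightarrow> (nat \<Rightarrow> nat \<Rightarrow> 'a \<Rightarrow> complex) \<Rightarrow> bool" where
  "cp_family r G \<longleftrightarrow>
     (\<forall>i<r. \<forall>j<r. \<forall>x\<in>C. \<forall>y\<in>C. G i j (x \<oplus> y) = G i j x + G i j y) \<and>
     (\<forall>i<r. \<forall>j<r. \<forall>c. \<forall>x\<in>C. G i j (c \<odot> x) = c * G i j x) \<and>
     (\<forall>i<r. \<forall>j<r. \<forall>x\<in>C. G i j (\<star> x) = cnj (G j i x)) \<and>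
     (\<forall>z. (\<forall>i<r. z i \<in> C) \<longrightarrow> 0 \<le> Re (\<Sum>i<r. \<Sum>j<r. G i j (\<star> (z j) \<otimes> z i)))"

lemma cp_familyD:
  assumes "cp_family r G" "i < r" "j < r"
  shows "x \<in> C \<Longrightarrow> y \<in> C \<Longrightarrow> G i j (x \<oplus> y) = G i j x + G i j y"
    "x \<in> C \<Longrightarrow> G i j (c \<odot> x) = c * G i j x" "x \<in> C \<Longrightarrow> G i j (\<star> x) = cnj (G j i x)"
  using assms by (simp_all add: cp_family_def)

lemma cp_family_pos:
  "cp_family r G \<Longrightarrow> (\<And>i. i < r \<Longrightarrow> z i \<in> C) \<Longrightarrow> 0 \<le> Re (\<Sum>i<r. \<Sum>j<r. G i j (\<star> (z j) \<otimes> z i))"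
  by (simp add: cp_family_def)

lemma cp_family_csum:
  assumes "cp_family r G" "i < r" "j < r"
  shows "(\<And>l. l < m \<Longrightarrow> g l \<in> C) \<Longrightarrow> G i j (csum g m) = (\<Sum>l<m. G i j (g l))"
proof (induction m)
  case 0
  show ?case using cp_familyD(2)[OF assms, of \<zero> 0] by simp
qed (simp add: cp_familyD(1)[OF assms])

lemma cp_family_sub:
  assumes "cp_family r G" "i < r" "j < r" "x \<in> C" "y \<in> C"
  shows "G i j (x \<ominus> y) = G i j x - G i j y"
  unfolding cs_sub_def using assms cp_familyD[OF assms(1-3)] by simp

end

context mf_embedding
begin

lemma hom_injD: "\<phi> x = \<phi> y \<Longrightarrow> x \<in> A.C \<Longrightarrow> y \<in> A.C \<Longrightarrow> x = y"
  using inj by (rule inj_onD)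

text \<open>An upper bound B for the form of T on all far matrix entries is inherited by G. Indeed B
  minus the real part of T is positive in the quotient, its root has entries in A, and G evaluated
  at the square of the root is a sum of expressions that are nonnegative by complete
  positivity.\<close>

lemma positive_bound:
  assumes G: "A.cp_family r G"
    and t: "\<And>i j. i < r \<Longrightarrow> j < r \<Longrightarrow> t i j \<in> A.C"
    and T: "\<And>i j. i < r \<Longrightarrow> j < r \<Longrightarrow> T i j \<in> prodM n"
      "\<And>i j. i < r \<Longrightarrow> j < r \<Longrightarrow> mq_class n (T i j) = \<phi> (t i j)"
    and H: "\<And>k \<eta>. K \<le> k \<Longrightarrow> Re (\<Sum>i<r. \<Sum>j<r. cip (n k) (mv (n k) (T i j k) (\<eta> i)) (\<eta> j))
        \<le> B * (\<Sum>i<r. (vecnorm (n k) (\<eta> i))\<^sup>2)"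
  shows "Re (\<Sum>i<r. \<Sum>j<r. G i j (t i j)) \<le> B * (\<Sum>i<r. Re (G i i \<one>\<^bsub>A\<^esub>))"
proof -
  let ?N = "\<lambda>k. r * n k"
  interpret R: cstar_algebra "MQ ?N" by (rule MQ_algebra)
  \<comment> \<open>In the form <T i j \<eta>_i, \<eta>_j> the first index belongs to the input
    vector; the block in row p and column q is therefore T q p.\<close>
  define S :: matseq where "S k P Q = (if P < r * n k \<and> Q < r * n k
      then T (Q div n k) (P div n k) k (P mod n k) (Q mod n k) else 0)" for k P Q
  have blkS: "blk n p q S = T q p" if "p < r" "q < r" for p q
  proof (intro ext)
    fix k \<alpha> \<beta>
    show "blk n p q S k \<alpha> \<beta> = T q p k \<alpha> \<beta>"
      using that block_index_less prodM_outside[OF T(1)[OF that(2,1)], of k \<alpha> \<beta>]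
      by (auto simp: blk_def S_def not_less)
  qed
  have Sv: "mv (r * n k) (S k) v (p * n k + \<alpha>) = (\<Sum>q<r. mv (n k) (T q p k) (\<lambda>\<beta>. v (q * n k + \<beta>)) \<alpha>)"
    if "p < r" "\<alpha> < n k" for k v p \<alpha>
    unfolding mv_def sum_split
    using that block_index_less by (intro sum.cong refl) (simp add: S_def)
  have "\<exists>b. \<forall>k. opnorm (n k) (T q p k) \<le> b" if "p < r" "q < r" for p q
    using prodM_bound[OF T(1)] that by blast
  then obtain b where b: "\<And>p q k. p < r \<Longrightarrow> q < r \<Longrightarrow> opnorm (n k) (T q p k) \<le> b p q" by metis
  have b0: "0 \<le> b p q" if "p < r" "q < r" for p q using b[OF that, of 0] opnorm_nonneg order_trans by blast
  have S: "S \<in> prodM ?N"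
  proof (rule prodMI)
    fix k
    show "opnorm (r * n k) (S k) \<le> (\<Sum>p<r. \<Sum>q<r. b p q)"
    proof (rule opnorm_le)
      show "0 \<le> (\<Sum>p<r. \<Sum>q<r. b p q)" using b0 by (intro sum_nonneg) simp_all
      fix v
      have "vecnorm (r * n k) (mv (r * n k) (S k) v) \<le> (\<Sum>p<r. vecnorm (n k) (\<lambda>\<alpha>. mv (r * n k) (S k) v (p * n k + \<alpha>)))"
        by (rule vecnorm_blocks_le)
      also have "\<dots> \<le> (\<Sum>p<r. \<Sum>q<r. b p q * vecnorm (r * n k) v)"
      proof (rule sum_mono)
        fix p assume p: "p \<in> {..<r}"
        have "vecnorm (n k) (\<lambda>\<alpha>. mv (r * n k) (S k) v (p * n k + \<alpha>))
            = vecnorm (n k) (\<lambda>\<alpha>. \<Sum>q<r. mv (n k) (T q p k) (\<lambda>\<beta>. v (q * n k + \<beta>)) \<alpha>)"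
          using p by (intro vecnorm_cong Sv) simp_all
        also have "\<dots> \<le> (\<Sum>q<r. vecnorm (n k) (mv (n k) (T q p k) (\<lambda>\<beta>. v (q * n k + \<beta>))))" by (rule vecnorm_sum)
        also have "\<dots> \<le> (\<Sum>q<r. b p q * vecnorm (r * n k) v)"
        proof (rule sum_mono)
          fix q assume q: "q \<in> {..<r}"
          have "vecnorm (n k) (mv (n k) (T q p k) (\<lambda>\<beta>. v (q * n k + \<beta>)))
              \<le> opnorm (n k) (T q p k) * vecnorm (n k) (\<lambda>\<beta>. v (q * n k + \<beta>))" by (rule opnorm_bound)
          also have "\<dots> \<le> b p q * vecnorm (r * n k) v"
            using p q b b0 by (intro mult_mono vecnorm_block_le) simp_all
          finally show "vecnorm (n k) (mv (n k) (T q p k) (\<lambda>\<beta>. v (q * n k + \<beta>))) \<le> b p q * vecnorm (r * n k) v" .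
        qed
        finally show "vecnorm (n k) (\<lambda>\<alpha>. mv (r * n k) (S k) v (p * n k + \<alpha>)) \<le> (\<Sum>q<r. b p q * vecnorm (r * n k) v)" .
      qed
      finally show "vecnorm (r * n k) (mv (r * n k) (S k) v) \<le> (\<Sum>p<r. \<Sum>q<r. b p q) * vecnorm (r * n k) v"
        by (simp add: sum_distrib_right)
    qed
  qed (auto simp: S_def)
  \<comment> \<open>The hypothesis speaks of the real part of the form, hence S is replaced by its
    self-adjoint part.\<close>
  define Y where "Y = ssub (ssm (of_real B) (sone ?N)) (ssm (1/2) (sadd S (sstar S)))"
  have Y: "Y \<in> prodM ?N" using S by (simp add: Y_def)
  have Ystar: "sstar Y = Y"
  proof -
    have "sstar (sone ?N) = sone ?N" by (intro ext) (auto simp: sstar_def sone_def adj_def mid_def)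
    then show ?thesis unfolding Y_def ssub_alt by (simp add: matseq_laws(14-16)) (simp add: matseq_laws(2))
  qed
  have "R.cpos (mq_class ?N Y)"
  proof (rule MQ_cpos_of_posdef[OF Y Ystar])
    fix k v assume k: "K \<le> k"
    let ?m = "r * n k"
    have Yv: "mv ?m (Y k) v = (\<lambda>i. of_real B * mv ?m (mid ?m) v i - 1/2 * (mv ?m (S k) v i + mv ?m (adj (S k)) v i))"
    proof -
      have "Y k = (\<lambda>i j. of_real B * mid ?m i j - 1/2 * (S k i j + adj (S k) i j))"
        by (simp add: Y_def ssub_def ssm_def sadd_def sstar_def sone_def)
      then show ?thesis by (simp only: mv_diff_left mv_scale_left mv_add_left)
    qed
    have c1: "cip ?m (mv ?m (mid ?m) v) v = of_real ((vecnorm ?m v)\<^sup>2)"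
      unfolding cip_self[symmetric] by (intro cip_cong) (simp_all add: mv_mid)
    have c2: "cip ?m (mv ?m (adj (S k)) v) v = cnj (cip ?m (mv ?m (S k) v) v)"
      using cip_adj[of ?m "adj (S k)" v v] cip_commute[of ?m v "mv ?m (S k) v"] by simp
    have "cip ?m (mv ?m (Y k) v) v = of_real B * of_real ((vecnorm ?m v)\<^sup>2)
        - 1/2 * (cip ?m (mv ?m (S k) v) v + cnj (cip ?m (mv ?m (S k) v) v))"
      unfolding Yv cip_diff_left cip_scale_left cip_add_left c1 c2 ..
    then have re: "Re (cip ?m (mv ?m (Y k) v) v) = B * (vecnorm ?m v)\<^sup>2 - Re (cip ?m (mv ?m (S k) v) v)"
      by simp
    define \<eta> where "\<eta> q \<beta> = v (q * n k + \<beta>)" for q \<beta>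
    have "cip ?m (mv ?m (S k) v) v = (\<Sum>j<r. \<Sum>\<alpha><n k. (\<Sum>i<r. mv (n k) (T i j k) (\<eta> i) \<alpha>) * cnj (\<eta> j \<alpha>))"
      unfolding cip_def sum_split by (intro sum.cong refl) (simp add: Sv \<eta>_def[abs_def])
    also have "\<dots> = (\<Sum>j<r. \<Sum>i<r. cip (n k) (mv (n k) (T i j k) (\<eta> i)) (\<eta> j))"
    proof (rule sum.cong[OF refl])
      fix j
      have "(\<Sum>\<alpha><n k. (\<Sum>i<r. mv (n k) (T i j k) (\<eta> i) \<alpha>) * cnj (\<eta> j \<alpha>))
          = (\<Sum>\<alpha><n k. \<Sum>i<r. mv (n k) (T i j k) (\<eta> i) \<alpha> * cnj (\<eta> j \<alpha>))" by (simp add: sum_distrib_right)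
      also have "\<dots> = (\<Sum>i<r. cip (n k) (mv (n k) (T i j k) (\<eta> i)) (\<eta> j))"
        unfolding cip_def by (rule sum.swap)
      finally show "(\<Sum>\<alpha><n k. (\<Sum>i<r. mv (n k) (T i j k) (\<eta> i) \<alpha>) * cnj (\<eta> j \<alpha>))
          = (\<Sum>i<r. cip (n k) (mv (n k) (T i j k) (\<eta> i)) (\<eta> j))" .
    qed
    also have "\<dots> = (\<Sum>i<r. \<Sum>j<r. cip (n k) (mv (n k) (T i j k) (\<eta> i)) (\<eta> j))" by (rule sum.swap)
    finally have "Re (cip ?m (mv ?m (S k) v) v) \<le> B * (\<Sum>i<r. (vecnorm (n k) (\<eta> i))\<^sup>2)" using H[OF k] by simp
    also have "(\<Sum>i<r. (vecnorm (n k) (\<eta> i))\<^sup>2) = (vecnorm ?m v)\<^sup>2"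
      by (simp add: vecnorm_sq sum_split \<eta>_def)
    finally show "0 \<le> Re (cip ?m (mv ?m (Y k) v) v)" using re by simp
  qed
  \<comment> \<open>The matrix over A behind Y: the block of Y at (p, q) represents the image of h p
    q.\<close>
  define h where "h p q = of_real (if p = q then B else 0) \<odot>\<^bsub>A\<^esub> \<one>\<^bsub>A\<^esub>
      \<ominus>\<^bsub>A\<^esub> (1/2) \<odot>\<^bsub>A\<^esub> (t q p \<oplus>\<^bsub>A\<^esub> \<star>\<^bsub>A\<^esub> (t p q))" for p q
  have h: "h p q \<in> A.C" if "p < r" "q < r" for p q using that t by (simp add: h_def)
  have blkY: "mq_class n (blk n p q Y) = \<phi> (h p q)" if pq: "p < r" "q < r" for p q
  proof -
    have "blk n p q Y = ssub (ssm (of_real (if p = q then B else 0)) (sone n)) (ssm (1/2) (sadd (T q p) (sstar (T p q))))"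
      unfolding Y_def using blkS pq
      by (simp add: blk_ssub blk_ssm blk_sadd blk_sstar blk_sone) (simp add: ssm_def)
    then show ?thesis unfolding h_def
      using pq t T by (simp add: T(2)[symmetric] MQ_one MQ_sm MQ_sub[symmetric] MQ_star MQ_add)
  qed
  then have "mq_class ?N Y \<in> MrA r" using h Y by (simp add: class_in_MrA)
  then obtain w where w: "w \<in> MrA r" "R.cpos w" "w \<otimes>\<^bsub>MQ ?N\<^esub> w = mq_class ?N Y"
    using MrA_sqrt \<open>R.cpos (mq_class ?N Y)\<close> by blast
  obtain W where W: "W \<in> prodM ?N" "w = mq_class ?N W"
    "\<And>i j. i < r \<Longrightarrow> j < r \<Longrightarrow> mq_class n (blk n i j W) \<in> \<phi> ` A.C"
    using MrA_cases[OF w(1)] by blast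
  have "\<exists>a. a \<in> A.C \<and> mq_class n (blk n i j W) = \<phi> a" if "i < r" "j < r" for i j
    using W(3)[OF that] by blast
  then obtain y where y: "\<And>i j. i < r \<Longrightarrow> j < r \<Longrightarrow> y i j \<in> A.C"
    "\<And>i j. i < r \<Longrightarrow> j < r \<Longrightarrow> mq_class n (blk n i j W) = \<phi> (y i j)" by metis
  have Wpr: "blk n i j W \<in> prodM n" if "i < r" "j < r" for i j using that W(1) by (rule prodM_blk)
  have ystar: "y i j = \<star>\<^bsub>A\<^esub> (y j i)" if ij: "i < r" "j < r" for i j
  proof -
    have "mq_class ?N (sstar W) = mq_class ?N W" using R.cposD(2)[OF w(2)] W by (simp add: MQ_star)
    then have "sim ?N (sstar W) W" using W by (simp add: mq_class_eq_iff)
    then have "sim n (sstar (blk n j i W)) (blk n i j W)"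
      unfolding blk_sstar[symmetric] by (rule sim_blk[OF ij])
    then have "mq_class n (sstar (blk n j i W)) = mq_class n (blk n i j W)"
      using Wpr ij by (simp add: mq_class_eq_iff)
    then have "\<phi> (\<star>\<^bsub>A\<^esub> (y j i)) = \<phi> (y i j)"
      using y ij Wpr by (simp add: MQ_star[symmetric])
    then have "\<star>\<^bsub>A\<^esub> (y j i) = y i j" by (rule hom_injD) (use y ij in simp_all)
    then show ?thesis by simp
  qed
  have hy: "h p q = A.csum (\<lambda>l. y p l \<otimes>\<^bsub>A\<^esub> y l q) r" if pq: "p < r" "q < r" for p q
  proof -
    have "mq_class ?N (smul ?N W W) = mq_class ?N Y" using w(3) W by (simp add: MQ_mult)
    then have "sim ?N (smul ?N W W) Y" using W Y by (simp add: mq_class_eq_iff)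
    then have "sim n (blk n p q (smul ?N W W)) (blk n p q Y)" by (rule sim_blk[OF pq])
    then have "mq_class n (blk n p q (smul ?N W W)) = mq_class n (blk n p q Y)"
      using W Y by (subst mq_class_eq_iff) (simp_all add: prodM_blk[OF pq])
    then have "\<phi> (h p q) = mq_class n (ssum (\<lambda>l. smul n (blk n p l W) (blk n l q W)) r)"
      using blkY[OF pq] by (simp add: blk_smul)
    also have "\<dots> = B.csum (\<lambda>l. mq_class n (smul n (blk n p l W) (blk n l q W))) r"
      using Wpr pq by (intro MQ_csum[symmetric]) simp
    also have "\<dots> = B.csum (\<lambda>l. \<phi> (y p l \<otimes>\<^bsub>A\<^esub> y l q)) r"
      using Wpr pq y by (intro B.csum_cong) (simp add: MQ_mult[symmetric])
    also have "\<dots> = \<phi> (A.csum (\<lambda>l. y p l \<otimes>\<^bsub>A\<^esub> y l q) r)"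
      using y pq by (intro hom_csum[symmetric]) simp
    finally show ?thesis by (rule hom_injD) (use h pq y in simp_all)
  qed
  \<comment> \<open>Row l of the root serves as the tuple in complete positivity. Since the root is
    self-adjoint, summation over l assembles the entries h j i.\<close>
  have "0 \<le> Re (\<Sum>i<r. \<Sum>j<r. G i j (\<star>\<^bsub>A\<^esub> (y l j) \<otimes>\<^bsub>A\<^esub> y l i))" if "l < r" for l
    using y that by (intro A.cp_family_pos[OF G]) simp
  then have "0 \<le> (\<Sum>l<r. Re (\<Sum>i<r. \<Sum>j<r. G i j (\<star>\<^bsub>A\<^esub> (y l j) \<otimes>\<^bsub>A\<^esub> y l i)))"
    by (intro sum_nonneg) simp
  also have "\<dots> = Re (\<Sum>l<r. \<Sum>i<r. \<Sum>j<r. G i j (\<star>\<^bsub>A\<^esub> (y l j) \<otimes>\<^bsub>A\<^esub> y l i))" by simp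
  also have "(\<Sum>l<r. \<Sum>i<r. \<Sum>j<r. G i j (\<star>\<^bsub>A\<^esub> (y l j) \<otimes>\<^bsub>A\<^esub> y l i))
      = (\<Sum>i<r. \<Sum>l<r. \<Sum>j<r. G i j (\<star>\<^bsub>A\<^esub> (y l j) \<otimes>\<^bsub>A\<^esub> y l i))" by (rule sum.swap)
  also have "\<dots> = (\<Sum>i<r. \<Sum>j<r. \<Sum>l<r. G i j (\<star>\<^bsub>A\<^esub> (y l j) \<otimes>\<^bsub>A\<^esub> y l i))"
    by (intro sum.cong refl sum.swap)
  also have "\<dots> = (\<Sum>i<r. \<Sum>j<r. G i j (h j i))"
  proof (intro sum.cong refl)
    fix i j assume "i \<in> {..<r}" "j \<in> {..<r}"
    then have ij: "i < r" "j < r" by simp_all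
    have "h j i = A.csum (\<lambda>l. \<star>\<^bsub>A\<^esub> (y l j) \<otimes>\<^bsub>A\<^esub> y l i) r"
      unfolding hy[OF ij(2,1)] using ystar[OF ij(2)] by (intro A.csum_cong) simp
    then show "(\<Sum>l<r. G i j (\<star>\<^bsub>A\<^esub> (y l j) \<otimes>\<^bsub>A\<^esub> y l i)) = G i j (h j i)"
      using A.cp_family_csum[OF G ij] y ij by simp
  qed
  also have "\<dots> = (\<Sum>i<r. \<Sum>j<r. of_real (if i = j then B else 0) * G i j \<one>\<^bsub>A\<^esub>
      - 1/2 * (G i j (t i j) + cnj (G j i (t j i))))"
  proof (intro sum.cong refl)
    fix i j assume "i \<in> {..<r}" "j \<in> {..<r}"
    then have ij: "i < r" "j < r" by simp_all
    show "G i j (h j i) = of_real (if i = j then B else 0) * G i j \<one>\<^bsub>A\<^esub> - 1/2 * (G i j (t i j) + cnj (G j i (t j i)))"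
      unfolding h_def using ij t A.cp_familyD[OF G ij] A.cp_family_sub[OF G ij] by auto
  qed
  also have "\<dots> = (\<Sum>i<r. of_real B * G i i \<one>\<^bsub>A\<^esub>)
      - 1/2 * ((\<Sum>i<r. \<Sum>j<r. G i j (t i j)) + (\<Sum>i<r. \<Sum>j<r. cnj (G j i (t j i))))"
  proof -
    have "(\<Sum>j<r. of_real (if i = j then B else 0) * G i j \<one>\<^bsub>A\<^esub>) = of_real B * G i i \<one>\<^bsub>A\<^esub>" if "i < r" for i
    proof -
      have "(\<Sum>j<r. of_real (if i = j then B else 0) * G i j \<one>\<^bsub>A\<^esub>) = (\<Sum>j<r. if j = i then of_real B * G i i \<one>\<^bsub>A\<^esub> else 0)"
        by (intro sum.cong) auto
      then show ?thesis using that by simp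
    qed
    then show ?thesis by (simp add: sum_subtractf sum.distrib sum_distrib_left[symmetric] add_divide_distrib sum_divide_distrib[symmetric])
  qed
  also have "(\<Sum>i<r. \<Sum>j<r. cnj (G j i (t j i))) = cnj (\<Sum>i<r. \<Sum>j<r. G i j (t i j))"
    by (subst sum.swap) simp
  finally have "0 \<le> Re (\<Sum>i<r. of_real B * G i i \<one>\<^bsub>A\<^esub>)
      - Re (1/2 * ((\<Sum>i<r. \<Sum>j<r. G i j (t i j)) + cnj (\<Sum>i<r. \<Sum>j<r. G i j (t i j))))"
    by (simp only: minus_complex.simps)
  moreover have "Re (1/2 * (z + cnj z)) = Re z" for z :: complex by simp
  moreover have "Re (\<Sum>i<r. of_real B * G i i \<one>\<^bsub>A\<^esub>) = B * (\<Sum>i<r. Re (G i i \<one>\<^bsub>A\<^esub>))"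
    by (simp add: sum_distrib_left)
  ultimately show ?thesis by (simp only: diff_ge_0_iff_ge)
qed

end

subsection \<open>Matrix models\<close>

lemma cmod_diff_sq: "(cmod (c - of_real s * z))\<^sup>2 = (cmod c)\<^sup>2 - 2 * s * Re (cnj c * z) + s\<^sup>2 * (cmod z)\<^sup>2"
  unfolding cmod_power2 by (simp add: power2_eq_square algebra_simps)

text \<open>An approximate version of the separation of a point from a convex cone; an almost closest point
  of the cone suffices.\<close>
lemma cone_separation:
  fixes K :: "('i \<Rightarrow> complex) set"
  assumes I: "finite I" and zero: "(\<lambda>_. 0) \<in> K"
    and add: "\<And>\<kappa> \<kappa>'. \<kappa> \<in> K \<Longrightarrow> \<kappa>' \<in> K \<Longrightarrow> (\<lambda>i. \<kappa> i + \<kappa>' i) \<in> K"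
    and scale: "\<And>\<kappa> s. \<kappa> \<in> K \<Longrightarrow> 0 \<le> s \<Longrightarrow> (\<lambda>i. of_real s * \<kappa> i) \<in> K"
    and far: "\<And>\<kappa>. \<kappa> \<in> K \<Longrightarrow> \<delta> \<le> (\<Sum>i\<in>I. (cmod (\<tau> i - \<kappa> i))\<^sup>2)"
    and \<theta>: "0 < \<theta>" "\<theta> \<le> 1"
  shows "\<exists>c. (\<forall>\<kappa>\<in>K. Re (\<Sum>i\<in>I. cnj (c i) * \<kappa> i) \<le> \<theta> * (1 + (\<Sum>i\<in>I. (cmod (\<kappa> i))\<^sup>2)) / 2) \<and>
     \<delta> - \<theta> * (3 + 4 * (\<Sum>i\<in>I. (cmod (\<tau> i))\<^sup>2)) / 2 \<le> Re (\<Sum>i\<in>I. cnj (c i) * \<tau> i)"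
proof -
  define q where "q \<kappa> = (\<Sum>i\<in>I. (cmod (\<tau> i - \<kappa> i))\<^sup>2)" for \<kappa>
  define m where "m = Inf (q ` K)"
  have bdd: "bdd_below (q ` K)" by (intro bdd_belowI2[of _ 0]) (simp add: q_def sum_nonneg)
  have m_le: "m \<le> q \<kappa>" if "\<kappa> \<in> K" for \<kappa> unfolding m_def using that bdd by (intro cInf_lower) simp_all
  have "\<exists>v\<in>q ` K. v < m + \<theta>\<^sup>2" unfolding m_def using zero \<theta> by (intro cInf_lessD) auto
  then obtain \<kappa>0 where \<kappa>0: "\<kappa>0 \<in> K" "q \<kappa>0 < m + \<theta>\<^sup>2" by blast
  \<comment> \<open>The functional points from the near-minimiser \<kappa>0 to \<tau>. Moves inside
    the cone lower q by less than \<theta>^2, so moves of size \<theta> bound the linear term by a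
    multiple of \<theta>.\<close>
  define c where "c i = \<tau> i - \<kappa>0 i" for i
  define M where "M = (\<Sum>i\<in>I. (cmod (c i))\<^sup>2)"
  have M: "M = q \<kappa>0" by (simp add: M_def q_def c_def)
  have expand: "(\<Sum>i\<in>I. (cmod (c i - of_real s * \<kappa> i))\<^sup>2)
      = M - 2 * s * Re (\<Sum>i\<in>I. cnj (c i) * \<kappa> i) + s\<^sup>2 * (\<Sum>i\<in>I. (cmod (\<kappa> i))\<^sup>2)" for s \<kappa>
    unfolding cmod_diff_sq M_def by (simp only: sum.distrib sum_subtractf sum_distrib_left Re_sum)
  have 1: "Re (\<Sum>i\<in>I. cnj (c i) * \<kappa> i) \<le> \<theta> * (1 + (\<Sum>i\<in>I. (cmod (\<kappa> i))\<^sup>2)) / 2" if \<kappa>: "\<kappa> \<in> K" for \<kappa>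
  proof -
    have "m \<le> q (\<lambda>i. \<kappa>0 i + of_real \<theta> * \<kappa> i)" using \<kappa> \<kappa>0 \<theta> by (intro m_le add scale) simp_all
    also have "q (\<lambda>i. \<kappa>0 i + of_real \<theta> * \<kappa> i) = (\<Sum>i\<in>I. (cmod (c i - of_real \<theta> * \<kappa> i))\<^sup>2)"
      by (simp add: q_def c_def algebra_simps)
    finally have "2 * \<theta> * Re (\<Sum>i\<in>I. cnj (c i) * \<kappa> i) \<le> \<theta>\<^sup>2 + \<theta>\<^sup>2 * (\<Sum>i\<in>I. (cmod (\<kappa> i))\<^sup>2)"
      unfolding expand using \<kappa>0 M by simp
    then have "\<theta> * (2 * Re (\<Sum>i\<in>I. cnj (c i) * \<kappa> i)) \<le> \<theta> * (\<theta> * (1 + (\<Sum>i\<in>I. (cmod (\<kappa> i))\<^sup>2)))"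
      by (simp add: power2_eq_square algebra_simps)
    then show ?thesis using \<theta>(1) by (simp only: mult_le_cancel_left_pos)
  qed
  define X where "X = Re (\<Sum>i\<in>I. cnj (c i) * \<kappa>0 i)"
  define Nk where "Nk = (\<Sum>i\<in>I. (cmod (\<kappa>0 i))\<^sup>2)"
  define Nt where "Nt = (\<Sum>i\<in>I. (cmod (\<tau> i))\<^sup>2)"
  \<comment> \<open>Shrinking \<kappa>0 by the factor 1 - \<theta> stays in the cone, and shows that
    c is almost nonnegative on \<kappa>0. As c = \<tau> - \<kappa>0, this bounds c at \<tau> from
    below.\<close>
  have X: "- (\<theta> * (1 + Nk) / 2) \<le> X"
  proof -
    have "m \<le> q (\<lambda>i. of_real (1 - \<theta>) * \<kappa>0 i)" using \<kappa>0 \<theta> by (intro m_le scale) simp_all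
    also have "q (\<lambda>i. of_real (1 - \<theta>) * \<kappa>0 i) = (\<Sum>i\<in>I. (cmod (c i - of_real (- \<theta>) * \<kappa>0 i))\<^sup>2)"
      by (simp add: q_def c_def algebra_simps)
    finally have "- (2 * \<theta> * X) \<le> \<theta>\<^sup>2 + \<theta>\<^sup>2 * Nk"
      unfolding expand using \<kappa>0 M by (simp add: X_def Nk_def)
    then have "\<theta> * (- (2 * X)) \<le> \<theta> * (\<theta> * (1 + Nk))" by (simp add: power2_eq_square algebra_simps)
    then have "- (2 * X) \<le> \<theta> * (1 + Nk)" using \<theta>(1) by (simp only: mult_le_cancel_left_pos)
    then show ?thesis by simp
  qed
  have "M \<le> Nt + 1"
  proof -
    have "m \<le> q (\<lambda>_. 0)" by (intro m_le zero)
    moreover have "\<theta>\<^sup>2 \<le> 1" using \<theta> by (simp add: power_le_one)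
    ultimately show ?thesis using \<kappa>0 M by (simp add: q_def Nt_def)
  qed
  moreover have "Nk \<le> 2 * Nt + 2 * M"
  proof -
    have "(cmod (\<kappa>0 i))\<^sup>2 \<le> 2 * (cmod (\<tau> i))\<^sup>2 + 2 * (cmod (c i))\<^sup>2" for i
    proof -
      have "cmod (\<kappa>0 i) \<le> cmod (\<tau> i) + cmod (c i)" using norm_triangle_ineq4[of "\<tau> i" "c i"] by (simp add: c_def)
      then have "(cmod (\<kappa>0 i))\<^sup>2 \<le> (cmod (\<tau> i) + cmod (c i))\<^sup>2" by (intro power_mono) simp_all
      also have "\<dots> \<le> 2 * (cmod (\<tau> i))\<^sup>2 + 2 * (cmod (c i))\<^sup>2"
        using zero_le_power2[of "cmod (\<tau> i) - cmod (c i)"] by (simp add: power2_sum power2_diff)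
      finally show ?thesis .
    qed
    then have "Nk \<le> (\<Sum>i\<in>I. 2 * (cmod (\<tau> i))\<^sup>2 + 2 * (cmod (c i))\<^sup>2)" unfolding Nk_def by (rule sum_mono)
    then show ?thesis by (simp add: Nt_def M_def sum.distrib sum_distrib_left)
  qed
  ultimately have "\<theta> * (1 + Nk) \<le> \<theta> * (3 + 4 * Nt)" using \<theta> by (intro mult_left_mono) simp_all
  moreover have "Re (\<Sum>i\<in>I. cnj (c i) * \<tau> i) = M + X"
  proof -
    have "cnj (c i) * \<tau> i = of_real ((cmod (c i))\<^sup>2) + cnj (c i) * \<kappa>0 i" for i
      unfolding complex_norm_square by (simp add: c_def algebra_simps)
    then show ?thesis by (simp add: sum.distrib M_def X_def del: of_real_power)
  qed
  moreover have "\<delta> \<le> M" using far[OF \<kappa>0(1)] M by (simp add: q_def)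
  ultimately have "\<delta> - \<theta> * (3 + 4 * Nt) / 2 \<le> Re (\<Sum>i\<in>I. cnj (c i) * \<tau> i)" using X by linarith
  then show ?thesis using 1 unfolding Nt_def by blast
qed

lemma sim_eventually:
  assumes "sim n x y" "e > 0"
  shows "\<forall>\<^sub>F k in sequentially. opnorm (n k) (ssub x y k) < e"
  using assms unfolding sim_def by (intro order_tendstoD(2)[of _ 0])

lemma mv_ssum: "mv m (ssum g r k) v = (\<lambda>i. \<Sum>s<r. mv m (g s k) v i)"
proof (induction r)
  case (Suc r)
  then show ?case by (simp add: sadd_def mv_add_left)
qed (simp add: mv_def)

lemma cip_sum_left: "cip m (\<lambda>i. \<Sum>s<r. f s i) w = (\<Sum>s<(r::nat). cip m (f s) w)"
  unfolding cip_def sum_distrib_right by (rule sum.swap)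

lemma cip_opnorm_diff:
  assumes "opnorm m (\<lambda>i j. M i j - N i j) \<le> e"
  shows "cmod (cip m (mv m M v) w - cip m (mv m N v) w) \<le> e * (vecnorm m v * vecnorm m w)"
proof -
  have "cip m (mv m M v) w - cip m (mv m N v) w = cip m (mv m (\<lambda>i j. M i j - N i j) v) w"
    by (simp add: mv_diff_left cip_diff_left)
  then have "cmod (cip m (mv m M v) w - cip m (mv m N v) w) \<le> vecnorm m (mv m (\<lambda>i j. M i j - N i j) v) * vecnorm m w"
    using cip_cauchy by simp
  also have "\<dots> \<le> (opnorm m (\<lambda>i j. M i j - N i j) * vecnorm m v) * vecnorm m w"
    by (intro mult_right_mono opnorm_bound) simp
  also have "\<dots> \<le> (e * vecnorm m v) * vecnorm m w" using assms by (intro mult_right_mono) simp_all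
  finally show ?thesis by (simp add: mult.assoc)
qed

context mf_embedding
begin

text \<open>The numbers <a_s \<eta>_i, \<eta>_j>, summed over blocks, as one vector indexed by
  triples; in this shape they can be separated from the target values.\<close>

definition block_form :: "(nat \<Rightarrow> 'a) \<Rightarrow> nat list \<Rightarrow> (nat \<Rightarrow> nat \<Rightarrow> nat \<Rightarrow> complex) \<Rightarrow> nat \<times> nat \<times> nat \<Rightarrow> complex" where
  "block_form av ks \<eta> = (\<lambda>(s, i, j). \<Sum>l<length ks.
     cip (n (ks ! l)) (mv (n (ks ! l)) (lift (av s) (ks ! l)) (\<eta> l i)) (\<eta> l j))"

lemma block_form_append:
  "block_form av (ks @ ks') (\<lambda>l. if l < length ks then \<eta> l else \<eta>' (l - length ks)) p
     = block_form av ks \<eta> p + block_form av ks' \<eta>' p"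
  by (simp add: block_form_def sum_lessThan_add nth_append split: prod.split)

lemma block_form_scale:
  "block_form av ks (\<lambda>l i \<alpha>. of_real s * \<eta> l i \<alpha>) p = of_real (s * s) * block_form av ks \<eta> p"
  by (simp add: block_form_def mv_scale cip_scale_left cip_scale_right sum_distrib_left mult.assoc split: prod.split)

lemma block_form_zero: "block_form av ks (\<lambda>l i \<alpha>. 0) p = 0"
  using block_form_scale[of av ks 0 "\<lambda>l i \<alpha>. 0" p] by simp

text \<open>Attainable data form a convex cone: joining block lists adds them, and multiplying the
  vectors by sqrt u multiplies them by u. If G stayed away from this cone, a separating functional
  would be an r x r matrix over A whose form is bounded by a small number on all far entries while
  its value under G is not small, against \<open>positive_bound\<close>.\<close>

lemma ex_model:
  fixes av :: "nat \<Rightarrow> 'a" and m r :: nat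
  assumes G: "A.cp_family r G" and av: "\<And>s. s < m \<Longrightarrow> av s \<in> A.C" and e: "0 < e"
  shows "\<exists>ks \<eta>. ks \<noteq> [] \<and> (\<forall>k\<in>set ks. K \<le> k) \<and>
    (\<forall>s<m. \<forall>i<r. \<forall>j<r. cmod (block_form av ks \<eta> (s, i, j) - G i j (av s)) < e)"
proof -
  define I where "I = {..<m} \<times> {..<r} \<times> {..<r}"
  have finI: "finite I" by (simp add: I_def)
  have sumI: "(\<Sum>p\<in>I. f p) = (\<Sum>i<r. \<Sum>j<r. \<Sum>s<m. f (s, i, j))" for f :: "_ \<Rightarrow> complex"
  proof -
    have "(\<Sum>p\<in>I. f p) = (\<Sum>s<m. \<Sum>i<r. \<Sum>j<r. f (s, i, j))"
      unfolding I_def by (simp add: sum.cartesian_product)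
    also have "\<dots> = (\<Sum>i<r. \<Sum>s<m. \<Sum>j<r. f (s, i, j))" by (rule sum.swap)
    also have "\<dots> = (\<Sum>i<r. \<Sum>j<r. \<Sum>s<m. f (s, i, j))" by (intro sum.cong refl sum.swap)
    finally show ?thesis .
  qed
  define Kc where "Kc = {\<kappa>. \<exists>ks \<eta>. (\<forall>k\<in>set ks. K \<le> k) \<and> \<kappa> = block_form av ks \<eta>}"
  define \<tau> where "\<tau> = (\<lambda>(s, i, j). G i j (av s))"
  have "\<exists>\<kappa>\<in>Kc. (\<Sum>p\<in>I. (cmod (\<tau> p - \<kappa> p))\<^sup>2) < e\<^sup>2"
  proof (rule ccontr)
    assume "\<not> ?thesis"
    then have far: "e\<^sup>2 \<le> (\<Sum>p\<in>I. (cmod (\<tau> p - \<kappa> p))\<^sup>2)" if "\<kappa> \<in> Kc" for \<kappa> using that by (auto simp: not_less)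
    have "\<exists>L. \<forall>k. opnorm (n k) (lift (av s) k) \<le> L" if "s < m" for s
      using prodM_bound lift(1) av that by blast
    then obtain L where L: "\<And>s k. s < m \<Longrightarrow> opnorm (n k) (lift (av s) k) \<le> L s" by metis
    \<comment> \<open>Bounds the squared size of the data of one block whose vectors have total
      squared norm 1.\<close>
    define P where "P = (\<Sum>p\<in>I. (L (fst p))\<^sup>2)"
    define Nt where "Nt = (\<Sum>p\<in>I. (cmod (\<tau> p))\<^sup>2)"
    define \<Gamma> where "\<Gamma> = (\<Sum>i<r. Re (G i i \<one>\<^bsub>A\<^esub>))"
    have P0: "0 \<le> P" and Nt0: "0 \<le> Nt" by (simp_all add: P_def Nt_def sum_nonneg)
    \<comment> \<open>The factor of \<theta> in the two errors together: one from the value at the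
      target, one from the bound on the cone. \<theta> is then taken with \<theta> E < e^2.\<close>
    define E where "E = (3 + 4 * Nt) / 2 + (1 + P) / 2 * \<bar>\<Gamma>\<bar>"
    have E0: "E > 0" unfolding E_def using P0 Nt0 by (intro add_pos_nonneg) simp_all
    define \<theta> where "\<theta> = min 1 (e\<^sup>2 / (2 * E))"
    have \<theta>: "0 < \<theta>" "\<theta> \<le> 1" using e E0 by (simp_all add: \<theta>_def)
    have "\<theta> * E \<le> e\<^sup>2 / (2 * E) * E" using E0 by (intro mult_right_mono) (simp_all add: \<theta>_def)
    also have "\<dots> < e\<^sup>2" using E0 e by simp
    finally have \<theta>E: "\<theta> * E < e\<^sup>2" .
    have zero: "(\<lambda>_. 0) \<in> Kc"
      unfolding Kc_def by (intro CollectI exI[of _ "[]"]) (auto simp: block_form_def)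
    have add: "(\<lambda>p. \<kappa> p + \<kappa>' p) \<in> Kc" if \<kappa>: "\<kappa> \<in> Kc" "\<kappa>' \<in> Kc" for \<kappa> \<kappa>'
    proof -
      obtain ks \<eta> ks' \<eta>' where "\<forall>k\<in>set ks. K \<le> k" "\<kappa> = block_form av ks \<eta>" "\<forall>k\<in>set ks'. K \<le> k" "\<kappa>' = block_form av ks' \<eta>'"
        using \<kappa> unfolding Kc_def by blast
      moreover have "(\<lambda>p. block_form av ks \<eta> p + block_form av ks' \<eta>' p)
          = block_form av (ks @ ks') (\<lambda>l. if l < length ks then \<eta> l else \<eta>' (l - length ks))"
        by (intro ext block_form_append[symmetric])
      ultimately show ?thesis unfolding Kc_def by (intro CollectI exI conjI) auto
    qed
    have scale: "(\<lambda>p. of_real u * \<kappa> p) \<in> Kc" if \<kappa>: "\<kappa> \<in> Kc" and u: "0 \<le> u" for \<kappa> u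
    proof -
      obtain ks \<eta> where ks: "\<forall>k\<in>set ks. K \<le> k" "\<kappa> = block_form av ks \<eta>"
        using \<kappa> unfolding Kc_def by blast
      have "(\<lambda>p. of_real u * \<kappa> p) = block_form av ks (\<lambda>l i \<alpha>. of_real (sqrt u) * \<eta> l i \<alpha>)"
        using u by (intro ext) (simp only: block_form_scale ks(2) real_sqrt_mult_self abs_of_nonneg)
      then show ?thesis using ks unfolding Kc_def by blast
    qed
    obtain c where c: "\<And>\<kappa>. \<kappa> \<in> Kc \<Longrightarrow> Re (\<Sum>p\<in>I. cnj (c p) * \<kappa> p) \<le> \<theta> * (1 + (\<Sum>p\<in>I. (cmod (\<kappa> p))\<^sup>2)) / 2"
      and c\<tau>: "e\<^sup>2 - \<theta> * (3 + 4 * Nt) / 2 \<le> Re (\<Sum>p\<in>I. cnj (c p) * \<tau> p)"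
      using cone_separation[OF finI zero add scale far \<theta>] unfolding Nt_def by blast
    \<comment> \<open>The coefficients of the separating functional are absorbed into elements of A,
      so that the functional becomes the form of the matrix T that represents t.\<close>
    define t where "t i j = A.csum (\<lambda>s. cnj (c (s, i, j)) \<odot>\<^bsub>A\<^esub> av s) m" for i j
    define T where "T i j = ssum (\<lambda>s. ssm (cnj (c (s, i, j))) (lift (av s))) m" for i j
    have tC: "t i j \<in> A.C" for i j using av by (simp add: t_def)
    have Tpr: "T i j \<in> prodM n" for i j unfolding T_def using av lift by (intro prodM_ssum) simp
    have Tcl: "mq_class n (T i j) = \<phi> (t i j)" for i j
    proof -
      have "\<phi> (t i j) = B.csum (\<lambda>s. mq_class n (ssm (cnj (c (s, i, j))) (lift (av s)))) m"
        unfolding t_def using av lift by (subst hom_csum) (auto intro!: B.csum_cong simp: MQ_sm[symmetric])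
      also have "\<dots> = mq_class n (T i j)" unfolding T_def using av lift by (intro MQ_csum) simp
      finally show ?thesis by simp
    qed
    have "Re (\<Sum>i<r. \<Sum>j<r. G i j (t i j)) \<le> (\<theta> * (1 + P) / 2) * (\<Sum>i<r. Re (G i i \<one>\<^bsub>A\<^esub>))"
    proof (rule positive_bound[OF G tC Tpr Tcl])
      fix k and \<eta> :: "nat \<Rightarrow> nat \<Rightarrow> complex" assume k: "K \<le> k"
      define X where "X \<eta> = Re (\<Sum>p\<in>I. cnj (c p) * block_form av [k] (\<lambda>l. \<eta>) p)" for \<eta>
      have "(\<Sum>i<r. \<Sum>j<r. cip (n k) (mv (n k) (T i j k) (\<eta> i)) (\<eta> j))
          = (\<Sum>p\<in>I. cnj (c p) * block_form av [k] (\<lambda>l. \<eta>) p)"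
        unfolding sumI
        by (intro sum.cong refl)
          (simp add: T_def mv_ssum cip_sum_left block_form_def ssm_def mv_scale_left cip_scale_left)
      then have XX: "Re (\<Sum>i<r. \<Sum>j<r. cip (n k) (mv (n k) (T i j k) (\<eta> i)) (\<eta> j)) = X \<eta>"
        by (simp add: X_def)
      define S where "S = (\<Sum>i<r. (vecnorm (n k) (\<eta> i))\<^sup>2)"
      have bf: "cmod (block_form av [k] (\<lambda>l. \<eta>) (s, i, j)) \<le> L s * (vecnorm (n k) (\<eta> i) * vecnorm (n k) (\<eta> j))"
        if "s < m" for s i j and \<eta> :: "nat \<Rightarrow> nat \<Rightarrow> complex"
      proof -
        have "cmod (cip (n k) (mv (n k) (lift (av s) k) (\<eta> i)) (\<eta> j))
            \<le> vecnorm (n k) (mv (n k) (lift (av s) k) (\<eta> i)) * vecnorm (n k) (\<eta> j)" by (rule cip_cauchy)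
        also have "\<dots> \<le> (opnorm (n k) (lift (av s) k) * vecnorm (n k) (\<eta> i)) * vecnorm (n k) (\<eta> j)"
          by (intro mult_right_mono opnorm_bound) simp
        also have "\<dots> \<le> (L s * vecnorm (n k) (\<eta> i)) * vecnorm (n k) (\<eta> j)"
          using L[OF that] by (intro mult_right_mono) simp_all
        finally show ?thesis by (simp add: block_form_def mult.assoc)
      qed
      have "X \<eta> \<le> \<theta> * (1 + P) / 2 * S"
      \<comment> \<open>The bound on the cone is not homogeneous in the data, whereas a quadratic
        bound in the vectors is wanted. Hence the vectors are normalised to total squared norm 1 by
        the factor \<rho>.\<close>
      proof (cases "S = 0")
        case True
        then have z: "vecnorm (n k) (\<eta> i) = 0" if "i < r" for i
          using that unfolding S_def by (subst (asm) sum_nonneg_eq_0_iff) auto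
        have "block_form av [k] (\<lambda>l. \<eta>) p = 0" if p: "p \<in> I" for p
        proof -
          obtain s i j where "p = (s, i, j)" "s < m" "i < r" "j < r" using p by (auto simp: I_def)
          then show ?thesis using bf[of s \<eta> i j] z[of i] by simp
        qed
        then show ?thesis using True by (simp add: X_def)
      next
        case False
        then have S: "S > 0" using sum_nonneg[of "{..<r}" "\<lambda>i. (vecnorm (n k) (\<eta> i))\<^sup>2"] by (simp add: S_def)
        define \<rho> where "\<rho> = 1 / sqrt S"
        have \<rho>: "\<rho> * \<rho> = 1 / S" "0 \<le> \<rho>" using S by (simp_all add: \<rho>_def)
        define \<eta>' where "\<eta>' i \<alpha> = of_real \<rho> * \<eta> i \<alpha>" for i \<alpha>
        have bf': "block_form av [k] (\<lambda>l. \<eta>') p = of_real (\<rho> * \<rho>) * block_form av [k] (\<lambda>l. \<eta>) p" for p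
          unfolding \<eta>'_def[abs_def] by (rule block_form_scale)
        have "(\<Sum>p\<in>I. cnj (c p) * block_form av [k] (\<lambda>l. \<eta>') p)
            = of_real (\<rho> * \<rho>) * (\<Sum>p\<in>I. cnj (c p) * block_form av [k] (\<lambda>l. \<eta>) p)"
          unfolding bf' sum_distrib_left by (intro sum.cong) (simp_all add: mult_ac)
        moreover have "Re (of_real a * w) = a * Re w" for a :: real and w by simp
        ultimately have "X \<eta>' = \<rho> * \<rho> * X \<eta>" unfolding X_def by (simp only:)
        moreover have "X \<eta>' \<le> \<theta> * (1 + (\<Sum>p\<in>I. (cmod (block_form av [k] (\<lambda>l. \<eta>') p))\<^sup>2)) / 2"
          unfolding X_def using k by (intro c) (auto simp: Kc_def intro!: exI[of _ "[k]"])
        moreover have "(\<Sum>p\<in>I. (cmod (block_form av [k] (\<lambda>l. \<eta>') p))\<^sup>2) \<le> P"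
          unfolding P_def
        proof (rule sum_mono)
          fix p assume "p \<in> I"
          then obtain s i j where p: "p = (s, i, j)" "s < m" "i < r" "j < r" by (auto simp: I_def)
          have le1: "vecnorm (n k) (\<eta>' i) \<le> 1" if "i < r" for i
          proof -
            have "(vecnorm (n k) (\<eta> i))\<^sup>2 \<le> S" unfolding S_def using that by (intro member_le_sum) simp_all
            then have "\<rho> * \<rho> * (vecnorm (n k) (\<eta> i))\<^sup>2 \<le> 1" using \<rho> S by simp
            then have "(vecnorm (n k) (\<eta>' i))\<^sup>2 \<le> 1\<^sup>2"
              unfolding \<eta>'_def[abs_def] vecnorm_scale using \<rho>(2) by (simp add: power2_eq_square mult_ac)
            then show ?thesis by (rule power2_le_imp_le) simp
          qed
          have L0: "0 \<le> L s" using L[OF p(2), of k] opnorm_nonneg order_trans by blast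
          have "cmod (block_form av [k] (\<lambda>l. \<eta>') p) \<le> L s * (vecnorm (n k) (\<eta>' i) * vecnorm (n k) (\<eta>' j))"
            using bf p by simp
          also have "\<dots> \<le> L s * (1 * 1)"
            using le1 p L0 by (intro mult_left_mono mult_mono) simp_all
          finally show "(cmod (block_form av [k] (\<lambda>l. \<eta>') p))\<^sup>2 \<le> (L (fst p))\<^sup>2"
            using p by (intro power_mono) simp_all
        qed
        then have "\<theta> * (1 + (\<Sum>p\<in>I. (cmod (block_form av [k] (\<lambda>l. \<eta>') p))\<^sup>2)) / 2 \<le> \<theta> * (1 + P) / 2"
          using \<theta> by (intro divide_right_mono mult_left_mono) simp_all
        ultimately have "1 / S * X \<eta> \<le> \<theta> * (1 + P) / 2" using \<rho> by simp
        then show ?thesis using S by (simp add: field_simps)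
      qed
      then show "Re (\<Sum>i<r. \<Sum>j<r. cip (n k) (mv (n k) (T i j k) (\<eta> i)) (\<eta> j))
          \<le> (\<theta> * (1 + P) / 2) * (\<Sum>i<r. (vecnorm (n k) (\<eta> i))\<^sup>2)"
        unfolding XX S_def .
    qed
    also have "\<dots> \<le> (\<theta> * (1 + P) / 2) * \<bar>\<Gamma>\<bar>"
      unfolding \<Gamma>_def using P0 \<theta> by (intro mult_left_mono) simp_all
    also have "(\<Sum>i<r. \<Sum>j<r. G i j (t i j)) = (\<Sum>p\<in>I. cnj (c p) * \<tau> p)"
      unfolding sumI
    proof (intro sum.cong refl)
      fix i j assume "i \<in> {..<r}" "j \<in> {..<r}"
      then have ij: "i < r" "j < r" by simp_all
      show "G i j (t i j) = (\<Sum>s<m. cnj (c (s, i, j)) * \<tau> (s, i, j))"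
        unfolding t_def using av by (simp add: A.cp_family_csum[OF G ij] A.cp_familyD(2)[OF G ij] \<tau>_def)
    qed
    finally have "e\<^sup>2 \<le> \<theta> * (3 + 4 * Nt) / 2 + (\<theta> * (1 + P) / 2) * \<bar>\<Gamma>\<bar>" using c\<tau> by linarith
    also have "\<dots> = \<theta> * E" by (simp add: E_def algebra_simps)
    finally show False using \<theta>E by simp
  qed
  then obtain ks \<eta> where ks: "\<forall>k\<in>set ks. K \<le> k" "(\<Sum>p\<in>I. (cmod (\<tau> p - block_form av ks \<eta> p))\<^sup>2) < e\<^sup>2"
    unfolding Kc_def by blast
  have close: "cmod (block_form av ks \<eta> (s, i, j) - G i j (av s)) < e" if "s < m" "i < r" "j < r" for s i j
  proof -
    have "(cmod (\<tau> (s, i, j) - block_form av ks \<eta> (s, i, j)))\<^sup>2 \<le> (\<Sum>p\<in>I. (cmod (\<tau> p - block_form av ks \<eta> p))\<^sup>2)"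
      using that finI by (intro member_le_sum) (simp_all add: I_def)
    then have "(cmod (\<tau> (s, i, j) - block_form av ks \<eta> (s, i, j)))\<^sup>2 < e\<^sup>2" by (rule le_less_trans[OF _ ks(2)])
    then have "cmod (\<tau> (s, i, j) - block_form av ks \<eta> (s, i, j)) < e"
      by (rule power2_less_imp_less) (rule less_imp_le[OF e])
    then show ?thesis by (simp add: \<tau>_def norm_minus_commute)
  qed
  show ?thesis
  \<comment> \<open>An empty list would lead to dimension 0; one block carrying zero vectors has the
    same data.\<close>
  proof (cases "ks = []")
    case True
    have "block_form av [K] (\<lambda>l i \<alpha>. 0) p = block_form av ks \<eta> p" for p
      unfolding block_form_zero using True by (simp add: block_form_def split: prod.split)
    then show ?thesis using close by (intro exI[of _ "[K]"] exI[of _ "\<lambda>l i \<alpha>. 0"]) simp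
  next
    case False
    then show ?thesis using close ks(1) by (intro exI[of _ ks] exI[of _ \<eta>] conjI allI impI) simp_all
  qed
qed

text \<open>Further copies of the block list, on which the vectors vanish, leave the data unchanged.
  All multiples of p become available as dimensions, so models of two algebras can be brought to a
  common one.\<close>

lemma ex_model_dim:
  fixes av :: "nat \<Rightarrow> 'a" and m r :: nat
  assumes G: "A.cp_family r G" and av: "\<And>s. s < m \<Longrightarrow> av s \<in> A.C" and e: "0 < e"
  shows "\<exists>p>0. \<forall>t\<ge>1. \<exists>\<Phi> \<zeta>. tail_hom n K (p * t) \<Phi> \<and>
    (\<forall>s<m. \<forall>i<r. \<forall>j<r. cmod (cip (p * t) (mv (p * t) (\<Phi> (lift (av s))) (\<zeta> i)) (\<zeta> j) - G i j (av s)) < e)"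
proof -
  obtain ks \<eta> where ks: "ks \<noteq> []" "\<forall>k\<in>set ks. K \<le> k"
    and close: "\<forall>s<m. \<forall>i<r. \<forall>j<r. cmod (block_form av ks \<eta> (s, i, j) - G i j (av s)) < e"
  proof -
    have "\<exists>ks \<eta>. ks \<noteq> [] \<and> (\<forall>k\<in>set ks. K \<le> k) \<and>
      (\<forall>s<m. \<forall>i<r. \<forall>j<r. cmod (block_form av ks \<eta> (s, i, j) - G i j (av s)) < e)"
      using G av e by (rule ex_model)
    then show thesis using that by (elim exE conjE)
  qed
  define p where "p = (\<Sum>k\<leftarrow>ks. n k)"
  have "p > 0" using ks(1) npos by (cases ks) (simp_all add: p_def)
  moreover have "\<exists>\<Phi> \<zeta>. tail_hom n K (p * t) \<Phi> \<and>
    (\<forall>s<m. \<forall>i<r. \<forall>j<r. cmod (cip (p * t) (mv (p * t) (\<Phi> (lift (av s))) (\<zeta> i)) (\<zeta> j) - G i j (av s)) < e)"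
    if t: "t \<ge> 1" for t
  proof -
    define rest where "rest u = concat (replicate u ks)" for u :: nat
    have rest: "(\<Sum>k\<leftarrow>rest u. n k) = u * p" "set (rest u) \<subseteq> set ks" for u
      by (induction u) (auto simp: rest_def p_def)
    define ks' where "ks' = ks @ rest (t - 1)"
    have dim: "(\<Sum>k\<leftarrow>ks'. n k) = p * t"
    proof -
      have "(\<Sum>k\<leftarrow>ks'. n k) = p + (t - 1) * p" using rest by (simp add: ks'_def p_def)
      also have "\<dots> = (1 + (t - 1)) * p" by (simp only: distrib_right mult_1)
      also have "1 + (t - 1) = t" using t by simp
      finally show ?thesis by (simp add: mult.commute)
    qed
    have "\<And>k. k \<in> set ks' \<Longrightarrow> K \<le> k" using ks(2) rest(2)[of "t - 1"] by (auto simp: ks'_def)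
    then have "\<exists>\<Phi> em. tail_hom n K (\<Sum>k\<leftarrow>ks'. n k) \<Phi> \<and>
      (\<forall>x \<eta> \<eta>'. cip (\<Sum>k\<leftarrow>ks'. n k) (mv (\<Sum>k\<leftarrow>ks'. n k) (\<Phi> x) (em \<eta>)) (em \<eta>')
       = (\<Sum>l<length ks'. cip (n (ks' ! l)) (mv (n (ks' ! l)) (x (ks' ! l)) (\<eta> l)) (\<eta>' l)))"
      by (rule ex_block_model)
    then obtain \<Phi> em where \<Phi>: "tail_hom n K (p * t) \<Phi>"
      and "\<forall>x \<eta> \<eta>'. cip (p * t) (mv (p * t) (\<Phi> x) (em \<eta>)) (em \<eta>')
        = (\<Sum>l<length ks'. cip (n (ks' ! l)) (mv (n (ks' ! l)) (x (ks' ! l)) (\<eta> l)) (\<eta>' l))"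
      unfolding dim by (elim exE conjE)
    then have em: "cip (p * t) (mv (p * t) (\<Phi> x) (em \<eta>)) (em \<eta>')
        = (\<Sum>l<length ks'. cip (n (ks' ! l)) (mv (n (ks' ! l)) (x (ks' ! l)) (\<eta> l)) (\<eta>' l))" for x \<eta> \<eta>'
      by simp
    define \<eta>' where "\<eta>' = (\<lambda>l. if l < length ks then \<eta> l else (\<lambda>i \<alpha>. 0))"
    have "cip (p * t) (mv (p * t) (\<Phi> (lift (av s))) (em (\<lambda>l. \<eta>' l i))) (em (\<lambda>l. \<eta>' l j)) = block_form av ks \<eta> (s, i, j)" for s i j
    proof -
      have "cip (p * t) (mv (p * t) (\<Phi> (lift (av s))) (em (\<lambda>l. \<eta>' l i))) (em (\<lambda>l. \<eta>' l j)) = block_form av ks' \<eta>' (s, i, j)"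
        unfolding em by (simp add: block_form_def)
      also have "\<dots> = block_form av ks \<eta> (s, i, j) + block_form av (rest (t - 1)) (\<lambda>l i \<alpha>. 0) (s, i, j)"
        unfolding ks'_def \<eta>'_def by (rule block_form_append[where \<eta>' = "\<lambda>l i \<alpha>. 0"])
      finally show ?thesis by (simp only: block_form_zero add_0_right)
    qed
    then show ?thesis using \<Phi> close by (intro exI[of _ \<Phi>] exI[of _ "\<lambda>i. em (\<lambda>l. \<eta>' l i)"] conjI allI impI) simp_all
  qed
  ultimately show ?thesis by blast
qed

text \<open>The double sum is F(Z^* Z) for the element Z that is the sum of \<sigma>(z_i)
  x_i.\<close>

lemma state_cp_family:
  assumes \<sigma>: "cstar_hom A D \<sigma>" and F: "cstar_algebra.is_state D F"
    and x: "\<And>i. i < r \<Longrightarrow> x i \<in> cs_carrier D"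
  shows "A.cp_family r (\<lambda>i j a. F (\<star>\<^bsub>D\<^esub> (x j) \<otimes>\<^bsub>D\<^esub> (\<sigma> a \<otimes>\<^bsub>D\<^esub> x i)))"
proof -
  interpret S: cstar_hom A D \<sigma> by fact
  note F = S.B.stateD[OF F]
  have pos: "0 \<le> Re (\<Sum>i<r. \<Sum>j<r. F (\<star>\<^bsub>D\<^esub> (x j) \<otimes>\<^bsub>D\<^esub> (\<sigma> (\<star>\<^bsub>A\<^esub> (z j) \<otimes>\<^bsub>A\<^esub> z i) \<otimes>\<^bsub>D\<^esub> x i)))"
    if z: "\<forall>i<r. z i \<in> A.C" for z
  proof -
    define g where "g i = \<sigma> (z i) \<otimes>\<^bsub>D\<^esub> x i" for i
    define Z where "Z = S.B.csum g r"
    have g: "g i \<in> S.B.C" if "i < r" for i using that z x by (simp add: g_def)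
    have Z: "Z \<in> S.B.C" using g by (simp add: Z_def)
    have "\<star>\<^bsub>D\<^esub> Z \<otimes>\<^bsub>D\<^esub> Z = S.B.csum (\<lambda>j. \<star>\<^bsub>D\<^esub> (g j) \<otimes>\<^bsub>D\<^esub> Z) r"
      using g Z by (subst (1) Z_def) (simp add: S.B.csum_star S.B.csum_mult)
    then have "F (\<star>\<^bsub>D\<^esub> Z \<otimes>\<^bsub>D\<^esub> Z) = (\<Sum>j<r. F (\<star>\<^bsub>D\<^esub> (g j) \<otimes>\<^bsub>D\<^esub> Z))"
      using g Z by (simp add: S.B.state_csum[OF assms(2)])
    also have "\<dots> = (\<Sum>j<r. \<Sum>i<r. F (\<star>\<^bsub>D\<^esub> (g j) \<otimes>\<^bsub>D\<^esub> g i))"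
    proof (rule sum.cong[OF refl])
      fix j assume "j \<in> {..<r}"
      then have "\<star>\<^bsub>D\<^esub> (g j) \<otimes>\<^bsub>D\<^esub> Z = S.B.csum (\<lambda>i. \<star>\<^bsub>D\<^esub> (g j) \<otimes>\<^bsub>D\<^esub> g i) r"
        unfolding Z_def using g by (intro S.B.csum_mult) simp_all
      then show "F (\<star>\<^bsub>D\<^esub> (g j) \<otimes>\<^bsub>D\<^esub> Z) = (\<Sum>i<r. F (\<star>\<^bsub>D\<^esub> (g j) \<otimes>\<^bsub>D\<^esub> g i))"
        using g \<open>j \<in> {..<r}\<close> by (simp add: S.B.state_csum[OF assms(2)])
    qed
    also have "\<dots> = (\<Sum>i<r. \<Sum>j<r. F (\<star>\<^bsub>D\<^esub> (g j) \<otimes>\<^bsub>D\<^esub> g i))" by (rule sum.swap)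
    also have "\<dots> = (\<Sum>i<r. \<Sum>j<r. F (\<star>\<^bsub>D\<^esub> (x j) \<otimes>\<^bsub>D\<^esub> (\<sigma> (\<star>\<^bsub>A\<^esub> (z j) \<otimes>\<^bsub>A\<^esub> z i) \<otimes>\<^bsub>D\<^esub> x i)))"
      using z x by (intro sum.cong refl) (simp add: g_def S.B.mult_assoc)
    finally show ?thesis using F(4)[OF Z] by simp
  qed
  have herm: "F (\<star>\<^bsub>D\<^esub> (x j) \<otimes>\<^bsub>D\<^esub> (\<sigma> (\<star>\<^bsub>A\<^esub> a) \<otimes>\<^bsub>D\<^esub> x i)) = cnj (F (\<star>\<^bsub>D\<^esub> (x i) \<otimes>\<^bsub>D\<^esub> (\<sigma> a \<otimes>\<^bsub>D\<^esub> x j)))"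
    if "i < r" "j < r" "a \<in> A.C" for i j a
  proof -
    have "\<star>\<^bsub>D\<^esub> (\<star>\<^bsub>D\<^esub> (x i) \<otimes>\<^bsub>D\<^esub> (\<sigma> a \<otimes>\<^bsub>D\<^esub> x j)) = \<star>\<^bsub>D\<^esub> (x j) \<otimes>\<^bsub>D\<^esub> (\<sigma> (\<star>\<^bsub>A\<^esub> a) \<otimes>\<^bsub>D\<^esub> x i)"
      using that x by (simp add: S.B.mult_assoc)
    then show ?thesis using F(3)[of "\<star>\<^bsub>D\<^esub> (x i) \<otimes>\<^bsub>D\<^esub> (\<sigma> a \<otimes>\<^bsub>D\<^esub> x j)"] that x by simp
  qed
  show ?thesis
    unfolding A.cp_family_def using x F(1,2) herm pos by (simp add: S.B.distl S.B.distr)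
qed

lemma lift_one_sim: "sim n (lift \<one>\<^bsub>A\<^esub>) (sone n)"
proof -
  have "mq_class n (lift \<one>\<^bsub>A\<^esub>) = mq_class n (sone n)" using lift(2)[of "\<one>\<^bsub>A\<^esub>"] by (simp add: MQ_one)
  then show ?thesis using lift(1)[of "\<one>\<^bsub>A\<^esub>"] by (simp add: mq_class_eq_iff)
qed

lemma lift_star_mult_sim:
  assumes a: "a \<in> A.C"
  shows "sim n (lift (\<star>\<^bsub>A\<^esub> a \<otimes>\<^bsub>A\<^esub> a)) (smul n (sstar (lift a)) (lift a))"
proof -
  have "mq_class n (lift (\<star>\<^bsub>A\<^esub> a \<otimes>\<^bsub>A\<^esub> a)) = \<star>\<^bsub>MQ n\<^esub> (\<phi> a) \<otimes>\<^bsub>MQ n\<^esub> \<phi> a" using a by (simp add: lift(2))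
  also have "\<dots> = mq_class n (smul n (sstar (lift a)) (lift a))"
    unfolding lift(2)[OF a, symmetric] using lift(1)[OF a] by (simp add: MQ_star MQ_mult)
  finally show ?thesis using a lift(1) by (simp add: mq_class_eq_iff)
qed

text \<open>The vector \<open>\<zeta>\<^sub>i\<close> imitates the GNS vector of \<open>x\<^sub>i\<close>.\<close>
lemma ex_stage:
  fixes av :: "nat \<Rightarrow> 'a" and m r K :: nat
  assumes \<sigma>: "cstar_hom A D \<sigma>" and F: "cstar_algebra.is_state D F"
    and x: "\<And>i. i < r \<Longrightarrow> x i \<in> cs_carrier D" and av: "\<And>s. s < m \<Longrightarrow> av s \<in> A.C" and e: "0 < e"
  shows "\<exists>p>0. \<forall>t\<ge>1. \<exists>\<Phi> \<zeta>. tail_hom n K (p * t) \<Phi> \<and>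
    (\<forall>i<r. \<forall>j<r. cmod (cip (p * t) (\<zeta> i) (\<zeta> j) - F (\<star>\<^bsub>D\<^esub> (x j) \<otimes>\<^bsub>D\<^esub> x i)) < e) \<and>
    (\<forall>s<m. \<forall>i<r. \<forall>j<r. \<sigma> (av s) \<otimes>\<^bsub>D\<^esub> x i = x j \<longrightarrow>
       vecnorm (p * t) (\<lambda>l. mv (p * t) (\<Phi> (lift (av s))) (\<zeta> i) l - \<zeta> j l) < e)"
proof -
  interpret S: cstar_hom A D \<sigma> by fact
  define G where "G = (\<lambda>i j a. F (\<star>\<^bsub>D\<^esub> (x j) \<otimes>\<^bsub>D\<^esub> (\<sigma> a \<otimes>\<^bsub>D\<^esub> x i)))"
  have G: "A.cp_family r G" unfolding G_def using \<sigma> F x by (rule state_cp_family)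
  \<comment> \<open>The unit controls the Gram matrix. The elements a_s and a_s^* a_s control the
    distance of \<Phi>(a_s) \<zeta>_i from \<zeta>_j once its square is expanded.\<close>
  define bv where "bv s = (if s = 0 then \<one>\<^bsub>A\<^esub> else if s \<le> m then av (s - 1)
      else \<star>\<^bsub>A\<^esub> (av (s - m - 1)) \<otimes>\<^bsub>A\<^esub> av (s - m - 1))" for s
  have bv: "bv s \<in> A.C" if "s < 2 * m + 1" for s using that av by (auto simp: bv_def)
  have bv_simps: "bv 0 = \<one>\<^bsub>A\<^esub>" "\<And>s. s < m \<Longrightarrow> bv (Suc s) = av s"
    "\<And>s. s < m \<Longrightarrow> bv (Suc (m + s)) = \<star>\<^bsub>A\<^esub> (av s) \<otimes>\<^bsub>A\<^esub> av s"
    by (auto simp: bv_def)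
  \<comment> \<open>A bound for all squared norms of the \<zeta>_i. The factor 2 pays for moving d
    times the squared norm to the other side, with d <= 1/2.\<close>
  define \<Gamma> where "\<Gamma> = (\<Sum>i<r. 2 * (cmod (G i i \<one>\<^bsub>A\<^esub>) + 1))"
  have \<Gamma>0: "0 \<le> \<Gamma>" unfolding \<Gamma>_def by (intro sum_nonneg) simp
  \<comment> \<open>5 + 2 \<Gamma> exceeds both error totals: 1 + \<Gamma> for Gram numbers, to be
    below e, and 4 + 2 \<Gamma> for the squared distance, to be below e^2.\<close>
  define d where "d = min (1/2) (min e (e\<^sup>2) / (5 + 2 * \<Gamma>))"
  have "d * (5 + 2 * \<Gamma>) \<le> min e (e\<^sup>2) / (5 + 2 * \<Gamma>) * (5 + 2 * \<Gamma>)"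
    using \<Gamma>0 by (intro mult_right_mono) (simp_all add: d_def)
  then have d5: "d * (5 + 2 * \<Gamma>) \<le> min e (e\<^sup>2)" using \<Gamma>0 by simp
  have "0 < min e (e\<^sup>2) / (5 + 2 * \<Gamma>)" using e \<Gamma>0 by (intro divide_pos_pos) simp_all
  then have d: "0 < d" "d \<le> 1/2" unfolding d_def by (simp, intro min.cobounded1)
  have "0 < d * (4 + \<Gamma>)" "0 < d * 1" using d \<Gamma>0 by (intro mult_pos_pos; simp)+
  then have d1: "d * (1 + \<Gamma>) < e" and d2: "d * (4 + 2 * \<Gamma>) < e\<^sup>2"
    using d5 by (simp_all add: algebra_simps)
  have "\<forall>\<^sub>F k in sequentially. opnorm (n k) (ssub (lift \<one>\<^bsub>A\<^esub>) (sone n) k) < d \<and>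
     (\<forall>s\<in>{..<m}. opnorm (n k) (ssub (lift (\<star>\<^bsub>A\<^esub> (av s) \<otimes>\<^bsub>A\<^esub> av s)) (smul n (sstar (lift (av s))) (lift (av s))) k) < d)"
    using d av by (intro eventually_conj eventually_ball_finite ballI sim_eventually lift_one_sim lift_star_mult_sim) simp_all
  then obtain K0 where K0: "\<And>k. K0 \<le> k \<Longrightarrow> opnorm (n k) (ssub (lift \<one>\<^bsub>A\<^esub>) (sone n) k) < d"
    "\<And>k s. K0 \<le> k \<Longrightarrow> s < m \<Longrightarrow> opnorm (n k) (ssub (lift (\<star>\<^bsub>A\<^esub> (av s) \<otimes>\<^bsub>A\<^esub> av s)) (smul n (sstar (lift (av s))) (lift (av s))) k) < d"
    unfolding eventually_sequentially by auto
  \<comment> \<open>\<open>lift\<close> chooses representatives, so it respects the unit and a_s^*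
    a_s only up to null sequences. Beyond K0 these defects are below d, and a representation of the
    tail inherits this.\<close>
  define K' where "K' = max K K0"
  have "\<exists>p>0. \<forall>t\<ge>1. \<exists>\<Phi> \<zeta>. tail_hom n K' (p * t) \<Phi> \<and>
    (\<forall>s<2 * m + 1. \<forall>i<r. \<forall>j<r. cmod (cip (p * t) (mv (p * t) (\<Phi> (lift (bv s))) (\<zeta> i)) (\<zeta> j) - G i j (bv s)) < d)"
    using G bv d(1) by (rule ex_model_dim)
  then obtain p where p: "p > 0" "\<forall>t\<ge>1. \<exists>\<Phi> \<zeta>. tail_hom n K' (p * t) \<Phi> \<and>
    (\<forall>s<2 * m + 1. \<forall>i<r. \<forall>j<r. cmod (cip (p * t) (mv (p * t) (\<Phi> (lift (bv s))) (\<zeta> i)) (\<zeta> j) - G i j (bv s)) < d)"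
    by (elim exE conjE)
  have "\<exists>\<Phi> \<zeta>. tail_hom n K (p * t) \<Phi> \<and>
    (\<forall>i<r. \<forall>j<r. cmod (cip (p * t) (\<zeta> i) (\<zeta> j) - F (\<star>\<^bsub>D\<^esub> (x j) \<otimes>\<^bsub>D\<^esub> x i)) < e) \<and>
    (\<forall>s<m. \<forall>i<r. \<forall>j<r. \<sigma> (av s) \<otimes>\<^bsub>D\<^esub> x i = x j \<longrightarrow>
       vecnorm (p * t) (\<lambda>l. mv (p * t) (\<Phi> (lift (av s))) (\<zeta> i) l - \<zeta> j l) < e)"
    if t: "t \<ge> 1" for t
  proof -
    let ?M = "p * t"
    obtain \<Phi> \<zeta> where \<Phi>: "tail_hom n K' ?M \<Phi>"
      and "\<forall>s<2 * m + 1. \<forall>i<r. \<forall>j<r. cmod (cip ?M (mv ?M (\<Phi> (lift (bv s))) (\<zeta> i)) (\<zeta> j) - G i j (bv s)) < d"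
      using p(2)[rule_format, OF t] by (elim exE conjE)
    then have app: "cmod (cip ?M (mv ?M (\<Phi> (lift (bv s))) (\<zeta> i)) (\<zeta> j) - G i j (bv s)) < d"
      if "s < 2 * m + 1" "i < r" "j < r" for s i j using that by simp
    have one: "opnorm ?M (\<lambda>i j. \<Phi> (lift \<one>\<^bsub>A\<^esub>) i j - mid ?M i j) \<le> d"
    proof -
      have "opnorm ?M (\<Phi> (ssub (lift \<one>\<^bsub>A\<^esub>) (sone n))) \<le> d"
        using K0(1) by (intro tail_homD(7)[OF \<Phi>]) (simp add: K'_def less_imp_le)
      then show ?thesis by (simp only: tail_hom_ssub[OF \<Phi>] tail_homD(5)[OF \<Phi>])
    qed
    have sq: "opnorm ?M (\<lambda>i j. \<Phi> (lift (\<star>\<^bsub>A\<^esub> (av s) \<otimes>\<^bsub>A\<^esub> av s)) i j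
        - mm ?M (adj (\<Phi> (lift (av s)))) (\<Phi> (lift (av s))) i j) \<le> d" if s: "s < m" for s
    proof -
      have "opnorm ?M (\<Phi> (ssub (lift (\<star>\<^bsub>A\<^esub> (av s) \<otimes>\<^bsub>A\<^esub> av s)) (smul n (sstar (lift (av s))) (lift (av s))))) \<le> d"
        using K0(2)[OF _ s] by (intro tail_homD(7)[OF \<Phi>]) (simp add: K'_def less_imp_le)
      then show ?thesis by (simp only: tail_hom_ssub[OF \<Phi>] tail_homD(3,4)[OF \<Phi>])
    qed
    have mid: "cip ?M (mv ?M (mid ?M) v) w = cip ?M v w" for v w
      by (intro cip_cong) (simp_all add: mv_mid)
    have norm: "(vecnorm ?M (\<zeta> i))\<^sup>2 \<le> \<Gamma>" if i: "i < r" for i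
    proof -
      have "cmod (cip ?M (mv ?M (\<Phi> (lift \<one>\<^bsub>A\<^esub>)) (\<zeta> i)) (\<zeta> i) - cip ?M (\<zeta> i) (\<zeta> i)) \<le> d * (vecnorm ?M (\<zeta> i))\<^sup>2"
        using cip_opnorm_diff[OF one, of "\<zeta> i" "\<zeta> i"] by (simp add: mid power2_eq_square)
      moreover have "cmod (cip ?M (mv ?M (\<Phi> (lift \<one>\<^bsub>A\<^esub>)) (\<zeta> i)) (\<zeta> i) - G i i \<one>\<^bsub>A\<^esub>) < d"
        using app[of 0 i i] i by (simp add: bv_simps)
      moreover have "cmod (cip ?M (\<zeta> i) (\<zeta> i)) = (vecnorm ?M (\<zeta> i))\<^sup>2" by (simp add: cip_self norm_power)
      moreover have "cmod c \<le> cmod g + cmod (a - c) + cmod (a - g)" for a c g :: complex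
      proof -
        have "c = (g + (a - g)) - (a - c)" by simp
        then show ?thesis using norm_triangle_ineq4[of "g + (a - g)" "a - c"] norm_triangle_ineq[of g "a - g"] by simp
      qed
      ultimately have "(vecnorm ?M (\<zeta> i))\<^sup>2 \<le> cmod (G i i \<one>\<^bsub>A\<^esub>) + d * (vecnorm ?M (\<zeta> i))\<^sup>2 + d"
        by (smt (verit))
      moreover have "d * (vecnorm ?M (\<zeta> i))\<^sup>2 \<le> 1/2 * (vecnorm ?M (\<zeta> i))\<^sup>2" using d by (intro mult_right_mono) simp_all
      ultimately have "(vecnorm ?M (\<zeta> i))\<^sup>2 \<le> 2 * (cmod (G i i \<one>\<^bsub>A\<^esub>) + 1)" using d by simp
      also have "\<dots> \<le> \<Gamma>" unfolding \<Gamma>_def using i by (intro member_le_sum) simp_all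
      finally show ?thesis .
    qed
    have norm2: "vecnorm ?M (\<zeta> i) * vecnorm ?M (\<zeta> j) \<le> \<Gamma>" if "i < r" "j < r" for i j
    proof -
      have "2 * (vecnorm ?M (\<zeta> i) * vecnorm ?M (\<zeta> j)) \<le> (vecnorm ?M (\<zeta> i))\<^sup>2 + (vecnorm ?M (\<zeta> j))\<^sup>2"
        using sum_squares_bound[of "vecnorm ?M (\<zeta> i)" "vecnorm ?M (\<zeta> j)"] by simp
      then show ?thesis using norm[OF that(1)] norm[OF that(2)] by linarith
    qed
    have G1: "G i j \<one>\<^bsub>A\<^esub> = F (\<star>\<^bsub>D\<^esub> (x j) \<otimes>\<^bsub>D\<^esub> x i)" if "i < r" for i j
      using that x by (simp add: G_def)
    have gram: "cmod (cip ?M (\<zeta> i) (\<zeta> j) - F (\<star>\<^bsub>D\<^esub> (x j) \<otimes>\<^bsub>D\<^esub> x i)) \<le> d * (1 + \<Gamma>)" if ij: "i < r" "j < r" for i j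
    proof -
      have "cmod (cip ?M (mv ?M (\<Phi> (lift \<one>\<^bsub>A\<^esub>)) (\<zeta> i)) (\<zeta> j) - cip ?M (\<zeta> i) (\<zeta> j))
          \<le> d * (vecnorm ?M (\<zeta> i) * vecnorm ?M (\<zeta> j))"
        using cip_opnorm_diff[OF one, of "\<zeta> i" "\<zeta> j"] by (simp add: mid)
      also have "\<dots> \<le> d * \<Gamma>" using norm2[OF ij] d by (intro mult_left_mono) simp_all
      finally have "cmod (cip ?M (mv ?M (\<Phi> (lift \<one>\<^bsub>A\<^esub>)) (\<zeta> i)) (\<zeta> j) - cip ?M (\<zeta> i) (\<zeta> j)) \<le> d * \<Gamma>" .
      moreover have "cmod (cip ?M (mv ?M (\<Phi> (lift \<one>\<^bsub>A\<^esub>)) (\<zeta> i)) (\<zeta> j) - F (\<star>\<^bsub>D\<^esub> (x j) \<otimes>\<^bsub>D\<^esub> x i)) < d"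
        using app[of 0 i j] ij by (simp add: bv_simps G1)
      moreover have "cmod (c - g) \<le> cmod (a - c) + cmod (a - g)" for a c g :: complex
        using norm_triangle_ineq4[of "a - g" "a - c"] by simp
      ultimately have "cmod (cip ?M (\<zeta> i) (\<zeta> j) - F (\<star>\<^bsub>D\<^esub> (x j) \<otimes>\<^bsub>D\<^esub> x i)) \<le> d * \<Gamma> + d"
        by (smt (verit))
      then show ?thesis by (simp add: algebra_simps)
    qed
    have act: "vecnorm ?M (\<lambda>l. mv ?M (\<Phi> (lift (av s))) (\<zeta> i) l - \<zeta> j l) < e"
      if s: "s < m" and ij: "i < r" "j < r" and rel: "\<sigma> (av s) \<otimes>\<^bsub>D\<^esub> x i = x j" for s i j
    proof -
      let ?P = "\<Phi> (lift (av s))"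
      let ?u = "mv ?M ?P (\<zeta> i)"
      define f where "f = F (\<star>\<^bsub>D\<^esub> (x j) \<otimes>\<^bsub>D\<^esub> x j)"
      have Gsq: "G i i (\<star>\<^bsub>A\<^esub> (av s) \<otimes>\<^bsub>A\<^esub> av s) = f"
      proof -
        have "\<star>\<^bsub>D\<^esub> (x i) \<otimes>\<^bsub>D\<^esub> (\<sigma> (\<star>\<^bsub>A\<^esub> (av s) \<otimes>\<^bsub>A\<^esub> av s) \<otimes>\<^bsub>D\<^esub> x i) = \<star>\<^bsub>D\<^esub> (\<sigma> (av s) \<otimes>\<^bsub>D\<^esub> x i) \<otimes>\<^bsub>D\<^esub> (\<sigma> (av s) \<otimes>\<^bsub>D\<^esub> x i)"
          using av s ij x by (simp add: S.B.mult_assoc)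
        then show ?thesis by (simp add: G_def f_def rel)
      qed
      have Ga: "G i j (av s) = f" by (simp add: G_def f_def rel)
      have "cip ?M ?u ?u = cip ?M (mv ?M (mm ?M (adj ?P) ?P) (\<zeta> i)) (\<zeta> i)"
        using cip_adj[of ?M "adj ?P" "mv ?M ?P (\<zeta> i)" "\<zeta> i"] by (simp add: mv_mm)
      then have "cmod (cip ?M (mv ?M (\<Phi> (lift (\<star>\<^bsub>A\<^esub> (av s) \<otimes>\<^bsub>A\<^esub> av s))) (\<zeta> i)) (\<zeta> i) - cip ?M ?u ?u)
          \<le> d * (vecnorm ?M (\<zeta> i) * vecnorm ?M (\<zeta> i))"
        using cip_opnorm_diff[OF sq[OF s], of "\<zeta> i" "\<zeta> i"] by simp
      also have "\<dots> \<le> d * \<Gamma>" using norm2[OF ij(1) ij(1)] d by (intro mult_left_mono) simp_all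
      finally have 1: "cmod (cip ?M (mv ?M (\<Phi> (lift (\<star>\<^bsub>A\<^esub> (av s) \<otimes>\<^bsub>A\<^esub> av s))) (\<zeta> i)) (\<zeta> i) - cip ?M ?u ?u) \<le> d * \<Gamma>" .
      have 2: "cmod (cip ?M (mv ?M (\<Phi> (lift (\<star>\<^bsub>A\<^esub> (av s) \<otimes>\<^bsub>A\<^esub> av s))) (\<zeta> i)) (\<zeta> i) - f) < d"
        using app[of "Suc (m + s)" i i] ij s by (simp add: bv_simps Gsq)
      have 3: "cmod (cip ?M ?u (\<zeta> j) - f) < d"
        using app[of "Suc s" i j] ij s by (simp add: bv_simps Ga)
      have 4: "cmod (cip ?M (\<zeta> j) (\<zeta> j) - f) \<le> d * (1 + \<Gamma>)"
        unfolding f_def using gram[OF ij(2) ij(2)] .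
      \<comment> \<open>All four terms are close to multiples of f, with total coefficient 1 - 1 - 1
        + 1 = 0.\<close>
      have "cip ?M (\<lambda>l. ?u l - \<zeta> j l) (\<lambda>l. ?u l - \<zeta> j l) = cip ?M ?u ?u - cip ?M ?u (\<zeta> j) - cnj (cip ?M ?u (\<zeta> j)) + cip ?M (\<zeta> j) (\<zeta> j)"
        using cip_commute[of ?M "\<zeta> j" ?u] by (simp add: cip_diff_left cip_diff_right)
      then have 5: "(vecnorm ?M (\<lambda>l. ?u l - \<zeta> j l))\<^sup>2 = Re (cip ?M ?u ?u) - 2 * Re (cip ?M ?u (\<zeta> j)) + Re (cip ?M (\<zeta> j) (\<zeta> j))"
        by (simp add: vecnorm_eq_cip)
      have 6: "Re (cip ?M ?u ?u) \<le> Re f + d * \<Gamma> + d"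
        using abs_Re_le_cmod[of "cip ?M (mv ?M (\<Phi> (lift (\<star>\<^bsub>A\<^esub> (av s) \<otimes>\<^bsub>A\<^esub> av s))) (\<zeta> i)) (\<zeta> i) - cip ?M ?u ?u"]
          abs_Re_le_cmod[of "cip ?M (mv ?M (\<Phi> (lift (\<star>\<^bsub>A\<^esub> (av s) \<otimes>\<^bsub>A\<^esub> av s))) (\<zeta> i)) (\<zeta> i) - f"] 1 2
        unfolding minus_complex.simps by linarith
      have 7: "Re (cip ?M (\<zeta> j) (\<zeta> j)) \<le> Re f + d * (1 + \<Gamma>)"
        using abs_Re_le_cmod[of "cip ?M (\<zeta> j) (\<zeta> j) - f"] 4 unfolding minus_complex.simps by linarith
      have 8: "Re f - d \<le> Re (cip ?M ?u (\<zeta> j))"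
        using abs_Re_le_cmod[of "cip ?M ?u (\<zeta> j) - f"] 3 unfolding minus_complex.simps by linarith
      have "d * (4 + 2 * \<Gamma>) = d * \<Gamma> + d + 2 * d + d * (1 + \<Gamma>)" by (simp add: algebra_simps)
      then have "(vecnorm ?M (\<lambda>l. ?u l - \<zeta> j l))\<^sup>2 < e\<^sup>2" using 5 6 7 8 d2 by linarith
      then show ?thesis by (rule power2_less_imp_less) (rule less_imp_le[OF e])
    qed
    have "tail_hom n K ?M \<Phi>" using \<Phi> by (rule tail_hom_mono) (simp add: K'_def)
    moreover have "cmod (cip ?M (\<zeta> i) (\<zeta> j) - F (\<star>\<^bsub>D\<^esub> (x j) \<otimes>\<^bsub>D\<^esub> x i)) < e" if "i < r" "j < r" for i j
      using gram[OF that] d1 by linarith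
    ultimately show ?thesis using act by (intro exI[of _ \<Phi>] exI[of _ \<zeta>] conjI allI impI) simp_all
  qed
  then show ?thesis using p(1) by (intro exI[of _ p] conjI allI impI) simp_all
qed

end

text \<open>The models of A and B are available in the dimensions p t and q t, so p q is common. A
  unitary U carries the vectors of the first model close to those of the second, and conjugation of
  the representation of B by U lets the first family of vectors serve both.\<close>

lemma ex_joint_stage:
  fixes a :: "nat \<Rightarrow> 'a" and b :: "nat \<Rightarrow> 'b" and k l r K :: nat
  assumes A: "mf_embedding A n \<phi>" and B: "mf_embedding B m \<psi>"
    and \<sigma>: "cstar_hom A D \<sigma>" and \<tau>: "cstar_hom B D \<tau>"
    and F: "cstar_algebra.is_state D F"
    and x: "\<And>i. i < r \<Longrightarrow> x i \<in> cs_carrier D" and a: "\<And>s. s < k \<Longrightarrow> a s \<in> cs_carrier A"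
    and b: "\<And>s. s < l \<Longrightarrow> b s \<in> cs_carrier B" and e: "0 < e"
  shows "\<exists>M \<Phi> \<Psi> \<zeta>. 0 < M \<and> tail_hom n K M \<Phi> \<and> tail_hom m K M \<Psi> \<and>
    (\<forall>i<r. \<forall>j<r. cmod (cip M (\<zeta> i) (\<zeta> j) - F (\<star>\<^bsub>D\<^esub> (x j) \<otimes>\<^bsub>D\<^esub> x i)) < e) \<and>
    (\<forall>s<k. \<forall>i<r. \<forall>j<r. \<sigma> (a s) \<otimes>\<^bsub>D\<^esub> x i = x j \<longrightarrow>
       vecnorm M (\<lambda>l. mv M (\<Phi> (mq_rep (\<phi> (a s)))) (\<zeta> i) l - \<zeta> j l) < e) \<and>
    (\<forall>s<l. \<forall>i<r. \<forall>j<r. \<tau> (b s) \<otimes>\<^bsub>D\<^esub> x i = x j \<longrightarrow>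
       vecnorm M (\<lambda>l. mv M (\<Psi> (mq_rep (\<psi> (b s)))) (\<zeta> i) l - \<zeta> j l) < e)"
proof -
  interpret A: mf_embedding A n \<phi> by fact
  interpret B: mf_embedding B m \<psi> by fact
  have "\<exists>L. \<forall>k. opnorm (m k) (mq_rep (\<psi> (b s)) k) \<le> L" if "s < l" for s
    using prodM_bound[OF B.lift(1)] b that by (simp add: B.lift_def)
  then obtain L' where L': "\<And>s k. s < l \<Longrightarrow> opnorm (m k) (mq_rep (\<psi> (b s)) k) \<le> L' s" by metis
  define L where "L = (\<Sum>s<l. \<bar>L' s\<bar>)"
  have L0: "0 \<le> L" by (simp add: L_def sum_nonneg)
  have L: "opnorm (m k) (mq_rep (\<psi> (b s)) k) \<le> L" if "s < l" for s k
  proof -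
    have "\<bar>L' s\<bar> \<le> L" unfolding L_def using that by (intro member_le_sum) simp_all
    then show ?thesis using L'[OF that, of k] by linarith
  qed
  \<comment> \<open>Bounds the squared norms of the vectors in both models; being at least 1, it
    also bounds the norms.\<close>
  define C where "C = 1 + (\<Sum>i<r. cmod (F (\<star>\<^bsub>D\<^esub> (x i) \<otimes>\<^bsub>D\<^esub> x i)))"
  have C1: "1 \<le> C" by (simp add: C_def sum_nonneg)
  have C: "cmod (F (\<star>\<^bsub>D\<^esub> (x i) \<otimes>\<^bsub>D\<^esub> x i)) + 1 \<le> C" if "i < r" for i
  proof -
    have "cmod (F (\<star>\<^bsub>D\<^esub> (x i) \<otimes>\<^bsub>D\<^esub> x i)) \<le> (\<Sum>i<r. cmod (F (\<star>\<^bsub>D\<^esub> (x i) \<otimes>\<^bsub>D\<^esub> x i)))"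
      using that by (intro member_le_sum) simp_all
    then show ?thesis by (simp add: C_def)
  qed
  \<comment> \<open>Three errors occur: a displacement by U under a matrix of norm at most L, the
    error of the relation in the model of B, and a second displacement.\<close>
  define e1 where "e1 = e / (L + 2)"
  have e1: "0 < e1" "L * e1 + e1 + e1 = e"
  proof -
    show "0 < e1" using e L0 by (simp add: e1_def)
    have "L * e1 + e1 + e1 = (L + 2) * e1" by (simp add: algebra_simps)
    also have "\<dots> = e" using L0 by (simp add: e1_def)
    finally show "L * e1 + e1 + e1 = e" .
  qed
  have "0 \<le> C" using C1 by simp
  from approx_congruence[where r = r, OF this e1(1)]
  obtain \<delta> where \<delta>: "0 < \<delta>"
    and cong: "\<forall>m \<xi> \<eta>. (\<forall>i<r. vecnorm m (\<xi> i) \<le> C \<and> vecnorm m (\<eta> i) \<le> C) \<longrightarrow>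
     (\<forall>i<r. \<forall>j<r. cmod (cip m (\<xi> i) (\<xi> j) - cip m (\<eta> i) (\<eta> j)) < \<delta>) \<longrightarrow>
     (\<exists>U. unitary m U \<and> (\<forall>i<r. vecnorm m (\<lambda>l. mv m U (\<xi> i) l - \<eta> i l) < e1))"
    by (elim exE conjE)
  define d where "d = Min {1, e, e1, \<delta> / 2}"
  have d: "0 < d" "d \<le> 1" "d \<le> e" "d \<le> e1" "d \<le> \<delta> / 2"
    using e e1 \<delta> by (simp_all add: d_def)
  have "\<exists>p>0. \<forall>t\<ge>1. \<exists>\<Phi> \<zeta>. tail_hom n K (p * t) \<Phi> \<and>
    (\<forall>i<r. \<forall>j<r. cmod (cip (p * t) (\<zeta> i) (\<zeta> j) - F (\<star>\<^bsub>D\<^esub> (x j) \<otimes>\<^bsub>D\<^esub> x i)) < d) \<and>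
    (\<forall>s<k. \<forall>i<r. \<forall>j<r. \<sigma> (a s) \<otimes>\<^bsub>D\<^esub> x i = x j \<longrightarrow>
       vecnorm (p * t) (\<lambda>l. mv (p * t) (\<Phi> (mq_rep (\<phi> (a s)))) (\<zeta> i) l - \<zeta> j l) < d)"
    using \<sigma> F x a d(1) unfolding A.lift_def[symmetric] by (rule A.ex_stage)
  then obtain p where p: "0 < p" and pA: "\<forall>t\<ge>1. \<exists>\<Phi> \<zeta>. tail_hom n K (p * t) \<Phi> \<and>
    (\<forall>i<r. \<forall>j<r. cmod (cip (p * t) (\<zeta> i) (\<zeta> j) - F (\<star>\<^bsub>D\<^esub> (x j) \<otimes>\<^bsub>D\<^esub> x i)) < d) \<and>
    (\<forall>s<k. \<forall>i<r. \<forall>j<r. \<sigma> (a s) \<otimes>\<^bsub>D\<^esub> x i = x j \<longrightarrow>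
       vecnorm (p * t) (\<lambda>l. mv (p * t) (\<Phi> (mq_rep (\<phi> (a s)))) (\<zeta> i) l - \<zeta> j l) < d)"
    by (elim exE conjE)
  have "\<exists>q>0. \<forall>t\<ge>1. \<exists>\<Phi> \<zeta>. tail_hom m K (q * t) \<Phi> \<and>
    (\<forall>i<r. \<forall>j<r. cmod (cip (q * t) (\<zeta> i) (\<zeta> j) - F (\<star>\<^bsub>D\<^esub> (x j) \<otimes>\<^bsub>D\<^esub> x i)) < d) \<and>
    (\<forall>s<l. \<forall>i<r. \<forall>j<r. \<tau> (b s) \<otimes>\<^bsub>D\<^esub> x i = x j \<longrightarrow>
       vecnorm (q * t) (\<lambda>l. mv (q * t) (\<Phi> (mq_rep (\<psi> (b s)))) (\<zeta> i) l - \<zeta> j l) < d)"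
    using \<tau> F x b d(1) unfolding B.lift_def[symmetric] by (rule B.ex_stage)
  then obtain q where q: "0 < q" and qB: "\<forall>t\<ge>1. \<exists>\<Phi> \<zeta>. tail_hom m K (q * t) \<Phi> \<and>
    (\<forall>i<r. \<forall>j<r. cmod (cip (q * t) (\<zeta> i) (\<zeta> j) - F (\<star>\<^bsub>D\<^esub> (x j) \<otimes>\<^bsub>D\<^esub> x i)) < d) \<and>
    (\<forall>s<l. \<forall>i<r. \<forall>j<r. \<tau> (b s) \<otimes>\<^bsub>D\<^esub> x i = x j \<longrightarrow>
       vecnorm (q * t) (\<lambda>l. mv (q * t) (\<Phi> (mq_rep (\<psi> (b s)))) (\<zeta> i) l - \<zeta> j l) < d)"
    by (elim exE conjE)
  define M where "M = p * q"
  have pq: "1 \<le> q" "1 \<le> p" using p q by simp_all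
  obtain \<Phi> \<xi> where \<Phi>: "tail_hom n K M \<Phi>"
    and g\<xi>: "\<forall>i<r. \<forall>j<r. cmod (cip M (\<xi> i) (\<xi> j) - F (\<star>\<^bsub>D\<^esub> (x j) \<otimes>\<^bsub>D\<^esub> x i)) < d"
    and r\<xi>: "\<forall>s<k. \<forall>i<r. \<forall>j<r. \<sigma> (a s) \<otimes>\<^bsub>D\<^esub> x i = x j \<longrightarrow>
       vecnorm M (\<lambda>l. mv M (\<Phi> (mq_rep (\<phi> (a s)))) (\<xi> i) l - \<xi> j l) < d"
    using pA[rule_format, OF pq(1)] unfolding M_def[symmetric] by (elim exE conjE)
  obtain \<Psi> \<eta> where \<Psi>: "tail_hom m K M \<Psi>"
    and g\<eta>: "\<forall>i<r. \<forall>j<r. cmod (cip M (\<eta> i) (\<eta> j) - F (\<star>\<^bsub>D\<^esub> (x j) \<otimes>\<^bsub>D\<^esub> x i)) < d"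
    and r\<eta>: "\<forall>s<l. \<forall>i<r. \<forall>j<r. \<tau> (b s) \<otimes>\<^bsub>D\<^esub> x i = x j \<longrightarrow>
       vecnorm M (\<lambda>l. mv M (\<Psi> (mq_rep (\<psi> (b s)))) (\<eta> i) l - \<eta> j l) < d"
    using qB[rule_format, OF pq(2)] unfolding mult.commute[of q p] M_def[symmetric] by (elim exE conjE)
  have norm: "vecnorm M (v i) \<le> C"
    if v: "\<forall>i<r. \<forall>j<r. cmod (cip M (v i) (v j) - F (\<star>\<^bsub>D\<^esub> (x j) \<otimes>\<^bsub>D\<^esub> x i)) < d" and i: "i < r" for v i
  proof -
    have "cmod (cip M (v i) (v i) - F (\<star>\<^bsub>D\<^esub> (x i) \<otimes>\<^bsub>D\<^esub> x i)) < d" using v i by blast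
    then have "cmod (cip M (v i) (v i)) \<le> cmod (F (\<star>\<^bsub>D\<^esub> (x i) \<otimes>\<^bsub>D\<^esub> x i)) + 1"
      using norm_triangle_ineq2[of "cip M (v i) (v i)" "F (\<star>\<^bsub>D\<^esub> (x i) \<otimes>\<^bsub>D\<^esub> x i)"] d(2) by linarith
    then have "(vecnorm M (v i))\<^sup>2 \<le> C" using C[OF i] by (simp add: cip_self norm_power)
    also have "C \<le> C\<^sup>2" using mult_left_mono[OF C1, of C] C1 by (simp add: power2_eq_square)
    finally show ?thesis by (rule power2_le_imp_le) (use C1 in simp)
  qed
  have "cmod (cip M (\<xi> i) (\<xi> j) - cip M (\<eta> i) (\<eta> j)) < \<delta>" if ij: "i < r" "j < r" for i j
  proof -
    have "cmod (cip M (\<xi> i) (\<xi> j) - F (\<star>\<^bsub>D\<^esub> (x j) \<otimes>\<^bsub>D\<^esub> x i)) < \<delta> / 2"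
      "cmod (cip M (\<eta> i) (\<eta> j) - F (\<star>\<^bsub>D\<^esub> (x j) \<otimes>\<^bsub>D\<^esub> x i)) < \<delta> / 2"
      using g\<xi> g\<eta> ij d(5) less_le_trans by blast+
    then show ?thesis by (rule norm_triangle_half_l)
  qed
  then obtain U where U: "unitary M U" and U\<xi>: "\<And>i. i < r \<Longrightarrow> vecnorm M (\<lambda>l. mv M U (\<xi> i) l - \<eta> i l) < e1"
    using cong norm[OF g\<xi>] norm[OF g\<eta>] by blast
  define \<Psi>' where "\<Psi>' = (\<lambda>x. mm M (adj U) (mm M (\<Psi> x) U))"
  have "vecnorm M (\<lambda>l. mv M (\<Psi>' (mq_rep (\<psi> (b s)))) (\<xi> i) l - \<xi> j l) < e"
    if s: "s < l" and ij: "i < r" "j < r" and rel: "\<tau> (b s) \<otimes>\<^bsub>D\<^esub> x i = x j" for s i j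
  proof -
    let ?P = "\<Psi> (mq_rep (\<psi> (b s)))"
    have P: "opnorm M ?P \<le> L" using tail_homD(7)[OF \<Psi>] L[OF s] by blast
    have "vecnorm M (\<lambda>h. mv M (\<Psi>' (mq_rep (\<psi> (b s)))) (\<xi> i) h - \<xi> j h)
        = vecnorm M (mv M (adj U) (\<lambda>h. mv M ?P (mv M U (\<xi> i)) h - mv M U (\<xi> j) h))"
    proof (rule vecnorm_cong)
      fix h assume "h < M"
      then have "\<xi> j h = mv M (adj U) (mv M U (\<xi> j)) h"
        using U by (simp add: mv_mm[symmetric] unitary_def mv_mid)
      then show "mv M (\<Psi>' (mq_rep (\<psi> (b s)))) (\<xi> i) h - \<xi> j h
          = mv M (adj U) (\<lambda>h. mv M ?P (mv M U (\<xi> i)) h - mv M U (\<xi> j) h) h"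
        by (simp add: \<Psi>'_def mv_mm mv_diff)
    qed
    also have "\<dots> = vecnorm M (\<lambda>h. mv M ?P (mv M U (\<xi> i)) h - mv M U (\<xi> j) h)"
      by (rule vecnorm_unitary[OF unitary_adj[OF U]])
    also have "\<dots> \<le> vecnorm M (\<lambda>h. mv M ?P (mv M U (\<xi> i)) h - mv M ?P (\<eta> i) h)
        + (vecnorm M (\<lambda>h. mv M ?P (\<eta> i) h - \<eta> j h) + vecnorm M (\<lambda>h. \<eta> j h - mv M U (\<xi> j) h))"
      by (rule order_trans[OF vecnorm_diff3 add_left_mono[OF vecnorm_diff3]])
    also have "\<dots> < L * e1 + (e1 + e1)"
    proof (rule add_le_less_mono[OF _ add_strict_mono])
      have "vecnorm M (mv M ?P (\<lambda>h. mv M U (\<xi> i) h - \<eta> i h)) \<le> L * e1"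
        using U\<xi>[OF ij(1)] by (intro order_trans[OF opnorm_bound] mult_mono P L0) simp_all
      then show "vecnorm M (\<lambda>h. mv M ?P (mv M U (\<xi> i)) h - mv M ?P (\<eta> i) h) \<le> L * e1"
        by (simp add: mv_diff)
      show "vecnorm M (\<lambda>h. mv M ?P (\<eta> i) h - \<eta> j h) < e1" using r\<eta> s ij rel d(4) less_le_trans by blast
      show "vecnorm M (\<lambda>h. \<eta> j h - mv M U (\<xi> j) h) < e1"
        using U\<xi>[OF ij(2)] by (simp add: vecnorm_diff_commute)
    qed
    also have "\<dots> = e" using e1(2) by simp
    finally show ?thesis .
  qed
  moreover have "tail_hom m K M \<Psi>'" unfolding \<Psi>'_def by (rule tail_hom_conj[OF \<Psi> U])
  moreover have "cmod (cip M (\<xi> i) (\<xi> j) - F (\<star>\<^bsub>D\<^esub> (x j) \<otimes>\<^bsub>D\<^esub> x i)) < e" if "i < r" "j < r" for i j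
    using g\<xi> that d(3) less_le_trans by blast
  moreover have "vecnorm M (\<lambda>l. mv M (\<Phi> (mq_rep (\<phi> (a s)))) (\<xi> i) l - \<xi> j l) < e"
    if "s < k" "i < r" "j < r" "\<sigma> (a s) \<otimes>\<^bsub>D\<^esub> x i = x j" for s i j
    using r\<xi> that d(3) less_le_trans by blast
  moreover have "0 < M" using p q by (simp add: M_def)
  ultimately show ?thesis using \<Phi>
    by (intro exI[of _ M] exI[of _ \<Phi>] exI[of _ \<Psi>'] exI[of _ \<xi>] conjI allI impI) simp_all
qed

subsection \<open>Countable dense subalgebras\<close>

definition crat :: "complex set" where
  "crat = (\<lambda>(p, q). Complex (of_rat p) (of_rat q)) ` UNIV"

lemma countable_crat: "countable crat"
  by (simp add: crat_def)

lemma crat_simps [simp]: "0 \<in> crat" "1 \<in> crat" "c \<in> crat \<Longrightarrow> cnj c \<in> crat"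
proof -
  show "0 \<in> crat" "1 \<in> crat"
    unfolding crat_def by (rule image_eqI[of _ _ "(0, 0)"], simp_all add: complex_eq_iff)
      (rule image_eqI[of _ _ "(1, 0)"], simp_all add: complex_eq_iff)
  assume "c \<in> crat"
  then obtain p q where "c = Complex (of_rat p) (of_rat q)" by (auto simp: crat_def)
  then have "cnj c = (\<lambda>(p, q). Complex (of_rat p) (of_rat q)) (p, - q)" by (simp add: of_rat_minus complex_eq_iff)
  then show "cnj c \<in> crat" unfolding crat_def by blast
qed

lemma crat_dense:
  assumes "0 < e"
  shows "\<exists>c'\<in>crat. cmod (c' - c) < e"
proof -
  have *: "\<exists>p. \<bar>of_rat p - (t :: real)\<bar> < e / 2" for t
  proof -
    obtain p where "t - e / 2 < of_rat p" "of_rat p < t" using of_rat_dense[of "t - e / 2" t] assms by auto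
    then show ?thesis by (intro exI[of _ p]) simp
  qed
  obtain p q where "\<bar>of_rat p - Re c\<bar> < e / 2" "\<bar>of_rat q - Im c\<bar> < e / 2" using *[of "Re c"] *[of "Im c"] by blast
  then have "cmod (Complex (of_rat p) (of_rat q) - c) < e"
    using cmod_le[of "Complex (of_rat p) (of_rat q) - c"] by simp
  then show ?thesis unfolding crat_def by auto
qed

context cstar_algebra
begin

definition closed_subalg :: "'a set \<Rightarrow> bool" where
  "closed_subalg T \<longleftrightarrow> T \<subseteq> C \<and> \<one> \<in> T \<and> (\<forall>x\<in>T. \<forall>y\<in>T. x \<oplus> y \<in> T \<and> x \<otimes> y \<in> T) \<and>
     (\<forall>c. \<forall>x\<in>T. c \<odot> x \<in> T) \<and> (\<forall>x\<in>T. \<star> x \<in> T) \<and>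
     (\<forall>f l. (\<forall>n. f n \<in> T) \<longrightarrow> l \<in> C \<longrightarrow> clim f l \<longrightarrow> l \<in> T)"

lemma closed_subalgD:
  "closed_subalg T \<Longrightarrow> (\<And>n. f n \<in> T) \<Longrightarrow> l \<in> C \<Longrightarrow> clim f l \<Longrightarrow> l \<in> T"
  unfolding closed_subalg_def by blast

lemma generatesD:
  assumes "cs_generates A S" "closed_subalg T" "S \<subseteq> T"
  shows "C \<subseteq> T"
proof (rule assms(1)[unfolded cs_generates_def, THEN conjunct2, THEN spec, THEN mp], intro conjI allI impI ballI; (elim conjE)?)
  fix f l assume f: "range f \<subseteq> T" and l: "l \<in> C" and lim: "\<forall>e>0. \<exists>N::nat. \<forall>n\<ge>N. \<parallel>f n \<ominus> l\<parallel> < e"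
  have fT: "f n \<in> T" for n using f by blast
  then have "f n \<in> C" for n using assms(2) unfolding closed_subalg_def by blast
  then have "clim f l" using lim l unfolding clim_def LIMSEQ_def by simp
  then show "l \<in> T" by (rule closed_subalgD[where f = f, OF assms(2) fT l])
qed (use assms(2,3) in \<open>auto simp: closed_subalg_def\<close>)

text \<open>Generators act from the left only, matching the relations g x = x' that the models
  reproduce, and coefficients are restricted to \<open>crat\<close> to stay countable. Closure under
  products is a consequence.\<close>

inductive_set rspan :: "'a set \<Rightarrow> 'a set" for S where
  one: "\<one> \<in> rspan S"
| gen: "s \<in> S \<Longrightarrow> x \<in> rspan S \<Longrightarrow> s \<otimes> x \<in> rspan S"
| lin: "a \<in> crat \<Longrightarrow> b \<in> crat \<Longrightarrow> x \<in> rspan S \<Longrightarrow> y \<in> rspan S \<Longrightarrow> a \<odot> x \<oplus> b \<odot> y \<in> rspan S"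

text \<open>The set is exhausted by levels, each arising from the previous one by a single
  application of the rules.\<close>

lemma rspan_countable:
  assumes S: "countable S"
  shows "countable (rspan S)"
proof -
  define step where "step T = T \<union> (\<lambda>(s, x). s \<otimes> x) ` (S \<times> T)
      \<union> (\<lambda>(a, b, x, y). a \<odot> x \<oplus> b \<odot> y) ` (crat \<times> crat \<times> T \<times> T)" for T
  define lvl where "lvl n = (step ^^ n) {\<one>}" for n
  have lvl: "lvl 0 = {\<one>}" "lvl (Suc n) = step (lvl n)" for n by (simp_all add: lvl_def)
  have "countable (lvl n)" for n
    by (induction n) (auto simp: lvl step_def S countable_crat)
  moreover have mono: "lvl n \<subseteq> lvl (n + k)" for n k
    by (induction k) (auto simp: lvl step_def)
  have "x \<in> (\<Union>n. lvl n)" if "x \<in> rspan S" for x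
    using that
  proof induction
    case one
    then show ?case using lvl(1) by blast
  next
    case (gen s x)
    then obtain n where "x \<in> lvl n" by blast
    then have "s \<otimes> x \<in> lvl (Suc n)" using gen(1) unfolding lvl step_def by (intro UnI1 UnI2 image_eqI[of _ _ "(s, x)"]) auto
    then show ?case by blast
  next
    case (lin a b x y)
    then obtain n k where "x \<in> lvl n" "y \<in> lvl k" by blast
    then have "x \<in> lvl (n + k)" "y \<in> lvl (n + k)" using mono[of n k] mono[of k n] by (auto simp: add.commute)
    then have "a \<odot> x \<oplus> b \<odot> y \<in> lvl (Suc (n + k))"
      using lin(1,2) unfolding lvl step_def by (intro UnI2 image_eqI[of _ _ "(a, b, x, y)"]) auto
    then show ?case by blast
  qed
  then have "rspan S \<subseteq> (\<Union>n. lvl n)" by blast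
  ultimately show ?thesis by (meson countable_UN countable_subset countableI_type)
qed

context
  fixes S assumes S: "S \<subseteq> C"
begin

lemma rspan_closed: "x \<in> rspan S \<Longrightarrow> x \<in> C"
  by (induction rule: rspan.induct) (use S in auto)

lemma rspan_base: "s \<in> S \<Longrightarrow> s \<in> rspan S"
  using rspan.gen[OF _ rspan.one, of s S] S by auto

lemma rspan_sm: "c \<in> crat \<Longrightarrow> x \<in> rspan S \<Longrightarrow> c \<odot> x \<in> rspan S"
  using rspan.lin[of c 0 x S x] rspan_closed[of x] by simp

lemma rspan_add: "x \<in> rspan S \<Longrightarrow> y \<in> rspan S \<Longrightarrow> x \<oplus> y \<in> rspan S"
  using rspan.lin[of 1 1 x S y] rspan_closed[of x] rspan_closed[of y] by simp

lemma rspan_mult: "x \<in> rspan S \<Longrightarrow> y \<in> rspan S \<Longrightarrow> x \<otimes> y \<in> rspan S"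
proof (induction rule: rspan.induct)
  case one
  then show ?case using rspan_closed by simp
next
  case (gen s x)
  then show ?case using rspan.gen[of s S "x \<otimes> y"] rspan_closed S by (simp add: mult_assoc subset_iff)
next
  case (lin a b x z)
  then show ?case using rspan.lin[of a b "x \<otimes> y" S "z \<otimes> y"] rspan_closed by (simp add: distr)
qed

lemma rspan_star:
  assumes "\<And>s. s \<in> S \<Longrightarrow> \<star> s \<in> S"
  shows "x \<in> rspan S \<Longrightarrow> \<star> x \<in> rspan S"
proof (induction rule: rspan.induct)
  case one
  then show ?case by (simp add: rspan.one)
next
  case (gen s x)
  then have "\<star> s \<in> rspan S" using assms rspan_base by blast
  then show ?case using gen rspan_mult[of "\<star> x" "\<star> s"] rspan_closed[of x] S by (simp add: subset_iff)
next
  case (lin a b x y)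
  then show ?case using rspan.lin[of "cnj a" "cnj b" "\<star> x" S "\<star> y"] rspan_closed by simp
qed

definition rspan_closure :: "'a set" where
  "rspan_closure = {x \<in> C. \<forall>e>0. \<exists>q\<in>rspan S. \<parallel>q \<ominus> x\<parallel> < e}"

lemma rspan_closureI:
  assumes f: "\<And>n. f n \<in> rspan S" and x: "x \<in> C" and lim: "clim f x"
  shows "x \<in> rspan_closure"
  unfolding rspan_closure_def
proof (intro CollectI conjI allI impI x)
  fix e :: real assume "0 < e"
  then have "\<forall>\<^sub>F n in sequentially. \<parallel>f n \<ominus> x\<parallel> < e" using lim unfolding clim_def by (rule order_tendstoD(2)[rotated])
  then have "\<exists>n. \<parallel>f n \<ominus> x\<parallel> < e" by (rule eventually_happens'[OF sequentially_bot])
  then show "\<exists>q\<in>rspan S. \<parallel>q \<ominus> x\<parallel> < e" using f by blast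
qed

lemma rspan_closureD:
  assumes "x \<in> rspan_closure"
  shows "x \<in> C" "\<exists>f. (\<forall>n. f n \<in> rspan S) \<and> clim f x"
proof -
  show x: "x \<in> C" using assms by (simp add: rspan_closure_def)
  have "\<exists>q. q \<in> rspan S \<and> \<parallel>q \<ominus> x\<parallel> < inverse (real (Suc n))" for n
    using assms unfolding rspan_closure_def Bex_def by simp
  then obtain f where f: "f n \<in> rspan S" "\<parallel>f n \<ominus> x\<parallel> < inverse (real (Suc n))" for n by metis
  have "clim f x"
    by (rule clim_le[OF less_imp_le[OF f(2)] LIMSEQ_inverse_real_of_nat rspan_closed[OF f(1)] x])
  then show "\<exists>f. (\<forall>n. f n \<in> rspan S) \<and> clim f x" using f(1) by (intro exI[of _ f]) simp
qed

lemma rspan_subset_closure: "rspan S \<subseteq> rspan_closure"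
  using rspan_closed by (auto intro!: rspan_closureI[of "\<lambda>_. x" x for x])

text \<open>Arbitrary scalars are reached by approximating coefficient and element simultaneously;
  stability under the involution comes from that of S.\<close>

lemma closed_subalg_rspan_closure:
  assumes star: "\<And>s. s \<in> S \<Longrightarrow> \<star> s \<in> S"
  shows "closed_subalg rspan_closure"
  unfolding closed_subalg_def
proof (intro conjI ballI allI impI)
  show "rspan_closure \<subseteq> C" by (auto simp: rspan_closure_def)
  show "\<one> \<in> rspan_closure" using rspan.one rspan_subset_closure by blast
  fix x assume "x \<in> rspan_closure"
  note x = rspan_closureD[OF this]
  obtain f where "\<forall>n. f n \<in> rspan S" "clim f x" using x(2) by (elim exE conjE)
  then have f: "f n \<in> rspan S" "x \<in> C" "clim f x" for n using x(1) by simp_all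
  note fC = rspan_closed[OF f(1)]
  show "\<star> x \<in> rspan_closure"
    by (rule rspan_closureI[of "\<lambda>n. \<star> (f n)"]) (use f fC rspan_star[OF star] clim_star in auto)
  fix c
  have "\<exists>c'\<in>crat. cmod (c' - c) < inverse (real (Suc n))" for n by (rule crat_dense) simp
  then obtain g where g: "\<And>n. g n \<in> crat" "\<And>n. cmod (g n - c) < inverse (real (Suc n))" by metis
  have gc: "(\<lambda>n. cmod (g n - c)) \<longlonglongrightarrow> 0"
    by (rule Lim_null_comparison[OF _ LIMSEQ_inverse_real_of_nat]) (simp add: less_imp_le[OF g(2)] del: of_nat_Suc)
  have "clim (\<lambda>n. g n \<odot> f n) (c \<odot> x)"
  proof (rule clim_le)
    have "(\<lambda>n. cmod (g n - c) * \<parallel>f n\<parallel> + cmod c * \<parallel>f n \<ominus> x\<parallel>) \<longlonglongrightarrow> 0 * \<parallel>x\<parallel> + cmod c * 0"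
      using gc clim_norm[OF f(3) fC f(2)] f(3)[unfolded clim_def] by (intro tendsto_intros)
    then show "(\<lambda>n. cmod (g n - c) * \<parallel>f n\<parallel> + cmod c * \<parallel>f n \<ominus> x\<parallel>) \<longlonglongrightarrow> 0" by simp
    fix n
    have "\<parallel>g n \<odot> f n \<ominus> c \<odot> x\<parallel> \<le> \<parallel>g n \<odot> f n \<ominus> c \<odot> f n\<parallel> + \<parallel>c \<odot> f n \<ominus> c \<odot> x\<parallel>"
      using fC f(2) by (intro nm_sub_triangle) simp_all
    also have "\<dots> = cmod (g n - c) * \<parallel>f n\<parallel> + cmod c * \<parallel>f n \<ominus> x\<parallel>"
      using fC f(2) by (simp add: sm_diff_left[symmetric] sm_sub[symmetric])
    finally show "\<parallel>g n \<odot> f n \<ominus> c \<odot> x\<parallel> \<le> cmod (g n - c) * \<parallel>f n\<parallel> + cmod c * \<parallel>f n \<ominus> x\<parallel>" .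
  qed (use fC f in simp_all)
  then show "c \<odot> x \<in> rspan_closure"
    by (rule rspan_closureI[rotated 2]) (use f g rspan_sm in simp_all)
  fix y assume "y \<in> rspan_closure"
  note y = rspan_closureD[OF this]
  obtain h where "\<forall>n. h n \<in> rspan S" "clim h y" using y(2) by (elim exE conjE)
  then have h: "h n \<in> rspan S" "y \<in> C" "clim h y" for n using y(1) by simp_all
  note hC = rspan_closed[OF h(1)]
  show "x \<oplus> y \<in> rspan_closure"
    by (rule rspan_closureI[OF _ _ clim_add[OF f(3) h(3)]]) (use f h fC hC rspan_add in simp_all)
  show "x \<otimes> y \<in> rspan_closure"
    by (rule rspan_closureI[OF _ _ clim_mult[OF f(3) h(3)]]) (use f h fC hC rspan_mult in simp_all)
next
  fix f l assume f: "\<forall>n. f n \<in> rspan_closure" and l: "l \<in> C" and lim: "clim f l"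
  have fC: "f n \<in> C" for n using f by (simp add: rspan_closure_def)
  show "l \<in> rspan_closure"
    unfolding rspan_closure_def
  proof (intro CollectI conjI allI impI l)
    fix e :: real assume e: "0 < e"
    then have "\<forall>\<^sub>F n in sequentially. \<parallel>f n \<ominus> l\<parallel> < e / 2" using lim unfolding clim_def by (intro order_tendstoD(2)[of _ 0]) simp_all
    then have "\<exists>n. \<parallel>f n \<ominus> l\<parallel> < e / 2" by (rule eventually_happens'[OF sequentially_bot])
    then obtain n where n: "\<parallel>f n \<ominus> l\<parallel> < e / 2" by (elim exE)
    have "\<forall>e>0. \<exists>q\<in>rspan S. \<parallel>q \<ominus> f n\<parallel> < e" using f by (simp add: rspan_closure_def)
    then obtain q where q: "q \<in> rspan S" "\<parallel>q \<ominus> f n\<parallel> < e / 2" using half_gt_zero[OF e] by blast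
    have "\<parallel>q \<ominus> l\<parallel> < e" using nm_sub_triangle[of q "f n" l] rspan_closed[OF q(1)] fC l n q(2) by simp
    then show "\<exists>q\<in>rspan S. \<parallel>q \<ominus> l\<parallel> < e" using q(1) by blast
  qed
qed

end

end

text \<open>Homomorphisms are contractive, so the preimage of T is a closed subalgebra and contains
  everything as soon as it contains generators.\<close>

lemma (in cstar_hom) hom_generated:
  assumes gen: "cs_generates A S" and T: "B.closed_subalg T" and S: "\<phi> ` S \<subseteq> T"
  shows "\<phi> ` A.C \<subseteq> T"
proof -
  let ?R = "{x \<in> A.C. \<phi> x \<in> T}"
  have "A.closed_subalg ?R"
    unfolding A.closed_subalg_def
  proof (intro conjI allI ballI impI)
    fix f l assume f: "\<forall>n. f n \<in> ?R" and l: "l \<in> A.C" and lim: "A.clim f l"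
    have "B.clim (\<lambda>n. \<phi> (f n)) (\<phi> l)"
    proof (rule B.clim_le[OF _ lim[unfolded A.clim_def]])
      show "\<parallel>\<phi> (f n) \<ominus>\<^bsub>B\<^esub> \<phi> l\<parallel>\<^bsub>B\<^esub> \<le> \<parallel>f n \<ominus>\<^bsub>A\<^esub> l\<parallel>\<^bsub>A\<^esub>" for n
        using contractive[of "f n \<ominus>\<^bsub>A\<^esub> l"] f l by simp
    qed (use f l in simp_all)
    then show "l \<in> ?R" using T f l B.closed_subalgD[of T "\<lambda>n. \<phi> (f n)" "\<phi> l"] by simp
  qed (use T in \<open>auto simp: B.closed_subalg_def\<close>)
  moreover have "S \<subseteq> ?R" using gen S by (auto simp: cs_generates_def)
  ultimately have "A.C \<subseteq> ?R" by (rule A.generatesD[OF gen])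
  then show ?thesis by blast
qed

subsection \<open>Transport of structure\<close>

text \<open>The universal property only speaks about algebras on the type \<open>'d\<close>. The quotient \<open>MQ p\<close> can be
  moved there, since it has at most the cardinality of the continuum and a nonzero algebra at least that.\<close>
definition transport :: "('a \<Rightarrow> 'b) \<Rightarrow> 'a cstar \<Rightarrow> 'b cstar" where
  "transport g E = (let h = inv_into (cs_carrier E) g in
     \<lparr>cs_carrier = g ` cs_carrier E, cs_zero = g (cs_zero E), cs_one = g (cs_one E),
      cs_add = (\<lambda>x y. g (cs_add E (h x) (h y))), cs_mult = (\<lambda>x y. g (cs_mult E (h x) (h y))),
      cs_smult = (\<lambda>c x. g (cs_smult E c (h x))), cs_star = (\<lambda>x. g (cs_star E (h x))),
      cs_norm = (\<lambda>x. cs_norm E (h x))\<rparr>)"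

context cstar_algebra
begin

context
  fixes g :: "'a \<Rightarrow> 'b"
  assumes g: "inj_on g C"
begin

lemma transport_simps:
  "cs_carrier (transport g A) = g ` C" "cs_zero (transport g A) = g \<zero>" "cs_one (transport g A) = g \<one>"
  "x \<in> C \<Longrightarrow> y \<in> C \<Longrightarrow> cs_add (transport g A) (g x) (g y) = g (x \<oplus> y)"
  "x \<in> C \<Longrightarrow> y \<in> C \<Longrightarrow> cs_mult (transport g A) (g x) (g y) = g (x \<otimes> y)"
  "x \<in> C \<Longrightarrow> cs_smult (transport g A) c (g x) = g (c \<odot> x)"
  "x \<in> C \<Longrightarrow> cs_star (transport g A) (g x) = g (\<star> x)"
  "x \<in> C \<Longrightarrow> cs_norm (transport g A) (g x) = \<parallel>x\<parallel>"
  using g by (simp_all add: transport_def Let_def)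

lemma transport_sub: "x \<in> C \<Longrightarrow> y \<in> C \<Longrightarrow> cs_sub (transport g A) (g x) (g y) = g (x \<ominus> y)"
  by (simp add: cs_sub_def transport_simps)

lemma transport_eq_iff: "x \<in> C \<Longrightarrow> y \<in> C \<Longrightarrow> g x = g y \<longleftrightarrow> x = y"
  using g by (auto dest: inj_onD)

lemma cstar_transport: "unital_cstar_algebra (transport g A)"
proof -
  have compl: "\<exists>l\<in>g ` C. \<forall>e>0. \<exists>N::nat. \<forall>n\<ge>N. cs_norm (transport g A) (cs_sub (transport g A) (f n) l) < e"
    if f: "range f \<subseteq> g ` C" and cauchy: "\<forall>e>0. \<exists>N::nat. \<forall>m\<ge>N. \<forall>n\<ge>N. cs_norm (transport g A) (cs_sub (transport g A) (f m) (f n)) < e"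
    for f
  proof -
    have "\<exists>u. u \<in> C \<and> f n = g u" for n using f by blast
    then obtain u where u: "\<And>n. u n \<in> C" "\<And>n. f n = g (u n)" by metis
    have "\<exists>l\<in>C. (\<lambda>n. \<parallel>u n \<ominus> l\<parallel>) \<longlonglongrightarrow> 0"
      by (rule complete) (use cauchy u in \<open>simp_all add: transport_sub transport_simps\<close>)
    then obtain l where l: "l \<in> C" "(\<lambda>n. \<parallel>u n \<ominus> l\<parallel>) \<longlonglongrightarrow> 0" by blast
    then show ?thesis
      using u by (intro bexI[of _ "g l"]) (simp_all add: transport_sub transport_simps LIMSEQ_def)
  qed
  show ?thesis
    unfolding unital_cstar_algebra_def Let_def transport_simps(1-3)
  proof (intro conjI)
    show "\<forall>f. range f \<subseteq> g ` C \<longrightarrow>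
        (\<forall>e>0. \<exists>N::nat. \<forall>m\<ge>N. \<forall>n\<ge>N. cs_norm (transport g A) (cs_sub (transport g A) (f m) (f n)) < e) \<longrightarrow>
        (\<exists>l\<in>g ` C. \<forall>e>0. \<exists>N::nat. \<forall>n\<ge>N. cs_norm (transport g A) (cs_sub (transport g A) (f n) l) < e)"
      using compl by blast
  qed (auto simp: transport_simps transport_eq_iff laws(4)[unfolded cs_sub_def] add_assoc mult_assoc sm_add_left sm_add_right
      distl distr nm_add nm_mult nm_cstar nm_eq_zero add_ac)
qed

lemma transport_hom: "unital_star_hom A (transport g A) g"
  by (simp add: unital_star_hom_def transport_simps)

lemma transport_inv_hom: "unital_star_hom (transport g A) A (inv_into C g)"
  using g by (simp add: unital_star_hom_def transport_simps)

end

end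

lemma real_eqI_rat:
  assumes "\<And>q :: rat. of_rat q < x \<longleftrightarrow> of_rat q < (y :: real)"
  shows "x = y"
proof (rule ccontr)
  assume "x \<noteq> y"
  then consider "x < y" | "y < x" by linarith
  then show False
  proof cases
    case 1
    then obtain q where "x < of_rat q" "of_rat q < y" using of_rat_dense by blast
    then show False using assms[of q] by simp
  next
    case 2
    then obtain q where "y < of_rat q" "of_rat q < x" using of_rat_dense by blast
    then show False using assms[of q] by simp
  qed
qed

text \<open>Every real and imaginary part is recorded by the set of rationals below it, with
  positions and rationals coded as natural numbers.\<close>

lemma matseq_inj_nat_set: "\<exists>h :: matseq \<Rightarrow> nat set. inj h"
proof -
  define w where "w b z = (if b then Re z else Im z)" for b and z :: complex
  define h :: "matseq \<Rightarrow> nat set" where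
    "h x = {to_nat (k, i, j, b, q) | k i j b q. real_of_rat q < w b (x k i j)}" for x
  have "x = y" if "h x = h y" for x y
  proof (intro ext)
    fix k i j
    have iff: "to_nat (k, i, j, b, q) \<in> h z \<longleftrightarrow> real_of_rat q < w b (z k i j)" for b q z
      unfolding h_def by auto
    have "w b (x k i j) = w b (y k i j)" for b
      by (rule real_eqI_rat) (use iff that in metis)
    from this[of True] this[of False] show "x k i j = y k i j" by (simp add: w_def complex_eq_iff)
  qed
  then show ?thesis by (auto simp: inj_def)
qed

text \<open>The real multiples of 1 give a nonzero algebra at least the cardinality of the
  continuum, while a class is determined by its chosen representative.\<close>

lemma (in cstar_algebra) ex_MQ_inj:
  assumes nontriv: "\<one> \<noteq> \<zero>"
  shows "\<exists>g :: matseq set \<Rightarrow> 'a. inj_on g (cs_carrier (MQ p))"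
proof -
  obtain h :: "matseq \<Rightarrow> nat set" where h: "inj h" using matseq_inj_nat_set by blast
  obtain r :: "nat set \<Rightarrow> real" where r: "inj r"
    using nat_sets_eqpoll_reals unfolding eqpoll_def bij_betw_def by auto
  define u :: "real \<Rightarrow> 'a" where "u t = of_real t \<odot> \<one>" for t
  have u: "inj u"
  proof (rule injI)
    fix s t assume "u s = u t"
    then have "of_real (s - t) \<odot> \<one> = \<zero>" unfolding u_def by (simp add: sm_diff_left)
    then have "\<parallel>of_real (s - t) \<odot> \<one>\<parallel> = 0" by simp
    then have "\<bar>s - t\<bar> = 0" using nm_one[OF nontriv] by (simp del: of_real_diff)
    then show "s = t" by simp
  qed
  have rep: "inj_on mq_rep (cs_carrier (MQ p))"
  proof (rule inj_onI)
    fix X Y assume "X \<in> cs_carrier (MQ p)" "Y \<in> cs_carrier (MQ p)" "mq_rep X = mq_rep Y"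
    then show "X = Y" by (metis class_rep(2))
  qed
  have "inj_on (u \<circ> r \<circ> h \<circ> mq_rep) (cs_carrier (MQ p))"
    using comp_inj_on[OF rep, of "u \<circ> r \<circ> h"] inj_compose[OF inj_compose[OF u r] h]
    by (simp add: comp_assoc inj_on_subset)
  then show ?thesis by blast
qed

lemma MQ_nontrivial:
  assumes "\<And>k. 0 < n k"
  shows "cs_one (MQ n) \<noteq> cs_zero (MQ n)"
proof
  assume "cs_one (MQ n) = cs_zero (MQ n)"
  then have "sim n (sone n) (\<lambda>k i j. 0)" unfolding MQ_one MQ_zero by (subst (asm) mq_class_eq_iff) simp_all
  then have lim: "(\<lambda>k. opnorm (n k) (mid (n k))) \<longlonglongrightarrow> 0" by (simp add: sim_def ssub_def sone_def)
  have "1 \<le> opnorm (n k) (mid (n k))" for k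
    using opnorm_entry[of 0 "n k" 0 "mid (n k)"] assms[of k] by (simp add: mid_def)
  then show False using LIMSEQ_le_const[OF lim, of 1] by auto
qed

subsection \<open>Asymptotic GNS vectors\<close>

text \<open>The vectors are chosen for each element separately, so linearity holds only
  asymptotically. The squared norm of the defect is a combination of Gram numbers whose limits
  cancel.\<close>

lemma (in cstar_algebra) gram_lincomb:
  assumes F: "is_state F" and xy: "x \<in> C" "y \<in> C"
    and gram: "\<And>u v. u \<in> {x, y, a \<odot> x \<oplus> b \<odot> y} \<Longrightarrow> v \<in> {x, y, a \<odot> x \<oplus> b \<odot> y} \<Longrightarrow>
      (\<lambda>t. cip (m t) (\<zeta> t u) (\<zeta> t v)) \<longlonglongrightarrow> F (\<star> v \<otimes> u)"
  shows "(\<lambda>t. vecnorm (m t) (\<lambda>i. a * \<zeta> t x i + b * \<zeta> t y i - \<zeta> t (a \<odot> x \<oplus> b \<odot> y) i)) \<longlonglongrightarrow> 0"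
proof -
  let ?z = "a \<odot> x \<oplus> b \<odot> y"
  define w where "w t = (\<lambda>i. a * \<zeta> t x i + b * \<zeta> t y i - \<zeta> t ?z i)" for t
  note F = stateD[OF F]
  have w: "cip (m t) (w t) v = a * cip (m t) (\<zeta> t x) v + b * cip (m t) (\<zeta> t y) v - cip (m t) (\<zeta> t ?z) v" for t v
    by (simp add: w_def cip_diff_left cip_add_left cip_scale_left)
  have lim: "(\<lambda>t. cip (m t) (w t) (\<zeta> t v)) \<longlonglongrightarrow> 0" if v: "v \<in> {x, y, ?z}" for v
  proof -
    have "v \<in> C" using v xy by auto
    then have "F (\<star> v \<otimes> ?z) = a * F (\<star> v \<otimes> x) + b * F (\<star> v \<otimes> y)"
      using xy by (simp add: distl F(1,2))
    moreover have "(\<lambda>t. cip (m t) (w t) (\<zeta> t v)) \<longlonglongrightarrow> a * F (\<star> v \<otimes> x) + b * F (\<star> v \<otimes> y) - F (\<star> v \<otimes> ?z)"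
      unfolding w by (intro tendsto_intros gram v) simp_all
    ultimately show ?thesis by simp
  qed
  have "cip (m t) (w t) (w t) = cnj a * cip (m t) (w t) (\<zeta> t x) + cnj b * cip (m t) (w t) (\<zeta> t y) - cip (m t) (w t) (\<zeta> t ?z)" for t
    by (subst (2) w_def) (simp add: cip_diff_right cip_add_right cip_scale_right)
  then have "(\<lambda>t. cip (m t) (w t) (w t)) \<longlonglongrightarrow> cnj a * 0 + cnj b * 0 - 0"
    by (simp only:) (intro tendsto_intros lim; simp)
  then have "(\<lambda>t. sqrt (Re (cip (m t) (w t) (w t)))) \<longlonglongrightarrow> sqrt (Re 0)"
    by (intro tendsto_real_sqrt tendsto_Re) simp
  then show ?thesis by (simp add: vecnorm_eq_cip[symmetric] w_def)
qed

text \<open>The finite-dimensional vectors \<open>\<zeta>\<^sub>t x\<close> play the role of the vectors \<open>\<pi>(x)\<xi>\<close> of the GNS representation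
  of the state \<open>F\<close>, so that \<open>\<psi>(x)\<close> asymptotically maps \<open>\<zeta>\<^sub>t 1\<close> to \<open>\<zeta>\<^sub>t x\<close>.\<close>
lemma MQ_norm_ge:
  assumes hom: "cstar_hom D (MQ p) \<psi>" and F: "cstar_algebra.is_state D F"
    and S: "S \<subseteq> cs_carrier D" and s: "filterlim s at_top sequentially"
    and gram: "\<And>x y. x \<in> cstar_algebra.rspan D S \<Longrightarrow> y \<in> cstar_algebra.rspan D S \<Longrightarrow>
      (\<lambda>t. cip (p (s t)) (\<zeta> t x) (\<zeta> t y)) \<longlonglongrightarrow> F (\<star>\<^bsub>D\<^esub> y \<otimes>\<^bsub>D\<^esub> x)"
    and act: "\<And>g. g \<in> S \<Longrightarrow> \<exists>Y\<in>prodM p. mq_class p Y = \<psi> g \<and> (\<forall>x\<in>cstar_algebra.rspan D S.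
      (\<lambda>t. vecnorm (p (s t)) (\<lambda>i. mv (p (s t)) (Y (s t)) (\<zeta> t x) i - \<zeta> t (g \<otimes>\<^bsub>D\<^esub> x) i)) \<longlonglongrightarrow> 0)"
    and d: "d \<in> cstar_algebra.rspan D S" and Fd: "(\<parallel>d\<parallel>\<^bsub>D\<^esub>)\<^sup>2 \<le> Re (F (\<star>\<^bsub>D\<^esub> d \<otimes>\<^bsub>D\<^esub> d))"
  shows "\<parallel>d\<parallel>\<^bsub>D\<^esub> \<le> \<parallel>\<psi> d\<parallel>\<^bsub>MQ p\<^esub>"
proof -
  interpret P: cstar_hom D "MQ p" \<psi> by fact
  note FD = P.A.stateD[OF F]
  let ?m = "\<lambda>t. p (s t)"
  have Q: "x \<in> P.A.C" if "x \<in> P.A.rspan S" for x using P.A.rspan_closed[OF S that] .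
  have one: "\<one>\<^bsub>D\<^esub> \<in> P.A.rspan S" by (rule P.A.rspan.one)
  have nrm: "(\<lambda>t. vecnorm (?m t) (\<zeta> t x)) \<longlonglongrightarrow> sqrt (Re (F (\<star>\<^bsub>D\<^esub> x \<otimes>\<^bsub>D\<^esub> x)))" if "x \<in> P.A.rspan S" for x
  proof -
    have "(\<lambda>t. sqrt (Re (cip (?m t) (\<zeta> t x) (\<zeta> t x)))) \<longlonglongrightarrow> sqrt (Re (F (\<star>\<^bsub>D\<^esub> x \<otimes>\<^bsub>D\<^esub> x)))"
      using gram[OF that that] by (intro tendsto_real_sqrt tendsto_Re)
    then show ?thesis by (simp add: vecnorm_eq_cip[symmetric])
  qed
  \<comment> \<open>Induction along the generation of x, building a representative of \<psi>(x) from
    those of its parts: generators act by hypothesis, and linear combinations are handled by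
    \<open>gram_lincomb\<close>.\<close>
  have "\<exists>Y\<in>prodM p. mq_class p Y = \<psi> x \<and>
      (\<lambda>t. vecnorm (?m t) (\<lambda>i. mv (?m t) (Y (s t)) (\<zeta> t \<one>\<^bsub>D\<^esub>) i - \<zeta> t x i)) \<longlonglongrightarrow> 0"
    if "x \<in> P.A.rspan S" for x
    using that
  proof (induction rule: P.A.rspan.induct)
    case one
    have "vecnorm (?m t) (\<lambda>i. mv (?m t) (mid (?m t)) (\<zeta> t \<one>\<^bsub>D\<^esub>) i - \<zeta> t \<one>\<^bsub>D\<^esub> i) = vecnorm (?m t) (\<lambda>i. 0)" for t
      by (rule vecnorm_cong) (simp add: mv_mid)
    then show ?case by (intro bexI[of _ "sone p"] conjI prodM_sone) (simp add: MQ_one, simp add: sone_def)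
  next
    case (gen g x)
    obtain X where X: "X \<in> prodM p" "mq_class p X = \<psi> x"
      and limX: "(\<lambda>t. vecnorm (?m t) (\<lambda>i. mv (?m t) (X (s t)) (\<zeta> t \<one>\<^bsub>D\<^esub>) i - \<zeta> t x i)) \<longlonglongrightarrow> 0"
      using gen.IH by blast
    obtain Y where Y: "Y \<in> prodM p" "mq_class p Y = \<psi> g"
      and "\<forall>x\<in>P.A.rspan S. (\<lambda>t. vecnorm (?m t) (\<lambda>i. mv (?m t) (Y (s t)) (\<zeta> t x) i - \<zeta> t (g \<otimes>\<^bsub>D\<^esub> x) i)) \<longlonglongrightarrow> 0"
      using act[OF gen.hyps(1)] by blast
    then have limY: "(\<lambda>t. vecnorm (?m t) (\<lambda>i. mv (?m t) (Y (s t)) (\<zeta> t x) i - \<zeta> t (g \<otimes>\<^bsub>D\<^esub> x) i)) \<longlonglongrightarrow> 0"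
      using gen.hyps(2) by blast
    obtain L where L: "\<And>k. opnorm (p k) (Y k) \<le> L" using prodM_bound[OF Y(1)] by blast
    have "(\<lambda>t. vecnorm (?m t) (\<lambda>i. mv (?m t) (smul p Y X (s t)) (\<zeta> t \<one>\<^bsub>D\<^esub>) i - \<zeta> t (g \<otimes>\<^bsub>D\<^esub> x) i)) \<longlonglongrightarrow> 0"
    proof (rule Lim_null_comparison[OF always_eventually, OF allI])
      show "(\<lambda>t. L * vecnorm (?m t) (\<lambda>i. mv (?m t) (X (s t)) (\<zeta> t \<one>\<^bsub>D\<^esub>) i - \<zeta> t x i)
          + vecnorm (?m t) (\<lambda>i. mv (?m t) (Y (s t)) (\<zeta> t x) i - \<zeta> t (g \<otimes>\<^bsub>D\<^esub> x) i)) \<longlonglongrightarrow> 0"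
        using tendsto_add[OF tendsto_mult[OF tendsto_const[of L] limX] limY] by simp
      fix t
      have "vecnorm (?m t) (\<lambda>i. mv (?m t) (smul p Y X (s t)) (\<zeta> t \<one>\<^bsub>D\<^esub>) i - \<zeta> t (g \<otimes>\<^bsub>D\<^esub> x) i)
          \<le> vecnorm (?m t) (\<lambda>i. mv (?m t) (Y (s t)) (mv (?m t) (X (s t)) (\<zeta> t \<one>\<^bsub>D\<^esub>)) i - mv (?m t) (Y (s t)) (\<zeta> t x) i)
            + vecnorm (?m t) (\<lambda>i. mv (?m t) (Y (s t)) (\<zeta> t x) i - \<zeta> t (g \<otimes>\<^bsub>D\<^esub> x) i)"
        unfolding smul_def mv_mm by (rule vecnorm_diff3)
      moreover have "vecnorm (?m t) (mv (?m t) (Y (s t)) (\<lambda>i. mv (?m t) (X (s t)) (\<zeta> t \<one>\<^bsub>D\<^esub>) i - \<zeta> t x i))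
          \<le> L * vecnorm (?m t) (\<lambda>i. mv (?m t) (X (s t)) (\<zeta> t \<one>\<^bsub>D\<^esub>) i - \<zeta> t x i)"
        by (rule order_trans[OF opnorm_bound mult_right_mono[OF L]]) simp
      ultimately show "norm (vecnorm (?m t) (\<lambda>i. mv (?m t) (smul p Y X (s t)) (\<zeta> t \<one>\<^bsub>D\<^esub>) i - \<zeta> t (g \<otimes>\<^bsub>D\<^esub> x) i))
          \<le> L * vecnorm (?m t) (\<lambda>i. mv (?m t) (X (s t)) (\<zeta> t \<one>\<^bsub>D\<^esub>) i - \<zeta> t x i)
          + vecnorm (?m t) (\<lambda>i. mv (?m t) (Y (s t)) (\<zeta> t x) i - \<zeta> t (g \<otimes>\<^bsub>D\<^esub> x) i)"
        by (simp add: mv_diff)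
    qed
    moreover have "mq_class p (smul p Y X) = \<psi> (g \<otimes>\<^bsub>D\<^esub> x)"
      using X Y gen.hyps S Q by (simp add: MQ_mult[symmetric] subset_iff)
    ultimately show ?case using X Y by (intro bexI[of _ "smul p Y X"]) simp_all
  next
    case (lin a b x y)
    let ?z = "a \<odot>\<^bsub>D\<^esub> x \<oplus>\<^bsub>D\<^esub> b \<odot>\<^bsub>D\<^esub> y"
    obtain X where X: "X \<in> prodM p" "mq_class p X = \<psi> x"
      and limX: "(\<lambda>t. vecnorm (?m t) (\<lambda>i. mv (?m t) (X (s t)) (\<zeta> t \<one>\<^bsub>D\<^esub>) i - \<zeta> t x i)) \<longlonglongrightarrow> 0"
      using lin.IH(1) by blast
    obtain Y where Y: "Y \<in> prodM p" "mq_class p Y = \<psi> y"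
      and limY: "(\<lambda>t. vecnorm (?m t) (\<lambda>i. mv (?m t) (Y (s t)) (\<zeta> t \<one>\<^bsub>D\<^esub>) i - \<zeta> t y i)) \<longlonglongrightarrow> 0"
      using lin.IH(2) by blast
    have z: "?z \<in> P.A.rspan S" using lin.hyps by (rule P.A.rspan.lin)
    have limz: "(\<lambda>t. vecnorm (?m t) (\<lambda>i. a * \<zeta> t x i + b * \<zeta> t y i - \<zeta> t ?z i)) \<longlonglongrightarrow> 0"
      by (rule P.A.gram_lincomb[OF F]) (use lin.hyps z Q in \<open>auto intro!: gram\<close>)
    let ?Z = "sadd (ssm a X) (ssm b Y)"
    have "(\<lambda>t. vecnorm (?m t) (\<lambda>i. mv (?m t) (?Z (s t)) (\<zeta> t \<one>\<^bsub>D\<^esub>) i - \<zeta> t ?z i)) \<longlonglongrightarrow> 0"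
    proof (rule Lim_null_comparison[OF always_eventually, OF allI])
      show "(\<lambda>t. (cmod a * vecnorm (?m t) (\<lambda>i. mv (?m t) (X (s t)) (\<zeta> t \<one>\<^bsub>D\<^esub>) i - \<zeta> t x i)
          + cmod b * vecnorm (?m t) (\<lambda>i. mv (?m t) (Y (s t)) (\<zeta> t \<one>\<^bsub>D\<^esub>) i - \<zeta> t y i))
          + vecnorm (?m t) (\<lambda>i. a * \<zeta> t x i + b * \<zeta> t y i - \<zeta> t ?z i)) \<longlonglongrightarrow> 0"
        using tendsto_add[OF tendsto_add[OF tendsto_mult[OF tendsto_const[of "cmod a"] limX]
            tendsto_mult[OF tendsto_const[of "cmod b"] limY]] limz] by simp
      fix t
      let ?u = "\<lambda>i. a * (mv (?m t) (X (s t)) (\<zeta> t \<one>\<^bsub>D\<^esub>) i - \<zeta> t x i)"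
      let ?v = "\<lambda>i. b * (mv (?m t) (Y (s t)) (\<zeta> t \<one>\<^bsub>D\<^esub>) i - \<zeta> t y i)"
      let ?w = "\<lambda>i. a * \<zeta> t x i + b * \<zeta> t y i - \<zeta> t ?z i"
      have "(\<lambda>i. mv (?m t) (?Z (s t)) (\<zeta> t \<one>\<^bsub>D\<^esub>) i - \<zeta> t ?z i) = (\<lambda>i. (?u i + ?v i) + ?w i)"
        by (simp add: sadd_def ssm_def mv_add_left mv_scale_left algebra_simps)
      then show "norm (vecnorm (?m t) (\<lambda>i. mv (?m t) (?Z (s t)) (\<zeta> t \<one>\<^bsub>D\<^esub>) i - \<zeta> t ?z i))
          \<le> (cmod a * vecnorm (?m t) (\<lambda>i. mv (?m t) (X (s t)) (\<zeta> t \<one>\<^bsub>D\<^esub>) i - \<zeta> t x i)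
          + cmod b * vecnorm (?m t) (\<lambda>i. mv (?m t) (Y (s t)) (\<zeta> t \<one>\<^bsub>D\<^esub>) i - \<zeta> t y i))
          + vecnorm (?m t) (\<lambda>i. a * \<zeta> t x i + b * \<zeta> t y i - \<zeta> t ?z i)"
        using order_trans[OF vecnorm_triangle[of "?m t" "\<lambda>i. ?u i + ?v i" ?w] add_right_mono[OF vecnorm_triangle[of "?m t" ?u ?v]]]
        by (simp only: vecnorm_scale real_norm_def abs_of_nonneg[OF vecnorm_nonneg])
    qed
    moreover have "mq_class p ?Z = \<psi> ?z"
      using X Y lin.hyps Q by (simp add: MQ_add[symmetric] MQ_sm[symmetric])
    ultimately show ?case using X Y by (intro bexI[of _ ?Z]) simp_all
  qed
  from this[OF d] obtain Y where Y: "Y \<in> prodM p" "mq_class p Y = \<psi> d"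
    and limY: "(\<lambda>t. vecnorm (?m t) (\<lambda>i. mv (?m t) (Y (s t)) (\<zeta> t \<one>\<^bsub>D\<^esub>) i - \<zeta> t d i)) \<longlonglongrightarrow> 0" by blast
  let ?c = "\<parallel>\<psi> d\<parallel>\<^bsub>MQ p\<^esub>"
  have c: "?c = sn p Y" using MQ_norm[OF Y(1)] Y(2) by simp
  have "\<parallel>d\<parallel>\<^bsub>D\<^esub> \<le> ?c + e" if e: "0 < e" for e
  proof -
    have "\<parallel>d\<parallel>\<^bsub>D\<^esub> \<le> sqrt (Re (F (\<star>\<^bsub>D\<^esub> d \<otimes>\<^bsub>D\<^esub> d)))" using Fd by (rule real_le_rsqrt)
    also have "\<dots> \<le> (?c + e) * 1 + 0"
    proof (rule tendsto_le[OF sequentially_bot _ nrm[OF d]])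
      have "(\<lambda>t. vecnorm (?m t) (\<zeta> t \<one>\<^bsub>D\<^esub>)) \<longlonglongrightarrow> 1" using nrm[OF one] by (simp add: FD(5))
      then show "(\<lambda>t. (?c + e) * vecnorm (?m t) (\<zeta> t \<one>\<^bsub>D\<^esub>)
          + vecnorm (?m t) (\<lambda>i. mv (?m t) (Y (s t)) (\<zeta> t \<one>\<^bsub>D\<^esub>) i - \<zeta> t d i)) \<longlonglongrightarrow> (?c + e) * 1 + 0"
        using limY by (intro tendsto_intros)
      have "\<forall>\<^sub>F t in sequentially. opnorm (?m t) (Y (s t)) < ?c + e"
        unfolding c using filterlim_iff[THEN iffD1, OF s] sn_eventually[OF Y(1) e] by blast
      then show "\<forall>\<^sub>F t in sequentially. vecnorm (?m t) (\<zeta> t d) \<le> (?c + e) * vecnorm (?m t) (\<zeta> t \<one>\<^bsub>D\<^esub>)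
          + vecnorm (?m t) (\<lambda>i. mv (?m t) (Y (s t)) (\<zeta> t \<one>\<^bsub>D\<^esub>) i - \<zeta> t d i)"
      proof eventually_elim
        case (elim t)
        let ?y = "mv (?m t) (Y (s t)) (\<zeta> t \<one>\<^bsub>D\<^esub>)"
        have "vecnorm (?m t) (\<zeta> t d) \<le> vecnorm (?m t) ?y + vecnorm (?m t) (\<lambda>i. ?y i - \<zeta> t d i)"
          using vecnorm_diff[of "?m t" ?y "\<lambda>i. ?y i - \<zeta> t d i"] by simp
        moreover have "vecnorm (?m t) ?y \<le> (?c + e) * vecnorm (?m t) (\<zeta> t \<one>\<^bsub>D\<^esub>)"
          by (rule order_trans[OF opnorm_bound mult_right_mono[OF less_imp_le[OF elim]]]) simp
        ultimately show ?case by linarith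
      qed
    qed
    finally show ?thesis by simp
  qed
  then show ?thesis by (rule field_le_epsilon)
qed

section \<open>The free product of two MF algebras\<close>

lemma mf_embeddingI:
  "unital_cstar_algebra A \<Longrightarrow> unital_star_hom A (MQ n) \<phi> \<Longrightarrow> inj_on \<phi> (cs_carrier A) \<Longrightarrow> (\<And>k. 0 < n k) \<Longrightarrow>
    mf_embedding A n \<phi>"
  by (intro mf_embedding.intro cstar_hom.intro cstar_hom_axioms.intro mf_embedding_axioms.intro cstar_algebra.intro MQ_cstar)

lemma cs_generates_mono:
  assumes S: "cs_generates A S" and G: "S \<subseteq> G" "G \<subseteq> cs_carrier A"
  shows "cs_generates A G"
  unfolding cs_generates_def
proof (intro conjI allI impI G(2))
  fix T
  assume "T \<subseteq> cs_carrier A \<and> G \<subseteq> T \<and> cs_one A \<in> T \<and>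
    (\<forall>x\<in>T. \<forall>y\<in>T. cs_add A x y \<in> T \<and> cs_mult A x y \<in> T) \<and>
    (\<forall>c. \<forall>x\<in>T. cs_smult A c x \<in> T) \<and> (\<forall>x\<in>T. cs_star A x \<in> T) \<and>
    (\<forall>f l. range f \<subseteq> T \<and> l \<in> cs_carrier A \<and>
      (\<forall>e>0. \<exists>N::nat. \<forall>n\<ge>N. cs_norm A (cs_sub A (f n) l) < e) \<longrightarrow> l \<in> T)"
  then show "cs_carrier A \<subseteq> T"
    by (intro S[unfolded cs_generates_def, THEN conjunct2, THEN spec, THEN mp])
      (elim conjE, intro conjI subset_trans[OF G(1)])
qed

text \<open>Adjoints are joined to the generators, so that the rational span is stable under the
  involution and its closure is a C*-subalgebra.\<close>

lemma (in cstar_algebra) finitely_generated_star_list: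
  assumes "finitely_generated A"
  shows "\<exists>(a :: nat \<Rightarrow> 'a) k. cs_generates A (a ` {..<k}) \<and> (\<forall>h<k. a h \<in> C) \<and> (\<forall>h<k. \<star> (a h) \<in> a ` {..<k})"
proof -
  obtain S where S: "finite S" "cs_generates A S" using assms unfolding finitely_generated_def by blast
  let ?G = "S \<union> cs_star A ` S"
  have SC: "S \<subseteq> C" using S(2) by (simp add: cs_generates_def)
  obtain a :: "nat \<Rightarrow> 'a" and k where a: "?G = a ` {i. i < k}"
    using finite_imp_nat_seg_image_inj_on[of ?G] S(1) by auto
  then have G: "a ` {..<k} = ?G" by (simp add: lessThan_def)
  have GC: "?G \<subseteq> C" using SC closed(6) by blast
  have "a h \<in> C \<and> \<star> (a h) \<in> a ` {..<k}" if "h < k" for h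
  proof -
    have "a h \<in> a ` {..<k}" using that by simp
    then show ?thesis unfolding G using SC by (auto dest: subsetD)
  qed
  moreover have "cs_generates A (a ` {..<k})" unfolding G by (rule cs_generates_mono[OF S(2) Un_upper1 GC])
  ultimately show ?thesis by (intro exI[of _ a] exI[of _ k]) simp
qed

lemma MF_nontrivial:
  assumes "mf_embedding A n \<phi>"
  shows "cs_one A \<noteq> cs_zero A"
proof
  interpret mf_embedding A n \<phi> by fact
  assume "cs_one A = cs_zero A"
  then have "\<phi> (cs_one A) = \<phi> (cs_zero A)" by simp
  then show False using MQ_nontrivial[of n] npos by simp
qed

theorem theorem5p4:
  fixes A :: "'a cstar" and B :: "'b cstar" and D :: "'d cstar"
    and \<sigma>1 :: "'a \<Rightarrow> 'd" and \<sigma>2 :: "'b \<Rightarrow> 'd"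
  assumes "unital_cstar_algebra A" and "unital_cstar_algebra B"
    and "finitely_generated A" and "finitely_generated B"
    and "MF_algebra A" and "MF_algebra B"
    and "unital_full_free_product A B D \<sigma>1 \<sigma>2"
  shows "MF_algebra D"
proof -
  obtain n \<phi>A where A: "mf_embedding A n \<phi>A"
    using assms(1,5) unfolding MF_algebra_def by (auto intro: mf_embeddingI)
  obtain m \<phi>B where B: "mf_embedding B m \<phi>B"
    using assms(2,6) unfolding MF_algebra_def by (auto intro: mf_embeddingI)
  interpret A: mf_embedding A n \<phi>A by fact
  interpret B: mf_embedding B m \<phi>B by fact
  have D: "unital_cstar_algebra D" and \<sigma>: "unital_star_hom A D \<sigma>1" "inj_on \<sigma>1 A.A.C" "unital_star_hom B D \<sigma>2"
    and genD: "cs_generates D (\<sigma>1 ` A.A.C \<union> \<sigma>2 ` B.A.C)"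
    and univ: "\<And>(E :: 'd cstar) \<phi>1 \<phi>2. unital_cstar_algebra E \<Longrightarrow> unital_star_hom A E \<phi>1 \<Longrightarrow> unital_star_hom B E \<phi>2 \<Longrightarrow>
      \<exists>\<psi>. unital_star_hom D E \<psi> \<and> (\<forall>a\<in>A.A.C. \<phi>1 a = \<psi> (\<sigma>1 a)) \<and> (\<forall>b\<in>B.A.C. \<phi>2 b = \<psi> (\<sigma>2 b))"
    using assms(7) unfolding unital_full_free_product_def by blast+
  interpret D: cstar_algebra D by (rule cstar_algebra.intro[OF D])
  interpret S1: cstar_hom A D \<sigma>1 by (intro cstar_hom.intro cstar_hom_axioms.intro cstar_algebra.intro assms D \<sigma>)
  interpret S2: cstar_hom B D \<sigma>2 by (intro cstar_hom.intro cstar_hom_axioms.intro cstar_algebra.intro assms D \<sigma>)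
  \<comment> \<open>Used twice: for the existence of states, and for room in D to hold a copy of
    \<open>MQ p\<close>.\<close>
  have nontriv: "\<one>\<^bsub>D\<^esub> \<noteq> \<zero>\<^bsub>D\<^esub>"
  proof
    assume "\<one>\<^bsub>D\<^esub> = \<zero>\<^bsub>D\<^esub>"
    then have "\<sigma>1 \<one>\<^bsub>A\<^esub> = \<sigma>1 \<zero>\<^bsub>A\<^esub>" by simp
    then have "\<one>\<^bsub>A\<^esub> = \<zero>\<^bsub>A\<^esub>" by (rule inj_onD[OF \<sigma>(2)]) simp_all
    then show False using MF_nontrivial[OF A] by simp
  qed

  obtain a and k :: nat where a: "cs_generates A (a ` {..<k})" "\<forall>h<k. a h \<in> A.A.C"
    "\<forall>h<k. \<star>\<^bsub>A\<^esub> (a h) \<in> a ` {..<k}"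
    using A.A.finitely_generated_star_list[OF assms(3)] by (elim exE conjE)
  note aC = a(2)[rule_format]
  obtain b and l :: nat where b: "cs_generates B (b ` {..<l})" "\<forall>h<l. b h \<in> B.A.C"
    "\<forall>h<l. \<star>\<^bsub>B\<^esub> (b h) \<in> b ` {..<l}"
    using B.A.finitely_generated_star_list[OF assms(4)] by (elim exE conjE)
  note bC = b(2)[rule_format]
  define S where "S = \<sigma>1 ` a ` {..<k} \<union> \<sigma>2 ` b ` {..<l}"
  have S: "S \<subseteq> D.C" using a(2) b(2) by (auto simp: S_def)
  have starS: "\<star>\<^bsub>D\<^esub> s \<in> S" if sS: "s \<in> S" for s
  proof -
    consider h where "h < k" "s = \<sigma>1 (a h)" | h where "h < l" "s = \<sigma>2 (b h)"
      using sS unfolding S_def by auto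
    then show ?thesis
    proof cases
      case 1
      then have "\<star>\<^bsub>D\<^esub> s = \<sigma>1 (\<star>\<^bsub>A\<^esub> (a h))" using a(2) by simp
      then show ?thesis using a(3) 1(1) unfolding S_def by blast
    next
      case 2
      then have "\<star>\<^bsub>D\<^esub> s = \<sigma>2 (\<star>\<^bsub>B\<^esub> (b h))" using b(2) by simp
      then show ?thesis using b(3) 2(1) unfolding S_def by blast
    qed
  qed
  define Q where "Q = D.rspan S"
  have QC: "x \<in> D.C" if "x \<in> Q" for x using D.rspan_closed[OF S] that by (simp add: Q_def)
  have Qmult: "s \<otimes>\<^bsub>D\<^esub> x \<in> Q" if "s \<in> S" "x \<in> Q" for s x using that unfolding Q_def by (rule D.rspan.gen)
  have dense: "\<exists>q\<in>Q. \<parallel>q \<ominus>\<^bsub>D\<^esub> x\<parallel>\<^bsub>D\<^esub> < e" if "x \<in> D.C" "0 < e" for x e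
  proof -
    let ?T = "D.rspan_closure S"
    have T: "D.closed_subalg ?T" by (rule D.closed_subalg_rspan_closure[OF S starS])
    have ST: "S \<subseteq> ?T" using D.rspan_base[OF S] D.rspan_subset_closure[OF S] by blast
    have "\<sigma>1 ` A.A.C \<subseteq> ?T" by (rule S1.hom_generated[OF a(1) T]) (use ST in \<open>simp add: S_def\<close>)
    moreover have "\<sigma>2 ` B.A.C \<subseteq> ?T" by (rule S2.hom_generated[OF b(1) T]) (use ST in \<open>simp add: S_def\<close>)
    ultimately have "D.C \<subseteq> ?T" by (intro D.generatesD[OF genD T]) simp
    then show ?thesis using that unfolding D.rspan_closure_def[OF S] Q_def by blast
  qed

  have "countable Q" unfolding Q_def by (intro D.rspan_countable countable_finite) (simp add: S_def)
  moreover have "Q \<noteq> {}" using D.rspan.one Q_def by blast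
  moreover define q where "q = from_nat_into Q"
  moreover define idx where "idx = to_nat_on Q"
  ultimately have q: "q i \<in> Q" and idx: "x \<in> Q \<Longrightarrow> q (idx x) = x" for i x
    by (simp_all add: from_nat_into)
  have "\<exists>F. D.is_state F \<and> (\<parallel>q i\<parallel>\<^bsub>D\<^esub>)\<^sup>2 \<le> Re (F (\<star>\<^bsub>D\<^esub> (q i) \<otimes>\<^bsub>D\<^esub> q i))" for i
    by (rule D.ex_state[OF nontriv QC[OF q]])
  then obtain F where F: "D.is_state (F i)" "(\<parallel>q i\<parallel>\<^bsub>D\<^esub>)\<^sup>2 \<le> Re (F i (\<star>\<^bsub>D\<^esub> (q i) \<otimes>\<^bsub>D\<^esub> q i))" for i by metis
  \<comment> \<open>Stage j treats the first j elements of Q with accuracy 1/(j+1) and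
    representations of the tails from index j on. Its state is numbered by the first component of
    \<open>prod_decode j\<close>, so every state recurs at infinitely many stages.\<close>
  define stage where "stage j M \<Phi> \<Psi> \<zeta> \<longleftrightarrow> 0 < M \<and> tail_hom n j M \<Phi> \<and> tail_hom m j M \<Psi> \<and>
    (\<forall>i<j. \<forall>i'<j. cmod (cip M (\<zeta> i) (\<zeta> i') - F (fst (prod_decode j)) (\<star>\<^bsub>D\<^esub> (q i') \<otimes>\<^bsub>D\<^esub> q i)) < inverse (real (Suc j))) \<and>
    (\<forall>h<k. \<forall>i<j. \<forall>i'<j. \<sigma>1 (a h) \<otimes>\<^bsub>D\<^esub> q i = q i' \<longrightarrow>
       vecnorm M (\<lambda>c. mv M (\<Phi> (mq_rep (\<phi>A (a h)))) (\<zeta> i) c - \<zeta> i' c) < inverse (real (Suc j))) \<and>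
    (\<forall>h<l. \<forall>i<j. \<forall>i'<j. \<sigma>2 (b h) \<otimes>\<^bsub>D\<^esub> q i = q i' \<longrightarrow>
       vecnorm M (\<lambda>c. mv M (\<Psi> (mq_rep (\<phi>B (b h)))) (\<zeta> i) c - \<zeta> i' c) < inverse (real (Suc j)))"
    for j M \<Phi> \<Psi> \<zeta>
  have "\<exists>M \<Phi> \<Psi> \<zeta>. stage j M \<Phi> \<Psi> \<zeta>" for j
    unfolding stage_def
    by (rule ex_joint_stage[OF A B S1.cstar_hom_axioms S2.cstar_hom_axioms F(1) QC[OF q] aC bC]) simp_all
  then obtain p \<Phi> \<Psi> \<zeta> where stage: "stage j (p j) (\<Phi> j) (\<Psi> j) (\<zeta> j)" for j by metis
  have p: "0 < p j" and \<Phi>: "tail_hom n j (p j) (\<Phi> j)" and \<Psi>: "tail_hom m j (p j) (\<Psi> j)" for j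
    using stage[of j] by (simp_all add: stage_def)
  have gram: "cmod (cip (p j) (\<zeta> j i) (\<zeta> j i') - F (fst (prod_decode j)) (\<star>\<^bsub>D\<^esub> (q i') \<otimes>\<^bsub>D\<^esub> q i)) < inverse (real (Suc j))"
    if "i < j" "i' < j" for i i' j
    using stage[of j] that unfolding stage_def by blast
  have act1: "vecnorm (p j) (\<lambda>c. mv (p j) (\<Phi> j (mq_rep (\<phi>A (a h)))) (\<zeta> j i) c - \<zeta> j i' c) < inverse (real (Suc j))"
    if "h < k" "i < j" "i' < j" "\<sigma>1 (a h) \<otimes>\<^bsub>D\<^esub> q i = q i'" for h i i' j
    using stage[of j] that unfolding stage_def by blast
  have act2: "vecnorm (p j) (\<lambda>c. mv (p j) (\<Psi> j (mq_rep (\<phi>B (b h)))) (\<zeta> j i) c - \<zeta> j i' c) < inverse (real (Suc j))"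
    if "h < l" "i < j" "i' < j" "\<sigma>2 (b h) \<otimes>\<^bsub>D\<^esub> q i = q i'" for h i i' j
    using stage[of j] that unfolding stage_def by blast

  define \<phi>1 where "\<phi>1 = tail_map p \<Phi> \<circ> \<phi>A"
  define \<phi>2 where "\<phi>2 = tail_map p \<Psi> \<circ> \<phi>B"
  have \<phi>1: "unital_star_hom A (MQ p) \<phi>1" and \<phi>2: "unital_star_hom B (MQ p) \<phi>2"
    unfolding \<phi>1_def \<phi>2_def using A.hom B.hom tail_map_hom[OF \<Phi>] tail_map_hom[OF \<Psi>]
    by (blast intro: unital_star_hom_comp)+
  interpret M: cstar_algebra "MQ p" by (intro cstar_algebra.intro MQ_cstar)
  obtain g :: "matseq set \<Rightarrow> 'd" where g: "inj_on g M.C" using D.ex_MQ_inj[OF nontriv] by blast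
  obtain \<psi>' where \<psi>': "unital_star_hom D (transport g (MQ p)) \<psi>'"
    "\<forall>a\<in>A.A.C. (g \<circ> \<phi>1) a = \<psi>' (\<sigma>1 a)" "\<forall>b\<in>B.A.C. (g \<circ> \<phi>2) b = \<psi>' (\<sigma>2 b)"
    using univ[OF M.cstar_transport[OF g] unital_star_hom_comp[OF \<phi>1 M.transport_hom[OF g]]
        unital_star_hom_comp[OF \<phi>2 M.transport_hom[OF g]]] by (elim exE conjE)
  define \<psi> where "\<psi> = inv_into M.C g \<circ> \<psi>'"
  have \<psi>: "unital_star_hom D (MQ p) \<psi>"
    unfolding \<psi>_def by (rule unital_star_hom_comp[OF \<psi>'(1) M.transport_inv_hom[OF g]])
  have \<psi>1: "\<psi> (\<sigma>1 x) = tail_map p \<Phi> (\<phi>A x)" if "x \<in> A.A.C" for x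
    using \<psi>'(2) \<phi>1 g that unfolding \<psi>_def unital_star_hom_def \<phi>1_def by (metis comp_apply inv_into_f_f)
  have \<psi>2: "\<psi> (\<sigma>2 x) = tail_map p \<Psi> (\<phi>B x)" if "x \<in> B.A.C" for x
    using \<psi>'(3) \<phi>2 g that unfolding \<psi>_def unital_star_hom_def \<phi>2_def by (metis comp_apply inv_into_f_f)
  interpret P: cstar_hom D "MQ p" \<psi> by (intro cstar_hom.intro cstar_hom_axioms.intro D.cstar_algebra_axioms M.cstar_algebra_axioms \<psi>)

  have lower: "\<parallel>d\<parallel>\<^bsub>D\<^esub> \<le> \<parallel>\<psi> d\<parallel>\<^bsub>MQ p\<^esub>" if d: "d \<in> Q" for d
  proof -
    \<comment> \<open>The stages devoted to the state that attains the norm of d; they tend to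
      infinity with t.\<close>
    define s where "s t = prod_encode (idx d, t)" for t
    have s: "filterlim s at_top sequentially"
      by (rule filterlim_at_top_mono[OF filterlim_ident]) (simp add: s_def le_prod_encode_2)
    have ev: "\<forall>\<^sub>F t in sequentially. i < s t" for i
      by (rule filterlim_iff[THEN iffD1, OF s, rule_format, OF eventually_gt_at_top])
    have inv: "(\<lambda>t. inverse (real (Suc (s t)))) \<longlonglongrightarrow> 0" by (rule filterlim_compose[OF LIMSEQ_inverse_real_of_nat s])
    show ?thesis
    proof (rule MQ_norm_ge[where F = "F (idx d)" and S = S and s = s and \<zeta> = "\<lambda>t x. \<zeta> (s t) (idx x)"])
      show "d \<in> D.rspan S" using d by (simp add: Q_def)
      show "(\<parallel>d\<parallel>\<^bsub>D\<^esub>)\<^sup>2 \<le> Re (F (idx d) (\<star>\<^bsub>D\<^esub> d \<otimes>\<^bsub>D\<^esub> d))" using F(2)[of "idx d"] idx[OF d] by simp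
      show "(\<lambda>t. cip (p (s t)) (\<zeta> (s t) (idx x)) (\<zeta> (s t) (idx y))) \<longlonglongrightarrow> F (idx d) (\<star>\<^bsub>D\<^esub> y \<otimes>\<^bsub>D\<^esub> x)"
        if xy: "x \<in> D.rspan S" "y \<in> D.rspan S" for x y
      proof (rule Lim_transform2[OF tendsto_const], rule Lim_null_comparison[OF _ inv])
        show "\<forall>\<^sub>F t in sequentially. norm (F (idx d) (\<star>\<^bsub>D\<^esub> y \<otimes>\<^bsub>D\<^esub> x) - cip (p (s t)) (\<zeta> (s t) (idx x)) (\<zeta> (s t) (idx y)))
            \<le> inverse (real (Suc (s t)))"
          using ev[of "idx x"] ev[of "idx y"]
        proof eventually_elim
          case (elim t)
          then show ?case
            using gram[OF elim] xy by (simp add: idx Q_def[symmetric] s_def norm_minus_commute less_imp_le)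
        qed
      qed
      have null: "(\<lambda>t. vecnorm (p (s t)) (\<lambda>i. mv (p (s t)) (Y (s t)) (\<zeta> (s t) (idx x)) i - \<zeta> (s t) (idx (z \<otimes>\<^bsub>D\<^esub> x)) i)) \<longlonglongrightarrow> 0"
        if x: "x \<in> Q" and z: "z \<in> S" and Y: "\<And>j i i'. i < j \<Longrightarrow> i' < j \<Longrightarrow> z \<otimes>\<^bsub>D\<^esub> q i = q i' \<Longrightarrow>
          vecnorm (p j) (\<lambda>c. mv (p j) (Y j) (\<zeta> j i) c - \<zeta> j i' c) < inverse (real (Suc j))" for x z Y
      proof (rule Lim_null_comparison[OF _ inv])
        show "\<forall>\<^sub>F t in sequentially. norm (vecnorm (p (s t)) (\<lambda>i. mv (p (s t)) (Y (s t)) (\<zeta> (s t) (idx x)) i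
            - \<zeta> (s t) (idx (z \<otimes>\<^bsub>D\<^esub> x)) i)) \<le> inverse (real (Suc (s t)))"
          using ev[of "idx x"] ev[of "idx (z \<otimes>\<^bsub>D\<^esub> x)"]
        proof eventually_elim
          case (elim t)
          \<comment> \<open>Products with a generator stay in Q and so have an index of their own;
            the relation is among those respected as soon as both indices are below the
            stage.\<close>
          have "z \<otimes>\<^bsub>D\<^esub> q (idx x) = q (idx (z \<otimes>\<^bsub>D\<^esub> x))" using idx x Qmult[OF z x] by simp
          from Y[OF elim this] show ?case by (simp add: less_imp_le)
        qed
      qed
      show "\<exists>Y\<in>prodM p. mq_class p Y = \<psi> z \<and> (\<forall>x\<in>D.rspan S.
          (\<lambda>t. vecnorm (p (s t)) (\<lambda>i. mv (p (s t)) (Y (s t)) (\<zeta> (s t) (idx x)) i - \<zeta> (s t) (idx (z \<otimes>\<^bsub>D\<^esub> x)) i)) \<longlonglongrightarrow> 0)"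
        if z: "z \<in> S" for z
      proof -
        consider h where "h < k" "z = \<sigma>1 (a h)" | h where "h < l" "z = \<sigma>2 (b h)"
          using z unfolding S_def by auto
        then show ?thesis
        proof cases
          case 1
          have lift: "A.lift (a h) \<in> prodM n" "mq_class n (A.lift (a h)) = \<phi>A (a h)" using A.lift a(2) 1(1) by simp_all
          have "mq_class p (\<lambda>j. \<Phi> j (A.lift (a h))) = \<psi> z"
            using tail_map_class[OF \<Phi> lift(1)] lift(2) \<psi>1[OF aC[OF 1(1)]] 1(2) by simp
          moreover have "(\<lambda>t. vecnorm (p (s t)) (\<lambda>i. mv (p (s t)) (\<Phi> (s t) (A.lift (a h))) (\<zeta> (s t) (idx x)) i
              - \<zeta> (s t) (idx (z \<otimes>\<^bsub>D\<^esub> x)) i)) \<longlonglongrightarrow> 0" if x: "x \<in> D.rspan S" for x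
          proof (rule null[where Y = "\<lambda>j. \<Phi> j (A.lift (a h))"])
            fix i i' j assume "i < j" "i' < j" "z \<otimes>\<^bsub>D\<^esub> q i = q i'"
            then show "vecnorm (p j) (\<lambda>c. mv (p j) (\<Phi> j (A.lift (a h))) (\<zeta> j i) c - \<zeta> j i' c) < inverse (real (Suc j))"
              unfolding 1(2) A.lift_def by (rule act1[OF 1(1)])
          qed (use x z in \<open>simp_all add: Q_def\<close>)
          ultimately show ?thesis
            using tail_hom_prodM[OF \<Phi> lift(1)] by (intro bexI[of _ "\<lambda>j. \<Phi> j (A.lift (a h))"] conjI ballI)
        next
          case 2
          have lift: "B.lift (b h) \<in> prodM m" "mq_class m (B.lift (b h)) = \<phi>B (b h)" using B.lift b(2) 2(1) by simp_all
          have "mq_class p (\<lambda>j. \<Psi> j (B.lift (b h))) = \<psi> z"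
            using tail_map_class[OF \<Psi> lift(1)] lift(2) \<psi>2[OF bC[OF 2(1)]] 2(2) by simp
          moreover have "(\<lambda>t. vecnorm (p (s t)) (\<lambda>i. mv (p (s t)) (\<Psi> (s t) (B.lift (b h))) (\<zeta> (s t) (idx x)) i
              - \<zeta> (s t) (idx (z \<otimes>\<^bsub>D\<^esub> x)) i)) \<longlonglongrightarrow> 0" if x: "x \<in> D.rspan S" for x
          proof (rule null[where Y = "\<lambda>j. \<Psi> j (B.lift (b h))"])
            fix i i' j assume "i < j" "i' < j" "z \<otimes>\<^bsub>D\<^esub> q i = q i'"
            then show "vecnorm (p j) (\<lambda>c. mv (p j) (\<Psi> j (B.lift (b h))) (\<zeta> j i) c - \<zeta> j i' c) < inverse (real (Suc j))"
              unfolding 2(2) B.lift_def by (rule act2[OF 2(1)])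
          qed (use x z in \<open>simp_all add: Q_def\<close>)
          ultimately show ?thesis
            using tail_hom_prodM[OF \<Psi> lift(1)] by (intro bexI[of _ "\<lambda>j. \<Psi> j (B.lift (b h))"] conjI ballI)
        qed
      qed
    qed (use P.cstar_hom_axioms F(1) S s in simp_all)
  qed

  \<comment> \<open>The lower bound is known on Q only. If \<psi> vanishes at d and q in Q is near
    d, then the norm of q is at most that of \<psi>(q - d), hence at most the distance of q and d;
    so d is small as well.\<close>
  have "inj_on \<psi> D.C"
  proof (rule inj_onI)
    fix x y assume xy: "x \<in> D.C" "y \<in> D.C" "\<psi> x = \<psi> y"
    let ?d = "x \<ominus>\<^bsub>D\<^esub> y"
    have d: "?d \<in> D.C" "\<psi> ?d = \<zero>\<^bsub>MQ p\<^esub>" using xy by simp_all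
    have "\<parallel>?d\<parallel>\<^bsub>D\<^esub> \<le> 0 + e" if e: "0 < e" for e
    proof -
      obtain q where q: "q \<in> Q" "\<parallel>q \<ominus>\<^bsub>D\<^esub> ?d\<parallel>\<^bsub>D\<^esub> < e / 2" using dense[OF d(1) half_gt_zero[OF e]] by blast
      have "\<psi> (q \<ominus>\<^bsub>D\<^esub> ?d) = \<psi> q" using QC[OF q(1)] d xy by (simp add: cs_sub_def)
      then have "\<parallel>q\<parallel>\<^bsub>D\<^esub> \<le> \<parallel>q \<ominus>\<^bsub>D\<^esub> ?d\<parallel>\<^bsub>D\<^esub>"
        using lower[OF q(1)] P.contractive[of "q \<ominus>\<^bsub>D\<^esub> ?d"] QC[OF q(1)] d(1) by simp
      then show ?thesis using D.nm_diff_le[OF QC[OF q(1)] d(1)] q(2) by linarith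
    qed
    then have "\<parallel>?d\<parallel>\<^bsub>D\<^esub> \<le> 0" by (rule field_le_epsilon)
    then have "\<parallel>?d\<parallel>\<^bsub>D\<^esub> = 0" using D.nm_nonneg[OF d(1)] by linarith
    then show "x = y" using d(1) xy by (simp add: D.nm_eq_zero D.sub_eq_zero)
  qed
  then show ?thesis
    unfolding MF_algebra_def using D \<psi> p by blast
qed

end
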